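(* Let $W_0\in L^2(\mathbb{R}^{2d})$ and let $W$ be the unique weak solution, uniformly bounded in $L^2(\mathbb{R}^{2d})$, of $$\partial_tW+\mathbf{k}\cdot\nabla_{\mathbf{x}}W=\mathcal{L}W,\quad W(0)=W_0,\qquad \mathcal{L}\varphi(\mathbf{k})=\int d\mathbf{p}\,\sigma(\mathbf{p}-\mathbf{k})(\varphi(\mathbf{p})-\varphi(\mathbf{k})),\quad \sigma(\mathbf{p})=\frac{2\widehat{R}_0(\mathbf{p})}{(2\pi)^d\mathfrak{g}(\mathbf{p})}.$$ Assume that, for some $\theta\in(0,1)$ and $\sigma_0>0$, $$\frac{\widehat{R}_0(\mathbf{p})}{\mathfrak{g}(\mathbf{p})}\sim\frac{\sigma_0}{|\mathbf{p}|^{d+\theta}}\quad\text{as }\mathbf{p}\to0 .$$ Then for every $t_0>0$, $$W\in\mathcal{C}^0\Big((0,+\infty),\bigcap_{k\ge0}H^k(\mathbb{R}^{2d})\Big)\cap L^\infty\Big([t_0,+\infty),\bigcap_{k\ge0}H^k(\mathbb{R}^{2d})\Big),$$ so that also $$W\in\mathcal{C}^0\big((0,+\infty),\mathcal{C}^\infty(\mathbb{R}^{2d})\big)\cap L^\infty\big([t_0,+\infty),\mathcal{C}^\infty(\mathbb{R}^{2d})\big).$$ Moreover, $$W(t,\mathbf{x},\mathbf{k})=\frac{1}{(2\pi)^{2d}}\int d\mathbf{y}\,d\mathbf{q}\,e^{i(\mathbf{x}\cdot\mathbf{y}+\mathbf{k}\cdot\mathbf{q})}e^{\int_0^tdu\,\Psi(\mathbf{q}+u\mathbf{y})}\,\widehat{W}_0(\mathbf{y},\mathbf{q}+t\mathbf{y}),\qquad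 \Psi(\mathbf{q})=\int d\mathbf{p}\,\sigma(\mathbf{p})\big(e^{i\mathbf{p}\cdot\mathbf{q}}-1\big).$$
   Context: $d\ge1$. $\widehat{R}_0:\mathbb{R}^d\to[0,\infty)$ is in $L^1(\mathbb{R}^d)$, is even, has support included in a compact set containing $0$, and has a singularity at $0$. $\mathfrak{g}:\mathbb{R}^d\to[0,\infty)$ is even. It is assumed that $\int \widehat{R}_0\frac{|\mathbf{p}|}{\mathfrak{g}}d\mathbf{p}+\int \widehat{R}_0\frac{|\mathbf{p}|^2}{\mathfrak{g}^2}d\mathbf{p}+\int \widehat{R}_0\frac{|\mathbf{p}|^3}{\mathfrak{g}^3}d\mathbf{p}<+\infty$. Quotients $\widehat R_0/\mathfrak g$ are understood as $0$ where $\widehat R_0=0$. $\widehat{W}_0(\mathbf{y},\mathbf{q})=\int e^{-i(\mathbf{x}\cdot\mathbf{y}+\mathbf{k}\cdot\mathbf{q})}W_0(\mathbf{x},\mathbf{k})d\mathbf{x}d\mathbf{k}$ is the Fourier transform; $H^k(\mathbb{R}^{2d})$ is the $k$-th $L^2$-Sobolev space; $\bigcap_kH^k$ carries the topology generated by all $H^k$ norms. Weak solution: for all $t\ge0$ and all $\lambda\in\mathcal{C}_0^\infty(\mathbb{R}^{2d})$ (smooth, compactly supported), $\langle W(t),\lambda\rangle_{L^2(\mathbb{R}^{2d})}-\langle W_0,\lambda\rangle_{L^2(\mathbb{R}^{2d})}-\int_0^t\langle W(s),\mathbf{k}\cdot\nabla_{\mathbf{x}}\lambda+\mathcal{L}\lambda\rangle_{L^2(\mathbb{R}^{2d})}ds=0$,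 where $\mathcal{L}$ acts on the $\mathbf{k}$ variable. Uniformly bounded means $\sup_{t\ge0}\|W(t)\|_{L^2(\mathbb{R}^{2d})}<\infty$; such a weak solution exists and is unique. *)

theory Defs
  imports "HOL-Analysis.Analysis" "HOL-Library.Landau_Symbols"
begin

text \<open>
  The space \<open>\<real>\<^sup>d\<close> is a type \<open>'a :: euclidean_space\<close> with \<open>d = DIM('a) \<ge> 1\<close>; phase space
  \<open>\<real>\<^sup>2\<^sup>d\<close> is \<open>'a \<times> 'a\<close>, with points \<open>(x, k)\<close> and dual points \<open>(y, q)\<close>. Elements of \<open>L\<^sup>2\<close> are
  represented by Borel functions; equality of elements is equality almost everywhere.
\<close>

definition square_integrable :: "('b::euclidean_space \<Rightarrow> complex) \<Rightarrow> bool" where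
  "square_integrable f \<longleftrightarrow>
     f \<in> borel_measurable borel \<and> integrable lborel (\<lambda>z. (norm (f z))\<^sup>2)"

definition L2_norm :: "('b::euclidean_space \<Rightarrow> complex) \<Rightarrow> real" where
  "L2_norm f = sqrt (LINT z|lborel. (norm (f z))\<^sup>2)"

definition L2_inner :: "('b::euclidean_space \<Rightarrow> complex) \<Rightarrow> ('b \<Rightarrow> complex) \<Rightarrow> complex" where
  "L2_inner f g = (LINT z|lborel. f z * cnj (g z))"

text \<open>The extended nonnegative integral ensures that a distance which is not finite is never read as 0.\<close>

definition L2_tendsto :: "(nat \<Rightarrow> 'b::euclidean_space \<Rightarrow> complex) \<Rightarrow> ('b \<Rightarrow> complex) \<Rightarrow> bool" where
  "L2_tendsto F f \<longleftrightarrow>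
     (\<lambda>n. \<integral>\<^sup>+ z. ennreal ((norm (F n z - f z))\<^sup>2) \<partial>lborel) \<longlonglongrightarrow> 0"

text \<open>
  The Fourier transform on \<open>L\<^sup>2\<close>, as the \<open>L\<^sup>2\<close>-limit of the Fourier integrals of the truncations of
  the function to balls (which are integrable), and likewise for the inverse transform.
\<close>

definition has_L2_fourier :: "('b::euclidean_space \<Rightarrow> complex) \<Rightarrow> ('b \<Rightarrow> complex) \<Rightarrow> bool" where
  "has_L2_fourier f F \<longleftrightarrow> square_integrable f \<and> square_integrable F \<and>
     L2_tendsto
       (\<lambda>n \<xi>. LINT z:ball 0 (real n)|lborel. exp (- (\<i> * complex_of_real (z \<bullet> \<xi>))) * f z) F"

definition L2_fourier :: "('b::euclidean_space \<Rightarrow> complex) \<Rightarrow> 'b \<Rightarrow> complex" where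
  "L2_fourier f = (SOME F. has_L2_fourier f F)"

definition has_L2_inverse_fourier ::
  "('b::euclidean_space \<Rightarrow> complex) \<Rightarrow> ('b \<Rightarrow> complex) \<Rightarrow> bool" where
  "has_L2_inverse_fourier F f \<longleftrightarrow> square_integrable F \<and> square_integrable f \<and>
     L2_tendsto
       (\<lambda>n z. 1 / (2 * pi) ^ DIM('b) *
          (LINT \<xi>:ball 0 (real n)|lborel. exp (\<i> * complex_of_real (z \<bullet> \<xi>)) * F \<xi>)) f"

text \<open>The factor \<open>(2\<pi>)\<^sup>-\<^sup>D\<close> makes the \<open>H\<^sup>0\<close>-norm the \<open>L\<^sup>2\<close>-norm.\<close>

definition sobolev_space :: "nat \<Rightarrow> ('b::euclidean_space \<Rightarrow> complex) set" where
  "sobolev_space m = {f. square_integrable f \<and>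
     integrable lborel (\<lambda>\<xi>. (1 + (norm \<xi>)\<^sup>2) ^ m * (norm (L2_fourier f \<xi>))\<^sup>2)}"

definition sobolev_norm :: "nat \<Rightarrow> ('b::euclidean_space \<Rightarrow> complex) \<Rightarrow> real" where
  "sobolev_norm m f = sqrt (1 / (2 * pi) ^ DIM('b) *
     (LINT \<xi>|lborel. (1 + (norm \<xi>)\<^sup>2) ^ m * (norm (L2_fourier f \<xi>))\<^sup>2))"

definition continuous_in_Hinf :: "(real \<Rightarrow> 'b::euclidean_space \<Rightarrow> complex) \<Rightarrow> bool" where
  "continuous_in_Hinf W \<longleftrightarrow> (\<forall>t>0. \<forall>m.
     W t \<in> sobolev_space m \<and>
     ((\<lambda>s. sobolev_norm m (\<lambda>z. W s z - W t z)) \<longlongrightarrow> 0) (at t))"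

text \<open>
  Boundedness in a space topologised by countably many (semi)norms is boundedness in each of them.
  The bounds are for all times instead of almost all times, which is the same for functions that
  are continuous in time.
\<close>

definition bounded_in_Hinf_from :: "real \<Rightarrow> (real \<Rightarrow> 'b::euclidean_space \<Rightarrow> complex) \<Rightarrow> bool" where
  "bounded_in_Hinf_from t0 W \<longleftrightarrow> (\<forall>m. \<exists>C. \<forall>t\<ge>t0.
     W t \<in> sobolev_space m \<and> sobolev_norm m (W t) \<le> C)"

text \<open>Iterated partial derivatives along a list of directions.\<close>

primrec partial_derivs :: "'b::euclidean_space list \<Rightarrow> ('b \<Rightarrow> complex) \<Rightarrow> 'b \<Rightarrow> complex" where
  "partial_derivs [] f = f"
| "partial_derivs (b # bs) f = (\<lambda>z. frechet_derivative (partial_derivs bs f) (at z) b)"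

definition smooth :: "('b::euclidean_space \<Rightarrow> complex) \<Rightarrow> bool" where
  "smooth f \<longleftrightarrow>
     (\<forall>bs. set bs \<subseteq> Basis \<longrightarrow> (\<forall>z. partial_derivs bs f differentiable (at z)))"

definition test_function :: "('b::euclidean_space \<Rightarrow> complex) \<Rightarrow> bool" where
  "test_function \<phi> \<longleftrightarrow> smooth \<phi> \<and> compact (closure {z. \<phi> z \<noteq> 0})"

text \<open>
  The space of smooth functions carries its Frechet topology: uniform convergence on compact sets
  of all partial derivatives.
\<close>

definition continuous_in_Cinf :: "(real \<Rightarrow> 'b::euclidean_space \<Rightarrow> complex) \<Rightarrow> bool" where
  "continuous_in_Cinf V \<longleftrightarrow> (\<forall>t>0. smooth (V t) \<and>
     (\<forall>bs K. set bs \<subseteq> Basis \<longrightarrow> compact K \<longrightarrow>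
        uniform_limit K (\<lambda>s. partial_derivs bs (V s)) (partial_derivs bs (V t)) (at t)))"

definition bounded_in_Cinf_from :: "real \<Rightarrow> (real \<Rightarrow> 'b::euclidean_space \<Rightarrow> complex) \<Rightarrow> bool" where
  "bounded_in_Cinf_from t0 V \<longleftrightarrow> (\<forall>t\<ge>t0. smooth (V t)) \<and>
     (\<forall>bs K. set bs \<subseteq> Basis \<longrightarrow> compact K \<longrightarrow>
        (\<exists>C. \<forall>t\<ge>t0. \<forall>z\<in>K. norm (partial_derivs bs (V t) z) \<le> C))"

text \<open>
  The standing assumptions. A singularity at 0 is the absence of a finite limit at 0, which is implied
  by divergence to infinity as well as by unboundedness near 0. In the extended nonnegative
  reals \<open>0 / 0 = 0\<close>, whereas \<open>c / 0 = \<infinity>\<close> for \<open>c > 0\<close>; so the integrability assumption includes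
  that \<open>g\<close> vanishes almost nowhere on the set where \<open>R0\<close> does not.
\<close>

definition standing_assumptions ::
  "('a::euclidean_space \<Rightarrow> real) \<Rightarrow> ('a \<Rightarrow> real) \<Rightarrow> bool" where
  "standing_assumptions R0 g \<longleftrightarrow>
     (\<forall>p. 0 \<le> R0 p) \<and> integrable lborel R0 \<and> (\<forall>p. R0 (- p) = R0 p) \<and>
     (\<exists>K. compact K \<and> 0 \<in> K \<and> closure {p. R0 p \<noteq> 0} \<subseteq> K) \<and>
     \<not> (\<exists>l. (R0 \<longlongrightarrow> l) (at 0)) \<and>
     (\<forall>p. 0 \<le> g p) \<and> g \<in> borel_measurable borel \<and> (\<forall>p. g (- p) = g p) \<and>
     (\<integral>\<^sup>+ p. ennreal (R0 p) * ennreal (norm p) / ennreal (g p) \<partial>lborel) +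
     (\<integral>\<^sup>+ p. ennreal (R0 p) * ennreal (norm p ^ 2) / ennreal (g p ^ 2) \<partial>lborel) +
     (\<integral>\<^sup>+ p. ennreal (R0 p) * ennreal (norm p ^ 3) / ennreal (g p ^ 3) \<partial>lborel) < \<infinity>"

definition scattering ::
  "('a::euclidean_space \<Rightarrow> real) \<Rightarrow> ('a \<Rightarrow> real) \<Rightarrow> 'a \<Rightarrow> real" where
  "scattering R0 g p = 2 * R0 p / ((2 * pi) ^ DIM('a) * g p)"

definition collision ::
  "('a::euclidean_space \<Rightarrow> real) \<Rightarrow> ('a \<Rightarrow> complex) \<Rightarrow> 'a \<Rightarrow> complex" where
  "collision \<sigma> \<phi> k = (LINT p|lborel. complex_of_real (\<sigma> (p - k)) * (\<phi> p - \<phi> k))"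

text \<open>The function \<open>k \<cdot> \<nabla>\<^sub>x \<lambda> + \<L> \<lambda>\<close> of \<open>(x, k)\<close>, with the collision operator acting on \<open>k\<close>.\<close>

definition adjoint_generator ::
  "('a::euclidean_space \<Rightarrow> real) \<Rightarrow> ('a \<times> 'a \<Rightarrow> complex) \<Rightarrow> 'a \<times> 'a \<Rightarrow> complex" where
  "adjoint_generator \<sigma> \<phi> = (\<lambda>(x, k).
     frechet_derivative (\<lambda>x'. \<phi> (x', k)) (at x) k + collision \<sigma> (\<lambda>k'. \<phi> (x, k')) k)"

text \<open>Integrability in time is required explicitly, because the Bochner integral is total.\<close>

definition weak_solution ::
  "('a::euclidean_space \<Rightarrow> real) \<Rightarrow> ('a \<times> 'a \<Rightarrow> complex) \<Rightarrow>
   (real \<Rightarrow> 'a \<times> 'a \<Rightarrow> complex) \<Rightarrow> bool" where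
  "weak_solution \<sigma> W0 W \<longleftrightarrow> (\<forall>t\<ge>0. square_integrable (W t)) \<and>
     (\<forall>t\<ge>0. \<forall>\<phi>. test_function \<phi> \<longrightarrow>
        set_integrable lborel {0..t} (\<lambda>s. L2_inner (W s) (adjoint_generator \<sigma> \<phi>)) \<and>
        L2_inner (W t) \<phi> - L2_inner W0 \<phi>
          - (LINT s:{0..t}|lborel. L2_inner (W s) (adjoint_generator \<sigma> \<phi>)) = 0)"

definition uniformly_L2_bounded :: "(real \<Rightarrow> 'b::euclidean_space \<Rightarrow> complex) \<Rightarrow> bool" where
  "uniformly_L2_bounded W \<longleftrightarrow> (\<exists>C. \<forall>t\<ge>0. L2_norm (W t) \<le> C)"

definition Psi :: "('a::euclidean_space \<Rightarrow> real) \<Rightarrow> 'a \<Rightarrow> complex" where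
  "Psi \<sigma> q = (LINT p|lborel. complex_of_real (\<sigma> p) * (exp (\<i> * complex_of_real (p \<bullet> q)) - 1))"

definition evolved_fourier ::
  "('a::euclidean_space \<Rightarrow> real) \<Rightarrow> ('a \<times> 'a \<Rightarrow> complex) \<Rightarrow> real \<Rightarrow> 'a \<times> 'a \<Rightarrow> complex" where
  "evolved_fourier \<sigma> W0 t = (\<lambda>(y, q).
     exp (LINT u:{0..t}|lborel. Psi \<sigma> (q + u *\<^sub>R y)) * L2_fourier W0 (y, q + t *\<^sub>R y))"

end

theory Submission
  imports Defs "HOL-Probability.Probability"
begin

text \<open>
  On the Fourier side the equation becomes the damped transport equation
  \<open>\<partial>\<^sub>t W = y \<cdot> \<nabla>\<^sub>q W + \<Psi>(q) W\<close>, whose solution is explicit along characteristics. That every bounded weak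
  solution is this one follows by duality: a test function is transported by the adjoint evolution, and the
  increments of its pairing with the solution are of second order in time, so that the pairing is constant.
  The test functions produced in this way are inverse Fourier integrals of compactly supported functions;
  they are admissible in the weak formulation after multiplication by cutoffs.

  Since the kernel behaves like \<open>\<bar>p\<bar>\<close> to the power \<open>-d-\<theta>\<close> at 0, the symbol satisfies
  \<open>\<Psi>(q) \<le> C - c \<bar>q\<bar>\<^sup>\<theta>\<close>, and its integral over a time interval along \<open>q + u y\<close> is bounded in the same way in
  terms of \<open>(y, q)\<close>. So the damping factor decays faster than any power, which gives all regularity.
\<close>

subsection \<open>Square-integrable functions\<close>

text \<open>The obstacle is the singularity of the kernel at 0. Only the moments of order 1 and 2 of
  \<open>\<sigma>\<close> are at hand: the collision operator is unbounded on L2, and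
  \<open>psi\<close> is differentiated just once. A test function evolved by the adjoint flow
  therefore need not stay smooth on the Fourier side, and its synthesis need not decay fast. What
  survives is a bounded function of compact support with a derivative in the one direction of the
  characteristics. Compact support makes the synthesis smooth, and this single derivative is exactly
  what the transport term asks for; hence the class \<open>admissible\<close>. Cutting off in phase
  space is affordable for two reasons: the commutator of the cutoff with the collision operator
  costs only a first moment of \<open>\<sigma>\<close>, and the derivative of a dilated cutoff along
  k stays bounded although k does not. The solution is known only through its integrated pairings,
  without any regularity in time; comparing increments avoids differentiating a product of two
  functions that both depend on time.\<close>

abbreviation sq_mass :: "('b::euclidean_space \<Rightarrow> complex) \<Rightarrow> ennreal" where
  "sq_mass f \<equiv> \<integral>\<^sup>+ z. ennreal ((norm (f z))\<^sup>2) \<partial>lborel"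

lemma square_integrable_iff_sq_mass:
  "square_integrable f \<longleftrightarrow> f \<in> borel_measurable borel \<and> sq_mass f < \<infinity>"
  by (auto simp: square_integrable_def integrable_iff_bounded)

lemma square_integrable_measurable [measurable_dest]:
  "square_integrable f \<Longrightarrow> f \<in> borel_measurable borel"
  by (simp add: square_integrable_def)

lemma square_integrable_integrable_sq:
  "square_integrable f \<Longrightarrow> integrable lborel (\<lambda>z. (norm (f z))\<^sup>2)"
  by (simp add: square_integrable_def)

lemma L2_norm_nonneg [simp]: "0 \<le> L2_norm f"
  by (simp add: L2_norm_def)

lemma L2_norm_power2: "(L2_norm f)\<^sup>2 = (LINT z|lborel. (norm (f z))\<^sup>2)"
  by (simp add: L2_norm_def)

lemma sq_mass_eq_L2_norm: "square_integrable f \<Longrightarrow> sq_mass f = ennreal ((L2_norm f)\<^sup>2)"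
  by (simp add: square_integrable_def L2_norm_power2 nn_integral_eq_integral)

lemma norm_add_power2_le: "(norm (a + b :: 'c::real_normed_vector))\<^sup>2 \<le> 2 * (norm a)\<^sup>2 + 2 * (norm b)\<^sup>2"
proof -
  have "(norm (a + b))\<^sup>2 \<le> (norm a + norm b)\<^sup>2"
    by (intro power_mono norm_triangle_ineq) auto
  also have "\<dots> \<le> 2 * (norm a)\<^sup>2 + 2 * (norm b)\<^sup>2"
    using zero_le_power2[of "norm a - norm b"] by (simp add: power2_eq_square algebra_simps)
  finally show ?thesis .
qed

lemma square_integrable_dominated:
  assumes "square_integrable f" "g \<in> borel_measurable borel" "\<And>z. norm (g z) \<le> norm (f z)"
  shows "square_integrable g"
  unfolding square_integrable_def
proof
  note [measurable] = assms(2)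
  show "integrable lborel (\<lambda>z. (norm (g z))\<^sup>2)"
    by (rule Bochner_Integration.integrable_bound[OF square_integrable_integrable_sq[OF assms(1)]])
      (auto intro!: power_mono assms(3))
qed fact

lemma square_integrable_add:
  assumes "square_integrable f" "square_integrable g"
  shows "square_integrable (\<lambda>z. f z + g z)"
  unfolding square_integrable_def
proof
  note [measurable] = square_integrable_measurable[OF assms(1)] square_integrable_measurable[OF assms(2)]
  show "(\<lambda>z. f z + g z) \<in> borel_measurable borel" by measurable
  have "integrable lborel (\<lambda>z. 2 * (norm (f z))\<^sup>2 + 2 * (norm (g z))\<^sup>2)"
    using assms by (auto simp: square_integrable_def)
  then show "integrable lborel (\<lambda>z. (norm (f z + g z))\<^sup>2)"
    by (rule Bochner_Integration.integrable_bound) (auto intro!: norm_add_power2_le)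
qed

lemma square_integrable_cmult:
  assumes "square_integrable f" shows "square_integrable (\<lambda>z. c * f z)"
  using assms by (auto simp: square_integrable_def norm_mult power_mult_distrib)

lemma square_integrable_diff:
  assumes "square_integrable f" "square_integrable g"
  shows "square_integrable (\<lambda>z. f z - g z)"
  using square_integrable_add[OF assms(1) square_integrable_cmult[OF assms(2), of "-1"]] by simp

lemma borel_measurable_cnj [measurable (raw)]:
  "f \<in> borel_measurable M \<Longrightarrow> (\<lambda>z. cnj (f z)) \<in> borel_measurable M"
  by (rule borel_measurable_continuous_on[where f = cnj]) (intro continuous_intros)

lemma square_integrable_cnj:
  assumes "square_integrable f" shows "square_integrable (\<lambda>z. cnj (f z))"
  using assms borel_measurable_cnj by (auto simp: square_integrable_def)

lemma square_integrable_norm: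
  assumes "square_integrable f" shows "square_integrable (\<lambda>z. complex_of_real (norm (f z)))"
  using assms by (auto simp: square_integrable_def)

lemma square_integrable_indicator_mult:
  assumes "square_integrable f" "A \<in> sets borel"
  shows "square_integrable (\<lambda>z. indicator A z * f z)"
proof (rule square_integrable_dominated[OF assms(1)])
  note [measurable] = square_integrable_measurable[OF assms(1)] assms(2)
  show "(\<lambda>z. indicator A z * f z) \<in> borel_measurable borel" by measurable
qed (auto simp: indicator_def)

lemma integrable_mult_square_integrable:
  assumes "square_integrable f" "square_integrable g"
  shows "integrable lborel (\<lambda>z. f z * g z)"
proof -
  note [measurable] = square_integrable_measurable[OF assms(1)] square_integrable_measurable[OF assms(2)]
  have "integrable lborel (\<lambda>z. (norm (f z))\<^sup>2 + (norm (g z))\<^sup>2)"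
    using assms by (auto simp: square_integrable_def)
  then show ?thesis
  proof (rule Bochner_Integration.integrable_bound)
    have "norm (f z * g z) \<le> (norm (f z))\<^sup>2 + (norm (g z))\<^sup>2" for z
    proof -
      have "0 \<le> norm (f z) * norm (g z)" by simp
      then show ?thesis
        using sum_squares_bound[of "norm (f z)" "norm (g z)"] unfolding norm_mult by linarith
    qed
    then show "AE z in lborel. norm (f z * g z) \<le> norm ((norm (f z))\<^sup>2 + (norm (g z))\<^sup>2)"
      by simp
  qed simp
qed

lemma integrable_L2_inner:
  assumes "square_integrable f" "square_integrable g"
  shows "integrable lborel (\<lambda>z. f z * cnj (g z))"
  by (intro integrable_mult_square_integrable square_integrable_cnj assms)

lemma Cauchy_Schwarz_norm_mult:
  assumes "square_integrable f" "square_integrable g"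
  shows "(LINT z|lborel. norm (f z) * norm (g z)) \<le> L2_norm f * L2_norm g"
proof -
  note [measurable] = square_integrable_measurable[OF assms(1)] square_integrable_measurable[OF assms(2)]
  let ?I = "LINT z|lborel. norm (f z) * norm (g z)"
  have int: "integrable lborel (\<lambda>z. norm (f z) * norm (g z))"
    using integrable_norm[OF integrable_mult_square_integrable[OF assms]] by (simp add: norm_mult)
  have "ennreal (?I\<^sup>2) = (\<integral>\<^sup>+ z. ennreal (norm (f z)) * ennreal (norm (g z)) \<partial>lborel)\<^sup>2"
    using int by (simp add: nn_integral_eq_integral ennreal_mult[symmetric] ennreal_power integral_nonneg_AE)
  also have "\<dots> \<le> (\<integral>\<^sup>+ z. (ennreal (norm (f z)))\<^sup>2 \<partial>lborel) * (\<integral>\<^sup>+ z. (ennreal (norm (g z)))\<^sup>2 \<partial>lborel)"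
    by (rule Cauchy_Schwarz_nn_integral) auto
  also have "\<dots> = ennreal ((L2_norm f * L2_norm g)\<^sup>2)"
    using sq_mass_eq_L2_norm[OF assms(1)] sq_mass_eq_L2_norm[OF assms(2)]
    by (simp add: ennreal_power ennreal_mult power_mult_distrib)
  finally have "?I\<^sup>2 \<le> (L2_norm f * L2_norm g)\<^sup>2"
    by (simp add: ennreal_le_iff)
  then show ?thesis
    by (rule power2_le_imp_le) simp
qed

lemma Cauchy_Schwarz_L2_inner:
  assumes "square_integrable f" "square_integrable g"
  shows "norm (L2_inner f g) \<le> L2_norm f * L2_norm g"
proof -
  have "norm (L2_inner f g) \<le> (LINT z|lborel. norm (f z) * norm (g z))"
    unfolding L2_inner_def
    by (rule order_trans[OF integral_norm_bound]) (simp add: norm_mult)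
  also have "\<dots> \<le> L2_norm f * L2_norm g"
    by (rule Cauchy_Schwarz_norm_mult[OF assms])
  finally show ?thesis .
qed

lemma L2_inner_diff_left:
  assumes "square_integrable f" "square_integrable f'" "square_integrable g"
  shows "L2_inner (\<lambda>z. f z - f' z) g = L2_inner f g - L2_inner f' g"
  using integrable_L2_inner[OF assms(1,3)] integrable_L2_inner[OF assms(2,3)]
  by (simp add: L2_inner_def left_diff_distrib)

lemma L2_inner_add_right:
  assumes "square_integrable f" "square_integrable g" "square_integrable g'"
  shows "L2_inner f (\<lambda>z. g z + g' z) = L2_inner f g + L2_inner f g'"
  using integrable_L2_inner[OF assms(1,2)] integrable_L2_inner[OF assms(1,3)]
  by (simp add: L2_inner_def distrib_left)

lemma L2_inner_cmult_right: "L2_inner f (\<lambda>z. c * g z) = cnj c * L2_inner f g"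
  by (simp add: L2_inner_def mult.left_commute)

lemma L2_inner_diff_right:
  assumes "square_integrable f" "square_integrable g" "square_integrable g'"
  shows "L2_inner f (\<lambda>z. g z - g' z) = L2_inner f g - L2_inner f g'"
  using integrable_L2_inner[OF assms(1,2)] integrable_L2_inner[OF assms(1,3)]
  by (simp add: L2_inner_def right_diff_distrib)

lemma L2_inner_self: "L2_inner f f = complex_of_real ((L2_norm f)\<^sup>2)"
  unfolding L2_inner_def L2_norm_power2
  by (simp add: complex_norm_square[symmetric] del: of_real_power)

lemma L2_inner_commute: "L2_inner g f = cnj (L2_inner f g)"
  unfolding L2_inner_def by (subst Bochner_Integration.integral_cnj[symmetric]) (simp add: mult.commute)

lemma L2_norm_0_imp_AE:
  assumes "square_integrable f" "L2_norm f = 0"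
  shows "AE z in lborel. f z = 0"
proof -
  have "(LINT z|lborel. (norm (f z))\<^sup>2) = 0"
    using assms(2) L2_norm_power2[of f] by simp
  then show ?thesis
    using integral_nonneg_eq_0_iff_AE[OF square_integrable_integrable_sq[OF assms(1)]] by simp
qed

subsection \<open>Convergence in the mean\<close>

lemma L2_tendsto_L2_norm:
  assumes "\<And>n. square_integrable (F n)" "square_integrable f"
  shows "L2_tendsto F f \<longleftrightarrow> (\<lambda>n. L2_norm (\<lambda>z. F n z - f z)) \<longlonglongrightarrow> 0"
proof -
  have "L2_tendsto F f \<longleftrightarrow> (\<lambda>n. ennreal ((L2_norm (\<lambda>z. F n z - f z))\<^sup>2)) \<longlonglongrightarrow> ennreal 0"
    unfolding L2_tendsto_def using sq_mass_eq_L2_norm[OF square_integrable_diff[OF assms]] by simp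
  also have "\<dots> \<longleftrightarrow> (\<lambda>n. (L2_norm (\<lambda>z. F n z - f z))\<^sup>2) \<longlonglongrightarrow> 0"
    by (subst tendsto_ennreal_iff) auto
  also have "\<dots> \<longleftrightarrow> (\<lambda>n. L2_norm (\<lambda>z. F n z - f z)) \<longlonglongrightarrow> 0"
  proof
    assume "(\<lambda>n. (L2_norm (\<lambda>z. F n z - f z))\<^sup>2) \<longlonglongrightarrow> 0"
    from tendsto_real_sqrt[OF this] show "(\<lambda>n. L2_norm (\<lambda>z. F n z - f z)) \<longlonglongrightarrow> 0"
      by simp
  next
    assume "(\<lambda>n. L2_norm (\<lambda>z. F n z - f z)) \<longlonglongrightarrow> 0"
    from tendsto_power[OF this, of 2] show "(\<lambda>n. (L2_norm (\<lambda>z. F n z - f z))\<^sup>2) \<longlonglongrightarrow> 0"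
      by simp
  qed
  finally show ?thesis .
qed

lemma L2_tendsto_inner:
  assumes "\<And>n. square_integrable (F n)" "square_integrable f" "square_integrable g" "L2_tendsto F f"
  shows "(\<lambda>n. L2_inner (F n) g) \<longlonglongrightarrow> L2_inner f g"
proof -
  have "(\<lambda>n. L2_norm (\<lambda>z. F n z - f z) * L2_norm g) \<longlonglongrightarrow> 0 * L2_norm g"
    using assms L2_tendsto_L2_norm by (intro tendsto_mult) auto
  then have lim: "(\<lambda>n. L2_norm (\<lambda>z. F n z - f z) * L2_norm g) \<longlonglongrightarrow> 0"
    by simp
  have "norm (L2_inner (F n) g - L2_inner f g) \<le> L2_norm (\<lambda>z. F n z - f z) * L2_norm g" for n
    unfolding L2_inner_diff_left[OF assms(1,2,3), symmetric]
    by (intro Cauchy_Schwarz_L2_inner square_integrable_diff assms)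
  then have "(\<lambda>n. L2_inner (F n) g - L2_inner f g) \<longlonglongrightarrow> 0"
    by (intro Lim_null_comparison[OF _ lim] always_eventually) auto
  then show ?thesis
    by (simp add: LIM_zero_iff)
qed

text \<open>With d = \<open>F n\<close> - f, the squared norms differ by the squared norm of d plus
  twice the real part of the inner product of d with f, and both tend to 0.\<close>

lemma L2_tendsto_norm:
  assumes "\<And>n. square_integrable (F n)" "square_integrable f" "L2_tendsto F f"
  shows "(\<lambda>n. (L2_norm (F n))\<^sup>2) \<longlonglongrightarrow> (L2_norm f)\<^sup>2"
proof -
  let ?d = "\<lambda>n z. F n z - f z"
  have d: "square_integrable (?d n)" for n by (intro square_integrable_diff assms)
  have d0: "(\<lambda>n. L2_norm (?d n)) \<longlonglongrightarrow> 0"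
    using assms L2_tendsto_L2_norm by auto
  have eq: "(L2_norm (F n))\<^sup>2 - (L2_norm f)\<^sup>2 = (L2_norm (?d n))\<^sup>2 + 2 * Re (L2_inner (?d n) f)" for n
  proof -
    have 1: "L2_inner (?d n) (?d n) = L2_inner (?d n) (F n) - L2_inner (?d n) f"
      by (rule L2_inner_diff_right[OF d assms(1,2)])
    have 2: "L2_inner (?d n) (F n) = L2_inner (F n) (F n) - L2_inner f (F n)"
      by (rule L2_inner_diff_left[OF assms(1,2,1)])
    have 3: "L2_inner (?d n) f = L2_inner (F n) f - L2_inner f f"
      by (rule L2_inner_diff_left[OF assms(1,2,2)])
    have 4: "L2_inner f (F n) = cnj (L2_inner (F n) f)"
      by (rule L2_inner_commute)
    show ?thesis
      using arg_cong[OF 1, of Re] arg_cong[OF 2, of Re] arg_cong[OF 3, of Re] arg_cong[OF 4, of Re]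
      by (simp add: L2_inner_self)
  qed
  have "(\<lambda>n. (L2_norm (?d n))\<^sup>2 + 2 * (L2_norm (?d n) * L2_norm f)) \<longlonglongrightarrow> 0\<^sup>2 + 2 * (0 * L2_norm f)"
    by (intro tendsto_intros d0)
  then have lim: "(\<lambda>n. (L2_norm (?d n))\<^sup>2 + 2 * (L2_norm (?d n) * L2_norm f)) \<longlonglongrightarrow> 0" by simp
  have "norm ((L2_norm (F n))\<^sup>2 - (L2_norm f)\<^sup>2) \<le> (L2_norm (?d n))\<^sup>2 + 2 * (L2_norm (?d n) * L2_norm f)" for n
  proof -
    have "\<bar>Re (L2_inner (?d n) f)\<bar> \<le> L2_norm (?d n) * L2_norm f"
      by (rule order_trans[OF abs_Re_le_cmod Cauchy_Schwarz_L2_inner[OF d assms(2)]])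
    moreover have "0 \<le> (L2_norm (?d n))\<^sup>2" by simp
    ultimately show ?thesis
      unfolding eq real_norm_def abs_le_iff by linarith
  qed
  then have "(\<lambda>n. (L2_norm (F n))\<^sup>2 - (L2_norm f)\<^sup>2) \<longlonglongrightarrow> 0"
    by (intro Lim_null_comparison[OF _ lim] always_eventually) auto
  then show ?thesis
    by (simp add: LIM_zero_iff)
qed

text \<open>Fatou's lemma applied to the squared distances: their liminf has integral 0, so no
  subsequence has to be extracted.\<close>

lemma L2_tendsto_pointwise_unique:
  assumes [measurable]: "\<And>n. F n \<in> borel_measurable borel" "f \<in> borel_measurable borel"
    and "L2_tendsto F f" "AE z in lborel. (\<lambda>n. F n z) \<longlonglongrightarrow> g z"
  shows "AE z in lborel. f z = g z"
proof -
  have "(\<integral>\<^sup>+ z. liminf (\<lambda>n. ennreal ((norm (F n z - f z))\<^sup>2)) \<partial>lborel)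
      \<le> liminf (\<lambda>n. sq_mass (\<lambda>z. F n z - f z))"
    by (intro nn_integral_liminf) measurable
  also have "\<dots> = 0"
    using assms(3) unfolding L2_tendsto_def by (simp add: lim_imp_Liminf)
  finally have "AE z in lborel. liminf (\<lambda>n. ennreal ((norm (F n z - f z))\<^sup>2)) = 0"
    by (simp add: nn_integral_0_iff_AE)
  with assms(4) show ?thesis
  proof eventually_elim
    case (elim z)
    have "(\<lambda>n. ennreal ((norm (F n z - f z))\<^sup>2)) \<longlonglongrightarrow> ennreal ((norm (g z - f z))\<^sup>2)"
      using elim(1) by (intro tendsto_ennrealI tendsto_intros)
    from lim_imp_Liminf[OF _ this] have "ennreal ((norm (g z - f z))\<^sup>2) = 0"
      using elim(2) by simp
    then show ?case by simp
  qed
qed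

lemma L2_tendsto_unique:
  assumes "\<And>n. square_integrable (F n)" "square_integrable f" "square_integrable g"
    "L2_tendsto F f" "L2_tendsto F g"
  shows "AE z in lborel. f z = g z"
proof -
  let ?d = "\<lambda>z. f z - g z"
  have d: "square_integrable ?d" by (intro square_integrable_diff assms)
  have "L2_inner f ?d = L2_inner g ?d"
    by (rule LIMSEQ_unique[OF L2_tendsto_inner[OF assms(1,2) d assms(4)] L2_tendsto_inner[OF assms(1,3) d assms(5)]])
  then have "L2_inner ?d ?d = 0"
    using L2_inner_diff_left[OF assms(2,3) d] by simp
  then have "L2_norm ?d = 0" by (simp add: L2_inner_self)
  from L2_norm_0_imp_AE[OF d this] show ?thesis by simp
qed

lemma L2_tendsto_dominated:
  fixes F :: "nat \<Rightarrow> 'b::euclidean_space \<Rightarrow> complex"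
  assumes [measurable]: "\<And>n. F n \<in> borel_measurable borel" "f \<in> borel_measurable borel"
    and D: "square_integrable D"
    and bound: "\<And>n z. norm (F n z - f z) \<le> norm (D z)"
    and lim: "\<And>z. (\<lambda>n. F n z) \<longlonglongrightarrow> f z"
  shows "L2_tendsto F f"
proof -
  note [measurable] = square_integrable_measurable[OF D]
  have "(\<lambda>n. \<integral>\<^sup>+ z. ennreal ((norm (F n z - f z))\<^sup>2) \<partial>lborel) \<longlonglongrightarrow> (\<integral>\<^sup>+ z. 0 \<partial>(lborel :: 'b measure))"
  proof (rule nn_integral_dominated_convergence[where w = "\<lambda>z. ennreal ((norm (D z))\<^sup>2)" and u' = "\<lambda>_. 0"])
    show "AE z in lborel. (\<lambda>n. ennreal ((norm (F n z - f z))\<^sup>2)) \<longlonglongrightarrow> 0"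
    proof (intro always_eventually allI)
      fix z
      have "(\<lambda>n. ennreal ((norm (F n z - f z))\<^sup>2)) \<longlonglongrightarrow> ennreal ((norm (f z - f z))\<^sup>2)"
        by (intro tendsto_ennrealI tendsto_intros lim)
      then show "(\<lambda>n. ennreal ((norm (F n z - f z))\<^sup>2)) \<longlonglongrightarrow> 0" by simp
    qed
    show "(\<integral>\<^sup>+ z. ennreal ((norm (D z))\<^sup>2) \<partial>lborel) < \<infinity>"
      using D by (simp add: square_integrable_iff_sq_mass)
  qed (auto intro!: always_eventually ennreal_leI power_mono bound)
  then show ?thesis by (simp add: L2_tendsto_def)
qed

subsection \<open>Volume-preserving maps\<close>

text \<open>Translations, the reflection and the shears along characteristics are treated alike
  through this notion; in particular continuity in the mean is proved once for all of them.\<close>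

definition volume_preserving :: "('b::euclidean_space \<Rightarrow> 'b) \<Rightarrow> bool" where
  "volume_preserving T \<longleftrightarrow> T \<in> borel_measurable borel \<and> distr lborel borel T = lborel"

lemma volume_preserving_measurable [measurable_dest]:
  "volume_preserving T \<Longrightarrow> T \<in> borel_measurable borel"
  by (simp add: volume_preserving_def)

lemma volume_preserving_integral:
  fixes f :: "'b::euclidean_space \<Rightarrow> 'c::{banach, second_countable_topology}"
  assumes "volume_preserving T" "f \<in> borel_measurable borel"
  shows "(LINT x|lborel. f (T x)) = (LINT x|lborel. f x)"
  using integral_distr[of T lborel borel f] assms by (simp add: volume_preserving_def)

lemma volume_preserving_nn_integral:
  assumes "volume_preserving T" "f \<in> borel_measurable borel"
  shows "(\<integral>\<^sup>+ x. f (T x) \<partial>lborel) = (\<integral>\<^sup>+ x. f x \<partial>lborel)"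
  using nn_integral_distr[of T lborel borel f] assms by (simp add: volume_preserving_def)

lemma volume_preserving_integrable:
  fixes f :: "'b::euclidean_space \<Rightarrow> 'c::{banach, second_countable_topology}"
  assumes "volume_preserving T" "integrable lborel f"
  shows "integrable lborel (\<lambda>x. f (T x))"
  using integrable_distr[of T lborel borel f] assms by (simp add: volume_preserving_def)

lemma volume_preserving_square_integrable:
  assumes "volume_preserving T" "square_integrable u"
  shows "square_integrable (\<lambda>x. u (T x))"
  using volume_preserving_integrable[OF assms(1) square_integrable_integrable_sq[OF assms(2)]]
    measurable_compose[OF volume_preserving_measurable[OF assms(1)] square_integrable_measurable[OF assms(2)]]
  by (simp add: square_integrable_def)

lemma volume_preserving_L2_norm:
  assumes "volume_preserving T" "square_integrable u"
  shows "L2_norm (\<lambda>x. u (T x)) = L2_norm u"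
  using volume_preserving_integral[OF assms(1), of "\<lambda>x. (norm (u x))\<^sup>2"]
    square_integrable_measurable[OF assms(2)]
  by (simp add: L2_norm_def)

lemma volume_preserving_translation:
  "volume_preserving (\<lambda>x. x + a :: 'b::euclidean_space)"
  unfolding volume_preserving_def
  using lborel_distr_plus[of a] by (simp add: add.commute[of _ a])

lemma volume_preserving_uminus: "volume_preserving (\<lambda>x. - x :: 'b::euclidean_space)"
  unfolding volume_preserving_def
  by (subst (2) lborel_affine[of "-1" 0]) (auto simp: density_1)

text \<open>For an indicator, outer regularity replaces approximation by continuous functions: a
  point of A is eventually mapped into a slightly larger open set U. Sums and limits then follow by
  induction on integrable functions.\<close>

lemma L1_continuous_volume_preserving:
  fixes f :: "'b::euclidean_space \<Rightarrow> real"
  assumes "integrable lborel f" and T: "\<And>n. volume_preserving (T n)"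
    and lim: "\<And>x. (\<lambda>n. T n x) \<longlonglongrightarrow> x"
  shows "(\<lambda>n. LINT x|lborel. \<bar>f (T n x) - f x\<bar>) \<longlonglongrightarrow> 0"
  using assms(1)
proof (induction rule: integrable_induct)
  case (base A c)
  have [measurable]: "A \<in> sets borel" using base by simp
  have T' [measurable]: "T n \<in> borel_measurable borel" for n
    by (rule volume_preserving_measurable[OF T])
  let ?i = "\<lambda>A x. indicator A x :: real"
  have iA: "integrable lborel (?i A)" using base by simp
  have iAT: "integrable lborel (\<lambda>x. ?i A (T n x))" for n
    by (rule volume_preserving_integrable[OF T iA])
  \<comment> \<open>The volume of the part of A that \<open>T n\<close> moves out of A.\<close>
  let ?d = "\<lambda>n. LINT x|lborel. ?i A x * (1 - ?i A (T n x))"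
  have id: "integrable lborel (\<lambda>x. ?i A x * (1 - ?i A (T n x)))" for n
    by (rule Bochner_Integration.integrable_bound[OF iA]) (auto simp: indicator_def)
  have d0: "0 \<le> ?d n" for n
    by (rule integral_nonneg_AE) (auto simp: indicator_def)
  have "?d \<longlonglongrightarrow> 0"
  proof (rule LIMSEQ_I)
    fix r :: real assume "0 < r"
    then obtain U where U: "open U" "A \<subseteq> U" "emeasure lborel (U - A) < ennreal (r / 2)"
      using outer_regular_lborel[of A "r / 2"] by auto
    then have [measurable]: "U \<in> sets borel" by auto
    have fin: "emeasure lborel (U - A) < \<infinity>"
      using U(3) by (rule order.strict_trans) simp
    then have UA: "integrable lborel (?i (U - A))" by simp
    have "integral\<^sup>L lborel (?i (U - A)) = measure lborel (U - A)" by simp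
    also have "\<dots> < r / 2"
      using U(3) \<open>0 < r\<close> fin by (simp add: emeasure_eq_ennreal_measure ennreal_less_iff)
    finally have r2: "integral\<^sup>L lborel (?i (U - A)) < r / 2" .
    have "(\<lambda>n. LINT x|lborel. ?i A x * (1 - ?i U (T n x))) \<longlonglongrightarrow> (LINT x|(lborel :: 'b measure). (0::real))"
    proof (rule integral_dominated_convergence[where w = "?i A"])
      show "AE x in lborel. (\<lambda>n. ?i A x * (1 - ?i U (T n x))) \<longlonglongrightarrow> 0"
      proof (intro always_eventually allI)
        fix x
        show "(\<lambda>n. ?i A x * (1 - ?i U (T n x))) \<longlonglongrightarrow> 0"
        proof (cases "x \<in> A")
          case True
          then have "\<forall>\<^sub>F n in sequentially. T n x \<in> U"
            using topological_tendstoD[OF lim U(1)] U(2) by auto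
          then have "\<forall>\<^sub>F n in sequentially. ?i A x * (1 - ?i U (T n x)) = 0"
            by eventually_elim auto
          then show ?thesis by (rule tendsto_eventually)
        qed simp
      qed
    qed (use iA in \<open>auto simp: indicator_def\<close>)
    then have "(\<lambda>n. LINT x|lborel. ?i A x * (1 - ?i U (T n x))) \<longlonglongrightarrow> 0" by simp
    from LIMSEQ_D[OF this, of "r / 2"] \<open>0 < r\<close> obtain N where
      N: "\<And>n. n \<ge> N \<Longrightarrow> \<bar>LINT x|lborel. ?i A x * (1 - ?i U (T n x))\<bar> < r / 2" by auto
    have "norm (?d n - 0) < r" if "n \<ge> N" for n
    proof -
      have i1: "integrable lborel (\<lambda>x. ?i A x * (1 - ?i U (T n x)))"
        by (rule Bochner_Integration.integrable_bound[OF iA]) (auto simp: indicator_def)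
      have i2: "integrable lborel (\<lambda>x. ?i (U - A) (T n x))"
        by (rule volume_preserving_integrable[OF T UA])
      \<comment> \<open>A point of A that leaves A either leaves U or lands in \<open>U - A\<close>;
        the preimage of \<open>U - A\<close> is as small as \<open>U - A\<close> itself.\<close>
      have "?d n \<le> (LINT x|lborel. ?i A x * (1 - ?i U (T n x)) + ?i (U - A) (T n x))"
        using i1 i2 by (intro integral_mono id) (auto simp: indicator_def)
      also have "\<dots> = (LINT x|lborel. ?i A x * (1 - ?i U (T n x))) + integral\<^sup>L lborel (?i (U - A))"
        using i1 i2 volume_preserving_integral[OF T, of "?i (U - A)" n] by simp
      also have "\<dots> < r / 2 + r / 2" using N[OF that] r2 by linarith
      finally show ?thesis using d0[of n] by simp
    qed
    then show "\<exists>N. \<forall>n\<ge>N. norm (?d n - 0) < r" by blast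
  qed
  then have "(\<lambda>n. \<bar>c\<bar> * (2 * ?d n)) \<longlonglongrightarrow> \<bar>c\<bar> * (2 * 0)"
    by (intro tendsto_mult tendsto_const)
  moreover have "(LINT x|lborel. \<bar>?i A (T n x) *\<^sub>R c - ?i A x *\<^sub>R c\<bar>) = \<bar>c\<bar> * (2 * ?d n)" for n
  proof -
    \<comment> \<open>For indicator values a at \<open>T n x\<close> and b at \<open>x\<close> one
      has |a - b| = (a - b) + 2 b (1 - a), and the first summand integrates to 0 because
      \<open>T n\<close> preserves volume.\<close>
    have "(LINT x|lborel. \<bar>?i A (T n x) *\<^sub>R c - ?i A x *\<^sub>R c\<bar>)
        = (LINT x|lborel. \<bar>c\<bar> * ((?i A (T n x) - ?i A x) + 2 * (?i A x * (1 - ?i A (T n x)))))"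
      by (intro Bochner_Integration.integral_cong refl) (auto simp: indicator_def)
    also have "\<dots> = \<bar>c\<bar> * (2 * ?d n)"
      using iAT[of n] iA id[of n] volume_preserving_integral[OF T, of "?i A" n] by simp
    finally show ?thesis .
  qed
  ultimately show ?case by simp
next
  case (add f g)
  have iT: "integrable lborel (\<lambda>x. \<bar>h (T n x) - h x\<bar>)" if "integrable lborel h" for h :: "'b \<Rightarrow> real" and n
    using volume_preserving_integrable[OF T that] that by auto
  have lim: "(\<lambda>n. (LINT x|lborel. \<bar>f (T n x) - f x\<bar>) + (LINT x|lborel. \<bar>g (T n x) - g x\<bar>)) \<longlonglongrightarrow> 0"
    using tendsto_add[OF add(3,4)] by simp
  show ?case
  proof (rule Lim_null_comparison[OF always_eventually lim], rule allI)
    fix n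
    have "(LINT x|lborel. \<bar>(f (T n x) + g (T n x)) - (f x + g x)\<bar>)
        \<le> (LINT x|lborel. \<bar>f (T n x) - f x\<bar> + \<bar>g (T n x) - g x\<bar>)"
      using iT[OF Bochner_Integration.integrable_add[OF add(1,2)]] iT[OF add(1)] iT[OF add(2)]
      by (intro integral_mono Bochner_Integration.integrable_add) auto
    then show "norm (LINT x|lborel. \<bar>(f (T n x) + g (T n x)) - (f x + g x)\<bar>)
        \<le> (LINT x|lborel. \<bar>f (T n x) - f x\<bar>) + (LINT x|lborel. \<bar>g (T n x) - g x\<bar>)"
      using iT[OF add(1)] iT[OF add(2)] by simp
  qed
next
  case (lim f s)
  have iT: "integrable lborel (\<lambda>x. \<bar>h (T n x) - h x\<bar>)" if "integrable lborel h" for h :: "'b \<Rightarrow> real" and n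
    using volume_preserving_integrable[OF T that] that by auto
  have [measurable]: "f \<in> borel_measurable borel" "\<And>i. s i \<in> borel_measurable borel"
    using lim(1,4) by (auto dest: borel_measurable_integrable)
  have [measurable]: "T n \<in> borel_measurable borel" for n
    by (rule volume_preserving_measurable[OF T])
  have "(\<lambda>i. LINT x|lborel. \<bar>f x - s i x\<bar>) \<longlonglongrightarrow> (LINT x|(lborel :: 'b measure). (0::real))"
  proof (rule integral_dominated_convergence[where w = "\<lambda>x. 3 * \<bar>f x\<bar>"])
    show "AE x in lborel. (\<lambda>i. \<bar>f x - s i x\<bar>) \<longlonglongrightarrow> 0"
    proof (intro always_eventually allI)
      fix x
      have "(\<lambda>i. \<bar>f x - s i x\<bar>) \<longlonglongrightarrow> \<bar>f x - f x\<bar>"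
        by (intro tendsto_intros lim(2)) simp
      then show "(\<lambda>i. \<bar>f x - s i x\<bar>) \<longlonglongrightarrow> 0" by simp
    qed
    show "AE x in lborel. norm \<bar>f x - s i x\<bar> \<le> 3 * \<bar>f x\<bar>" for i
    proof (intro always_eventually allI)
      fix x show "norm \<bar>f x - s i x\<bar> \<le> 3 * \<bar>f x\<bar>" using lim(3)[of x i] by simp
    qed
  qed (use lim(4) in auto)
  then have si: "(\<lambda>i. LINT x|lborel. \<bar>f x - s i x\<bar>) \<longlonglongrightarrow> 0" by simp
  show ?case
  proof (rule LIMSEQ_I)
    fix r :: real assume r: "0 < r"
    from LIMSEQ_D[OF si, of "r / 3"] r obtain i where i: "(LINT x|lborel. \<bar>f x - s i x\<bar>) < r / 3"
      by fastforce
    from LIMSEQ_D[OF lim(5)[of i], of "r / 3"] r obtain N where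
      N: "\<And>n. n \<ge> N \<Longrightarrow> (LINT x|lborel. \<bar>s i (T n x) - s i x\<bar>) < r / 3" by fastforce
    have "norm ((LINT x|lborel. \<bar>f (T n x) - f x\<bar>) - 0) < r" if "n \<ge> N" for n
    proof -
      have j: "integrable lborel (\<lambda>x. \<bar>f x - s i x\<bar>)" using lim(1)[of i] lim(4) by auto
      have jT: "integrable lborel (\<lambda>x. \<bar>f (T n x) - s i (T n x)\<bar>)"
        by (rule volume_preserving_integrable[OF T j])
      \<comment> \<open>The approximation error composed with \<open>T n\<close> has the same
        integral as the error itself, so it is small uniformly in n.\<close>
      have "(LINT x|lborel. \<bar>f (T n x) - f x\<bar>) \<le>
          (LINT x|lborel. \<bar>f (T n x) - s i (T n x)\<bar> + (\<bar>s i (T n x) - s i x\<bar> + \<bar>f x - s i x\<bar>))"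
        by (intro integral_mono Bochner_Integration.integrable_add iT j jT lim(1,4)) auto
      also have "\<dots> = (LINT x|lborel. \<bar>f (T n x) - s i (T n x)\<bar>) +
          ((LINT x|lborel. \<bar>s i (T n x) - s i x\<bar>) + (LINT x|lborel. \<bar>f x - s i x\<bar>))"
        using j jT iT[OF lim(1)[of i], of n] by simp
      also have "\<dots> < r / 3 + (r / 3 + r / 3)"
        using volume_preserving_integral[OF T, of "\<lambda>x. \<bar>f x - s i x\<bar>" n] i N[OF that] by simp
      finally show ?thesis by simp
    qed
    then show "\<exists>N. \<forall>n\<ge>N. norm ((LINT x|lborel. \<bar>f (T n x) - f x\<bar>) - 0) < r" by blast
  qed
qed

text \<open>For nonnegative reals \<open>\<bar>a - b\<bar>\<^sup>2 \<le> \<bar>a\<^sup>2 - b\<^sup>2\<bar>\<close>, which reduces the square-integrable case to the integrable one.\<close>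

lemma L2_continuous_volume_preserving:
  fixes u :: "'b::euclidean_space \<Rightarrow> complex"
  assumes u: "square_integrable u" and T: "\<And>n. volume_preserving (T n)"
    and lim: "\<And>x. (\<lambda>n. T n x) \<longlonglongrightarrow> x"
  shows "L2_tendsto (\<lambda>n x. u (T n x)) u"
proof -
  note [measurable] = square_integrable_measurable[OF u]
  have [measurable]: "T n \<in> borel_measurable borel" for n
    by (rule volume_preserving_measurable[OF T])
  \<comment> \<open>The positive and negative parts of the real and imaginary parts. The square of
    each is integrable and nonnegative, as the reduction to integrable functions requires.\<close>
  define p :: "nat \<Rightarrow> 'b \<Rightarrow> real" where
    "p j x = (if j = 0 then max 0 (Re (u x)) else if j = 1 then max 0 (- Re (u x))
       else if j = 2 then max 0 (Im (u x)) else max 0 (- Im (u x)))" for j x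
  have p_meas [measurable]: "p j \<in> borel_measurable borel" for j
    unfolding p_def by measurable
  have p_nonneg: "0 \<le> p j x" for j x by (simp add: p_def)
  have p_le: "(p j x)\<^sup>2 \<le> (norm (u x))\<^sup>2" for j x
    using abs_Re_le_cmod[of "u x"] abs_Im_le_cmod[of "u x"] by (intro power_mono) (auto simp: p_def)
  have p_int: "integrable lborel (\<lambda>x. (p j x)\<^sup>2)" for j
    by (rule Bochner_Integration.integrable_bound[OF square_integrable_integrable_sq[OF u]]) (auto simp: p_le)
  have part: "\<bar>max 0 a - max 0 b\<bar>\<^sup>2 \<le> \<bar>(max 0 a)\<^sup>2 - (max 0 b)\<^sup>2\<bar>" for a b :: real
  proof -
    let ?a = "max 0 a" and ?b = "max 0 b"
    have "\<bar>?a - ?b\<bar> * \<bar>?a - ?b\<bar> \<le> \<bar>?a - ?b\<bar> * \<bar>?a + ?b\<bar>"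
      by (intro mult_left_mono) auto
    moreover have "?a\<^sup>2 - ?b\<^sup>2 = (?a - ?b) * (?a + ?b)"
      by (simp add: power2_eq_square algebra_simps)
    ultimately show ?thesis
      by (simp only: abs_mult power2_eq_square)
  qed
  have split: "(a - b)\<^sup>2 \<le> 2 * (max 0 a - max 0 b)\<^sup>2 + 2 * (max 0 (-a) - max 0 (-b))\<^sup>2" for a b :: real
  proof -
    have "(max 0 a - max 0 b) + (max 0 (-b) - max 0 (-a)) = a - b" by simp
    then show ?thesis
      using norm_add_power2_le[of "max 0 a - max 0 b" "max 0 (-b) - max 0 (-a)"]
      by (simp add: power2_commute[of "max 0 (-a)"])
  qed
  have bound: "(norm (u x - u y))\<^sup>2 \<le> (\<Sum>j<4. 2 * \<bar>(p j x)\<^sup>2 - (p j y)\<^sup>2\<bar>)" for x y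
  proof -
    have "(norm (u x - u y))\<^sup>2 = (Re (u x) - Re (u y))\<^sup>2 + (Im (u x) - Im (u y))\<^sup>2"
      by (simp add: cmod_power2)
    also have "\<dots> \<le> (\<Sum>j<4. 2 * \<bar>p j x - p j y\<bar>\<^sup>2)"
      using split[of "Re (u x)" "Re (u y)"] split[of "Im (u x)" "Im (u y)"]
      by (simp add: eval_nat_numeral p_def)
    also have "\<dots> \<le> (\<Sum>j<4. 2 * \<bar>(p j x)\<^sup>2 - (p j y)\<^sup>2\<bar>)"
      by (intro sum_mono mult_left_mono) (auto simp: p_def part[simplified])
    finally show ?thesis .
  qed
  have sT: "square_integrable (\<lambda>x. u (T n x))" for n
    by (rule volume_preserving_square_integrable[OF T u])
  have pT: "integrable lborel (\<lambda>x. \<bar>(p j (T n x))\<^sup>2 - (p j x)\<^sup>2\<bar>)" for n j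
    using volume_preserving_integrable[OF T p_int[of j], of n] p_int[of j] by auto
  have lim0: "(\<lambda>n. \<Sum>j<4. 2 * (LINT x|lborel. \<bar>(p j (T n x))\<^sup>2 - (p j x)\<^sup>2\<bar>)) \<longlonglongrightarrow> (\<Sum>j<(4::nat). 2 * 0)"
    by (intro tendsto_sum tendsto_mult tendsto_const L1_continuous_volume_preserving[OF p_int T lim])
  have "(\<lambda>n. (L2_norm (\<lambda>x. u (T n x) - u x))\<^sup>2) \<longlonglongrightarrow> 0"
  proof (rule Lim_null_comparison[OF always_eventually], rule allI)
    fix n
    have "(L2_norm (\<lambda>x. u (T n x) - u x))\<^sup>2 \<le> (LINT x|lborel. (\<Sum>j<4. 2 * \<bar>(p j (T n x))\<^sup>2 - (p j x)\<^sup>2\<bar>))"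
      unfolding L2_norm_power2 using pT bound
      by (intro integral_mono square_integrable_integrable_sq square_integrable_diff sT u) auto
    also have "\<dots> = (\<Sum>j<4. 2 * (LINT x|lborel. \<bar>(p j (T n x))\<^sup>2 - (p j x)\<^sup>2\<bar>))"
      using pT by (subst Bochner_Integration.integral_sum) auto
    finally show "norm ((L2_norm (\<lambda>x. u (T n x) - u x))\<^sup>2) \<le> (\<Sum>j<4. 2 * (LINT x|lborel. \<bar>(p j (T n x))\<^sup>2 - (p j x)\<^sup>2\<bar>))"
      by simp
  qed (use lim0 in simp)
  from tendsto_real_sqrt[OF this] show ?thesis
    using L2_tendsto_L2_norm[OF sT u] by simp
qed

subsection \<open>Approximate identities\<close>

lemma integrable_kernel_correlation:
  fixes K :: "'b::euclidean_space \<Rightarrow> real" and u :: "'b \<Rightarrow> complex"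
  assumes K: "integrable lborel K" and u: "square_integrable u" and v: "square_integrable v"
  shows "integrable (lborel \<Otimes>\<^sub>M lborel) (\<lambda>(w, x). complex_of_real (K w) * (u (x + e *\<^sub>R w) * cnj (v x)))"
proof -
  note [measurable] = square_integrable_measurable[OF u] square_integrable_measurable[OF v]
    borel_measurable_integrable[OF K]
  let ?f = "\<lambda>(w, x). complex_of_real (K w) * (u (x + e *\<^sub>R w) * cnj (v x))"
  have uT: "square_integrable (\<lambda>x. u (x + e *\<^sub>R w))" for w
    by (rule volume_preserving_square_integrable[OF volume_preserving_translation u])
  show ?thesis
  proof (rule lborel_pair.Fubini_integrable)
    show "?f \<in> borel_measurable (lborel \<Otimes>\<^sub>M lborel)" by measurable
    show "integrable lborel (\<lambda>w. LINT x|lborel. norm (?f (w, x)))"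
    proof (rule Bochner_Integration.integrable_bound)
      show "integrable lborel (\<lambda>w. K w * (L2_norm u * L2_norm v))" using K by simp
      show "(\<lambda>w. LINT x|lborel. norm (?f (w, x))) \<in> borel_measurable lborel"
        by measurable
      show "AE w in lborel. norm (LINT x|lborel. norm (?f (w, x))) \<le> norm (K w * (L2_norm u * L2_norm v))"
      proof (intro always_eventually allI)
        fix w
        have "(LINT x|lborel. norm (?f (w, x))) = \<bar>K w\<bar> * (LINT x|lborel. norm (u (x + e *\<^sub>R w)) * norm (v x))"
          by (simp add: norm_mult)
        also have "\<dots> \<le> \<bar>K w\<bar> * (L2_norm u * L2_norm v)"
          using Cauchy_Schwarz_norm_mult[OF uT[of w] v]
          unfolding volume_preserving_L2_norm[OF volume_preserving_translation u]
          by (intro mult_left_mono) auto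
        finally show "norm (LINT x|lborel. norm (?f (w, x))) \<le> norm (K w * (L2_norm u * L2_norm v))"
          by (simp add: abs_mult integral_nonneg_AE)
      qed
    qed
    show "AE w in lborel. integrable lborel (\<lambda>x. ?f (w, x))"
      using integrable_L2_inner[OF uT v] by auto
  qed
qed

text \<open>Convergence is tested against \<open>u\<close> only, which is all that is used: with the
  Gaussian it gives Plancherel's identity, with a bump it shows that a function orthogonal to all
  bumps vanishes. The kernel is not normalised, so its total integral appears in the limit.\<close>

lemma approximate_identity:
  fixes K :: "'b::euclidean_space \<Rightarrow> real" and u :: "'b \<Rightarrow> complex"
  assumes K: "integrable lborel K" and u: "square_integrable u" and e: "e \<longlonglongrightarrow> 0"
  shows "(\<lambda>n. LINT x|lborel. (LINT w|lborel. complex_of_real (K w) * u (x + e n *\<^sub>R w)) * cnj (u x))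
    \<longlonglongrightarrow> complex_of_real ((LINT w|lborel. K w) * (L2_norm u)\<^sup>2)"
proof -
  note [measurable] = square_integrable_measurable[OF u] borel_measurable_integrable[OF K]
  have uT: "square_integrable (\<lambda>x. u (x + a))" for a
    by (rule volume_preserving_square_integrable[OF volume_preserving_translation u])
  have eq: "(LINT x|lborel. (LINT w|lborel. complex_of_real (K w) * u (x + e n *\<^sub>R w)) * cnj (u x))
      = (LINT w|lborel. complex_of_real (K w) * L2_inner (\<lambda>x. u (x + e n *\<^sub>R w)) u)" for n
    using lborel_pair.Fubini_integral[OF integrable_kernel_correlation[OF K u u, of "e n"]]
    by (simp add: L2_inner_def mult.assoc flip: integral_mult_left_zero)
  have "(\<lambda>n. LINT w|lborel. complex_of_real (K w) * L2_inner (\<lambda>x. u (x + e n *\<^sub>R w)) u) \<longlonglongrightarrow>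
     (LINT w|lborel. complex_of_real (K w) * L2_inner u u)"
  proof (rule integral_dominated_convergence[where w = "\<lambda>w. \<bar>K w\<bar> * (L2_norm u)\<^sup>2"])
    show "(\<lambda>w. complex_of_real (K w) * L2_inner (\<lambda>x. u (x + e n *\<^sub>R w)) u) \<in> borel_measurable lborel" for n
      unfolding L2_inner_def by measurable
    show "AE w in lborel. (\<lambda>n. complex_of_real (K w) * L2_inner (\<lambda>x. u (x + e n *\<^sub>R w)) u)
        \<longlonglongrightarrow> complex_of_real (K w) * L2_inner u u"
    proof (intro always_eventually allI tendsto_mult tendsto_const)
      fix w :: 'b
      have "(\<lambda>n. x + e n *\<^sub>R w) \<longlonglongrightarrow> x + 0 *\<^sub>R w" for x
        by (intro tendsto_intros e)
      then have "L2_tendsto (\<lambda>n x. u (x + e n *\<^sub>R w)) u"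
        by (intro L2_continuous_volume_preserving[OF u volume_preserving_translation]) simp
      from L2_tendsto_inner[OF uT u u this]
      show "(\<lambda>n. L2_inner (\<lambda>x. u (x + e n *\<^sub>R w)) u) \<longlonglongrightarrow> L2_inner u u" .
    qed
    show "AE w in lborel. norm (complex_of_real (K w) * L2_inner (\<lambda>x. u (x + e n *\<^sub>R w)) u) \<le> \<bar>K w\<bar> * (L2_norm u)\<^sup>2" for n
    proof (intro always_eventually allI)
      fix w
      have "norm (L2_inner (\<lambda>x. u (x + e n *\<^sub>R w)) u) \<le> (L2_norm u)\<^sup>2"
        using Cauchy_Schwarz_L2_inner[OF uT u, of "e n *\<^sub>R w"]
        unfolding volume_preserving_L2_norm[OF volume_preserving_translation u] by (simp add: power2_eq_square)
      then show "norm (complex_of_real (K w) * L2_inner (\<lambda>x. u (x + e n *\<^sub>R w)) u) \<le> \<bar>K w\<bar> * (L2_norm u)\<^sup>2"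
        by (auto simp: norm_mult intro: mult_left_mono)
    qed
    show "integrable lborel (\<lambda>w. \<bar>K w\<bar> * (L2_norm u)\<^sup>2)" using K by auto
  qed simp
  then show ?thesis
    unfolding eq by (simp add: L2_inner_self)
qed

subsection \<open>Fourier integrals and the Gaussian\<close>

definition fourier_integral :: "('b::euclidean_space \<Rightarrow> complex) \<Rightarrow> 'b \<Rightarrow> complex" where
  "fourier_integral f \<xi> = (LINT z|lborel. exp (- (\<i> * complex_of_real (z \<bullet> \<xi>))) * f z)"

lemma norm_exp_i_of_real [simp]: "norm (iexp r) = 1"
  "norm (exp (- (\<i> * complex_of_real r))) = 1"
  by (auto simp: norm_exp_eq_Re)

lemma integrable_exp_mult [intro]:
  assumes "integrable lborel f"
  shows "integrable lborel (\<lambda>z. exp (- (\<i> * complex_of_real (z \<bullet> \<xi>))) * f z)"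
    and "integrable lborel (\<lambda>z. iexp (z \<bullet> \<xi>) * f z)"
    and "integrable lborel (\<lambda>z. iexp (\<xi> \<bullet> z) * f z)"
proof -
  note [measurable] = borel_measurable_integrable[OF assms]
  show "integrable lborel (\<lambda>z. exp (- (\<i> * complex_of_real (z \<bullet> \<xi>))) * f z)"
    by (rule Bochner_Integration.integrable_bound[OF assms]) (auto simp: norm_mult)
  show 1: "integrable lborel (\<lambda>z. iexp (z \<bullet> \<xi>) * f z)"
    by (rule Bochner_Integration.integrable_bound[OF assms]) (auto simp: norm_mult)
  show "integrable lborel (\<lambda>z. iexp (\<xi> \<bullet> z) * f z)"
    using 1 by (simp add: inner_commute)
qed

lemma borel_measurable_fourier_integral [measurable]:
  assumes [measurable]: "f \<in> borel_measurable borel"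
  shows "fourier_integral f \<in> borel_measurable borel"
  unfolding fourier_integral_def[abs_def] by measurable

lemma norm_fourier_integral_le:
  assumes "integrable lborel f"
  shows "norm (fourier_integral f \<xi>) \<le> (LINT z|lborel. norm (f z))"
  unfolding fourier_integral_def
  by (rule order_trans[OF integral_norm_bound]) (simp add: norm_mult)

lemma fourier_integral_diff:
  assumes "integrable lborel f" "integrable lborel g"
  shows "fourier_integral (\<lambda>z. f z - g z) \<xi> = fourier_integral f \<xi> - fourier_integral g \<xi>"
  unfolding fourier_integral_def right_diff_distrib
  by (rule Bochner_Integration.integral_diff) (auto intro: assms)

text \<open>With this scaling the function is its own Fourier transform up to the factor
  \<open>sqrt (2 * pi) ^ DIM('b)\<close>. Being positive and square-integrable, it also serves as
  the weight in the proof of completeness.\<close>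

definition gauss :: "'b::euclidean_space \<Rightarrow> real" where
  "gauss z = exp (- (norm z)\<^sup>2 / 2)"

lemma borel_measurable_gauss [measurable]: "gauss \<in> borel_measurable borel"
  unfolding gauss_def[abs_def] by measurable

lemma gauss_nonneg [simp]: "0 \<le> gauss z" and gauss_le_1: "gauss z \<le> 1"
  by (auto simp: gauss_def)

text \<open>The characteristic function of the standard normal law, with the normalisation of its
  density moved to the other side.\<close>

lemma gaussian_integral_real:
  fixes t :: real
  shows "integrable lborel (\<lambda>x::real. complex_of_real (exp (- x\<^sup>2 / 2)))"
    and "(LINT x|lborel. exp (- (\<i> * complex_of_real (x * t))) * complex_of_real (exp (- x\<^sup>2 / 2)))
       = complex_of_real (sqrt (2 * pi) * exp (- t\<^sup>2 / 2))"
proof -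
  have "integrable lborel (\<lambda>x::real. sqrt (2 * pi) * std_normal_density x)"
    by simp
  then show "integrable lborel (\<lambda>x::real. complex_of_real (exp (- x\<^sup>2 / 2)))"
    by (simp add: normal_density_def)
  have "char std_normal_distribution (- t) = complex_of_real (exp (- t\<^sup>2 / 2))"
    by (simp add: char_std_normal_distribution)
  moreover have "char std_normal_distribution (- t) =
      (LINT x|lborel. std_normal_density x *\<^sub>R iexp (- t * x))"
    unfolding char_def by (subst integral_density) auto
  ultimately have "complex_of_real (sqrt (2 * pi)) * (LINT x|lborel. std_normal_density x *\<^sub>R iexp (- t * x))
      = complex_of_real (sqrt (2 * pi) * exp (- t\<^sup>2 / 2))"
    by simp
  moreover have "complex_of_real (sqrt (2 * pi)) * (LINT x|lborel. std_normal_density x *\<^sub>R iexp (- t * x))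
     = (LINT x|lborel. exp (- (\<i> * complex_of_real (x * t))) * complex_of_real (exp (- x\<^sup>2 / 2)))"
    by (subst integral_mult_right_zero[symmetric], intro Bochner_Integration.integral_cong refl)
       (simp add: normal_density_def scaleR_conv_of_real mult_ac)
  ultimately show "(LINT x|lborel. exp (- (\<i> * complex_of_real (x * t))) * complex_of_real (exp (- x\<^sup>2 / 2)))
       = complex_of_real (sqrt (2 * pi) * exp (- t\<^sup>2 / 2))"
    by simp
qed

lemma product_sigma_finite_lborel: "product_sigma_finite (\<lambda>_. lborel :: real measure)"
  by standard

lemma integrable_prod_coordinates:
  fixes f :: "'b::euclidean_space \<Rightarrow> real \<Rightarrow> 'c::{real_normed_field,banach,second_countable_topology}"
  assumes "\<And>b. b \<in> Basis \<Longrightarrow> integrable lborel (f b)"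
  shows "integrable lborel (\<lambda>z. \<Prod>b\<in>Basis. f b (z \<bullet> b))"
    and "(LINT z|lborel. (\<Prod>b\<in>Basis. f b (z \<bullet> b))) = (\<Prod>b\<in>Basis. (LINT x|lborel. f b x))"
proof -
  interpret P: product_sigma_finite "\<lambda>_::'b. lborel :: real measure"
    by (rule product_sigma_finite_lborel)
  have [measurable]: "f b \<in> borel_measurable borel" if "b \<in> Basis" for b
    using borel_measurable_integrable[OF assms[OF that]] by simp
  have m: "(\<lambda>z. \<Prod>b\<in>Basis. f b (z \<bullet> b)) \<in> borel_measurable borel"
    by (intro borel_measurable_prod) measurable
  have eq: "(\<Prod>b\<in>Basis. f b ((\<Sum>b\<in>Basis. w b *\<^sub>R b) \<bullet> b)) = (\<Prod>b\<in>Basis. f b (w b))" for w :: "'b \<Rightarrow> real"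
    by (intro prod.cong refl) simp
  have "integrable (Pi\<^sub>M Basis (\<lambda>_. lborel)) (\<lambda>w. \<Prod>b\<in>Basis. f b (w b))"
    by (rule P.product_integrable_prod) (auto intro: assms)
  then show "integrable lborel (\<lambda>z. \<Prod>b\<in>Basis. f b (z \<bullet> b))"
    by (subst lborel_eq, subst integrable_distr_eq[OF _ m]) (auto simp: eq)
  show "(LINT z|lborel. (\<Prod>b\<in>Basis. f b (z \<bullet> b))) = (\<Prod>b\<in>Basis. (LINT x|lborel. f b x))"
    by (subst lborel_eq, subst integral_distr[OF _ m])
      (auto simp: eq intro!: P.product_integral_prod assms)
qed

lemma gauss_prod: "gauss z = (\<Prod>b\<in>Basis. exp (- (z \<bullet> b)\<^sup>2 / 2))"
proof -
  have "(norm z)\<^sup>2 = (\<Sum>b\<in>Basis. (z \<bullet> b)\<^sup>2)"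
    unfolding power2_norm_eq_inner by (subst euclidean_inner) (simp add: power2_eq_square)
  then show ?thesis
    by (simp add: gauss_def exp_sum[symmetric] sum_negf sum_divide_distrib)
qed

lemma integrable_gauss: "integrable lborel (gauss :: 'b::euclidean_space \<Rightarrow> real)"
  unfolding gauss_prod[abs_def]
  by (rule integrable_prod_coordinates)
    (use gaussian_integral_real(1) in \<open>simp only: complex_of_real_integrable_eq\<close>)

lemma fourier_integral_gauss:
  "fourier_integral (\<lambda>z. complex_of_real (gauss z)) (\<xi> :: 'b::euclidean_space)
     = complex_of_real (sqrt (2 * pi) ^ DIM('b) * gauss \<xi>)"
proof -
  have "exp (- (\<i> * complex_of_real (z \<bullet> \<xi>))) * complex_of_real (gauss z) =
    (\<Prod>b\<in>Basis. exp (- (\<i> * complex_of_real ((z \<bullet> b) * (\<xi> \<bullet> b)))) * complex_of_real (exp (- (z \<bullet> b)\<^sup>2 / 2)))" for z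
  proof -
    have "exp (- (\<i> * complex_of_real (z \<bullet> \<xi>))) = (\<Prod>b\<in>Basis. exp (- (\<i> * complex_of_real ((z \<bullet> b) * (\<xi> \<bullet> b)))))"
      by (subst exp_sum[symmetric], simp, subst euclidean_inner) (simp add: sum_negf sum_distrib_left)
    then show ?thesis
      by (simp add: gauss_prod prod.distrib)
  qed
  then have "fourier_integral (\<lambda>z. complex_of_real (gauss z)) \<xi> =
    (LINT z|lborel. (\<Prod>b\<in>Basis. exp (- (\<i> * complex_of_real ((z \<bullet> b) * (\<xi> \<bullet> b)))) * complex_of_real (exp (- (z \<bullet> b)\<^sup>2 / 2))))"
    unfolding fourier_integral_def by (simp only:)
  also have "\<dots> = (\<Prod>b\<in>Basis. (LINT x|lborel. exp (- (\<i> * complex_of_real (x * (\<xi> \<bullet> b)))) * complex_of_real (exp (- x\<^sup>2 / 2))))"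
    using integrable_exp_mult(1)[OF gaussian_integral_real(1)]
    by (intro integrable_prod_coordinates(2)[where f = "\<lambda>b x. exp (- (\<i> * complex_of_real (x * (\<xi> \<bullet> b)))) * complex_of_real (exp (- x\<^sup>2 / 2))"])
      (simp only: inner_real_def)
  also have "\<dots> = complex_of_real (sqrt (2 * pi) ^ DIM('b) * gauss \<xi>)"
    unfolding gaussian_integral_real(2) by (simp add: gauss_prod prod.distrib)
  finally show ?thesis .
qed

lemma integral_gauss: "(LINT z|lborel. gauss (z :: 'b::euclidean_space)) = sqrt (2 * pi) ^ DIM('b)"
proof -
  have "complex_of_real (LINT z|lborel. gauss (z :: 'b)) = complex_of_real (sqrt (2 * pi) ^ DIM('b) * gauss (0 :: 'b))"
    using fourier_integral_gauss[of "0 :: 'b"] unfolding fourier_integral_def by simp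
  then show ?thesis unfolding of_real_eq_iff by (simp add: gauss_def[of 0])
qed

subsection \<open>Plancherel's identity for integrable functions\<close>

lemma integrable_bounded_kernel:
  fixes f :: "'b::euclidean_space \<Rightarrow> complex" and g :: "'c::euclidean_space \<Rightarrow> complex"
  assumes f: "integrable lborel f" and g: "integrable lborel g"
    and k [measurable]: "case_prod k \<in> borel_measurable (lborel \<Otimes>\<^sub>M lborel)" and le: "\<And>x y. norm (k x y) \<le> 1"
  shows "integrable (lborel \<Otimes>\<^sub>M lborel) (\<lambda>(x, y). f x * g y * k x y)"
proof (rule lborel_pair.Fubini_integrable)
  note [measurable] = borel_measurable_integrable[OF f] borel_measurable_integrable[OF g]
  have k' [measurable]: "(\<lambda>y. k x y) \<in> borel_measurable lborel" for x
    using measurable_compose[OF measurable_Pair1' k, of x] by simp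
  show m: "(\<lambda>(x, y). f x * g y * k x y) \<in> borel_measurable (lborel \<Otimes>\<^sub>M lborel)" by measurable
  have le': "norm (f x * g y * k x y) \<le> norm (f x) * norm (g y)" for x y
    using mult_left_mono[OF le[of x y], of "norm (f x) * norm (g y)"] by (simp add: norm_mult)
  have i: "integrable lborel (\<lambda>y. f x * g y * k x y)" for x
    by (rule Bochner_Integration.integrable_bound[where f = "\<lambda>y. norm (f x) * norm (g y)"])
      (use g le' in auto)
  show "AE x in lborel. integrable lborel (\<lambda>y. case (x, y) of (x, y) \<Rightarrow> f x * g y * k x y)"
    using i by simp
  show "integrable lborel (\<lambda>x. LINT y|lborel. norm (case (x, y) of (x, y) \<Rightarrow> f x * g y * k x y))"
  proof (rule Bochner_Integration.integrable_bound)
    show "integrable lborel (\<lambda>x. norm (f x) * (LINT y|lborel. norm (g y)))" using f by simp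
    show "(\<lambda>x. LINT y|lborel. norm (case (x, y) of (x, y) \<Rightarrow> f x * g y * k x y)) \<in> borel_measurable lborel"
      using m by measurable
    show "AE x in lborel. norm (LINT y|lborel. norm (case (x, y) of (x, y) \<Rightarrow> f x * g y * k x y))
       \<le> norm (norm (f x) * (LINT y|lborel. norm (g y)))"
    proof (intro always_eventually allI)
      fix x
      have "(LINT y|lborel. norm (f x * g y * k x y)) \<le> (LINT y|lborel. norm (f x) * norm (g y))"
        using le' g i by (intro integral_mono) auto
      then show "norm (LINT y|lborel. norm (case (x, y) of (x, y) \<Rightarrow> f x * g y * k x y))
         \<le> norm (norm (f x) * (LINT y|lborel. norm (g y)))"
        by (simp add: integral_nonneg_AE)
    qed
  qed
qed

text \<open>The interchanges of Fourier integrals all have this shape: the kernel is an exponential,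
  or, in \<open>kernel_synthesis\<close>, a difference quotient of one.\<close>

lemma Fubini_bounded_kernel:
  fixes f :: "'b::euclidean_space \<Rightarrow> complex" and g :: "'c::euclidean_space \<Rightarrow> complex"
  assumes "integrable lborel f" "integrable lborel g"
    and "case_prod k \<in> borel_measurable (lborel \<Otimes>\<^sub>M lborel)" "\<And>x y. norm (k x y) \<le> 1"
  shows "(LINT y|lborel. g y * (LINT x|lborel. f x * k x y)) = (LINT x|lborel. f x * (LINT y|lborel. g y * k x y))"
proof -
  have "(LINT y|lborel. (LINT x|lborel. f x * g y * k x y)) = (LINT x|lborel. (LINT y|lborel. f x * g y * k x y))"
    by (rule lborel_pair.Fubini_integral[OF integrable_bounded_kernel[OF assms]])
  then show ?thesis
    by (simp add: mult_ac flip: integral_mult_right_zero)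
qed

lemma lborel_integral_affine:
  fixes f :: "'b::euclidean_space \<Rightarrow> 'c::{banach, second_countable_topology}"
  assumes [measurable]: "f \<in> borel_measurable borel" and "c \<noteq> 0"
  shows "(LINT x|lborel. f x) = \<bar>c\<bar> ^ DIM('b) *\<^sub>R (LINT x|lborel. f (t + c *\<^sub>R x))"
  by (subst lborel_affine[OF assms(2), of t]) (simp add: integral_density integral_distr)

lemma lborel_integrable_affine:
  fixes f :: "'b::euclidean_space \<Rightarrow> 'c::{banach, second_countable_topology}"
  assumes "integrable lborel f" and c: "c \<noteq> 0"
  shows "integrable lborel (\<lambda>x. f (t + c *\<^sub>R x))"
proof -
  have [measurable]: "f \<in> borel_measurable borel"
    using borel_measurable_integrable[OF assms(1)] by simp
  have "integrable (density (distr lborel borel (\<lambda>x. t + c *\<^sub>R x)) (\<lambda>_. ennreal (\<bar>c\<bar> ^ DIM('b)))) f"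
    using assms(1) lborel_affine[OF c, of t] by (simp add: ennreal_power)
  then have "integrable lborel (\<lambda>x. \<bar>c\<bar> ^ DIM('b) *\<^sub>R f (t + c *\<^sub>R x))"
    using c by (subst (asm) integrable_density) (auto simp: integrable_distr_eq)
  from integrable_scaleR_right[OF this, of "inverse (\<bar>c\<bar> ^ DIM('b))"] show ?thesis
    using c by simp
qed

lemma fourier_integral_gauss_scaled:
  fixes \<xi> :: "'b::euclidean_space"
  assumes e: "0 < e"
  shows "fourier_integral (\<lambda>z. complex_of_real (gauss (e *\<^sub>R z))) \<xi>
     = complex_of_real (sqrt (2 * pi) ^ DIM('b) / e ^ DIM('b) * gauss ((1 / e) *\<^sub>R \<xi>))"
proof -
  have "complex_of_real (sqrt (2 * pi) ^ DIM('b) * gauss ((1 / e) *\<^sub>R \<xi>))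
      = e ^ DIM('b) *\<^sub>R (LINT z|lborel. exp (- (\<i> * complex_of_real ((0 + e *\<^sub>R z) \<bullet> ((1 / e) *\<^sub>R \<xi>)))) * complex_of_real (gauss (0 + e *\<^sub>R z)))"
    unfolding fourier_integral_gauss[symmetric] fourier_integral_def
    by (subst lborel_integral_affine[where c = e and t = 0]) (use e in auto)
  also have "\<dots> = e ^ DIM('b) *\<^sub>R fourier_integral (\<lambda>z. complex_of_real (gauss (e *\<^sub>R z))) \<xi>"
    unfolding fourier_integral_def using e by simp
  finally show ?thesis
    using e by (simp add: scaleR_conv_of_real field_simps)
qed

text \<open>The Gaussian factor makes the threefold integral over \<open>\<xi>\<close> and the two
  copies of the argument of \<open>f\<close> absolutely convergent. Integrating over
  \<open>\<xi>\<close> before the other variables then leaves a Gaussian average of \<open>f\<close>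
  at scale \<open>e\<close>, paired with \<open>f\<close>.\<close>

lemma plancherel_regularised:
  fixes f :: "'b::euclidean_space \<Rightarrow> complex"
  assumes f: "integrable lborel f" and e: "0 < e"
  shows "complex_of_real (LINT \<xi>|lborel. gauss (e *\<^sub>R \<xi>) * (norm (fourier_integral f \<xi>))\<^sup>2)
    = complex_of_real (sqrt (2 * pi) ^ DIM('b)) *
      (LINT x|lborel. (LINT w|lborel. complex_of_real (gauss w) * f (x + e *\<^sub>R w)) * cnj (f x))"
proof -
  have [measurable]: "f \<in> borel_measurable borel"
    using borel_measurable_integrable[OF f] by simp
  let ?G = "\<lambda>\<xi>. complex_of_real (gauss (e *\<^sub>R \<xi> :: 'b))"
  let ?F = "fourier_integral f"
  have iG: "integrable lborel ?G"
    using lborel_integrable_affine[OF integrable_gauss, of e "0 :: 'b"] e by (simp add: complex_of_real_integrable_eq)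
  have iGF: "integrable lborel (\<lambda>\<xi>. ?G \<xi> * ?F \<xi>)"
  proof (rule Bochner_Integration.integrable_bound)
    show "integrable lborel (\<lambda>\<xi>. ?G \<xi> * complex_of_real (LINT z|lborel. norm (f z)))" using iG by simp
    show "AE \<xi> in lborel. norm (?G \<xi> * ?F \<xi>) \<le> norm (?G \<xi> * complex_of_real (LINT z|lborel. norm (f z)))"
      using norm_fourier_integral_le[OF f]
      by (auto simp: norm_mult integral_nonneg_AE intro!: mult_left_mono)
  qed simp
  have icf: "integrable lborel (\<lambda>x. cnj (f x))" using f by simp
  have inner: "(LINT \<xi>|lborel. ?G \<xi> * ?F \<xi> * iexp (x \<bullet> \<xi>))
     = complex_of_real (sqrt (2 * pi) ^ DIM('b)) * (LINT w|lborel. complex_of_real (gauss w) * f (x + e *\<^sub>R w))" for x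
  proof -
    have "(LINT \<xi>|lborel. ?G \<xi> * ?F \<xi> * iexp (x \<bullet> \<xi>))
      = (LINT \<xi>|lborel. ?G \<xi> * (LINT z|lborel. f z * exp (- (\<i> * complex_of_real ((z - x) \<bullet> \<xi>)))))"
    proof (intro Bochner_Integration.integral_cong refl)
      fix \<xi>
      have "?F \<xi> * iexp (x \<bullet> \<xi>) = (LINT z|lborel. f z * exp (- (\<i> * complex_of_real ((z - x) \<bullet> \<xi>))))"
        unfolding fourier_integral_def integral_mult_left_zero[symmetric]
        by (intro Bochner_Integration.integral_cong refl)
          (simp add: inner_diff_left algebra_simps flip: exp_add)
      then show "?G \<xi> * ?F \<xi> * iexp (x \<bullet> \<xi>) =
        ?G \<xi> * (LINT z|lborel. f z * exp (- (\<i> * complex_of_real ((z - x) \<bullet> \<xi>))))"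
        by (simp add: mult.assoc)
    qed
    also have "\<dots> = (LINT z|lborel. f z * (LINT \<xi>|lborel. ?G \<xi> * exp (- (\<i> * complex_of_real ((z - x) \<bullet> \<xi>)))))"
      by (rule Fubini_bounded_kernel[OF f iG])
        (auto simp: lborel_prod split_beta' intro!: borel_measurable_continuous_onI continuous_intros)
    also have "\<dots> = (LINT z|lborel. f z * fourier_integral ?G (z - x))"
      unfolding fourier_integral_def by (simp add: inner_commute mult.commute)
    also have "\<dots> = (LINT z|lborel. f z * complex_of_real (sqrt (2 * pi) ^ DIM('b) / e ^ DIM('b) * gauss ((1 / e) *\<^sub>R (z - x))))"
      unfolding fourier_integral_gauss_scaled[OF e] ..
    \<comment> \<open>Substitution of \<open>x + e *\<^sub>R w\<close> for the variable: its
      Jacobian cancels the factor \<open>1 / e ^ DIM('b)\<close> of the transformed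
      Gaussian.\<close>
    also have "\<dots> = e ^ DIM('b) *\<^sub>R (LINT w|lborel. f (x + e *\<^sub>R w) * complex_of_real (sqrt (2 * pi) ^ DIM('b) / e ^ DIM('b) * gauss ((1 / e) *\<^sub>R (x + e *\<^sub>R w - x))))"
      by (subst lborel_integral_affine[where c = e and t = x]) (use e in auto)
    also have "\<dots> = e ^ DIM('b) *\<^sub>R (LINT w|lborel. complex_of_real (sqrt (2 * pi) ^ DIM('b) / e ^ DIM('b)) * (complex_of_real (gauss w) * f (x + e *\<^sub>R w)))"
      using e by (simp add: mult_ac)
    also have "\<dots> = complex_of_real (sqrt (2 * pi) ^ DIM('b)) * (LINT w|lborel. complex_of_real (gauss w) * f (x + e *\<^sub>R w))"
      unfolding integral_mult_right_zero using e by (simp add: scaleR_conv_of_real)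
    finally show ?thesis .
  qed
  have "complex_of_real (LINT \<xi>|lborel. gauss (e *\<^sub>R \<xi>) * (norm (?F \<xi>))\<^sup>2)
    = (LINT \<xi>|lborel. ?G \<xi> * ?F \<xi> * (LINT x|lborel. cnj (f x) * iexp (x \<bullet> \<xi>)))"
  proof (subst integral_complex_of_real[symmetric], intro Bochner_Integration.integral_cong refl)
    fix \<xi>
    have "cnj (?F \<xi>) = (LINT x|lborel. cnj (f x) * iexp (x \<bullet> \<xi>))"
      unfolding fourier_integral_def Bochner_Integration.integral_cnj[symmetric]
      by (intro Bochner_Integration.integral_cong refl) (simp add: exp_cnj mult.commute)
    then show "complex_of_real (gauss (e *\<^sub>R \<xi>) * (norm (?F \<xi>))\<^sup>2) =
       ?G \<xi> * ?F \<xi> * (LINT x|lborel. cnj (f x) * iexp (x \<bullet> \<xi>))"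
      by (metis complex_norm_square mult.assoc of_real_mult)
  qed
  also have "\<dots> = (LINT x|lborel. cnj (f x) * (LINT \<xi>|lborel. ?G \<xi> * ?F \<xi> * iexp (x \<bullet> \<xi>)))"
    by (rule Fubini_bounded_kernel[OF icf iGF])
      (auto simp: lborel_prod split_beta' intro!: borel_measurable_continuous_onI continuous_intros)
  also have "\<dots> = complex_of_real (sqrt (2 * pi) ^ DIM('b)) *
      (LINT x|lborel. (LINT w|lborel. complex_of_real (gauss w) * f (x + e *\<^sub>R w)) * cnj (f x))"
  proof -
    have "(LINT x|lborel. cnj (f x) * (c * g x)) = c * (LINT x|lborel. g x * cnj (f x))" for c and g :: "'b \<Rightarrow> complex"
      by (subst integral_mult_right_zero[symmetric]) (simp add: mult_ac)
    then show ?thesis unfolding inner .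
  qed
  finally show ?thesis .
qed

text \<open>The scale of the Gaussian tends to 0: on one side the damping disappears, on the other
  side \<open>approximate_identity\<close> applies.\<close>

theorem plancherel_fourier_integral:
  fixes f :: "'b::euclidean_space \<Rightarrow> complex"
  assumes f: "integrable lborel f" and f2: "square_integrable f"
  shows "square_integrable (fourier_integral f)"
    and "(L2_norm (fourier_integral f))\<^sup>2 = (2 * pi) ^ DIM('b) * (L2_norm f)\<^sup>2"
proof -
  note [measurable] = square_integrable_measurable[OF f2]
  let ?F = "fourier_integral f"
  define e :: "nat \<Rightarrow> real" where "e n = inverse (real (Suc n))" for n
  have e0: "e \<longlonglongrightarrow> 0" and epos: "0 < e n" for n
    unfolding e_def by (rule LIMSEQ_inverse_real_of_nat) simp
  let ?I = "\<lambda>n. LINT \<xi>|lborel. gauss (e n *\<^sub>R \<xi>) * (norm (?F \<xi>))\<^sup>2"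
  have "(\<lambda>n. complex_of_real (?I n)) \<longlonglongrightarrow>
      complex_of_real (sqrt (2 * pi) ^ DIM('b)) * complex_of_real ((LINT w|lborel. gauss (w :: 'b)) * (L2_norm f)\<^sup>2)"
    unfolding plancherel_regularised[OF f epos]
    by (intro tendsto_mult tendsto_const approximate_identity integrable_gauss f2 e0)
  moreover have "complex_of_real (sqrt (2 * pi) ^ DIM('b)) * complex_of_real ((LINT w|lborel. gauss (w :: 'b)) * (L2_norm f)\<^sup>2)
     = complex_of_real ((2 * pi) ^ DIM('b) * (L2_norm f)\<^sup>2)"
  proof -
    have "sqrt (2 * pi) ^ DIM('b) * sqrt (2 * pi) ^ DIM('b) = (2 * pi) ^ DIM('b)"
      unfolding power_mult_distrib[symmetric] by simp
    then show ?thesis unfolding integral_gauss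
      by (metis mult.assoc of_real_mult)
  qed
  ultimately have lim: "?I \<longlonglongrightarrow> (2 * pi) ^ DIM('b) * (L2_norm f)\<^sup>2"
    by (simp only: tendsto_of_real_iff)
  have gauss_lim: "(\<lambda>n. gauss (e n *\<^sub>R \<xi>) * (norm (?F \<xi>))\<^sup>2) \<longlonglongrightarrow> (norm (?F \<xi>))\<^sup>2" for \<xi>
  proof -
    have "(\<lambda>n. exp (- (norm (e n *\<^sub>R \<xi>))\<^sup>2 / 2) * (norm (?F \<xi>))\<^sup>2) \<longlonglongrightarrow> exp (- (norm (0 *\<^sub>R \<xi>))\<^sup>2 / 2) * (norm (?F \<xi>))\<^sup>2"
      by (intro tendsto_intros e0) auto
    then show ?thesis by (simp add: gauss_def)
  qed
  have int: "integrable lborel (\<lambda>\<xi>. gauss (e n *\<^sub>R \<xi>) * (norm (?F \<xi>))\<^sup>2)" for n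
  proof (rule Bochner_Integration.integrable_bound)
    show "integrable lborel (\<lambda>\<xi>. gauss (e n *\<^sub>R \<xi> :: 'b) * (LINT z|lborel. norm (f z))\<^sup>2)"
      using lborel_integrable_affine[OF integrable_gauss, of "e n" "0 :: 'b"] epos[of n] by simp
    show "AE \<xi> in lborel. norm (gauss (e n *\<^sub>R \<xi>) * (norm (?F \<xi>))\<^sup>2) \<le> norm (gauss (e n *\<^sub>R \<xi> :: 'b) * (LINT z|lborel. norm (f z))\<^sup>2)"
      using norm_fourier_integral_le[OF f]
      by (auto intro!: mult_left_mono power_mono)
  qed simp
  \<comment> \<open>Integrability of the squared transform is not yet known, so Fatou's lemma has to
    supply it before dominated convergence can identify the limit.\<close>
  have "sq_mass ?F = (\<integral>\<^sup>+ \<xi>. liminf (\<lambda>n. ennreal (gauss (e n *\<^sub>R \<xi>) * (norm (?F \<xi>))\<^sup>2)) \<partial>lborel)"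
    by (intro nn_integral_cong lim_imp_Liminf[symmetric] tendsto_ennrealI gauss_lim) simp
  also have "\<dots> \<le> liminf (\<lambda>n. \<integral>\<^sup>+ \<xi>. ennreal (gauss (e n *\<^sub>R \<xi>) * (norm (?F \<xi>))\<^sup>2) \<partial>lborel)"
    by (intro nn_integral_liminf) measurable
  also have "\<dots> = liminf (\<lambda>n. ennreal (?I n))"
    using int by (simp add: nn_integral_eq_integral)
  also have "\<dots> = ennreal ((2 * pi) ^ DIM('b) * (L2_norm f)\<^sup>2)"
    by (intro lim_imp_Liminf tendsto_ennrealI lim) simp
  finally show F2: "square_integrable ?F"
    by (auto simp: square_integrable_iff_sq_mass intro: order_le_less_trans)
  have "?I \<longlonglongrightarrow> (LINT \<xi>|lborel. (norm (?F \<xi>))\<^sup>2)"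
  proof (rule integral_dominated_convergence[where w = "\<lambda>\<xi>. (norm (?F \<xi>))\<^sup>2"])
    show "AE \<xi> in lborel. norm (gauss (e n *\<^sub>R \<xi>) * (norm (?F \<xi>))\<^sup>2) \<le> (norm (?F \<xi>))\<^sup>2" for n
      by (auto intro!: mult_left_le_one_le gauss_le_1)
  qed (use gauss_lim square_integrable_integrable_sq[OF F2] in auto)
  from LIMSEQ_unique[OF this lim]
  show "(L2_norm ?F)\<^sup>2 = (2 * pi) ^ DIM('b) * (L2_norm f)\<^sup>2"
    by (simp add: L2_norm_power2)
qed

subsection \<open>Completeness\<close>

lemma L2_norm_add_power2_le:
  assumes "square_integrable f" "square_integrable g"
  shows "(L2_norm (\<lambda>z. f z + g z))\<^sup>2 \<le> 2 * (L2_norm f)\<^sup>2 + 2 * (L2_norm g)\<^sup>2"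
proof -
  have "(L2_norm (\<lambda>z. f z + g z))\<^sup>2 \<le> (LINT z|lborel. 2 * (norm (f z))\<^sup>2 + 2 * (norm (g z))\<^sup>2)"
    unfolding L2_norm_power2
    using square_integrable_integrable_sq[OF assms(1)] square_integrable_integrable_sq[OF assms(2)]
    by (intro integral_mono square_integrable_integrable_sq square_integrable_add assms norm_add_power2_le) auto
  also have "\<dots> = 2 * (L2_norm f)\<^sup>2 + 2 * (L2_norm g)\<^sup>2"
    unfolding L2_norm_power2
    using square_integrable_integrable_sq[OF assms(1)] square_integrable_integrable_sq[OF assms(2)]
    by simp
  finally show ?thesis .
qed

lemma L2_norm_minus_commute: "L2_norm (\<lambda>z. f z - g z) = L2_norm (\<lambda>z. g z - f z)"
  by (simp add: L2_norm_def norm_minus_commute)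

lemma square_integrable_gauss: "square_integrable (\<lambda>z. complex_of_real (gauss z))"
  unfolding square_integrable_def
proof
  show "integrable lborel (\<lambda>z :: 'a. (norm (complex_of_real (gauss z)))\<^sup>2)"
    by (rule Bochner_Integration.integrable_bound[OF integrable_gauss])
      (auto simp: power2_eq_square intro!: mult_left_le_one_le gauss_le_1)
qed simp

text \<open>Along a fast subsequence the increments, weighted by a positive square-integrable function, have a
  finite total integral; so the subsequence converges almost everywhere.\<close>

lemma Riesz_Fischer:
  fixes F :: "nat \<Rightarrow> 'b::euclidean_space \<Rightarrow> complex"
  assumes F: "\<And>n. square_integrable (F n)"
    and Cauchy: "\<And>e. 0 < e \<Longrightarrow> \<exists>N. \<forall>m\<ge>N. \<forall>n\<ge>N. L2_norm (\<lambda>z. F m z - F n z) < e"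
  obtains f where "square_integrable f" "L2_tendsto F f"
proof -
  have "\<forall>k. \<exists>N. \<forall>m\<ge>N. \<forall>n\<ge>N. L2_norm (\<lambda>z. F m z - F n z) < (1 / 2) ^ k"
    using Cauchy by simp
  then obtain N :: "nat \<Rightarrow> nat" where
    N: "\<And>k m n. m \<ge> N k \<Longrightarrow> n \<ge> N k \<Longrightarrow> L2_norm (\<lambda>z. F m z - F n z) < (1 / 2) ^ k"
    by metis
  \<comment> \<open>Partial sums turn the thresholds \<open>N k\<close> into a monotone sequence of
    indices that stays above them.\<close>
  define r where "r k = (\<Sum>j\<le>k. N j)" for k
  have rN: "N k \<le> r k" for k
    unfolding r_def by (rule member_le_sum) auto
  have rS: "r k \<le> r (Suc k)" for k by (simp add: r_def)
  \<comment> \<open>Taken as \<open>lim\<close> everywhere, f is Borel; its values where the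
    subsequence diverges do not matter, since that set is null.\<close>
  define f where "f z = lim (\<lambda>k. F (r k) z)" for z
  note [measurable] = square_integrable_measurable[OF F]
  have f_meas [measurable]: "f \<in> borel_measurable borel"
    unfolding f_def[abs_def] by measurable
  let ?d = "\<lambda>k z. F (r (Suc k)) z - F (r k) z"
  have d: "square_integrable (?d k)" for k by (intro square_integrable_diff F)
  let ?g = "\<lambda>z :: 'b. complex_of_real (gauss z)"
  have "(\<integral>\<^sup>+ z. (\<Sum>k. ennreal (norm (?d k z) * gauss z)) \<partial>lborel) = (\<Sum>k. \<integral>\<^sup>+ z. ennreal (norm (?d k z) * gauss z) \<partial>lborel)"
    by (intro nn_integral_suminf) measurable
  also have "\<dots> \<le> (\<Sum>k. ennreal ((1 / 2) ^ k * L2_norm ?g))"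
  proof (intro suminf_le)
    fix k
    have i: "integrable lborel (\<lambda>z. norm (?d k z) * gauss z)"
      using integrable_norm[OF integrable_mult_square_integrable[OF d square_integrable_gauss], of k]
      by (simp add: norm_mult)
    have "(\<integral>\<^sup>+ z. ennreal (norm (?d k z) * gauss z) \<partial>lborel) = ennreal (LINT z|lborel. norm (?d k z) * gauss z)"
      using i by (intro nn_integral_eq_integral) auto
    also have "\<dots> \<le> ennreal (L2_norm (?d k) * L2_norm ?g)"
      using Cauchy_Schwarz_norm_mult[OF d square_integrable_gauss, of k] by (intro ennreal_leI) simp
    also have "\<dots> \<le> ennreal ((1 / 2) ^ k * L2_norm ?g)"
      using N[of k "r (Suc k)" "r k"] rN[of k] rS[of k]
      by (intro ennreal_leI mult_right_mono) auto
    finally show "(\<integral>\<^sup>+ z. ennreal (norm (?d k z) * gauss z) \<partial>lborel) \<le> ennreal ((1 / 2) ^ k * L2_norm ?g)" .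
  qed auto
  also have "\<dots> = ennreal (\<Sum>k. (1 / 2) ^ k * L2_norm ?g)"
    by (intro suminf_ennreal2 summable_mult2 summable_geometric) auto
  also have "\<dots> < \<infinity>" by simp
  finally have "AE z in lborel. (\<Sum>k. ennreal (norm (?d k z) * gauss z)) \<noteq> \<infinity>"
    by (intro nn_integral_PInf_AE) auto
  then have conv: "AE z in lborel. (\<lambda>k. F (r k) z) \<longlonglongrightarrow> f z"
  proof eventually_elim
    case (elim z)
    have "summable (\<lambda>k. norm (?d k z) * gauss z)"
      using elim by (intro summable_suminf_not_top) auto
    then have "summable (\<lambda>k. norm (?d k z) * gauss z * inverse (gauss z))"
      by (rule summable_mult2)
    moreover have "gauss z \<noteq> 0" by (simp add: gauss_def)
    ultimately have "summable (\<lambda>k. norm (?d k z))"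
      by (simp add: mult.assoc)
    then have "summable (\<lambda>k. ?d k z)"
      by (rule summable_norm_cancel)
    then have "convergent (\<lambda>n. \<Sum>k<n. ?d k z)"
      by (simp add: summable_iff_convergent)
    then have "convergent (\<lambda>n. F (r n) z - F (r 0) z)"
      using sum_lessThan_telescope[of "\<lambda>k. F (r k) z"] by simp
    then have "convergent (\<lambda>n. (F (r n) z - F (r 0) z) + F (r 0) z)"
      by (intro convergent_add convergent_const)
    then show ?case
      by (simp add: f_def convergent_LIMSEQ_iff)
  qed
  \<comment> \<open>Fatou's lemma along the subsequence turns the Cauchy estimate into an estimate
    of the distance of the full sequence to the limit.\<close>
  have est: "sq_mass (\<lambda>z. F n z - f z) \<le> ennreal (((1 / 2) ^ j)\<^sup>2)" if n: "n \<ge> N j" for n j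
  proof -
    have "sq_mass (\<lambda>z. F n z - f z) = (\<integral>\<^sup>+ z. liminf (\<lambda>k. ennreal ((norm (F n z - F (r k) z))\<^sup>2)) \<partial>lborel)"
    proof (rule nn_integral_cong_AE)
      show "AE z in lborel. ennreal ((norm (F n z - f z))\<^sup>2) = liminf (\<lambda>k. ennreal ((norm (F n z - F (r k) z))\<^sup>2))"
        using conv
        by eventually_elim (intro lim_imp_Liminf[symmetric] tendsto_ennrealI tendsto_intros; simp)
    qed
    also have "\<dots> \<le> liminf (\<lambda>k. sq_mass (\<lambda>z. F n z - F (r k) z))"
      by (intro nn_integral_liminf) measurable
    also have "\<dots> \<le> liminf (\<lambda>k. ennreal (((1 / 2) ^ j)\<^sup>2))"
    proof (rule Liminf_mono)
      have "sq_mass (\<lambda>z. F n z - F (r k) z) \<le> ennreal (((1 / 2) ^ j)\<^sup>2)" if k: "k \<ge> j" for k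
      proof -
        have "N j \<le> r k"
          using rN[of j] lift_Suc_mono_le[of r, OF rS k] by simp
        then have "L2_norm (\<lambda>z. F n z - F (r k) z) < (1 / 2) ^ j"
          using n by (intro N) auto
        then show ?thesis
          unfolding sq_mass_eq_L2_norm[OF square_integrable_diff[OF F F]]
          by (intro ennreal_leI power_mono) auto
      qed
      then show "\<forall>\<^sub>F k in sequentially. sq_mass (\<lambda>z. F n z - F (r k) z) \<le> ennreal (((1 / 2) ^ j)\<^sup>2)"
        unfolding eventually_sequentially by blast
    qed
    also have "\<dots> = ennreal (((1 / 2) ^ j)\<^sup>2)"
      by (intro lim_imp_Liminf) auto
    finally show ?thesis .
  qed
  have "sq_mass (\<lambda>z. F (N 0) z - f z) < \<infinity>"
    using est[of 0 "N 0"] by (auto intro: order_le_less_trans)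
  then have "square_integrable (\<lambda>z. F (N 0) z - f z)"
    by (auto simp: square_integrable_iff_sq_mass)
  from square_integrable_diff[OF F[of "N 0"] this] have f: "square_integrable f" by simp
  have "(\<lambda>n. L2_norm (\<lambda>z. F n z - f z)) \<longlonglongrightarrow> 0"
  proof (rule LIMSEQ_I)
    fix e :: real assume "0 < e"
    then obtain j where j: "(1 / 2) ^ j < e"
      using real_arch_pow_inv[of e "1 / 2"] by auto
    have "norm (L2_norm (\<lambda>z. F n z - f z) - 0) < e" if "n \<ge> N j" for n
    proof -
      have "(L2_norm (\<lambda>z. F n z - f z))\<^sup>2 \<le> ((1 / 2) ^ j)\<^sup>2"
        using est[OF that] unfolding sq_mass_eq_L2_norm[OF square_integrable_diff[OF F f]]
        by (simp add: ennreal_le_iff)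
      then have "L2_norm (\<lambda>z. F n z - f z) \<le> (1 / 2) ^ j"
        by (rule power2_le_imp_le) simp
      then show ?thesis using j by simp
    qed
    then show "\<exists>M. \<forall>n\<ge>M. norm (L2_norm (\<lambda>z. F n z - f z) - 0) < e" by blast
  qed
  then have "L2_tendsto F f"
    using L2_tendsto_L2_norm[OF F f] by simp
  with f show thesis by (rule that)
qed

subsection \<open>The Fourier transform of square-integrable functions\<close>

abbreviation truncate :: "('b::euclidean_space \<Rightarrow> complex) \<Rightarrow> nat \<Rightarrow> 'b \<Rightarrow> complex" where
  "truncate f n \<equiv> \<lambda>z. indicator (ball 0 (real n)) z * f z"

lemma square_integrable_truncate:
  "square_integrable f \<Longrightarrow> square_integrable (truncate f n)"
  by (rule square_integrable_indicator_mult) auto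

lemma integrable_truncate:
  assumes "square_integrable f" shows "integrable lborel (truncate f n)"
proof (rule integrable_mult_square_integrable[OF _ assms])
  have "integrable lborel (indicator (ball 0 (real n)) :: 'a \<Rightarrow> real)"
    using emeasure_lborel_ball_finite[of "0 :: 'a" "real n"] by (intro integrable_real_indicator) auto
  moreover have "(norm (indicator (ball 0 (real n)) z :: complex))\<^sup>2 = indicator (ball 0 (real n)) z" for z :: 'a
    by (simp add: indicator_def)
  ultimately show "square_integrable (\<lambda>z. indicator (ball 0 (real n)) (z :: 'a))"
    by (auto simp: square_integrable_def intro!: borel_measurable_indicator)
qed

lemma fourier_integral_truncate:
  "(LINT z:ball 0 (real n)|lborel. exp (- (\<i> * complex_of_real (z \<bullet> \<xi>))) * f z) = fourier_integral (truncate f n) \<xi>"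
  unfolding fourier_integral_def set_lebesgue_integral_def
  by (intro Bochner_Integration.integral_cong refl) (simp add: indicator_def)

lemma L2_tendsto_truncate:
  assumes f: "square_integrable f" shows "L2_tendsto (truncate f) f"
proof (rule L2_tendsto_dominated[OF _ _ f])
  show "truncate f n \<in> borel_measurable borel" for n
    by (intro square_integrable_measurable square_integrable_truncate f)
  show "f \<in> borel_measurable borel"
    by (intro square_integrable_measurable f)
  show "norm (truncate f n z - f z) \<le> norm (f z)" for n z by (simp add: indicator_def)
  show "(\<lambda>n. truncate f n z) \<longlonglongrightarrow> f z" for z
  proof (rule tendsto_eventually)
    obtain N :: nat where N: "norm z < real N" using reals_Archimedean2 by blast
    show "\<forall>\<^sub>F n in sequentially. truncate f n z = f z"
      using eventually_ge_at_top[of N] by eventually_elim (use N in \<open>simp add: indicator_def\<close>)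
  qed
qed

lemma square_integrable_fourier_truncate:
  "square_integrable f \<Longrightarrow> square_integrable (fourier_integral (truncate f n))"
  by (intro plancherel_fourier_integral integrable_truncate square_integrable_truncate)

lemma has_L2_fourier_iff:
  "has_L2_fourier f F \<longleftrightarrow> square_integrable f \<and> square_integrable F \<and>
     L2_tendsto (\<lambda>n. fourier_integral (truncate f n)) F"
  unfolding has_L2_fourier_def fourier_integral_truncate ..

text \<open>Plancherel's identity makes the transforms of the truncations a Cauchy sequence, because
  the truncations converge.\<close>

lemma ex_has_L2_fourier:
  fixes f :: "'b::euclidean_space \<Rightarrow> complex"
  assumes f: "square_integrable f"
  shows "\<exists>F. has_L2_fourier f F"
proof -
  let ?F = "\<lambda>n. fourier_integral (truncate f n)"
  let ?c = "(2 * pi) ^ DIM('b)"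
  note t = square_integrable_truncate[OF f]
  have c: "?c > 0" by simp
  have 0: "(\<lambda>n. L2_norm (\<lambda>z. truncate f n z - f z)) \<longlonglongrightarrow> 0"
    using L2_tendsto_truncate[OF f] L2_tendsto_L2_norm[OF t f] by simp
  have "\<exists>N. \<forall>m\<ge>N. \<forall>n\<ge>N. L2_norm (\<lambda>z. ?F m z - ?F n z) < e" if e: "0 < e" for e
  proof -
    \<comment> \<open>Chosen so that \<open>?c * (2 * e'\<^sup>2 + 2 * e'\<^sup>2)\<close> equals
      \<open>e\<^sup>2\<close>.\<close>
    define e' where "e' = e / (2 * sqrt ?c)"
    have e': "0 < e'" using e by (simp add: e'_def)
    from LIMSEQ_D[OF 0 this] obtain N where N: "\<And>n. n \<ge> N \<Longrightarrow> L2_norm (\<lambda>z. truncate f n z - f z) < e'"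
      by auto
    have "L2_norm (\<lambda>z. ?F m z - ?F n z) < e" if mn: "m \<ge> N" "n \<ge> N" for m n
    proof -
      have eq: "?F m \<xi> - ?F n \<xi> = fourier_integral (\<lambda>z. truncate f m z - truncate f n z) \<xi>" for \<xi>
        using fourier_integral_diff[OF integrable_truncate[OF f] integrable_truncate[OF f]] by simp
      have "(L2_norm (\<lambda>z. ?F m z - ?F n z))\<^sup>2 = ?c * (L2_norm (\<lambda>z. truncate f m z - truncate f n z))\<^sup>2"
        unfolding eq
        by (intro plancherel_fourier_integral square_integrable_diff t Bochner_Integration.integrable_diff integrable_truncate f)
      also have "(L2_norm (\<lambda>z. truncate f m z - truncate f n z))\<^sup>2
         \<le> 2 * (L2_norm (\<lambda>z. truncate f m z - f z))\<^sup>2 + 2 * (L2_norm (\<lambda>z. f z - truncate f n z))\<^sup>2"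
        using L2_norm_add_power2_le[OF square_integrable_diff[OF t[of m] f] square_integrable_diff[OF f t[of n]]] by simp
      also have "\<dots> < 2 * e'\<^sup>2 + 2 * e'\<^sup>2"
        using N[OF mn(1)] N[OF mn(2)] e'
        by (intro add_strict_mono mult_strict_left_mono power_strict_mono) (auto simp: L2_norm_minus_commute[of f])
      finally have "(L2_norm (\<lambda>z. ?F m z - ?F n z))\<^sup>2 < ?c * (4 * e'\<^sup>2)"
        using c by simp
      also have "\<dots> = e\<^sup>2"
        using c by (simp add: e'_def power_divide power_mult_distrib real_sqrt_pow2)
      finally show ?thesis
        using e by (intro power_less_imp_less_base[of _ 2 e]) auto
    qed
    then show ?thesis by blast
  qed
  then obtain F where "square_integrable F" "L2_tendsto ?F F"
    using Riesz_Fischer[of ?F] square_integrable_fourier_truncate[OF f] by blast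
  then show ?thesis
    using f by (auto simp: has_L2_fourier_iff)
qed

lemma has_L2_fourier_L2_fourier:
  "square_integrable f \<Longrightarrow> has_L2_fourier f (L2_fourier f)"
  unfolding L2_fourier_def using ex_has_L2_fourier by (rule someI_ex)

lemma has_L2_fourier_unique:
  assumes "has_L2_fourier f F" "has_L2_fourier f G"
  shows "AE z in lborel. F z = G z"
  using assms by (intro L2_tendsto_unique[of "\<lambda>n. fourier_integral (truncate f n)"])
    (auto simp: has_L2_fourier_iff square_integrable_fourier_truncate)

lemma square_integrable_cong_AE:
  assumes "square_integrable f" "g \<in> borel_measurable borel" "AE z in lborel. f z = g z"
  shows "square_integrable g"
proof -
  have "sq_mass g = sq_mass f"
    using assms(3) by (intro nn_integral_cong_AE) auto
  then show ?thesis using assms by (simp add: square_integrable_iff_sq_mass)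
qed

lemma L2_tendsto_cong_AE:
  assumes "L2_tendsto F f" "AE z in lborel. f z = g z"
  shows "L2_tendsto F g"
proof -
  have "sq_mass (\<lambda>z. F n z - g z) = sq_mass (\<lambda>z. F n z - f z)" for n
    using assms(2) by (intro nn_integral_cong_AE) auto
  then show ?thesis using assms(1) by (simp add: L2_tendsto_def)
qed

lemma has_L2_fourier_cong_AE:
  assumes "has_L2_fourier f F" "G \<in> borel_measurable borel" "AE z in lborel. F z = G z"
  shows "has_L2_fourier f G"
proof -
  have F: "square_integrable f" "square_integrable F" "L2_tendsto (\<lambda>n. fourier_integral (truncate f n)) F"
    using assms(1) unfolding has_L2_fourier_iff by blast+
  show ?thesis
    unfolding has_L2_fourier_iff
    using F(1) square_integrable_cong_AE[OF F(2) assms(2,3)] L2_tendsto_cong_AE[OF F(3) assms(3)] by blast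
qed

lemma L2_tendsto_diff:
  assumes "\<And>n. square_integrable (F n)" "\<And>n. square_integrable (G n)" "square_integrable f" "square_integrable g"
    and "L2_tendsto F f" "L2_tendsto G g"
  shows "L2_tendsto (\<lambda>n z. F n z - G n z) (\<lambda>z. f z - g z)"
proof -
  have sd: "square_integrable (\<lambda>z. F n z - G n z)" for n by (intro square_integrable_diff assms)
  have d: "square_integrable (\<lambda>z. f z - g z)" by (intro square_integrable_diff assms)
  have 1: "(\<lambda>n. L2_norm (\<lambda>z. F n z - f z)) \<longlonglongrightarrow> 0" "(\<lambda>n. L2_norm (\<lambda>z. G n z - g z)) \<longlonglongrightarrow> 0"
    using assms L2_tendsto_L2_norm by auto
  have "(\<lambda>n. 2 * (L2_norm (\<lambda>z. F n z - f z))\<^sup>2 + 2 * (L2_norm (\<lambda>z. g z - G n z))\<^sup>2) \<longlonglongrightarrow> 2 * 0\<^sup>2 + 2 * 0\<^sup>2"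
    unfolding L2_norm_minus_commute[of g] by (intro tendsto_intros 1)
  then have lim: "(\<lambda>n. 2 * (L2_norm (\<lambda>z. F n z - f z))\<^sup>2 + 2 * (L2_norm (\<lambda>z. g z - G n z))\<^sup>2) \<longlonglongrightarrow> 0" by simp
  have "norm ((L2_norm (\<lambda>z. F n z - G n z - (f z - g z)))\<^sup>2) \<le> 2 * (L2_norm (\<lambda>z. F n z - f z))\<^sup>2 + 2 * (L2_norm (\<lambda>z. g z - G n z))\<^sup>2" for n
    using L2_norm_add_power2_le[OF square_integrable_diff[OF assms(1)[of n] assms(3)] square_integrable_diff[OF assms(4) assms(2)[of n]]]
    by (simp add: algebra_simps)
  from Lim_null_comparison[OF always_eventually lim, of "\<lambda>n. (L2_norm (\<lambda>z. F n z - G n z - (f z - g z)))\<^sup>2"] this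
  have "(\<lambda>n. (L2_norm (\<lambda>z. F n z - G n z - (f z - g z)))\<^sup>2) \<longlonglongrightarrow> 0" by blast
  from tendsto_real_sqrt[OF this] show ?thesis
    using L2_tendsto_L2_norm[OF sd d] by simp
qed

lemma has_L2_fourier_diff:
  assumes "has_L2_fourier f F" "has_L2_fourier g G"
  shows "has_L2_fourier (\<lambda>z. f z - g z) (\<lambda>z. F z - G z)"
proof -
  have f: "square_integrable f" "square_integrable g" "square_integrable F" "square_integrable G"
    using assms by (auto simp: has_L2_fourier_iff)
  have "truncate (\<lambda>z. f z - g z) n = (\<lambda>z. truncate f n z - truncate g n z)" for n
    by (simp add: right_diff_distrib fun_eq_iff)
  then have "fourier_integral (truncate (\<lambda>z. f z - g z) n)
      = (\<lambda>\<xi>. fourier_integral (truncate f n) \<xi> - fourier_integral (truncate g n) \<xi>)" for n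
    using fourier_integral_diff[OF integrable_truncate[OF f(1)] integrable_truncate[OF f(2)]]
    by (simp add: fun_eq_iff)
  then show ?thesis
    using assms f by (auto simp: has_L2_fourier_iff
        intro!: square_integrable_diff L2_tendsto_diff square_integrable_fourier_truncate)
qed

theorem plancherel:
  fixes f :: "'b::euclidean_space \<Rightarrow> complex"
  assumes "has_L2_fourier f F"
  shows "(L2_norm F)\<^sup>2 = (2 * pi) ^ DIM('b) * (L2_norm f)\<^sup>2"
proof -
  have f: "square_integrable f" "square_integrable F"
    and lim: "L2_tendsto (\<lambda>n. fourier_integral (truncate f n)) F"
    using assms by (auto simp: has_L2_fourier_iff)
  have "(\<lambda>n. (L2_norm (fourier_integral (truncate f n)))\<^sup>2) \<longlonglongrightarrow> (L2_norm F)\<^sup>2"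
    by (intro L2_tendsto_norm square_integrable_fourier_truncate f lim)
  moreover have "(\<lambda>n. (2 * pi) ^ DIM('b) * (L2_norm (truncate f n))\<^sup>2) \<longlonglongrightarrow> (2 * pi) ^ DIM('b) * (L2_norm f)\<^sup>2"
    by (intro tendsto_mult tendsto_const L2_tendsto_norm square_integrable_truncate f L2_tendsto_truncate)
  ultimately show ?thesis
    using plancherel_fourier_integral(2)[OF integrable_truncate[OF f(1)] square_integrable_truncate[OF f(1)]]
    by (simp add: LIMSEQ_unique)
qed

subsection \<open>Fourier synthesis and inversion\<close>

text \<open>The inverse Fourier integral without its factor; leaving the factor out makes the
  duality \<open>L2_inner_synthesis\<close> free of constants.\<close>

definition synthesis :: "('b::euclidean_space \<Rightarrow> complex) \<Rightarrow> 'b \<Rightarrow> complex" where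
  "synthesis h z = (LINT \<xi>|lborel. iexp (z \<bullet> \<xi>) * h \<xi>)"

lemma synthesis_eq_fourier_integral: "synthesis h z = fourier_integral h (- z)"
  by (simp add: synthesis_def fourier_integral_def inner_commute)

lemma synthesis_L2:
  fixes h :: "'b::euclidean_space \<Rightarrow> complex"
  assumes "integrable lborel h" "square_integrable h"
  shows "square_integrable (synthesis h)"
    and "(L2_norm (synthesis h))\<^sup>2 = (2 * pi) ^ DIM('b) * (L2_norm h)\<^sup>2"
  unfolding synthesis_eq_fourier_integral[abs_def]
  using volume_preserving_square_integrable[OF volume_preserving_uminus plancherel_fourier_integral(1)[OF assms]]
    volume_preserving_L2_norm[OF volume_preserving_uminus plancherel_fourier_integral(1)[OF assms]]
    plancherel_fourier_integral(2)[OF assms]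
  by simp_all

text \<open>Parseval's relation in the form that carries a pairing in phase space over to the
  Fourier side. For truncations of \<open>f\<close> it is Fubini's theorem; the truncations converge
  in the mean on both sides.\<close>

lemma L2_inner_synthesis:
  fixes f :: "'b::euclidean_space \<Rightarrow> complex"
  assumes "has_L2_fourier f F" and h: "integrable lborel h" "square_integrable h"
  shows "L2_inner f (synthesis h) = L2_inner F h"
proof -
  have f: "square_integrable f" "square_integrable F"
    and lim: "L2_tendsto (\<lambda>n. fourier_integral (truncate f n)) F"
    using assms by (auto simp: has_L2_fourier_iff)
  have ch: "integrable lborel (\<lambda>\<xi>. cnj (h \<xi>))" using h by simp
  have eq: "L2_inner (truncate f n) (synthesis h) = L2_inner (fourier_integral (truncate f n)) h" for n
  proof -
    have "cnj (synthesis h z) = (LINT \<xi>|lborel. cnj (h \<xi>) * exp (- (\<i> * complex_of_real (z \<bullet> \<xi>))))" for z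
      unfolding synthesis_def Bochner_Integration.integral_cnj[symmetric]
      by (intro Bochner_Integration.integral_cong refl) (simp add: exp_cnj mult.commute)
    then have "L2_inner (truncate f n) (synthesis h)
        = (LINT z|lborel. truncate f n z * (LINT \<xi>|lborel. cnj (h \<xi>) * exp (- (\<i> * complex_of_real (z \<bullet> \<xi>)))))"
      by (simp add: L2_inner_def)
    also have "\<dots> = (LINT \<xi>|lborel. cnj (h \<xi>) * (LINT z|lborel. truncate f n z * exp (- (\<i> * complex_of_real (z \<bullet> \<xi>)))))"
      by (rule Fubini_bounded_kernel[OF integrable_truncate[OF f(1)] ch, symmetric])
        (auto simp: lborel_prod split_beta' intro!: borel_measurable_continuous_onI continuous_intros)
    also have "\<dots> = L2_inner (fourier_integral (truncate f n)) h"
      by (simp add: L2_inner_def fourier_integral_def mult.commute)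
    finally show ?thesis .
  qed
  have "(\<lambda>n. L2_inner (truncate f n) (synthesis h)) \<longlonglongrightarrow> L2_inner f (synthesis h)"
    by (intro L2_tendsto_inner square_integrable_truncate f synthesis_L2 h L2_tendsto_truncate)
  moreover have "(\<lambda>n. L2_inner (fourier_integral (truncate f n)) h) \<longlonglongrightarrow> L2_inner F h"
    by (intro L2_tendsto_inner square_integrable_fourier_truncate f h lim)
  ultimately show ?thesis
    unfolding eq by (rule LIMSEQ_unique)
qed

text \<open>Let \<open>G\<close> be the inverse transform of \<open>F\<close>. By Plancherel \<open>\<parallel>G\<parallel> = \<parallel>f\<parallel>\<close>, and \<open>\<langle>f, G\<rangle> = \<parallel>f\<parallel>\<^sup>2\<close> by
  duality, so that \<open>\<parallel>G - f\<parallel> = 0\<close>.\<close>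

theorem fourier_inversion:
  fixes f :: "'b::euclidean_space \<Rightarrow> complex"
  assumes fF: "has_L2_fourier f F"
  shows "has_L2_inverse_fourier F f"
proof -
  have f: "square_integrable f" "square_integrable F" using fF by (auto simp: has_L2_fourier_iff)
  obtain H where FH: "has_L2_fourier F H" using ex_has_L2_fourier[OF f(2)] by blast
  then have H: "square_integrable H" and limH: "L2_tendsto (\<lambda>n. fourier_integral (truncate F n)) H"
    by (auto simp: has_L2_fourier_iff)
  define c :: real where "c = 1 / (2 * pi) ^ DIM('b)"
  have c: "c > 0" by (simp add: c_def)
  \<comment> \<open>The inverse transform is the forward transform, reflected and divided by the
    power of \<open>2 * pi\<close>; so its existence needs no separate argument.\<close>
  define G where "G z = complex_of_real c * H (- z)" for z
  have Hm: "square_integrable (\<lambda>z. H (- z))" "L2_norm (\<lambda>z. H (- z)) = L2_norm H"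
    using volume_preserving_square_integrable[OF volume_preserving_uminus H]
      volume_preserving_L2_norm[OF volume_preserving_uminus H] by auto
  have G: "square_integrable G"
    unfolding G_def[abs_def] by (intro square_integrable_cmult Hm)
  have L2_norm_cmult: "(L2_norm (\<lambda>z. complex_of_real c * u z))\<^sup>2 = c\<^sup>2 * (L2_norm u)\<^sup>2" for u :: "'b \<Rightarrow> complex"
    by (simp add: L2_norm_power2 norm_mult power_mult_distrib)
  have normG: "(L2_norm G)\<^sup>2 = (L2_norm f)\<^sup>2"
  proof -
    have "(L2_norm G)\<^sup>2 = c\<^sup>2 * (L2_norm H)\<^sup>2"
      unfolding G_def[abs_def] L2_norm_cmult Hm(2) ..
    also have "\<dots> = c\<^sup>2 * ((2 * pi) ^ DIM('b) * ((2 * pi) ^ DIM('b) * (L2_norm f)\<^sup>2))"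
      using plancherel[OF FH] plancherel[OF fF] by simp
    also have "\<dots> = (L2_norm f)\<^sup>2"
      by (simp add: c_def power2_eq_square)
    finally show ?thesis .
  qed
  let ?S = "\<lambda>n z. complex_of_real c * synthesis (truncate F n) z"
  have Sn: "square_integrable (synthesis (truncate F n))" for n
    by (intro synthesis_L2 integrable_truncate square_integrable_truncate f)
  have S: "square_integrable (?S n)" for n
    by (intro square_integrable_cmult Sn)
  have limG: "L2_tendsto ?S G"
  proof -
    have "sq_mass (\<lambda>z. ?S n z - G z) = ennreal (c\<^sup>2) * sq_mass (\<lambda>z. fourier_integral (truncate F n) z - H z)" for n
    proof -
      note [measurable] = square_integrable_measurable[OF H]
        square_integrable_measurable[OF square_integrable_fourier_truncate[OF f(2)]]
      have "sq_mass (\<lambda>z. fourier_integral (truncate F n) z - H z) = sq_mass (\<lambda>z. fourier_integral (truncate F n) (- z) - H (- z))"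
        by (rule volume_preserving_nn_integral[OF volume_preserving_uminus, symmetric])
          (simp add: square_integrable_measurable H square_integrable_fourier_truncate f)
      moreover have "(norm (?S n z - G z))\<^sup>2 = c\<^sup>2 * (norm (fourier_integral (truncate F n) (- z) - H (- z)))\<^sup>2" for z
        unfolding G_def synthesis_eq_fourier_integral right_diff_distrib[symmetric]
        using c by (simp add: norm_mult power_mult_distrib)
      ultimately show ?thesis
        by (simp add: ennreal_mult nn_integral_cmult)
    qed
    moreover have "(\<lambda>n. ennreal (c\<^sup>2) * sq_mass (\<lambda>z. fourier_integral (truncate F n) z - H z)) \<longlonglongrightarrow> ennreal (c\<^sup>2) * 0"
      using limH unfolding L2_tendsto_def by (intro ennreal_tendsto_cmult) auto
    ultimately show ?thesis
      unfolding L2_tendsto_def by simp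
  qed
  have inner: "L2_inner G f = complex_of_real ((L2_norm f)\<^sup>2)"
  proof -
    have "L2_inner (?S n) f = complex_of_real c * L2_inner (truncate F n) F" for n
    proof -
      have "L2_inner (?S n) f = cnj (L2_inner f (?S n))" by (rule L2_inner_commute)
      also have "\<dots> = complex_of_real c * cnj (L2_inner f (synthesis (truncate F n)))"
        by (simp add: L2_inner_cmult_right)
      also have "\<dots> = complex_of_real c * cnj (L2_inner F (truncate F n))"
        by (subst L2_inner_synthesis[OF fF]) (auto intro: integrable_truncate square_integrable_truncate f)
      finally show ?thesis by (simp add: L2_inner_commute[of "truncate F n"])
    qed
    moreover have "(\<lambda>n. complex_of_real c * L2_inner (truncate F n) F) \<longlonglongrightarrow> complex_of_real c * L2_inner F F"
      by (intro tendsto_mult tendsto_const L2_tendsto_inner square_integrable_truncate f L2_tendsto_truncate)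
    moreover have "(\<lambda>n. L2_inner (?S n) f) \<longlonglongrightarrow> L2_inner G f"
      by (intro L2_tendsto_inner S G f limG)
    ultimately have "L2_inner G f = complex_of_real c * L2_inner F F"
      using LIMSEQ_unique by auto
    also have "\<dots> = complex_of_real (c * ((2 * pi) ^ DIM('b) * (L2_norm f)\<^sup>2))"
      unfolding L2_inner_self plancherel[OF fF] by simp
    also have "c * ((2 * pi) ^ DIM('b) * (L2_norm f)\<^sup>2) = (L2_norm f)\<^sup>2"
      by (simp add: c_def)
    finally show ?thesis .
  qed
  let ?d = "\<lambda>z. G z - f z"
  have d: "square_integrable ?d" by (intro square_integrable_diff G f)
  have "L2_inner ?d ?d = L2_inner G G - L2_inner G f - (L2_inner f G - L2_inner f f)"
    using L2_inner_diff_left[OF G f(1) d] L2_inner_diff_right[OF G G f(1)] L2_inner_diff_right[OF f(1) G f(1)] by simp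
  also have "L2_inner f G = complex_of_real ((L2_norm f)\<^sup>2)"
    using L2_inner_commute[of f G] inner by simp
  finally have "L2_norm ?d = 0"
    unfolding L2_inner_self inner normG by simp
  from L2_norm_0_imp_AE[OF d this] have "AE z in lborel. G z = f z" by simp
  from L2_tendsto_cong_AE[OF limG this] have "L2_tendsto ?S f" .
  moreover have "?S n z = 1 / (2 * pi) ^ DIM('b) *
          (LINT \<xi>:ball 0 (real n)|lborel. iexp (z \<bullet> \<xi>) * F \<xi>)" for n z
  proof -
    have "iexp (z \<bullet> \<xi>) * truncate F n \<xi>
       = indicator (ball 0 (real n)) \<xi> *\<^sub>R (iexp (z \<bullet> \<xi>) * F \<xi>)" for \<xi>
      by (simp add: indicator_def)
    then show ?thesis
      unfolding synthesis_def set_lebesgue_integral_def c_def by simp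
  qed
  ultimately show ?thesis
    unfolding has_L2_inverse_fourier_def using f by simp
qed

subsection \<open>Smooth functions\<close>

text \<open>A class of differentiable functions that is closed under partial derivatives consists of
  smooth functions. For Fourier syntheses and for function algebras such a class is visible at once,
  whereas iterated derivatives are awkward to write down.\<close>

lemma smooth_coinduct:
  assumes "f \<in> S"
    and "\<And>f z. f \<in> S \<Longrightarrow> f differentiable (at z)"
    and "\<And>f b. f \<in> S \<Longrightarrow> b \<in> Basis \<Longrightarrow> (\<lambda>z. frechet_derivative f (at z) b) \<in> S"
  shows "smooth f"
proof -
  have "partial_derivs bs f \<in> S" if "set bs \<subseteq> Basis" for bs
    using that by (induction bs) (use assms in auto)
  then show ?thesis
    using assms(2) by (auto simp: smooth_def)
qed

lemma partial_derivs_append: "partial_derivs (bs @ cs) f = partial_derivs bs (partial_derivs cs f)"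
  by (induction bs) auto

lemma smooth_differentiable: "smooth f \<Longrightarrow> f differentiable (at z)"
  unfolding smooth_def by (drule spec[of _ "[]"]) simp

lemma smooth_frechet_derivative:
  assumes "smooth f" "b \<in> Basis"
  shows "smooth (\<lambda>z. frechet_derivative f (at z) b)"
proof -
  have "partial_derivs bs (\<lambda>z. frechet_derivative f (at z) b) = partial_derivs (bs @ [b]) f" for bs
    by (simp add: partial_derivs_append)
  then show ?thesis
    using assms unfolding smooth_def by (metis empty_set empty_subsetI insert_subset list.simps(15) set_append sup.bounded_iff)
qed

lemma smooth_has_derivative: "smooth f \<Longrightarrow> (f has_derivative frechet_derivative f (at z)) (at z)"
  using smooth_differentiable frechet_derivative_works by blast

lemma smooth_continuous_on: "smooth f \<Longrightarrow> continuous_on A f"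
  by (meson continuous_at_imp_continuous_on has_derivative_continuous smooth_has_derivative)

lemma smooth_borel_measurable: "smooth f \<Longrightarrow> f \<in> borel_measurable borel"
  by (intro borel_measurable_continuous_onI smooth_continuous_on)

text \<open>By the Leibniz rule, smoothness on the whole algebra reduces to the generators: they
  must be differentiable, with derivatives again in the algebra.\<close>

inductive_set fun_algebra :: "('b::euclidean_space \<Rightarrow> complex) set \<Rightarrow> ('b \<Rightarrow> complex) set" for G where
  gen: "g \<in> G \<Longrightarrow> g \<in> fun_algebra G"
| const: "(\<lambda>_. c) \<in> fun_algebra G"
| add: "f \<in> fun_algebra G \<Longrightarrow> g \<in> fun_algebra G \<Longrightarrow> (\<lambda>z. f z + g z) \<in> fun_algebra G"
| mult: "f \<in> fun_algebra G \<Longrightarrow> g \<in> fun_algebra G \<Longrightarrow> (\<lambda>z. f z * g z) \<in> fun_algebra G"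

lemma fun_algebra_prod:
  "finite I \<Longrightarrow> (\<And>i. i \<in> I \<Longrightarrow> f i \<in> fun_algebra G) \<Longrightarrow> (\<lambda>z. \<Prod>i\<in>I. f i z) \<in> fun_algebra G"
  by (induction I rule: finite_induct) (auto intro: fun_algebra.intros)

lemma fun_algebra_sum:
  "finite I \<Longrightarrow> (\<And>i. i \<in> I \<Longrightarrow> f i \<in> fun_algebra G) \<Longrightarrow> (\<lambda>z. \<Sum>i\<in>I. f i z) \<in> fun_algebra G"
  by (induction I rule: finite_induct) (auto intro: fun_algebra.intros)

lemma smooth_fun_algebra:
  assumes "f \<in> fun_algebra G"
    and diff: "\<And>g z. g \<in> G \<Longrightarrow> g differentiable (at z)"
    and deriv: "\<And>g b. g \<in> G \<Longrightarrow> b \<in> Basis \<Longrightarrow> (\<lambda>z. frechet_derivative g (at z) b) \<in> fun_algebra G"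
  shows "smooth f"
proof (rule smooth_coinduct[OF assms(1)])
  have D: "f differentiable (at z)" if "f \<in> fun_algebra G" for f z
    using that by induction (auto intro: diff derivative_intros)
  then show "f differentiable (at z)" if "f \<in> fun_algebra G" for f z
    using that by blast
  show "(\<lambda>z. frechet_derivative f (at z) b) \<in> fun_algebra G" if "f \<in> fun_algebra G" "b \<in> Basis" for f b
    using that(1)
  proof induction
    case (gen g) then show ?case using deriv that(2) by blast
  next
    case (const c) show ?case using fun_algebra.const[of 0] by simp
  next
    case (add f g)
    have "frechet_derivative (\<lambda>z. f z + g z) (at z) b = frechet_derivative f (at z) b + frechet_derivative g (at z) b" for z
      by (subst frechet_derivative_at[symmetric, OF has_derivative_add])
        (use D add frechet_derivative_works in blast)+
    then show ?case using add by (auto intro: fun_algebra.intros)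
  next
    case (mult f g)
    have "frechet_derivative (\<lambda>z. f z * g z) (at z) b = f z * frechet_derivative g (at z) b + frechet_derivative f (at z) b * g z" for z
      by (subst frechet_derivative_at[symmetric, OF has_derivative_mult])
        (use D mult frechet_derivative_works in blast)+
    then show ?case using mult by (auto intro: fun_algebra.intros)
  qed
qed

lemma smooth_fun_algebra_smooth: "f \<in> fun_algebra {g. smooth g} \<Longrightarrow> smooth f"
  by (rule smooth_fun_algebra) (auto intro: smooth_differentiable fun_algebra.gen smooth_frechet_derivative)

lemma smooth_mult: "smooth f \<Longrightarrow> smooth g \<Longrightarrow> smooth (\<lambda>z. f z * g z)"
  by (rule smooth_fun_algebra_smooth) (auto intro: fun_algebra.intros)

lemma smooth_sum: "finite I \<Longrightarrow> (\<And>i. i \<in> I \<Longrightarrow> smooth (f i)) \<Longrightarrow> smooth (\<lambda>z. \<Sum>i\<in>I. f i z)"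
  by (rule smooth_fun_algebra_smooth) (auto intro: fun_algebra_sum fun_algebra.gen)

lemma smooth_inner: "smooth (\<lambda>z. complex_of_real (z \<bullet> a))"
proof (rule smooth_fun_algebra[where G = "{\<lambda>z. complex_of_real (z \<bullet> a)}"])
  have D: "((\<lambda>z. complex_of_real (z \<bullet> a)) has_derivative (\<lambda>v. complex_of_real (v \<bullet> a))) (at z)" for z
    by (auto intro!: derivative_eq_intros)
  show "g differentiable (at z)" if "g \<in> {\<lambda>z. complex_of_real (z \<bullet> a)}" for g z
    using that D differentiable_def by blast
  show "(\<lambda>z. frechet_derivative g (at z) b) \<in> fun_algebra {\<lambda>z. complex_of_real (z \<bullet> a)}"
    if "g \<in> {\<lambda>z. complex_of_real (z \<bullet> a)}" for g b
    using that frechet_derivative_at[OF D, symmetric] by (auto intro: fun_algebra.const)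
qed (auto intro: fun_algebra.gen)

subsection \<open>A smooth bump\<close>

lemma power_div_fact_le_exp:
  fixes x :: real
  assumes "0 \<le> x" shows "x ^ k / fact k \<le> exp x"
proof -
  have "(\<Sum>i\<in>{k}. inverse (fact i) * x ^ i) \<le> (\<Sum>i. inverse (fact i) * x ^ i)"
    using assms by (intro sum_le_suminf summable_exp) auto
  then show ?thesis by (simp add: exp_def field_simps scaleR_conv_of_real)
qed

text \<open>The powers of x in the denominator close the family under differentiation: the
  derivative of index n combines the indices n + 1 and n + 2.\<close>

definition flat_exp :: "nat \<Rightarrow> real \<Rightarrow> real" where
  "flat_exp n x = (if 0 < x then exp (- (1 / x)) / x ^ n else 0)"

text \<open>One term of the exponential series at 1 / x, of order n + 2, beats the denominator and
  leaves two powers of x.\<close>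

lemma flat_exp_le: "\<bar>flat_exp n x\<bar> \<le> fact (n + 2) * x\<^sup>2"
proof (cases "0 < x")
  case True
  define c :: real where "c = fact (n + 2)"
  have c: "0 < c" by (simp add: c_def)
  have "(1 / x) ^ (n + 2) / c \<le> exp (1 / x)"
    unfolding c_def using True by (intro power_div_fact_le_exp) simp
  then have "1 / (c * x ^ (n + 2)) \<le> exp (1 / x)"
    by (simp add: power_divide mult.commute)
  then have "inverse (exp (1 / x)) \<le> inverse (1 / (c * x ^ (n + 2)))"
    using True c by (intro le_imp_inverse_le) auto
  then have "exp (- (1 / x)) \<le> c * x\<^sup>2 * x ^ n"
    by (simp add: exp_minus power_add power2_eq_square mult_ac)
  then have "flat_exp n x \<le> c * x\<^sup>2"
    using True by (simp add: flat_exp_def pos_divide_le_eq)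
  moreover have "0 \<le> flat_exp n x" by (simp add: flat_exp_def)
  ultimately show ?thesis by (simp add: c_def)
qed (simp add: flat_exp_def)

lemma DERIV_flat_exp: "(flat_exp n has_real_derivative flat_exp (n + 2) x - real n * flat_exp (n + 1) x) (at x)"
proof -
  consider "x > 0" | "x = 0" | "x < 0" by linarith
  then show ?thesis
  proof cases
    case 1
    have "((\<lambda>x. exp (- (1 / x)) * inverse (x ^ n)) has_real_derivative flat_exp (n + 2) x - real n * flat_exp (n + 1) x) (at x)"
    proof (cases n)
      case 0
      then show ?thesis using 1
        by (auto intro!: derivative_eq_intros simp: flat_exp_def field_simps power2_eq_square)
    next
      case (Suc m)
      then show ?thesis using 1
        by (auto intro!: derivative_eq_intros simp: flat_exp_def divide_simps power2_eq_square) (cases m; simp add: algebra_simps)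
    qed
    then show ?thesis
      by (rule has_field_derivative_transform_within_open[where S = "{0<..}"])
        (use 1 in \<open>auto simp: flat_exp_def field_simps\<close>)
  next
    case 2
    \<comment> \<open>The quadratic bound leaves a factor of order |h| in the difference quotient,
      so the derivative at 0 is 0.\<close>
    have "((\<lambda>h. flat_exp n h / h) \<longlongrightarrow> 0) (at 0)"
    proof (rule Lim_null_comparison[OF always_eventually])
      show "\<forall>h. norm (flat_exp n h / h) \<le> fact (n + 2) * \<bar>h\<bar>"
      proof
        fix h :: real
        show "norm (flat_exp n h / h) \<le> fact (n + 2) * \<bar>h\<bar>"
          using flat_exp_le[of n h] by (cases "h = 0")
            (simp_all add: pos_divide_le_eq power2_eq_square mult.assoc del: fact_Suc add_2_eq_Suc')
      qed
      have "((\<lambda>h::real. fact (n + 2) * \<bar>h\<bar>) \<longlongrightarrow> fact (n + 2) * \<bar>0\<bar>) (at 0)"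
        by (intro tendsto_intros)
      then show "((\<lambda>h::real. fact (n + 2) * \<bar>h\<bar>) \<longlongrightarrow> 0) (at 0)" by simp
    qed
    then show ?thesis using 2
      by (simp add: flat_exp_def DERIV_def)
  next
    case 3
    have "((\<lambda>_. 0) has_real_derivative flat_exp (n + 2) x - real n * flat_exp (n + 1) x) (at x)"
      using 3 by (simp add: flat_exp_def)
    then show ?thesis
      by (rule has_field_derivative_transform_within_open[where S = "{..<0}"])
        (use 3 in \<open>auto simp: flat_exp_def\<close>)
  qed
qed

definition bump :: "'b::euclidean_space \<Rightarrow> real" where
  "bump z = (\<Prod>b\<in>Basis. flat_exp 0 (1 + z \<bullet> b) * flat_exp 0 (1 - z \<bullet> b))"

lemma flat_exp_0_bounds: "0 \<le> flat_exp 0 x" "flat_exp 0 x \<le> 1"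
  by (auto simp: flat_exp_def)

lemma bump_nonneg: "0 \<le> bump z" and bump_le_1: "bump z \<le> 1"
  unfolding bump_def using flat_exp_0_bounds by (auto intro!: prod_nonneg prod_le_1 mult_le_one)

lemma bump_0_pos: "0 < bump 0"
  by (auto simp: bump_def flat_exp_def intro!: prod_pos)

text \<open>The support lies in the cube of half-side 1, and the norm is at most the sum of the
  absolute coordinates.\<close>

lemma bump_eq_0: "norm z > DIM('b) \<Longrightarrow> bump (z :: 'b::euclidean_space) = 0"
proof (rule ccontr)
  assume z: "norm z > DIM('b)" and "bump z \<noteq> 0"
  then have "\<bar>z \<bullet> b\<bar> \<le> 1" if "b \<in> Basis" for b
    using that by (force simp: bump_def flat_exp_def split: if_splits)
  then have "(\<Sum>b\<in>Basis. \<bar>z \<bullet> b\<bar>) \<le> (\<Sum>b\<in>(Basis :: 'b set). 1)"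
    by (intro sum_mono) auto
  then show False using norm_le_l1[of z] z by simp
qed

text \<open>Every factor is a function of the family \<open>flat_exp\<close> of an affine form. The
  algebra generated by all such functions, over all indices and all forms, contains the dilated and
  translated bumps and is closed under derivatives.\<close>

lemma smooth_bump: "smooth (\<lambda>z :: 'b::euclidean_space. complex_of_real (bump (s *\<^sub>R (z - a))))"
proof -
  let ?G = "{\<lambda>z :: 'b. complex_of_real (flat_exp n (c + z \<bullet> v)) | n c v. True}"
  have D: "((\<lambda>z. complex_of_real (flat_exp n (c + z \<bullet> v))) has_derivative
       (\<lambda>w. complex_of_real ((w \<bullet> v) * (flat_exp (n + 2) (c + z \<bullet> v) - real n * flat_exp (n + 1) (c + z \<bullet> v))))) (at z)" for n c v z
  proof -
    have "((\<lambda>z. c + z \<bullet> v) has_derivative (\<lambda>w. w \<bullet> v)) (at z)"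
      by (auto intro!: derivative_eq_intros)
    from DERIV_compose_FDERIV[OF DERIV_flat_exp this, of n] show ?thesis
      by (rule has_derivative_of_real)
  qed
  have "(\<lambda>z. complex_of_real (flat_exp n (c + z \<bullet> v))) \<in> fun_algebra ?G" for n c v
    by (intro fun_algebra.gen) blast
  note gen = this
  have "(\<lambda>z. \<Prod>b\<in>Basis. complex_of_real (flat_exp 0 ((1 - s * (a \<bullet> b)) + z \<bullet> (s *\<^sub>R b))) * complex_of_real (flat_exp 0 ((1 + s * (a \<bullet> b)) + z \<bullet> (- s *\<^sub>R b)))) \<in> fun_algebra ?G"
    by (intro fun_algebra_prod fun_algebra.mult gen) auto
  also have "(\<lambda>z. \<Prod>b\<in>Basis. complex_of_real (flat_exp 0 ((1 - s * (a \<bullet> b)) + z \<bullet> (s *\<^sub>R b))) * complex_of_real (flat_exp 0 ((1 + s * (a \<bullet> b)) + z \<bullet> (- s *\<^sub>R b))))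
     = (\<lambda>z. complex_of_real (bump (s *\<^sub>R (z - a))))"
    by (auto simp: bump_def inner_diff_left algebra_simps fun_eq_iff)
  finally show ?thesis
  proof (rule smooth_fun_algebra)
    show "g differentiable (at z)" if "g \<in> ?G" for g z
      using that D differentiable_def by blast
    show "(\<lambda>z. frechet_derivative g (at z) b) \<in> fun_algebra ?G" if "g \<in> ?G" for g b
    proof -
      from that obtain n c v where g: "g = (\<lambda>z. complex_of_real (flat_exp n (c + z \<bullet> v)))" by blast
      have "(\<lambda>z. frechet_derivative g (at z) b) =
        (\<lambda>z. complex_of_real (b \<bullet> v) * (complex_of_real (flat_exp (n + 2) (c + z \<bullet> v)) + (complex_of_real (- real n)) * complex_of_real (flat_exp (n + 1) (c + z \<bullet> v))))"
        unfolding g frechet_derivative_at[OF D, symmetric] by (simp add: fun_eq_iff)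
      also have "\<dots> \<in> fun_algebra ?G"
        by (intro fun_algebra.add fun_algebra.mult fun_algebra.const gen)
      finally show ?thesis .
    qed
  qed
qed

lemma test_functionI:
  assumes "smooth f" "\<And>z. norm z > r \<Longrightarrow> f z = 0"
  shows "test_function f"
proof -
  have "{z. f z \<noteq> 0} \<subseteq> cball 0 r" using assms(2) by force
  then have "bounded {z. f z \<noteq> 0}" using bounded_cball bounded_subset by blast
  then show ?thesis using assms(1) by (auto simp: test_function_def compact_eq_bounded_closed bounded_closure)
qed

lemma test_function_support:
  assumes "test_function f"
  shows "\<exists>r>0. \<forall>z. norm z > r \<longrightarrow> f z = 0"
proof -
  have "bounded {z. f z \<noteq> 0}"
    using assms closure_subset bounded_subset compact_imp_bounded by (metis test_function_def)
  then obtain r where "0 < r" "\<And>z. f z \<noteq> 0 \<Longrightarrow> norm z \<le> r"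
    by (auto simp: bounded_pos)
  then show ?thesis by (intro exI[of _ r]) force
qed

lemma test_function_bump:
  assumes "s \<noteq> 0"
  shows "test_function (\<lambda>z :: 'b::euclidean_space. complex_of_real (bump (s *\<^sub>R (z - a))))"
proof (rule test_functionI[OF smooth_bump, where r = "norm a + real DIM('b) / \<bar>s\<bar>"])
  fix z :: 'b assume "norm z > norm a + real DIM('b) / \<bar>s\<bar>"
  then have "real DIM('b) / \<bar>s\<bar> < norm (z - a)"
    using norm_triangle_ineq2[of z a] by linarith
  then have "norm (s *\<^sub>R (z - a)) > real DIM('b)"
    using assms by (simp only: norm_scaleR) (simp add: field_simps)
  then show "complex_of_real (bump (s *\<^sub>R (z - a))) = 0"
    by (simp add: bump_eq_0)
qed

lemma test_function_mult:
  assumes "test_function f" "smooth g"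
  shows "test_function (\<lambda>z. f z * g z)"
proof -
  obtain r where "0 < r" and "\<And>z. norm z > r \<Longrightarrow> f z = 0" using test_function_support[OF assms(1)] by blast
  then show ?thesis using assms
    by (intro test_functionI[of _ r] smooth_mult) (auto simp: test_function_def)
qed

lemma test_function_sum:
  fixes f :: "'i \<Rightarrow> 'b::euclidean_space \<Rightarrow> complex"
  assumes "finite I" "\<And>i. i \<in> I \<Longrightarrow> test_function (f i)"
  shows "test_function (\<lambda>z. \<Sum>i\<in>I. f i z)"
proof -
  have "\<forall>i\<in>I. \<exists>r. \<forall>z. norm z > r \<longrightarrow> f i z = 0"
    using assms(2) test_function_support by metis
  then obtain r where r: "\<And>i z. i \<in> I \<Longrightarrow> norm z > r i \<Longrightarrow> f i z = 0" by metis
  show ?thesis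
  proof (rule test_functionI[where r = "\<Sum>i\<in>I. \<bar>r i\<bar>"])
    show "smooth (\<lambda>z. \<Sum>i\<in>I. f i z)"
      using assms by (intro smooth_sum) (auto simp: test_function_def)
    fix z :: 'b assume z: "norm z > (\<Sum>i\<in>I. \<bar>r i\<bar>)"
    have "norm z > r i" if "i \<in> I" for i
      using member_le_sum[of i I "\<lambda>i. \<bar>r i\<bar>"] that assms(1) z by auto
    then show "(\<Sum>i\<in>I. f i z) = 0" using r by simp
  qed
qed

lemma test_function_frechet_derivative:
  assumes "test_function f" "b \<in> Basis"
  shows "test_function (\<lambda>z. frechet_derivative f (at z) b)"
proof -
  obtain r where "0 < r" and r: "\<And>z. norm z > r \<Longrightarrow> f z = 0" using test_function_support[OF assms(1)] by blast
  have s: "smooth f" using assms by (simp add: test_function_def)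
  show ?thesis
  proof (rule test_functionI[where r = r])
    show "smooth (\<lambda>z. frechet_derivative f (at z) b)" by (rule smooth_frechet_derivative[OF s assms(2)])
    fix z :: 'a assume "norm z > r"
    moreover have "open {z :: 'a. norm z > r}" by (intro open_Collect_less continuous_intros)
    ultimately have "frechet_derivative f (at z) = frechet_derivative (\<lambda>_. 0) (at z)"
      using r by (intro frechet_derivative_transform_within_open[of _ _ "{z. norm z > r}"] smooth_differentiable s) auto
    then show "frechet_derivative f (at z) b = 0" by simp
  qed
qed

lemma test_function_bounded:
  assumes "test_function f"
  shows "\<exists>M>0. \<forall>z. norm (f z) \<le> M"
proof -
  obtain r where "0 < r" and r: "\<And>z. norm z > r \<Longrightarrow> f z = 0" using test_function_support[OF assms] by blast
  have "continuous_on (cball 0 r) f"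
    using assms by (intro smooth_continuous_on) (simp add: test_function_def)
  then have "bounded (f ` cball 0 r)"
    by (intro compact_imp_bounded compact_continuous_image) auto
  then obtain M where M: "0 < M" "\<And>z. norm z \<le> r \<Longrightarrow> norm (f z) \<le> M"
    by (auto simp: bounded_pos)
  have "norm (f z) \<le> M" for z
    using M r by (cases "norm z \<le> r") auto
  with M(1) show ?thesis by blast
qed

lemma frechet_derivative_Basis_sum:
  assumes "f differentiable (at z)"
  shows "frechet_derivative f (at z) v = (\<Sum>b\<in>Basis. complex_of_real (v \<bullet> b) * frechet_derivative f (at z) b)"
proof -
  interpret linear "frechet_derivative f (at z)" by (rule linear_frechet_derivative[OF assms])
  have "frechet_derivative f (at z) v = frechet_derivative f (at z) (\<Sum>b\<in>Basis. (v \<bullet> b) *\<^sub>R b)"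
    by (simp add: euclidean_representation)
  also have "\<dots> = (\<Sum>b\<in>Basis. (v \<bullet> b) *\<^sub>R frechet_derivative f (at z) b)"
    by (simp add: sum scaleR)
  finally show ?thesis by (simp add: scaleR_conv_of_real)
qed

lemma test_function_derivative_bounded:
  fixes f :: "'b::euclidean_space \<Rightarrow> complex"
  assumes "test_function f"
  shows "\<exists>L>0. (\<forall>z v. norm (frechet_derivative f (at z) v) \<le> L * norm v) \<and>
    (\<forall>z w. norm (f z - f w) \<le> L * norm (z - w))"
proof -
  have s: "smooth f" using assms by (simp add: test_function_def)
  have "\<forall>b\<in>Basis. \<exists>M. 0 < M \<and> (\<forall>z. norm (frechet_derivative f (at z) b) \<le> M)"
    using test_function_bounded[OF test_function_frechet_derivative[OF assms]] by blast
  then obtain M where M: "\<And>b. b \<in> Basis \<Longrightarrow> 0 < M b" "\<And>b z. b \<in> Basis \<Longrightarrow> norm (frechet_derivative f (at z) b) \<le> M b"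
    by metis
  define L where "L = (\<Sum>b\<in>Basis. M b)"
  have L: "0 < L" unfolding L_def by (rule sum_pos) (auto intro: M)
  have bound: "norm (frechet_derivative f (at z) v) \<le> L * norm v" for z v
  proof -
    have "norm (frechet_derivative f (at z) v) \<le> (\<Sum>b\<in>Basis. norm (complex_of_real (v \<bullet> b) * frechet_derivative f (at z) b))"
      by (subst frechet_derivative_Basis_sum[OF smooth_differentiable[OF s]]) (rule norm_sum)
    also have "\<dots> \<le> (\<Sum>b\<in>Basis. norm v * M b)"
      by (intro sum_mono) (auto simp: norm_mult Basis_le_norm intro!: mult_mono M)
    finally show ?thesis by (simp add: L_def sum_distrib_left mult.commute)
  qed
  moreover have "norm (f z - f w) \<le> L * norm (z - w)" for z w
  proof (rule differentiable_bound[of UNIV f "\<lambda>z. frechet_derivative f (at z)"])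
    show "(f has_derivative frechet_derivative f (at x)) (at x within UNIV)" for x
      by (rule smooth_has_derivative[OF s])
    show "onorm (frechet_derivative f (at x)) \<le> L" for x
      by (rule onorm_le) (rule bound)
  qed auto
  ultimately show ?thesis using L by blast
qed

lemma test_function_integrable:
  assumes "test_function f"
  shows "integrable lborel f" "square_integrable f"
proof -
  obtain r where "0 < r" and r: "\<And>z. norm z > r \<Longrightarrow> f z = 0" using test_function_support[OF assms] by blast
  obtain M where M: "0 < M" "\<And>z. norm (f z) \<le> M" using test_function_bounded[OF assms] by blast
  have [measurable]: "f \<in> borel_measurable borel"
    using assms by (intro smooth_borel_measurable) (simp add: test_function_def)
  have i: "integrable lborel (\<lambda>z :: 'a. c * indicator (cball 0 r) z :: real)" for c
    using emeasure_lborel_cball_finite[of "0 :: 'a" r] by (intro integrable_mult_right integrable_real_indicator) auto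
  show "integrable lborel f"
    by (rule Bochner_Integration.integrable_bound[OF i[of M]]) (use M r in \<open>auto simp: indicator_def not_le\<close>)
  have "integrable lborel (\<lambda>z. (norm (f z))\<^sup>2)"
    by (rule Bochner_Integration.integrable_bound[OF i[of "M\<^sup>2"]])
      (use M r in \<open>auto simp: indicator_def not_le intro!: power_mono\<close>)
  then show "square_integrable f" by (simp add: square_integrable_def)
qed

subsection \<open>Smoothness of Fourier synthesis\<close>

text \<open>Serves both derivatives under an integral, of \<open>synthesis\<close> and of
  \<open>psi\<close>, where Taylor's formula for the integrand yields exactly such a bound.\<close>

lemma has_derivative_quadratic:
  assumes "bounded_linear L" "\<And>w. norm (f (z + w) - f z - L w) \<le> C * (norm w)\<^sup>2"
  shows "(f has_derivative L) (at z)"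
  unfolding has_derivative_at
proof
  show "((\<lambda>h. norm (f (z + h) - f z - L h) / norm h) \<longlongrightarrow> 0) (at 0)"
  proof (rule Lim_null_comparison[OF always_eventually])
    show "\<forall>h. norm (norm (f (z + h) - f z - L h) / norm h) \<le> C * norm h"
    proof
      fix h show "norm (norm (f (z + h) - f z - L h) / norm h) \<le> C * norm h"
        using assms(2)[of h] by (cases "h = 0") (auto simp: field_simps power2_eq_square)
    qed
    show "((\<lambda>h. C * norm h) \<longlongrightarrow> 0) (at 0)"
      by (intro tendsto_mult_right_zero tendsto_norm_zero tendsto_ident_at)
  qed
qed fact

lemma norm_iexp_minus_1_le: "norm (iexp x - 1) \<le> \<bar>x\<bar>"
  using iexp_approx1[of x 0] by simp

lemma norm_iexp_taylor_le: "norm (iexp x - 1 - \<i> * complex_of_real x) \<le> x\<^sup>2"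
proof -
  have "2 * norm (iexp x - 1 - \<i> * complex_of_real x) \<le> x\<^sup>2"
    using iexp_approx1[of x 1] by (simp add: numeral_2_eq_2 algebra_simps)
  then show ?thesis
    using norm_ge_zero[of "iexp x - 1 - \<i> * complex_of_real x"] by linarith
qed

text \<open>Finiteness of all polynomial moments is what differentiating a Fourier synthesis
  consumes; no regularity of \<open>h\<close> enters, in contrast to Schwartz functions.\<close>

definition rapidly_integrable :: "('b::euclidean_space \<Rightarrow> complex) \<Rightarrow> bool" where
  "rapidly_integrable h \<longleftrightarrow> h \<in> borel_measurable borel \<and> (\<forall>N. integrable lborel (\<lambda>\<xi>. norm \<xi> ^ N * norm (h \<xi>)))"

lemma rapidly_integrable_integrable: "rapidly_integrable h \<Longrightarrow> integrable lborel h"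
  unfolding rapidly_integrable_def
  using integrable_norm_iff[of h lborel] by (auto dest: spec[of _ "0::nat"])

lemma rapidly_integrable_inner:
  assumes "rapidly_integrable h"
  shows "rapidly_integrable (\<lambda>\<xi>. \<i> * complex_of_real (v \<bullet> \<xi>) * h \<xi>)"
  unfolding rapidly_integrable_def
proof (intro conjI allI)
  have [measurable]: "h \<in> borel_measurable borel" using assms by (simp add: rapidly_integrable_def)
  show "(\<lambda>\<xi>. \<i> * complex_of_real (v \<bullet> \<xi>) * h \<xi>) \<in> borel_measurable borel" by measurable
  fix N
  have i: "integrable lborel (\<lambda>\<xi>. norm v * (norm \<xi> ^ Suc N * norm (h \<xi>)))"
    using assms by (intro integrable_mult_right) (simp only: rapidly_integrable_def)
  have "norm \<xi> ^ N * norm (\<i> * complex_of_real (v \<bullet> \<xi>) * h \<xi>) \<le> norm v * (norm \<xi> ^ Suc N * norm (h \<xi>))" for \<xi>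
  proof -
    have "norm \<xi> ^ N * norm (\<i> * complex_of_real (v \<bullet> \<xi>) * h \<xi>) = \<bar>v \<bullet> \<xi>\<bar> * (norm \<xi> ^ N * norm (h \<xi>))"
      by (simp add: norm_mult)
    also have "\<dots> \<le> (norm v * norm \<xi>) * (norm \<xi> ^ N * norm (h \<xi>))"
      by (intro mult_right_mono Cauchy_Schwarz_ineq2) auto
    finally show ?thesis by (simp add: mult_ac)
  qed
  then show "integrable lborel (\<lambda>\<xi>. norm \<xi> ^ N * norm (\<i> * complex_of_real (v \<bullet> \<xi>) * h \<xi>))"
    by (intro Bochner_Integration.integrable_bound[OF i]) auto
qed

text \<open>The second-order remainder of the exponential is at most the square of |w|
  |\<open>\<xi>\<close>|, so the second moment of \<open>h\<close> is the constant of the quadratic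
  remainder.\<close>

lemma has_derivative_synthesis:
  assumes h: "rapidly_integrable h"
  shows "(synthesis h has_derivative (\<lambda>v. synthesis (\<lambda>\<xi>. \<i> * complex_of_real (v \<bullet> \<xi>) * h \<xi>) z)) (at z)"
proof (rule has_derivative_quadratic[where C = "LINT \<xi>|lborel. norm \<xi> ^ 2 * norm (h \<xi>)"])
  let ?L = "\<lambda>v. synthesis (\<lambda>\<xi>. \<i> * complex_of_real (v \<bullet> \<xi>) * h \<xi>) z"
  have ih: "integrable lborel h" by (rule rapidly_integrable_integrable[OF h])
  have iv: "integrable lborel (\<lambda>\<xi>. \<i> * complex_of_real (v \<bullet> \<xi>) * h \<xi>)" for v
    by (rule rapidly_integrable_integrable[OF rapidly_integrable_inner[OF h]])
  have i2: "integrable lborel (\<lambda>\<xi>. norm \<xi> ^ 2 * norm (h \<xi>))"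
    using h by (auto simp: rapidly_integrable_def)
  have i1: "integrable lborel (\<lambda>\<xi>. norm \<xi> * norm (h \<xi>))"
    using h unfolding rapidly_integrable_def by (auto dest: spec[of _ "1::nat"])
  show "bounded_linear ?L"
  proof (rule bounded_linear_intro[where K = "LINT \<xi>|lborel. norm \<xi> * norm (h \<xi>)"])
    show "?L (v + w) = ?L v + ?L w" for v w
      unfolding synthesis_def
      by (subst Bochner_Integration.integral_add[OF integrable_exp_mult(3)[OF iv] integrable_exp_mult(3)[OF iv], symmetric],
          intro Bochner_Integration.integral_cong refl) (simp add: inner_add_left algebra_simps)
    show "?L (r *\<^sub>R v) = r *\<^sub>R ?L v" for r v
      unfolding synthesis_def scaleR_conv_of_real integral_mult_right_zero[symmetric]
      by (intro Bochner_Integration.integral_cong) auto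
    show "norm (?L v) \<le> norm v * (LINT \<xi>|lborel. norm \<xi> * norm (h \<xi>))" for v
    proof -
      have "norm (?L v) \<le> (LINT \<xi>|lborel. norm v * (norm \<xi> * norm (h \<xi>)))"
        unfolding synthesis_def
      proof (rule Bochner_Integration.integral_norm_bound_integral[OF integrable_exp_mult(3)[OF iv]])
        show "integrable lborel (\<lambda>\<xi>. norm v * (norm \<xi> * norm (h \<xi>)))" using i1 by simp
        show "norm (iexp (z \<bullet> \<xi>) * (\<i> * complex_of_real (v \<bullet> \<xi>) * h \<xi>)) \<le> norm v * (norm \<xi> * norm (h \<xi>))" for \<xi>
          using mult_right_mono[OF Cauchy_Schwarz_ineq2[of v \<xi>] norm_ge_zero[of "h \<xi>"]]
          by (simp add: norm_mult mult_ac)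
      qed
      then show ?thesis by simp
    qed
  qed
  fix w
  have "synthesis h (z + w) - synthesis h z - ?L w =
    (LINT \<xi>|lborel. iexp (z \<bullet> \<xi>) * (iexp (w \<bullet> \<xi>) - 1 - \<i> * complex_of_real (w \<bullet> \<xi>)) * h \<xi>)"
    unfolding synthesis_def
    using integrable_exp_mult(3)[OF ih, of "z + w"] integrable_exp_mult(3)[OF ih, of z] integrable_exp_mult(3)[OF iv[of w], of z]
    by (simp flip: Bochner_Integration.integral_diff, intro Bochner_Integration.integral_cong refl)
      (simp add: inner_add_left exp_add algebra_simps)
  also have "norm \<dots> \<le> (LINT \<xi>|lborel. (norm w)\<^sup>2 * (norm \<xi> ^ 2 * norm (h \<xi>)))"
  proof (rule Bochner_Integration.integral_norm_bound_integral)
    show i: "integrable lborel (\<lambda>\<xi>. (norm w)\<^sup>2 * (norm \<xi> ^ 2 * norm (h \<xi>)))" using i2 by simp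
    show le: "norm (iexp (z \<bullet> \<xi>) * (iexp (w \<bullet> \<xi>) - 1 - \<i> * complex_of_real (w \<bullet> \<xi>)) * h \<xi>)
       \<le> (norm w)\<^sup>2 * (norm \<xi> ^ 2 * norm (h \<xi>))" for \<xi>
    proof -
      have "norm (iexp (w \<bullet> \<xi>) - 1 - \<i> * complex_of_real (w \<bullet> \<xi>)) \<le> (w \<bullet> \<xi>)\<^sup>2"
        by (rule norm_iexp_taylor_le)
      also have "\<dots> \<le> (norm w * norm \<xi>)\<^sup>2"
        using Cauchy_Schwarz_ineq2[of w \<xi>] by (intro power2_le_iff_abs_le[THEN iffD2]) auto
      finally have "norm (iexp (w \<bullet> \<xi>) - 1 - \<i> * complex_of_real (w \<bullet> \<xi>)) * norm (h \<xi>) \<le> (norm w * norm \<xi>)\<^sup>2 * norm (h \<xi>)"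
        by (rule mult_right_mono) simp
      then show ?thesis by (simp add: norm_mult power_mult_distrib mult_ac)
    qed
    have [measurable]: "h \<in> borel_measurable borel" using h by (simp add: rapidly_integrable_def)
    show "integrable lborel (\<lambda>\<xi>. iexp (z \<bullet> \<xi>) * (iexp (w \<bullet> \<xi>) - 1 - \<i> * complex_of_real (w \<bullet> \<xi>)) * h \<xi>)"
      by (rule Bochner_Integration.integrable_bound[OF i]) (use le in auto)
  qed
  finally show "norm (synthesis h (z + w) - synthesis h z - ?L w) \<le> (LINT \<xi>|lborel. norm \<xi> ^ 2 * norm (h \<xi>)) * (norm w)\<^sup>2"
    by (simp add: mult.commute)
qed

lemma frechet_derivative_synthesis:
  assumes "rapidly_integrable h"
  shows "frechet_derivative (synthesis h) (at z) v = synthesis (\<lambda>\<xi>. \<i> * complex_of_real (v \<bullet> \<xi>) * h \<xi>) z"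
  using frechet_derivative_at[OF has_derivative_synthesis[OF assms, of z]] by metis

lemma smooth_synthesis:
  assumes "rapidly_integrable h" shows "smooth (synthesis h)"
proof (rule smooth_coinduct[where S = "{synthesis h | h. rapidly_integrable h}"])
  show "f differentiable (at z)" if "f \<in> {synthesis h | h. rapidly_integrable h}" for f z
    using that has_derivative_synthesis differentiable_def by blast
  show "(\<lambda>z. frechet_derivative f (at z) b) \<in> {synthesis h | h. rapidly_integrable h}"
    if "f \<in> {synthesis h | h. rapidly_integrable h}" for f b
  proof -
    from that obtain h where h: "f = synthesis h" "rapidly_integrable h" by blast
    have "(\<lambda>z. frechet_derivative f (at z) b) = synthesis (\<lambda>\<xi>. \<i> * complex_of_real (b \<bullet> \<xi>) * h \<xi>)"
      unfolding h(1) by (intro ext frechet_derivative_synthesis h(2))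
    then show ?thesis using rapidly_integrable_inner[OF h(2)] by blast
  qed
qed (use assms in blast)

text \<open>The Fourier multiplier of the iterated partial derivative along the list.\<close>

primrec symbol :: "'b::euclidean_space list \<Rightarrow> 'b \<Rightarrow> complex" where
  "symbol [] \<xi> = 1"
| "symbol (b # bs) \<xi> = \<i> * complex_of_real (b \<bullet> \<xi>) * symbol bs \<xi>"

lemma rapidly_integrable_symbol:
  "rapidly_integrable h \<Longrightarrow> rapidly_integrable (\<lambda>\<xi>. symbol bs \<xi> * h \<xi>)"
proof (induction bs)
  case (Cons b bs)
  from rapidly_integrable_inner[OF Cons.IH[OF Cons.prems], of b] show ?case by (simp add: mult_ac)
qed simp

lemma partial_derivs_synthesis:
  assumes "rapidly_integrable h"
  shows "partial_derivs bs (synthesis h) = synthesis (\<lambda>\<xi>. symbol bs \<xi> * h \<xi>)"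
proof (induction bs)
  case (Cons b bs)
  show ?case
    using frechet_derivative_synthesis[OF rapidly_integrable_symbol[OF assms], of bs _ b]
    by (intro ext) (simp add: Cons mult.assoc)
qed simp

lemma norm_symbol_le:
  assumes "set bs \<subseteq> Basis" shows "norm (symbol bs \<xi>) \<le> norm \<xi> ^ length bs"
  using assms
proof (induction bs)
  case (Cons b bs)
  have "\<bar>b \<bullet> \<xi>\<bar> * norm (symbol bs \<xi>) \<le> norm \<xi> * norm \<xi> ^ length bs"
    using Cons Basis_le_norm[of b \<xi>] by (intro mult_mono) (auto simp: inner_commute)
  then show ?case by (simp add: norm_mult)
qed simp

lemma borel_measurable_symbol [measurable]: "symbol bs \<in> borel_measurable borel"
  by (induction bs) auto

subsection \<open>The symbol of the collision operator\<close>

lemma integrable_dominated: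
  fixes f :: "'c \<Rightarrow> 'd::{banach, second_countable_topology}"
  assumes "integrable M g" "f \<in> borel_measurable M" "\<And>x. norm (f x) \<le> g x"
  shows "integrable M f"
proof (rule Bochner_Integration.integrable_bound[OF assms(1,2)])
  show "AE x in M. norm (f x) \<le> norm (g x)"
    using order_trans[OF assms(3) abs_ge_self] by auto
qed

lemma norm_iexp_diff_le: "norm (iexp a - iexp b) \<le> \<bar>a - b\<bar>"
proof -
  have "iexp a - iexp b
      = iexp b * (iexp (a - b) - 1)"
    by (simp add: algebra_simps flip: exp_add)
  then show ?thesis
    using norm_iexp_minus_1_le[of "a - b"] by (simp add: norm_mult)
qed

lemma abs_cos_diff_le: "\<bar>cos a - cos b\<bar> \<le> \<bar>a - b :: real\<bar>"
  using order_trans[OF abs_Re_le_cmod norm_iexp_diff_le[of a b]] by (simp add: Re_exp)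

lemma abs_cos_taylor_le: "\<bar>cos (a + b) - cos a + b * sin a\<bar> \<le> (b :: real)\<^sup>2"
proof -
  have "cos (a + b) - cos a + b * sin a = Re (iexp a * (iexp b - 1 - \<i> * complex_of_real b))"
    by (simp add: Re_exp Im_exp cos_add algebra_simps)
  also have "\<bar>\<dots>\<bar> \<le> norm (iexp a * (iexp b - 1 - \<i> * complex_of_real b))"
    by (rule abs_Re_le_cmod)
  also have "\<dots> \<le> b\<^sup>2"
    using norm_iexp_taylor_le[of b] by (simp add: norm_mult)
  finally show ?thesis .
qed

text \<open>The first moment compensates the singularity at 0, since
  \<open>iexp (p \<bullet> q) - 1\<close> vanishes there to first order; it makes the symbol finite
  and Lipschitz. The second moment makes the symbol differentiable with a quadratic
  remainder.\<close>

locale scattering_kernel =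
  fixes \<sigma> :: "'a::euclidean_space \<Rightarrow> real"
  assumes kernel_measurable [measurable]: "\<sigma> \<in> borel_measurable borel"
    and kernel_nonneg: "0 \<le> \<sigma> p"
    and kernel_even: "\<sigma> (- p) = \<sigma> p"
    and first_moment: "integrable lborel (\<lambda>p. norm p * \<sigma> p)"
    and second_moment: "integrable lborel (\<lambda>p. (norm p)\<^sup>2 * \<sigma> p)"
begin

definition M1 :: real where "M1 = (LINT p|lborel. norm p * \<sigma> p)"

definition M2 :: real where "M2 = (LINT p|lborel. (norm p)\<^sup>2 * \<sigma> p)"

text \<open>The symbol \<open>Psi\<close> in real form: evenness of the kernel removes the sine
  part, see \<open>Psi_eq\<close>.\<close>

definition psi :: "'a \<Rightarrow> real" where
  "psi q = (LINT p|lborel. \<sigma> p * (cos (p \<bullet> q) - 1))"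

definition dpsi :: "'a \<Rightarrow> 'a \<Rightarrow> real" where
  "dpsi q v = (LINT p|lborel. - (\<sigma> p * (p \<bullet> v) * sin (p \<bullet> q)))"

lemma M1_nonneg: "0 \<le> M1"
  unfolding M1_def by (rule integral_nonneg_AE) (auto simp: kernel_nonneg)

lemma borel_measurable_psi [measurable]: "psi \<in> borel_measurable borel"
  unfolding psi_def[abs_def] by measurable

lemma integrable_kernel_bound:
  fixes f :: "'a \<Rightarrow> 'c::{banach, second_countable_topology}"
  assumes [measurable]: "f \<in> borel_measurable borel" and "\<And>p. norm (f p) \<le> C * (norm p * \<sigma> p)"
  shows "integrable lborel f" "norm (LINT p|lborel. f p) \<le> C * M1"
proof -
  have i: "integrable lborel (\<lambda>p. C * (norm p * \<sigma> p))" using first_moment by simp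
  show "integrable lborel f"
    by (rule integrable_dominated[OF i _ assms(2)]) measurable
  then have "norm (LINT p|lborel. f p) \<le> (LINT p|lborel. C * (norm p * \<sigma> p))"
    using i assms(2) by (intro Bochner_Integration.integral_norm_bound_integral) auto
  then show "norm (LINT p|lborel. f p) \<le> C * M1" by (simp add: M1_def)
qed

lemma abs_inner_le: "\<bar>p \<bullet> q\<bar> * \<sigma> p \<le> norm q * (norm p * \<sigma> p)"
  using mult_right_mono[OF Cauchy_Schwarz_ineq2[of p q] kernel_nonneg[of p]] by (simp add: mult_ac)

lemma integrable_psi: "integrable lborel (\<lambda>p. \<sigma> p * (cos (p \<bullet> q) - 1))"
proof (rule integrable_kernel_bound(1)[where C = "norm q"])
  show "norm (\<sigma> p * (cos (p \<bullet> q) - 1)) \<le> norm q * (norm p * \<sigma> p)" for p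
    using mult_left_mono[OF abs_cos_diff_le[of "p \<bullet> q" 0] kernel_nonneg[of p]] abs_inner_le[of p q]
    by (simp add: abs_mult kernel_nonneg mult_ac)
qed measurable

lemma integrable_Psi: "integrable lborel (\<lambda>p. complex_of_real (\<sigma> p) * (iexp (p \<bullet> q) - 1))"
proof (rule integrable_kernel_bound(1)[where C = "norm q"])
  show "norm (complex_of_real (\<sigma> p) * (iexp (p \<bullet> q) - 1)) \<le> norm q * (norm p * \<sigma> p)" for p
    using mult_left_mono[OF norm_iexp_minus_1_le[of "p \<bullet> q"] kernel_nonneg[of p]] abs_inner_le[of p q]
    by (simp add: norm_mult kernel_nonneg mult_ac)
qed measurable

lemma Psi_eq: "Psi \<sigma> q = complex_of_real (psi q)"
proof (rule complex_eqI)
  let ?f = "\<lambda>p. complex_of_real (\<sigma> p) * (iexp (p \<bullet> q) - 1)"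
  show "Re (Psi \<sigma> q) = Re (complex_of_real (psi q))"
    unfolding Psi_def psi_def integral_Re[OF integrable_Psi, symmetric] by (simp add: Re_exp)
  have im: "Im (Psi \<sigma> q) = (LINT p|lborel. \<sigma> p * sin (p \<bullet> q))"
    unfolding Psi_def integral_Im[OF integrable_Psi, symmetric] by (simp add: Im_exp)
  have "(LINT p|lborel. \<sigma> p * sin (p \<bullet> q)) = (LINT p|lborel. \<sigma> (- p) * sin ((- p) \<bullet> q))"
    by (rule volume_preserving_integral[OF volume_preserving_uminus, symmetric]) measurable
  also have "\<dots> = - (LINT p|lborel. \<sigma> p * sin (p \<bullet> q))"
    by (simp add: kernel_even)
  finally show "Im (Psi \<sigma> q) = Im (complex_of_real (psi q))"
    unfolding im by simp
qed

lemma psi_nonpos: "psi q \<le> 0"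
proof -
  have "0 \<le> (LINT p|lborel. - (\<sigma> p * (cos (p \<bullet> q) - 1)))"
    by (rule integral_nonneg_AE) (auto intro!: mult_nonneg_nonpos kernel_nonneg)
  then show ?thesis by (simp add: psi_def)
qed

lemma psi_Lipschitz: "\<bar>psi q - psi q'\<bar> \<le> M1 * norm (q - q')"
proof -
  have "psi q - psi q' = (LINT p|lborel. \<sigma> p * (cos (p \<bullet> q) - cos (p \<bullet> q')))"
    unfolding psi_def using integrable_psi[of q] integrable_psi[of q']
    by (simp flip: Bochner_Integration.integral_diff) (simp add: algebra_simps)
  also have "norm \<dots> \<le> norm (q - q') * M1"
  proof (rule integrable_kernel_bound(2))
    show "norm (\<sigma> p * (cos (p \<bullet> q) - cos (p \<bullet> q'))) \<le> norm (q - q') * (norm p * \<sigma> p)" for p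
      using mult_left_mono[OF abs_cos_diff_le[of "p \<bullet> q" "p \<bullet> q'"] kernel_nonneg[of p]] abs_inner_le[of p "q - q'"]
      by (simp add: abs_mult kernel_nonneg mult_ac inner_diff_right)
  qed measurable
  finally show ?thesis by (simp add: mult.commute)
qed

lemma psi_0: "psi 0 = 0"
  by (simp add: psi_def)

lemma abs_psi_le: "\<bar>psi q\<bar> \<le> M1 * norm q"
  using psi_Lipschitz[of q 0] by (simp add: psi_0)

lemma continuous_on_psi: "continuous_on A psi"
proof (rule lipschitz_on_continuous_on)
  show "lipschitz_on M1 A psi"
    by (rule lipschitz_onI) (use psi_Lipschitz M1_nonneg in \<open>auto simp: dist_norm\<close>)
qed

lemma abs_dpsi_le: "\<bar>dpsi q v\<bar> \<le> M1 * norm v"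
proof -
  have "norm (- (\<sigma> p * (p \<bullet> v) * sin (p \<bullet> q))) \<le> norm v * (norm p * \<sigma> p)" for p
  proof -
    have "norm (- (\<sigma> p * (p \<bullet> v) * sin (p \<bullet> q))) = \<bar>p \<bullet> v\<bar> * \<sigma> p * \<bar>sin (p \<bullet> q)\<bar>"
      by (simp add: abs_mult kernel_nonneg)
    also have "\<dots> \<le> \<bar>p \<bullet> v\<bar> * \<sigma> p * 1"
      by (intro mult_left_mono) (auto simp: kernel_nonneg)
    finally show ?thesis using abs_inner_le[of p v] by simp
  qed
  then have "norm (dpsi q v) \<le> norm v * M1"
    unfolding dpsi_def by (intro integrable_kernel_bound(2)) measurable
  then show ?thesis by (simp add: mult.commute)
qed

lemma integrable_dpsi: "integrable lborel (\<lambda>p. - (\<sigma> p * (p \<bullet> v) * sin (p \<bullet> q)))"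
proof (rule integrable_kernel_bound(1)[where C = "norm v"])
  fix p
  have "norm (- (\<sigma> p * (p \<bullet> v) * sin (p \<bullet> q))) = \<bar>p \<bullet> v\<bar> * \<sigma> p * \<bar>sin (p \<bullet> q)\<bar>"
    by (simp add: abs_mult kernel_nonneg)
  also have "\<dots> \<le> \<bar>p \<bullet> v\<bar> * \<sigma> p * 1"
    by (intro mult_left_mono) (auto simp: kernel_nonneg)
  finally show "norm (- (\<sigma> p * (p \<bullet> v) * sin (p \<bullet> q))) \<le> norm v * (norm p * \<sigma> p)"
    using abs_inner_le[of p v] by simp
qed measurable

text \<open>The remainder of the cosine after the linear term is quadratic in
  \<open>p \<bullet> w\<close>, so it is absorbed by the second moment of the kernel.\<close>

lemma has_derivative_psi: "(psi has_derivative dpsi q) (at q)"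
proof (rule has_derivative_quadratic[where C = M2])
  show "bounded_linear (dpsi q)"
  proof (rule bounded_linear_intro[where K = M1])
    show "dpsi q (v + w) = dpsi q v + dpsi q w" for v w
      unfolding dpsi_def
      by (subst Bochner_Integration.integral_add[OF integrable_dpsi integrable_dpsi, symmetric])
        (simp add: inner_add_right algebra_simps)
    show "dpsi q (r *\<^sub>R v) = r *\<^sub>R dpsi q v" for r v
      unfolding dpsi_def by (simp add: mult_ac flip: integral_mult_right_zero)
    show "norm (dpsi q v) \<le> norm v * M1" for v
      using abs_dpsi_le[of q v] by (simp add: mult.commute)
  qed
  fix w
  have eq: "psi (q + w) - psi q - dpsi q w
      = (LINT p|lborel. \<sigma> p * (cos (p \<bullet> q + p \<bullet> w) - cos (p \<bullet> q) + (p \<bullet> w) * sin (p \<bullet> q)))"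
    unfolding psi_def dpsi_def
    by (subst Bochner_Integration.integral_diff[OF integrable_psi integrable_psi, symmetric],
        subst Bochner_Integration.integral_diff[OF Bochner_Integration.integrable_diff[OF integrable_psi integrable_psi] integrable_dpsi, symmetric])
      (simp add: inner_add_right algebra_simps)
  have i: "integrable lborel (\<lambda>p. (norm w)\<^sup>2 * ((norm p)\<^sup>2 * \<sigma> p))" using second_moment by simp
  have le: "norm (\<sigma> p * (cos (p \<bullet> q + p \<bullet> w) - cos (p \<bullet> q) + (p \<bullet> w) * sin (p \<bullet> q))) \<le> (norm w)\<^sup>2 * ((norm p)\<^sup>2 * \<sigma> p)" for p
  proof -
    have "\<bar>cos (p \<bullet> q + p \<bullet> w) - cos (p \<bullet> q) + (p \<bullet> w) * sin (p \<bullet> q)\<bar> \<le> (p \<bullet> w)\<^sup>2"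
      by (rule abs_cos_taylor_le)
    also have "\<dots> \<le> (norm p * norm w)\<^sup>2"
      using Cauchy_Schwarz_ineq2[of p w] by (intro power2_le_iff_abs_le[THEN iffD2]) auto
    finally have "\<sigma> p * \<bar>cos (p \<bullet> q + p \<bullet> w) - cos (p \<bullet> q) + (p \<bullet> w) * sin (p \<bullet> q)\<bar> \<le> \<sigma> p * (norm p * norm w)\<^sup>2"
      by (intro mult_left_mono kernel_nonneg)
    then show ?thesis by (simp add: abs_mult kernel_nonneg power_mult_distrib mult_ac)
  qed
  have "integrable lborel (\<lambda>p. \<sigma> p * (cos (p \<bullet> q + p \<bullet> w) - cos (p \<bullet> q) + (p \<bullet> w) * sin (p \<bullet> q)))"
    by (rule integrable_dominated[OF i _ le]) measurable
  then have "norm (psi (q + w) - psi q - dpsi q w) \<le> (LINT p|lborel. (norm w)\<^sup>2 * ((norm p)\<^sup>2 * \<sigma> p))"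
    unfolding eq using i le by (intro Bochner_Integration.integral_norm_bound_integral) auto
  then show "norm (psi (q + w) - psi q - dpsi q w) \<le> M2 * (norm w)\<^sup>2"
    by (simp add: M2_def mult.commute)
qed

lemma psi_line_derivative: "((\<lambda>v. psi (q + v *\<^sub>R y)) has_real_derivative dpsi q y) (at 0)"
proof -
  have d: "((\<lambda>v::real. q + v *\<^sub>R y) has_derivative (\<lambda>v. v *\<^sub>R y)) (at 0)"
    by (auto intro!: derivative_eq_intros)
  have p: "(psi has_derivative dpsi q) (at (q + 0 *\<^sub>R y))" using has_derivative_psi by simp
  interpret linear "dpsi q" using has_derivative_psi by (rule has_derivative_linear)
  have "((\<lambda>v. psi (q + v *\<^sub>R y)) has_derivative (\<lambda>v. dpsi q (v *\<^sub>R y))) (at 0)"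
    by (rule has_derivative_compose[OF d p])
  then show ?thesis
    by (simp add: has_field_derivative_def scaleR mult_commute_abs)
qed

text \<open>Only the ball of radius \<open>1 / (2\<bar>q\<bar>)\<close> about \<open>q / \<bar>q\<bar>\<^sup>2\<close> is used: there \<open>1/2 \<le> p \<cdot> q \<le> 3/2\<close>, so the
  integrand is bounded away from 0.\<close>

lemma psi_upper_bound:
  assumes "0 < c0" "0 < \<delta>" "0 < \<theta>"
    and lower: "\<And>p. p \<noteq> 0 \<Longrightarrow> norm p < \<delta> \<Longrightarrow> c0 / norm p powr (real DIM('a) + \<theta>) \<le> \<sigma> p"
  obtains c C where "0 < c" "0 \<le> C" "\<And>q. psi q \<le> C - c * norm q powr \<theta>"
proof -
  \<comment> \<open>The minimum of 1 - cos on the interval from 1/2 to 3/2, which lies in the range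
    where the cosine decreases.\<close>
  define \<kappa> where "\<kappa> = 1 - cos (1 / 2 :: real)"
  have \<kappa>: "0 < \<kappa>"
    using cos_monotone_0_pi[of 0 "1 / 2"] pi_gt3 by (simp add: \<kappa>_def)
  define \<omega> where "\<omega> = unit_ball_vol (real DIM('a))"
  have \<omega>: "0 < \<omega>" by (simp add: \<omega>_def)
  \<comment> \<open>Collects \<open>\<kappa>\<close>, the lower bound of the kernel for |p| < 3 / (2
    r), and the volume of a ball of radius 1 / (2 r), where r = |q|. The powers of r combine to r to
    the power \<open>\<theta>\<close>.\<close>
  define c where "c = \<kappa> * c0 * (2 / 3) powr (real DIM('a) + \<theta>) * (\<omega> * (1 / 2) ^ DIM('a))"
  have c: "0 < c" using \<kappa> \<omega> assms(1) by (simp add: c_def)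
  \<comment> \<open>Beyond this size of q the ball lies inside the region of radius
    \<open>\<delta>\<close> where the lower bound of the kernel is known.\<close>
  define q0 where "q0 = 2 / \<delta>"
  have q0: "0 < q0" using assms by (simp add: q0_def)
  have big: "psi q \<le> - c * norm q powr \<theta>" if q: "norm q \<ge> q0" for q
  proof -
    define r where "r = norm q"
    have r: "0 < r" using q q0 unfolding r_def by linarith
    have rd: "3 / (2 * r) < \<delta>"
    proof -
      have "2 \<le> r * \<delta>" using q assms(2) by (simp add: q0_def r_def field_simps)
      then show ?thesis using r by (simp add: field_simps)
    qed
    define B where "B = ball ((1 / r\<^sup>2) *\<^sub>R q) (1 / (2 * r))"
    define m where "m = c0 * (2 * r / 3) powr (real DIM('a) + \<theta>)"
    have m: "0 < m" using assms(1) r by (simp add: m_def)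
    have B: "\<kappa> * m \<le> \<sigma> p * (1 - cos (p \<bullet> q))" if "p \<in> B" for p
    proof -
      let ?w = "p - (1 / r\<^sup>2) *\<^sub>R q"
      have w: "norm ?w < 1 / (2 * r)"
        using that by (simp add: B_def dist_norm norm_minus_commute)
      have "\<bar>?w \<bullet> q\<bar> \<le> norm ?w * r" unfolding r_def by (rule Cauchy_Schwarz_ineq2)
      also have "\<dots> \<le> 1 / (2 * r) * r" using w r by (intro mult_right_mono) auto
      also have "\<dots> = 1 / 2" using r by simp
      finally have "\<bar>?w \<bullet> q\<bar> \<le> 1 / 2" .
      moreover have "?w \<bullet> q = p \<bullet> q - 1"
        using r by (simp add: inner_diff_left power2_norm_eq_inner[symmetric] r_def[symmetric])
      ultimately have pq: "1 / 2 \<le> p \<bullet> q" "p \<bullet> q \<le> 3 / 2" by linarith+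
      have "cos (p \<bullet> q) \<le> cos (1 / 2)"
        using pq pi_gt3 by (intro cos_monotone_0_pi_le) auto
      then have k: "\<kappa> \<le> 1 - cos (p \<bullet> q)" by (simp add: \<kappa>_def)
      have p0: "p \<noteq> 0" using pq by auto
      have "norm p \<le> norm ?w + norm ((1 / r\<^sup>2) *\<^sub>R q)"
        by (metis norm_triangle_ineq diff_add_cancel)
      also have "norm ((1 / r\<^sup>2) *\<^sub>R q) = 1 / r" using r by (simp add: r_def[symmetric] power2_eq_square)
      also have "norm ?w + 1 / r < 1 / (2 * r) + 1 / r" using w by simp
      also have "\<dots> = 3 / (2 * r)" using r by (simp add: field_simps)
      finally have np: "norm p < 3 / (2 * r)" .
      have "m = c0 / (3 / (2 * r)) powr (real DIM('a) + \<theta>)"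
        using r by (simp add: m_def powr_divide)
      also have "\<dots> \<le> c0 / norm p powr (real DIM('a) + \<theta>)"
        using np p0 r assms(1,3) by (intro divide_left_mono powr_mono2 mult_pos_pos) auto
      also have "\<dots> \<le> \<sigma> p"
        using np rd by (intro lower p0) auto
      finally have "m \<le> \<sigma> p" .
      then have "m * \<kappa> \<le> \<sigma> p * (1 - cos (p \<bullet> q))"
        using k m \<kappa> by (intro mult_mono) (auto simp: kernel_nonneg)
      then show ?thesis by (simp add: mult.commute)
    qed
    have vol: "measure lborel B = \<omega> * (1 / (2 * r)) ^ DIM('a)"
      unfolding B_def \<omega>_def using r by (subst content_ball) auto
    have iB: "integrable lborel (\<lambda>p. \<kappa> * m * indicator B p)"
      unfolding B_def using emeasure_lborel_ball_finite by (intro integrable_mult_right integrable_real_indicator) auto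
    have ip: "integrable lborel (\<lambda>p. \<sigma> p * (1 - cos (p \<bullet> q)))"
      using Bochner_Integration.integrable_minus[OF integrable_psi[of q]] by (simp add: algebra_simps)
    have "\<kappa> * m * measure lborel B = (LINT p|lborel. \<kappa> * m * indicator B p)"
      by (simp add: B_def)
    also have "\<dots> \<le> (LINT p|lborel. \<sigma> p * (1 - cos (p \<bullet> q)))"
    proof (rule integral_mono[OF iB ip])
      show "\<kappa> * m * indicator B p \<le> \<sigma> p * (1 - cos (p \<bullet> q))" for p
        using B[of p] kernel_nonneg[of p] by (auto simp: indicator_def)
    qed
    also have "\<dots> = (LINT p|lborel. - (\<sigma> p * (cos (p \<bullet> q) - 1)))"
      by (simp add: algebra_simps)
    also have "\<dots> = - psi q"
      by (simp add: psi_def)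
    finally have "\<kappa> * m * measure lborel B \<le> - psi q" .
    moreover have "\<kappa> * m * measure lborel B = c * r powr \<theta>"
    proof -
      have "(2 * r / 3) powr (real DIM('a) + \<theta>) = (2 / 3) powr (real DIM('a) + \<theta>) * (r ^ DIM('a) * r powr \<theta>)"
      proof -
        have "(2 * r / 3) powr (real DIM('a) + \<theta>) = ((2 / 3) * r) powr (real DIM('a) + \<theta>)" by simp
        also have "\<dots> = (2 / 3) powr (real DIM('a) + \<theta>) * r powr (real DIM('a) + \<theta>)"
          by (rule powr_mult)
        also have "r powr (real DIM('a) + \<theta>) = r ^ DIM('a) * r powr \<theta>"
          using r by (simp add: powr_add powr_realpow)
        finally show ?thesis .
      qed
      then show ?thesis
        unfolding vol m_def c_def using r by (simp add: power_divide power_mult_distrib field_simps)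
    qed
    ultimately show ?thesis by (simp add: r_def)
  qed
  \<comment> \<open>For small q the bound reduces to \<open>psi_nonpos\<close>, since the additive
    constant exceeds the term that is subtracted.\<close>
  have "psi q \<le> c * q0 powr \<theta> - c * norm q powr \<theta>" for q
  proof (cases "norm q \<ge> q0")
    case True
    have "0 \<le> c * q0 powr \<theta>" using c by simp
    then show ?thesis using big[OF True] by linarith
  next
    case False
    then have "norm q powr \<theta> \<le> q0 powr \<theta>" using assms(3) by (intro powr_mono2) auto
    then have "c * norm q powr \<theta> \<le> c * q0 powr \<theta>" using c by simp
    then show ?thesis using psi_nonpos[of q] by simp
  qed
  then show thesis using c by (intro that[of c "c * q0 powr \<theta>"]) auto
qed

subsection \<open>The symbol accumulated along characteristics\<close>

definition accum :: "real \<Rightarrow> 'a \<Rightarrow> 'a \<Rightarrow> real" where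
  "accum t y q = (LINT u:{0..t}|lborel. psi (q + u *\<^sub>R y))"

lemma continuous_on_psi_line: "continuous_on A (\<lambda>u::real. psi (q + u *\<^sub>R y))"
  by (rule continuous_on_compose2[OF continuous_on_psi[of UNIV]]) (auto intro!: continuous_intros)

lemma set_integrable_psi_line: "set_integrable lborel {a..b} (\<lambda>u. psi (q + u *\<^sub>R y))"
  by (rule borel_integrable_atLeastAtMost') (rule continuous_on_psi_line)

lemma accum_eq_integral: "accum t y q = integral {0..t} (\<lambda>u. psi (q + u *\<^sub>R y))"
  unfolding accum_def by (rule set_borel_integral_eq_integral(2)[OF set_integrable_psi_line])

lemma borel_measurable_accum [measurable]:
  "(\<lambda>\<xi>. accum t (fst \<xi>) (snd \<xi>)) \<in> borel_measurable borel"
proof -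
  have [measurable]: "(\<lambda>p :: ('a \<times> 'a) \<times> real. snd (fst p) + snd p *\<^sub>R fst (fst p)) \<in> borel_measurable (borel \<Otimes>\<^sub>M borel)"
    unfolding borel_prod by (intro borel_measurable_continuous_onI continuous_intros)
  have "(\<lambda>p :: ('a \<times> 'a) \<times> real. indicator {0..t} (snd p) *\<^sub>R psi (snd (fst p) + snd p *\<^sub>R fst (fst p))) \<in> borel_measurable (borel \<Otimes>\<^sub>M lborel)"
    by measurable
  then show ?thesis
    unfolding accum_def set_lebesgue_integral_def
    by (intro lborel.borel_measurable_lebesgue_integral) (simp add: split_beta')
qed

text \<open>The integrand is nonpositive, so discarding the rest of the interval only increases the
  integral.\<close>

lemma accum_le_subinterval:
  assumes "0 \<le> a" "a \<le> b" "b \<le> t" and m: "\<And>u. u \<in> {a..b} \<Longrightarrow> psi (q + u *\<^sub>R y) \<le> m"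
  shows "accum t y q \<le> (b - a) * m"
proof -
  have i: "(\<lambda>u. - psi (q + u *\<^sub>R y)) integrable_on {c..d}" for c d
    by (intro integrable_continuous_real continuous_intros continuous_on_psi_line)
  have i': "(\<lambda>u. psi (q + u *\<^sub>R y)) integrable_on {c..d}" for c d
    by (intro integrable_continuous_real continuous_on_psi_line)
  have "integral {a..b} (\<lambda>u. - psi (q + u *\<^sub>R y)) \<le> integral {0..t} (\<lambda>u. - psi (q + u *\<^sub>R y))"
    using assms by (intro integral_subset_le i) (auto simp: psi_nonpos)
  then have "accum t y q \<le> integral {a..b} (\<lambda>u. psi (q + u *\<^sub>R y))"
    by (simp add: accum_eq_integral)
  also have "\<dots> \<le> integral {a..b} (\<lambda>u. m)"
    using m by (intro integral_le i') auto
  finally show ?thesis using assms by simp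
qed

lemma accum_nonpos: "accum t y q \<le> 0"
proof (cases "0 \<le> t")
  case True
  then show ?thesis using accum_le_subinterval[of 0 0 t q y 0] psi_nonpos by simp
next
  case False
  then show ?thesis by (simp add: accum_eq_integral)
qed

text \<open>Rewrites the accumulated symbol, seen from a point that itself moves on the
  characteristic, as a difference of two values of one primitive. The lower limit \<open>- T\<close>
  lies to the left of every point used, so the primitive can be differentiated there in both
  parameters.\<close>

lemma accum_line:
  assumes "0 \<le> \<tau>" "- T \<le> v - \<tau>"
  shows "accum \<tau> y (q + (v - \<tau>) *\<^sub>R y) =
     integral {-T..v} (\<lambda>w. psi (q + w *\<^sub>R y)) - integral {-T..v - \<tau>} (\<lambda>w. psi (q + w *\<^sub>R y))"
proof -
  let ?f = "\<lambda>w. psi (q + w *\<^sub>R y)"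
  have "accum \<tau> y (q + (v - \<tau>) *\<^sub>R y) = integral {0..\<tau>} (?f \<circ> (\<lambda>x. x + (v - \<tau>)))"
    by (simp add: accum_eq_integral algebra_simps o_def)
  also have "\<dots> = integral {0 + (v - \<tau>)..\<tau> + (v - \<tau>)} ?f"
    by (rule integral_shift) (rule continuous_on_psi_line)
  finally have "accum \<tau> y (q + (v - \<tau>) *\<^sub>R y) = integral {v - \<tau>..v} ?f" by simp
  moreover have "integral {-T..v - \<tau>} ?f + integral {v - \<tau>..v} ?f = integral {-T..v} ?f"
    using assms by (intro Henstock_Kurzweil_Integration.integral_combine integrable_continuous_real continuous_on_psi_line) auto
  ultimately show ?thesis by simp
qed

lemma DERIV_line_integral:
  assumes "- T < v"
  shows "((\<lambda>v. integral {-T..v} (\<lambda>w. psi (q + w *\<^sub>R y))) has_real_derivative psi (q + v *\<^sub>R y)) (at v)"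
proof -
  have "((\<lambda>v. integral {-T..v} (\<lambda>w. psi (q + w *\<^sub>R y))) has_vector_derivative psi (q + v *\<^sub>R y)) (at v within {-T..v + 1})"
    using assms by (intro integral_has_vector_derivative continuous_on_psi_line) auto
  moreover have "at v within {-T..v + 1} = at v"
    using assms by (intro at_within_interior) auto
  ultimately show ?thesis
    by (simp add: has_real_derivative_iff_has_vector_derivative)
qed

end

subsection \<open>Admissible functions on the Fourier side\<close>

text \<open>No continuity is demanded, because a derivative along the characteristics is only known
  to be Borel and bounded. The class still gives smooth syntheses, since all moments are
  finite.\<close>

definition compactly_bounded :: "('b::euclidean_space \<Rightarrow> complex) \<Rightarrow> bool" where
  "compactly_bounded h \<longleftrightarrow> h \<in> borel_measurable borel \<and> (\<exists>M r. \<forall>\<xi>. norm (h \<xi>) \<le> M * indicator (cball 0 r) \<xi>)"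

lemma compactly_boundedI:
  assumes "h \<in> borel_measurable borel" "\<And>\<xi>. norm (h \<xi>) \<le> M" "\<And>\<xi>. r < norm \<xi> \<Longrightarrow> h \<xi> = 0"
  shows "compactly_bounded h"
  unfolding compactly_bounded_def
  using assms by (intro conjI exI[of _ M] exI[of _ r]) (auto simp: indicator_def not_le)

lemma compactly_boundedE:
  assumes "compactly_bounded h"
  obtains M r where "0 < M" "0 < r" "\<And>\<xi>. norm (h \<xi>) \<le> M" "\<And>\<xi>. r < norm \<xi> \<Longrightarrow> h \<xi> = 0"
proof -
  from assms obtain M r where *: "\<And>\<xi>. norm (h \<xi>) \<le> M * indicator (cball 0 r) \<xi>"
    unfolding compactly_bounded_def by blast
  have "norm (h \<xi>) \<le> \<bar>M\<bar> + 1" for \<xi>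
    using *[of \<xi>] by (cases "\<xi> \<in> cball 0 r") (auto simp del: mem_cball)
  moreover have "h \<xi> = 0" if "\<bar>r\<bar> + 1 < norm \<xi>" for \<xi>
    using *[of \<xi>] that by (cases "norm \<xi> \<le> r") (auto simp: indicator_def)
  ultimately show thesis by (intro that[of "\<bar>M\<bar> + 1" "\<bar>r\<bar> + 1"]) auto
qed

lemma compactly_bounded_measurable: "compactly_bounded h \<Longrightarrow> h \<in> borel_measurable borel"
  by (simp add: compactly_bounded_def)

lemma integrable_indicator_cball:
  "integrable lborel (\<lambda>\<xi> :: 'b::euclidean_space. M * indicator (cball 0 r) \<xi> :: real)"
  using emeasure_lborel_cball_finite[of "0 :: 'b" r] by (intro integrable_mult_right integrable_real_indicator) auto

lemma compactly_bounded_rapidly_integrable: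
  assumes "compactly_bounded h" shows "rapidly_integrable h"
proof -
  obtain M r where h: "0 < M" "0 < r" "\<And>\<xi>. norm (h \<xi>) \<le> M" "\<And>\<xi>. r < norm \<xi> \<Longrightarrow> h \<xi> = 0"
    using assms by (rule compactly_boundedE) blast
  note [measurable] = compactly_bounded_measurable[OF assms]
  have "integrable lborel (\<lambda>\<xi>. norm \<xi> ^ N * norm (h \<xi>))" for N
  proof (rule integrable_dominated[OF integrable_indicator_cball[of "r ^ N * M" r]])
    show "norm (norm \<xi> ^ N * norm (h \<xi>)) \<le> r ^ N * M * indicator (cball 0 r) \<xi>" for \<xi>
      using h by (auto simp: indicator_def abs_mult not_le intro!: mult_mono power_mono)
  qed measurable
  then show ?thesis by (simp add: rapidly_integrable_def)
qed

lemma compactly_bounded_integrable: "compactly_bounded h \<Longrightarrow> integrable lborel h"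
  by (intro rapidly_integrable_integrable compactly_bounded_rapidly_integrable)

lemma compactly_bounded_square_integrable:
  assumes "compactly_bounded h" shows "square_integrable h"
proof -
  obtain M r where h: "0 < M" "0 < r" "\<And>\<xi>. norm (h \<xi>) \<le> M" "\<And>\<xi>. r < norm \<xi> \<Longrightarrow> h \<xi> = 0"
    using assms by (rule compactly_boundedE) blast
  note [measurable] = compactly_bounded_measurable[OF assms]
  have "integrable lborel (\<lambda>\<xi>. (norm (h \<xi>))\<^sup>2)"
  proof (rule integrable_dominated[OF integrable_indicator_cball[of "M\<^sup>2" r]])
    show "norm ((norm (h \<xi>))\<^sup>2) \<le> M\<^sup>2 * indicator (cball 0 r) \<xi>" for \<xi>
      using h by (auto simp: indicator_def not_le intro!: power_mono)
  qed measurable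
  then show ?thesis by (simp add: square_integrable_def)
qed

text \<open>Only a bound and a radius enter, so the estimate is uniform over a family of functions
  supported in one ball; this gives constants independent of time.\<close>

lemma compactly_bounded_L2_norm_le:
  fixes h :: "'b::euclidean_space \<Rightarrow> complex"
  assumes "h \<in> borel_measurable borel" "0 \<le> C" "\<And>\<xi>. norm (h \<xi>) \<le> C * indicator (cball 0 r) \<xi>"
  shows "L2_norm h \<le> C * sqrt (measure lborel (cball 0 r :: 'b set))"
proof -
  have h: "square_integrable h"
    using assms unfolding compactly_bounded_def by (intro compactly_bounded_square_integrable) (auto simp: compactly_bounded_def)
  have "(L2_norm h)\<^sup>2 \<le> (LINT \<xi>|lborel. C\<^sup>2 * indicator (cball 0 r) (\<xi> :: 'b))"
    unfolding L2_norm_power2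
  proof (rule integral_mono[OF square_integrable_integrable_sq[OF h] integrable_indicator_cball])
    show "(norm (h \<xi>))\<^sup>2 \<le> C\<^sup>2 * indicator (cball 0 r) \<xi>" for \<xi>
      using power_mono[OF assms(3)[of \<xi>] norm_ge_zero, of 2] by (auto simp: indicator_def split: if_splits)
  qed
  also have "\<dots> = (C * sqrt (measure lborel (cball 0 r :: 'b set)))\<^sup>2"
    by (simp add: power_mult_distrib)
  finally show ?thesis
    by (rule power2_le_imp_le) (use assms in auto)
qed

lemma compactly_bounded_diff:
  assumes "compactly_bounded h" "compactly_bounded k"
  shows "compactly_bounded (\<lambda>\<xi>. h \<xi> - k \<xi>)"
proof -
  obtain M r where h: "0 < M" "0 < r" "\<And>\<xi>. norm (h \<xi>) \<le> M" "\<And>\<xi>. r < norm \<xi> \<Longrightarrow> h \<xi> = 0"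
    using assms(1) by (rule compactly_boundedE) blast
  obtain N s where k: "0 < N" "0 < s" "\<And>\<xi>. norm (k \<xi>) \<le> N" "\<And>\<xi>. s < norm \<xi> \<Longrightarrow> k \<xi> = 0"
    using assms(2) by (rule compactly_boundedE) blast
  show ?thesis
  proof (rule compactly_boundedI[where M = "M + N" and r = "max r s"])
    show "(\<lambda>\<xi>. h \<xi> - k \<xi>) \<in> borel_measurable borel"
      using assms[THEN compactly_bounded_measurable] by measurable
    show "norm (h \<xi> - k \<xi>) \<le> M + N" for \<xi>
      using norm_triangle_ineq4[of "h \<xi>" "k \<xi>"] h(3)[of \<xi>] k(3)[of \<xi>] by linarith
  qed (use h k in auto)
qed

lemma compactly_bounded_mult:
  assumes "compactly_bounded h" "g \<in> borel_measurable borel"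
    and "\<And>r. \<exists>C. \<forall>\<xi>. norm \<xi> \<le> r \<longrightarrow> norm (g \<xi>) \<le> C"
  shows "compactly_bounded (\<lambda>\<xi>. g \<xi> * h \<xi>)"
proof -
  obtain M r where h: "0 < M" "0 < r" "\<And>\<xi>. norm (h \<xi>) \<le> M" "\<And>\<xi>. r < norm \<xi> \<Longrightarrow> h \<xi> = 0"
    using assms(1) by (rule compactly_boundedE) blast
  obtain C where C: "\<And>\<xi>. norm \<xi> \<le> r \<Longrightarrow> norm (g \<xi>) \<le> C" using assms(3) by blast
  show ?thesis
  proof (rule compactly_boundedI[where M = "\<bar>C\<bar> * M" and r = r])
    show "(\<lambda>\<xi>. g \<xi> * h \<xi>) \<in> borel_measurable borel"
      using assms(2) compactly_bounded_measurable[OF assms(1)] by measurable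
    show "norm (g \<xi> * h \<xi>) \<le> \<bar>C\<bar> * M" for \<xi>
    proof (cases "norm \<xi> \<le> r")
      case True
      then have "norm (g \<xi>) \<le> \<bar>C\<bar>" using C[of \<xi>] by linarith
      then show ?thesis unfolding norm_mult using h by (intro mult_mono) auto
    next
      case False then show ?thesis using h by simp
    qed
  qed (use h in auto)
qed

lemma test_function_compactly_bounded:
  assumes "test_function f" shows "compactly_bounded f"
proof -
  obtain r where "0 < r" and r: "\<And>z. norm z > r \<Longrightarrow> f z = 0" using test_function_support[OF assms] by blast
  obtain M where M: "0 < M" "\<And>z. norm (f z) \<le> M" using test_function_bounded[OF assms] by blast
  show ?thesis
    using assms by (intro compactly_boundedI[of f M r] smooth_borel_measurable M r) (auto simp: test_function_def)
qed

section \<open>The shear along characteristics and functions differentiable along it\<close>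

definition shear :: "real \<Rightarrow> 'a::euclidean_space \<times> 'a \<Rightarrow> 'a \<times> 'a" where
  "shear v \<xi> = (fst \<xi>, snd \<xi> + v *\<^sub>R fst \<xi>)"

lemma shear_0 [simp]: "shear 0 \<xi> = \<xi>"
  by (simp add: shear_def)

lemma shear_shear [simp]: "shear v (shear w \<xi>) = shear (v + w) \<xi>"
  by (simp add: shear_def algebra_simps)

lemma fst_shear [simp]: "fst (shear v \<xi>) = fst \<xi>" and snd_shear: "snd (shear v \<xi>) = snd \<xi> + v *\<^sub>R fst \<xi>"
  by (simp_all add: shear_def)

lemma continuous_on_shear: "continuous_on A (shear v)"
  unfolding shear_def[abs_def] by (intro continuous_intros)

lemma borel_measurable_shear [measurable]: "shear v \<in> borel_measurable borel"
  by (intro borel_measurable_continuous_onI continuous_on_shear)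

lemma norm_shear_le: "norm (shear v \<xi>) \<le> (1 + \<bar>v\<bar>) * norm \<xi>"
proof -
  have "shear v \<xi> = \<xi> + v *\<^sub>R (0, fst \<xi>)" by (simp add: shear_def prod_eq_iff)
  then have "norm (shear v \<xi>) \<le> norm \<xi> + \<bar>v\<bar> * norm (fst \<xi>)"
    using norm_triangle_ineq[of \<xi> "v *\<^sub>R (0, fst \<xi>)"] by (simp add: norm_Pair)
  also have "\<dots> \<le> norm \<xi> + \<bar>v\<bar> * norm \<xi>"
    using norm_fst_le[of "fst \<xi>" "snd \<xi>"] by (intro add_left_mono mult_left_mono) auto
  finally show ?thesis by (simp add: algebra_simps)
qed

lemma norm_le_norm_shear: "norm \<xi> \<le> (1 + \<bar>v\<bar>) * norm (shear v \<xi>)"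
  using norm_shear_le[of "- v" "shear v \<xi>"] by simp

text \<open>On each slice of constant y the shear is a translation in q, so Tonelli's theorem
  applies.\<close>

lemma volume_preserving_shear: "volume_preserving (shear v :: 'a::euclidean_space \<times> 'a \<Rightarrow> _)"
  unfolding volume_preserving_def
proof
  show "shear v \<in> borel_measurable borel" by measurable
  show "distr lborel borel (shear v) = (lborel :: ('a \<times> 'a) measure)"
  proof (rule measure_eqI)
    fix A :: "('a \<times> 'a) set" assume "A \<in> sets (distr lborel borel (shear v))"
    then have A [measurable]: "A \<in> sets borel" by simp
    have A' [measurable]: "A \<in> sets (lborel \<Otimes>\<^sub>M lborel)" by (simp only: lborel_prod sets_lborel A)
    have B [measurable]: "shear v -` A \<in> sets borel"
      using measurable_sets[OF borel_measurable_shear A, of v] by simp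
    have B' [measurable]: "shear v -` A \<in> sets (lborel \<Otimes>\<^sub>M lborel)" by (simp only: lborel_prod sets_lborel B)
    have tr: "(\<integral>\<^sup>+ q. indicator A (y, q + v *\<^sub>R y) \<partial>lborel) = (\<integral>\<^sup>+ q. indicator A (y, q) \<partial>lborel)" for y
      by (rule volume_preserving_nn_integral[OF volume_preserving_translation, where f = "\<lambda>q. indicator A (y, q)"]) measurable
    have "emeasure (distr lborel borel (shear v)) A = emeasure (lborel \<Otimes>\<^sub>M lborel) (shear v -` A)"
      by (subst emeasure_distr) (auto simp: lborel_prod)
    also have "\<dots> = (\<integral>\<^sup>+ y. \<integral>\<^sup>+ q. indicator (shear v -` A) (y, q) \<partial>lborel \<partial>lborel)"
      by (rule lborel.emeasure_pair_measure[OF B'])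
    also have "\<dots> = (\<integral>\<^sup>+ y. \<integral>\<^sup>+ q. indicator A (y, q + v *\<^sub>R y) \<partial>lborel \<partial>lborel)"
      by (simp add: indicator_def shear_def)
    also have "\<dots> = (\<integral>\<^sup>+ y. \<integral>\<^sup>+ q. indicator A (y, q) \<partial>lborel \<partial>lborel)"
      unfolding tr ..
    also have "\<dots> = emeasure (lborel \<Otimes>\<^sub>M lborel) A"
      by (rule lborel.emeasure_pair_measure[OF A', symmetric])
    finally show "emeasure (distr lborel borel (shear v)) A = emeasure lborel A"
      by (simp add: lborel_prod)
  qed simp
qed

text \<open>The derivative exists in the direction of the shear only. This property survives
  multiplication by accumulated symbols along the characteristics, which smoothness need not, and it
  is what the transport operator corresponds to on the Fourier side.\<close>

definition admissible :: "('a::euclidean_space \<times> 'a \<Rightarrow> complex) \<Rightarrow> ('a \<times> 'a \<Rightarrow> complex) \<Rightarrow> bool" where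
  "admissible h h' \<longleftrightarrow> compactly_bounded h \<and> compactly_bounded h' \<and>
     (\<forall>\<xi>. ((\<lambda>v. h (shear v \<xi>)) has_vector_derivative h' \<xi>) (at 0))"

lemma admissible_derivative:
  "admissible h h' \<Longrightarrow> ((\<lambda>v. h (shear v \<xi>)) has_vector_derivative h' \<xi>) (at 0)"
  unfolding admissible_def by blast

text \<open>Shears form a one-parameter group, so the derivative at 0, known at every point, gives
  the derivative at every parameter.\<close>

lemma admissible_line_derivative:
  assumes "admissible h h'"
  shows "((\<lambda>v. h (shear v \<xi>)) has_vector_derivative h' (shear w \<xi>)) (at w)"
proof -
  have 1: "((\<lambda>v. v - w) has_vector_derivative 1) (at w)"
    by (auto intro!: derivative_eq_intros)
  have 2: "((\<lambda>v. h (shear v (shear w \<xi>))) has_vector_derivative h' (shear w \<xi>)) (at (w - w))"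
    using admissible_derivative[OF assms, of "shear w \<xi>"] by simp
  from vector_diff_chain_at[OF 1 2] show ?thesis
    by (simp add: o_def)
qed

lemma line_Lipschitz:
  fixes f :: "real \<Rightarrow> complex"
  assumes "\<And>v. v \<in> S \<Longrightarrow> (f has_vector_derivative f' v) (at v within S)" "\<And>v. v \<in> S \<Longrightarrow> norm (f' v) \<le> M" "convex S" "a \<in> S" "b \<in> S"
  shows "norm (f a - f b) \<le> M * \<bar>a - b\<bar>"
proof -
  have "norm (f a - f b) \<le> M * norm (a - b)"
  proof (rule differentiable_bound[of S f "\<lambda>v x. x *\<^sub>R f' v"])
    show "(f has_derivative (\<lambda>x. x *\<^sub>R f' v)) (at v within S)" if "v \<in> S" for v
      using assms(1)[OF that] by (simp add: has_vector_derivative_def)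
    show "onorm (\<lambda>x::real. x *\<^sub>R f' v) \<le> M" if "v \<in> S" for v
      using assms(2)[OF that] by (intro onorm_le) (simp add: mult.commute[of M] mult_left_mono)
  qed (use assms in auto)
  then show ?thesis by simp
qed

lemma has_vector_derivative_sequentially:
  fixes f :: "real \<Rightarrow> 'c::real_normed_vector"
  assumes "(f has_vector_derivative D) (at 0)" "filterlim e (at 0) sequentially"
  shows "(\<lambda>n. (1 / e n) *\<^sub>R (f (e n) - f 0)) \<longlonglongrightarrow> D"
proof -
  have "((\<lambda>v. norm (f (0 + v) - f 0 - v *\<^sub>R D) / norm v) \<longlongrightarrow> 0) (at 0)"
    using assms(1) by (simp add: has_vector_derivative_def has_derivative_at)
  from filterlim_compose[OF this assms(2)]
  have "(\<lambda>n. norm (f (e n) - f 0 - e n *\<^sub>R D) / norm (e n)) \<longlonglongrightarrow> 0" by simp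
  moreover have "\<forall>\<^sub>F n in sequentially. norm (f (e n) - f 0 - e n *\<^sub>R D) / norm (e n) = norm ((1 / e n) *\<^sub>R (f (e n) - f 0) - D)"
  proof -
    have "\<forall>\<^sub>F n in sequentially. e n \<noteq> 0" using assms(2) by (simp add: filterlim_at)
    then show ?thesis
    proof eventually_elim
      case (elim n)
      have "(1 / e n) *\<^sub>R (f (e n) - f 0) - D = (1 / e n) *\<^sub>R (f (e n) - f 0 - e n *\<^sub>R D)"
        using elim by (simp add: scaleR_diff_right)
      then show ?case by simp
    qed
  qed
  ultimately have "(\<lambda>n. norm ((1 / e n) *\<^sub>R (f (e n) - f 0) - D)) \<longlonglongrightarrow> 0"
    using tendsto_cong by force
  then show ?thesis
    by (simp add: tendsto_norm_zero_iff LIM_zero_iff)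
qed

text \<open>Translating x by v k is dual to the shear: the inner product of
  \<open>(x + v *\<^sub>R k, k)\<close> with \<open>\<xi>\<close> equals that of
  \<open>(x, k)\<close> with \<open>shear v \<xi>\<close>.\<close>

lemma synthesis_shear:
  fixes h :: "'a::euclidean_space \<times> 'a \<Rightarrow> complex"
  assumes [measurable]: "h \<in> borel_measurable borel"
  shows "synthesis h (x + v *\<^sub>R k, k) = synthesis (\<lambda>\<xi>. h (shear (- v) \<xi>)) (x, k)"
proof -
  have "synthesis h (x + v *\<^sub>R k, k) = (LINT \<xi>|lborel. iexp ((x, k) \<bullet> shear v \<xi>) * h (shear (- v) (shear v \<xi>)))"
    unfolding synthesis_def
    by (intro Bochner_Integration.integral_cong refl) (simp add: shear_def inner_prod_def inner_add_left inner_add_right add_ac)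
  also have "\<dots> = synthesis (\<lambda>\<xi>. h (shear (- v) \<xi>)) (x, k)"
    unfolding synthesis_def
    by (rule volume_preserving_integral[OF volume_preserving_shear, where f = "\<lambda>\<xi>. iexp ((x, k) \<bullet> \<xi>) * h (shear (- v) \<xi>)"]) measurable
  finally show ?thesis .
qed

text \<open>By \<open>synthesis_shear\<close>, moving in the direction \<open>(k, 0)\<close> shears
  \<open>h\<close> backwards, whence the minus sign. The derivative passes under the integral by
  dominated convergence of the difference quotients of \<open>h\<close> along the shear.\<close>

lemma transport_synthesis:
  fixes h :: "'a::euclidean_space \<times> 'a \<Rightarrow> complex"
  assumes adm: "admissible h h'"
  shows "frechet_derivative (synthesis h) (at (x, k)) (k, 0) = - synthesis h' (x, k)"
proof -
  have cb: "compactly_bounded h" "compactly_bounded h'" using adm by (auto simp: admissible_def)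
  note [measurable] = cb[THEN compactly_bounded_measurable]
  obtain M r where h: "0 < M" "0 < r" "\<And>\<xi>. norm (h \<xi>) \<le> M" "\<And>\<xi>. r < norm \<xi> \<Longrightarrow> h \<xi> = 0"
    using cb(1) by (rule compactly_boundedE) blast
  obtain M' r' where h': "0 < M'" "0 < r'" "\<And>\<xi>. norm (h' \<xi>) \<le> M'" "\<And>\<xi>. r' < norm \<xi> \<Longrightarrow> h' \<xi> = 0"
    using cb(2) by (rule compactly_boundedE) blast
  define e :: "nat \<Rightarrow> real" where "e n = inverse (real (Suc n))" for n
  have e0: "e \<longlonglongrightarrow> 0" unfolding e_def by (rule LIMSEQ_inverse_real_of_nat)
  have epos: "0 < e n" "e n \<le> 1" for n unfolding e_def by (auto simp: inverse_le_1_iff)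
  have e_at: "filterlim e (at 0) sequentially"
    using e0 epos by (auto simp: filterlim_at intro!: always_eventually) (metis less_irrefl)
  let ?q = "\<lambda>n \<xi>. (1 / e n) *\<^sub>R (h (shear (- e n) \<xi>) - h \<xi>)"
  have ih: "integrable lborel h" by (rule compactly_bounded_integrable[OF cb(1)])
  have ihs: "integrable lborel (\<lambda>\<xi>. h (shear v \<xi>))" for v
    by (rule volume_preserving_integrable[OF volume_preserving_shear ih])
  have D: "((\<lambda>v. synthesis h ((x, k) + v *\<^sub>R (k, 0))) has_vector_derivative frechet_derivative (synthesis h) (at (x, k)) (k, 0)) (at 0)"
  proof -
    have d: "((\<lambda>v::real. (x, k) + v *\<^sub>R (k, 0)) has_derivative (\<lambda>v. v *\<^sub>R (k, 0))) (at 0)"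
      by (auto intro!: derivative_eq_intros)
    have s: "smooth (synthesis h)"
      by (intro smooth_synthesis compactly_bounded_rapidly_integrable cb)
    have p: "(synthesis h has_derivative frechet_derivative (synthesis h) (at (x, k))) (at ((x, k) + 0 *\<^sub>R (k, 0)))"
      using smooth_has_derivative[OF s, of "(x, k)"] by simp
    interpret linear "frechet_derivative (synthesis h) (at (x, k))"
      by (rule linear_frechet_derivative[OF smooth_differentiable[OF s]])
    from has_derivative_compose[OF d p] show ?thesis
      unfolding has_vector_derivative_def scaleR .
  qed
  have q: "synthesis h ((x, k) + e n *\<^sub>R (k, 0)) - synthesis h (x, k)
     = (LINT \<xi>|lborel. iexp ((x, k) \<bullet> \<xi>) * (h (shear (- e n) \<xi>) - h \<xi>))" for n
    using synthesis_shear[of h x "e n" k] integrable_exp_mult(3)[OF ihs[of "- e n"], of "(x, k)"] integrable_exp_mult(3)[OF ih, of "(x, k)"]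
    by (simp add: synthesis_def right_diff_distrib)
  have lim1: "(\<lambda>n. (1 / e n) *\<^sub>R (synthesis h ((x, k) + e n *\<^sub>R (k, 0)) - synthesis h (x, k)))
      \<longlonglongrightarrow> frechet_derivative (synthesis h) (at (x, k)) (k, 0)"
    using has_vector_derivative_sequentially[OF D e_at] by simp
  have "(\<lambda>n. LINT \<xi>|lborel. iexp ((x, k) \<bullet> \<xi>) * ?q n \<xi>) \<longlonglongrightarrow>
      (LINT \<xi>|lborel. iexp ((x, k) \<bullet> \<xi>) * (- h' \<xi>))"
  \<comment> \<open>The difference quotients are bounded by \<open>M'\<close> by the mean value
    inequality; a shear of parameter at most 1 in absolute value enlarges the support by a factor of
    at most 2.\<close>
  proof (rule integral_dominated_convergence[where w = "\<lambda>\<xi>. M' * indicator (cball 0 (2 * r)) \<xi>"])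
    show "integrable lborel (\<lambda>\<xi>. M' * indicator (cball 0 (2 * r)) (\<xi> :: 'a \<times> 'a))"
      by (rule integrable_indicator_cball)
    show "AE \<xi> in lborel. (\<lambda>n. iexp ((x, k) \<bullet> \<xi>) * ?q n \<xi>)
        \<longlonglongrightarrow> iexp ((x, k) \<bullet> \<xi>) * (- h' \<xi>)"
    proof (intro always_eventually allI tendsto_mult tendsto_const)
      fix \<xi> :: "'a \<times> 'a"
      have "((\<lambda>v. h (shear v \<xi>)) has_vector_derivative h' \<xi>) (at 0)"
        by (rule admissible_derivative[OF adm])
      moreover have "filterlim (\<lambda>n. - e n) (at 0) sequentially"
        using e_at by (auto simp: filterlim_at intro!: tendsto_eq_intros)
      ultimately have "(\<lambda>n. (1 / (- e n)) *\<^sub>R (h (shear (- e n) \<xi>) - h (shear 0 \<xi>))) \<longlonglongrightarrow> h' \<xi>"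
        by (rule has_vector_derivative_sequentially)
      from tendsto_minus[OF this] show "(\<lambda>n. ?q n \<xi>) \<longlonglongrightarrow> - h' \<xi>" by simp
    qed
    show "AE \<xi> in lborel. norm (iexp ((x, k) \<bullet> \<xi>) * ?q n \<xi>) \<le> M' * indicator (cball 0 (2 * r)) \<xi>" for n
    proof (intro always_eventually allI)
      fix \<xi> :: "'a \<times> 'a"
      show "norm (iexp ((x, k) \<bullet> \<xi>) * ?q n \<xi>) \<le> M' * indicator (cball 0 (2 * r)) \<xi>"
      proof (cases "norm \<xi> \<le> 2 * r")
        case True
        have "norm (h (shear (- e n) \<xi>) - h (shear 0 \<xi>)) \<le> M' * \<bar>- e n - 0\<bar>"
          by (rule line_Lipschitz[of UNIV _ "\<lambda>v. h' (shear v \<xi>)"])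
            (auto intro: admissible_line_derivative[OF adm] h')
        then have "norm (?q n \<xi>) \<le> M'"
          unfolding norm_scaleR using epos[of n] by (simp add: field_simps)
        then show ?thesis using True by (simp add: norm_mult indicator_def)
      next
        case False
        have "norm \<xi> \<le> (1 + \<bar>- e n\<bar>) * norm (shear (- e n) \<xi>)"
          by (rule norm_le_norm_shear)
        also have "\<dots> \<le> 2 * norm (shear (- e n) \<xi>)"
          using epos[of n] by (intro mult_right_mono) auto
        finally have "r < norm (shear (- e n) \<xi>)" "r < norm \<xi>" using False h(2) by linarith+
        then show ?thesis using h(4) False by (simp add: indicator_def)
      qed
    qed
  qed measurable
  moreover have "(LINT \<xi>|lborel. iexp ((x, k) \<bullet> \<xi>) * (- h' \<xi>)) = - synthesis h' (x, k)"
    by (simp add: synthesis_def)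
  moreover have "(LINT \<xi>|lborel. iexp ((x, k) \<bullet> \<xi>) * ?q n \<xi>)
      = (1 / e n) *\<^sub>R (synthesis h ((x, k) + e n *\<^sub>R (k, 0)) - synthesis h (x, k))" for n
    unfolding q scaleR_conv_of_real integral_mult_right_zero[symmetric]
    by (intro Bochner_Integration.integral_cong refl) (simp add: mult_ac)
  ultimately have "(\<lambda>n. (1 / e n) *\<^sub>R (synthesis h ((x, k) + e n *\<^sub>R (k, 0)) - synthesis h (x, k)))
      \<longlonglongrightarrow> - synthesis h' (x, k)"
    by (simp only:)
  from LIMSEQ_unique[OF lim1 this] show ?thesis .
qed

subsection \<open>Extension of the weak formulation to synthesised test functions\<close>

lemma norm_synthesis_le:
  assumes "integrable lborel h"
  shows "norm (synthesis h z) \<le> (LINT \<xi>|lborel. norm (h \<xi>))"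
  unfolding synthesis_eq_fourier_integral by (rule norm_fourier_integral_le[OF assms])

lemma borel_measurable_synthesis [measurable]:
  assumes [measurable]: "h \<in> borel_measurable borel"
  shows "synthesis h \<in> borel_measurable borel"
  unfolding synthesis_def[abs_def] by measurable

lemma synthesis_diff:
  assumes "integrable lborel f" "integrable lborel g"
  shows "synthesis (\<lambda>\<xi>. f \<xi> - g \<xi>) z = synthesis f z - synthesis g z"
  unfolding synthesis_eq_fourier_integral by (rule fourier_integral_diff[OF assms])

lemma synthesis_cmult: "synthesis (\<lambda>\<xi>. c * h \<xi>) z = c * synthesis h z"
  unfolding synthesis_def integral_mult_right_zero[symmetric]
  by (intro Bochner_Integration.integral_cong refl) (simp add: mult_ac)

lemma synthesis_Lipschitz:
  assumes "rapidly_integrable h"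
  shows "norm (synthesis h z - synthesis h w) \<le> (LINT \<xi>|lborel. norm \<xi> * norm (h \<xi>)) * norm (z - w)"
proof -
  have ih: "integrable lborel h" by (rule rapidly_integrable_integrable[OF assms])
  note [measurable] = borel_measurable_integrable[OF ih]
  have i1: "integrable lborel (\<lambda>\<xi>. norm \<xi> * norm (h \<xi>))"
    using assms unfolding rapidly_integrable_def by (auto dest: spec[of _ "1::nat"])
  then have i: "integrable lborel (\<lambda>\<xi>. norm (z - w) * (norm \<xi> * norm (h \<xi>)))" by simp
  have le: "norm ((iexp (z \<bullet> \<xi>) - iexp (w \<bullet> \<xi>)) * h \<xi>) \<le> norm (z - w) * (norm \<xi> * norm (h \<xi>))" for \<xi>
  proof -
    have "norm (iexp (z \<bullet> \<xi>) - iexp (w \<bullet> \<xi>)) \<le> \<bar>(z - w) \<bullet> \<xi>\<bar>"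
      using norm_iexp_diff_le[of "z \<bullet> \<xi>" "w \<bullet> \<xi>"] by (simp add: inner_diff_left)
    also have "\<dots> \<le> norm (z - w) * norm \<xi>" by (rule Cauchy_Schwarz_ineq2)
    finally show ?thesis
      unfolding norm_mult mult.assoc[symmetric] by (rule mult_right_mono) simp
  qed
  have "synthesis h z - synthesis h w = (LINT \<xi>|lborel. (iexp (z \<bullet> \<xi>) - iexp (w \<bullet> \<xi>)) * h \<xi>)"
    unfolding synthesis_def left_diff_distrib
    by (rule Bochner_Integration.integral_diff[symmetric]) (auto intro: ih)
  also have "norm \<dots> \<le> (LINT \<xi>|lborel. norm (z - w) * (norm \<xi> * norm (h \<xi>)))"
  proof (rule Bochner_Integration.integral_norm_bound_integral[OF _ i])
    show "integrable lborel (\<lambda>\<xi>. (iexp (z \<bullet> \<xi>) - iexp (w \<bullet> \<xi>)) * h \<xi>)"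
      by (rule integrable_dominated[OF i _ le]) measurable
  qed (rule le)
  finally show ?thesis by (simp add: mult.commute)
qed

lemma frechet_derivative_fst_direction:
  assumes "f differentiable (at (x, k))"
  shows "frechet_derivative (\<lambda>x'. f (x', k)) (at x) v = frechet_derivative f (at (x, k)) (v, 0)"
proof -
  have 1: "((\<lambda>x'. (x', k)) has_derivative (\<lambda>v. (v, 0))) (at x)"
    by (auto intro!: derivative_eq_intros)
  have 2: "(f has_derivative frechet_derivative f (at (x, k))) (at (x, k))"
    using assms frechet_derivative_works by blast
  from has_derivative_compose[OF 1 2]
  have "((\<lambda>x'. f (x', k)) has_derivative (\<lambda>v. frechet_derivative f (at (x, k)) (v, 0))) (at x)" .
  from frechet_derivative_at[OF this] show ?thesis by metis
qed

lemma L2_norm_mono: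
  assumes "square_integrable g" "f \<in> borel_measurable borel" "\<And>z. norm (f z) \<le> norm (g z)"
  shows "L2_norm f \<le> L2_norm g"
proof -
  have f: "square_integrable f" by (rule square_integrable_dominated[OF assms])
  have "(LINT z|lborel. (norm (f z))\<^sup>2) \<le> (LINT z|lborel. (norm (g z))\<^sup>2)"
    by (intro integral_mono square_integrable_integrable_sq f assms(1) power_mono assms(3)) auto
  then show ?thesis by (simp add: L2_norm_def)
qed

lemma L2_tendsto_inner_right:
  assumes "\<And>n. square_integrable (F n)" "square_integrable f" "square_integrable g" "L2_tendsto F f"
  shows "(\<lambda>n. L2_inner g (F n)) \<longlonglongrightarrow> L2_inner g f"
  unfolding L2_inner_commute[of g] by (intro tendsto_cnj L2_tendsto_inner assms)

text \<open>Differentiation in a direction that depends linearly on the point, as in the transport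
  operators in phase space and on the Fourier side. \<open>A'\<close> is the adjoint of
  \<open>A\<close>; it makes the coefficients inner products with fixed vectors, which are
  smooth.\<close>

lemma test_function_linear_derivative:
  fixes f :: "'b::euclidean_space \<Rightarrow> complex"
  assumes "test_function f" "\<And>z b. A z \<bullet> b = z \<bullet> A' b"
  shows "test_function (\<lambda>z. frechet_derivative f (at z) (A z))"
proof -
  have "f differentiable (at z)" for z
    using assms(1) by (intro smooth_differentiable) (simp add: test_function_def)
  then have "(\<lambda>z. frechet_derivative f (at z) (A z)) = (\<lambda>z. \<Sum>b\<in>Basis. frechet_derivative f (at z) b * complex_of_real (z \<bullet> A' b))"
    by (intro ext, subst frechet_derivative_Basis_sum) (auto simp: assms(2) mult.commute)
  then show ?thesis
    by (auto intro!: test_function_sum test_function_mult test_function_frechet_derivative assms(1) smooth_inner)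
qed

context scattering_kernel
begin

text \<open>The adjoint generator seen on the Fourier side: the collision operator becomes
  multiplication by \<open>psi\<close>, the transport term becomes minus the derivative along the
  shear. That derivative is a separate argument \<open>h'\<close>, supplied by the relation
  \<open>admissible\<close>.\<close>

definition gen :: "('a \<times> 'a \<Rightarrow> complex) \<Rightarrow> ('a \<times> 'a \<Rightarrow> complex) \<Rightarrow> 'a \<times> 'a \<Rightarrow> complex" where
  "gen h h' \<xi> = complex_of_real (psi (snd \<xi>)) * h \<xi> - h' \<xi>"

lemma borel_measurable_psi_snd [measurable]:
  "(\<lambda>\<xi> :: 'a \<times> 'a. psi (snd \<xi>)) \<in> borel_measurable borel"
  by (rule borel_measurable_continuous_onI)
    (rule continuous_on_compose2[OF continuous_on_psi[of UNIV]], auto intro!: continuous_intros)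

lemma compactly_bounded_psi_mult:
  fixes h :: "'a \<times> 'a \<Rightarrow> complex"
  assumes "compactly_bounded h"
  shows "compactly_bounded (\<lambda>\<xi>. complex_of_real (psi (snd \<xi>)) * h \<xi>)"
proof (rule compactly_bounded_mult[OF assms])
  show "\<exists>C. \<forall>\<xi> :: 'a \<times> 'a. norm \<xi> \<le> r \<longrightarrow> norm (complex_of_real (psi (snd \<xi>))) \<le> C" for r
  proof (intro exI[of _ "M1 * r"] allI impI)
    fix \<xi> :: "'a \<times> 'a" assume "norm \<xi> \<le> r"
    then have "norm (snd \<xi>) \<le> r"
      using norm_snd_le[of "snd \<xi>" "fst \<xi>"] by simp
    then show "norm (complex_of_real (psi (snd \<xi>))) \<le> M1 * r"
      using order_trans[OF abs_psi_le mult_left_mono[OF _ M1_nonneg]] by simp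
  qed
qed measurable

lemma compactly_bounded_gen:
  "compactly_bounded h \<Longrightarrow> compactly_bounded h' \<Longrightarrow> compactly_bounded (gen h h')"
  unfolding gen_def[abs_def] by (intro compactly_bounded_diff compactly_bounded_psi_mult)

lemma collision_translate:
  assumes [measurable]: "\<phi> \<in> borel_measurable borel"
  shows "collision \<sigma> \<phi> k = (LINT p|lborel. complex_of_real (\<sigma> p) * (\<phi> (k + p) - \<phi> k))"
proof -
  have "collision \<sigma> \<phi> k = (LINT p|lborel. complex_of_real (\<sigma> ((p + k) - k)) * (\<phi> (p + k) - \<phi> k))"
    unfolding collision_def
    by (rule volume_preserving_integral[OF volume_preserving_translation, symmetric]) measurable
  then show ?thesis by (simp add: add.commute)
qed

text \<open>The kernel may fail to be integrable at 0, so Fubini's theorem is applied after moving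
  one factor |p| to the kernel and one factor |\<open>\<xi>\<close>| to \<open>h\<close>; the
  exponential difference divided by both factors is bounded by 1.\<close>

lemma kernel_synthesis:
  fixes h :: "'a \<times> 'a \<Rightarrow> complex"
  assumes h: "rapidly_integrable h"
  shows "(LINT p|lborel. complex_of_real (\<sigma> p) * (synthesis h (z + (0, p)) - synthesis h z))
    = synthesis (\<lambda>\<xi>. complex_of_real (psi (snd \<xi>)) * h \<xi>) z"
proof -
  have ih: "integrable lborel h" by (rule rapidly_integrable_integrable[OF h])
  note [measurable] = borel_measurable_integrable[OF ih]
  let ?e = "\<lambda>\<xi>. iexp (z \<bullet> \<xi>)"
  let ?f = "\<lambda>p. complex_of_real (norm p * \<sigma> p)"
  let ?g = "\<lambda>\<xi>. complex_of_real (norm \<xi>) * (?e \<xi> * h \<xi>)"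
  \<comment> \<open>At p = 0 or \<open>\<xi>\<close> = 0 the quotient is 0 by convention. This is
    consistent, because the exponential difference vanishes there as well.\<close>
  let ?k = "\<lambda>p \<xi> :: 'a \<times> 'a. (iexp (p \<bullet> snd \<xi>) - 1) / complex_of_real (norm p * norm \<xi>)"
  have f: "integrable lborel ?f" using first_moment by (simp only: complex_of_real_integrable_eq)
  have g: "integrable lborel ?g"
  proof -
    have "integrable lborel (\<lambda>\<xi>. norm \<xi> * norm (h \<xi>))"
      using h unfolding rapidly_integrable_def by (auto dest: spec[of _ "1::nat"])
    then show ?thesis
      by (rule integrable_dominated) (auto simp: norm_mult)
  qed
  have kle: "norm (?k p \<xi>) \<le> 1" for p \<xi>
  proof (cases "norm p * norm \<xi> = 0")
    case False
    have "norm (iexp (p \<bullet> snd \<xi>) - 1) \<le> \<bar>p \<bullet> snd \<xi>\<bar>"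
      by (rule norm_iexp_minus_1_le)
    also have "\<dots> \<le> norm p * norm (snd \<xi>)" by (rule Cauchy_Schwarz_ineq2)
    also have "\<dots> \<le> norm p * norm \<xi>"
      using norm_snd_le[of "snd \<xi>" "fst \<xi>"] by (intro mult_left_mono) auto
    finally have le: "norm (iexp (p \<bullet> snd \<xi>) - 1) \<le> norm p * norm \<xi>" .
    have "norm (?k p \<xi>) = norm (iexp (p \<bullet> snd \<xi>) - 1) / (norm p * norm \<xi>)"
      by (simp add: norm_divide norm_mult)
    also have "\<dots> \<le> 1" using le False by (simp add: divide_le_eq_1)
    finally show ?thesis .
  qed auto
  have km: "case_prod ?k \<in> borel_measurable (lborel \<Otimes>\<^sub>M lborel)"
  proof -
    have k: "(\<lambda>x :: 'a \<times> 'a \<times> 'a. iexp (fst x \<bullet> snd (snd x)) - 1) \<in> borel_measurable borel"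
      "(\<lambda>x :: 'a \<times> 'a \<times> 'a. complex_of_real (norm (fst x) * norm (snd x))) \<in> borel_measurable borel"
      by (intro borel_measurable_continuous_onI continuous_intros)+
    show ?thesis
      using borel_measurable_divide[OF k] unfolding split_beta' lborel_prod by simp
  qed
  have e1: "complex_of_real (\<sigma> p) * (synthesis h (z + (0, p)) - synthesis h z) = ?f p * (LINT \<xi>|lborel. ?g \<xi> * ?k p \<xi>)" for p
  proof (cases "p = 0")
    case False
    have "synthesis h (z + (0, p)) - synthesis h z = (LINT \<xi>|lborel. ?e \<xi> * h \<xi> * (iexp (p \<bullet> snd \<xi>) - 1))"
      unfolding synthesis_def
      by (subst Bochner_Integration.integral_diff[OF integrable_exp_mult(3)[OF ih] integrable_exp_mult(3)[OF ih], symmetric],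
          intro Bochner_Integration.integral_cong refl)
        (simp add: inner_add_left inner_prod_def algebra_simps exp_add)
    also have "\<dots> = (LINT \<xi>|lborel. complex_of_real (norm p) * (?g \<xi> * ?k p \<xi>))"
      using False by (intro Bochner_Integration.integral_cong refl) (auto simp: prod_eq_iff)
    also have "\<dots> = complex_of_real (norm p) * (LINT \<xi>|lborel. ?g \<xi> * ?k p \<xi>)"
      by (rule integral_mult_right_zero)
    finally show ?thesis by (simp add: mult_ac)
  qed (simp add: zero_prod_def[symmetric])
  have e2: "?g \<xi> * (LINT p|lborel. ?f p * ?k p \<xi>) = ?e \<xi> * (complex_of_real (psi (snd \<xi>)) * h \<xi>)" for \<xi>
  proof (cases "\<xi> = 0")
    case True then show ?thesis by (simp add: psi_0)
  next
    case False
    have "complex_of_real (norm \<xi>) * (LINT p|lborel. ?f p * ?k p \<xi>) = (LINT p|lborel. complex_of_real (norm \<xi>) * (?f p * ?k p \<xi>))"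
      by (rule integral_mult_right_zero[symmetric])
    also have "\<dots> = Psi \<sigma> (snd \<xi>)"
      unfolding Psi_def using False by (intro Bochner_Integration.integral_cong refl) auto
    also have "\<dots> = complex_of_real (psi (snd \<xi>))" by (rule Psi_eq)
    finally show ?thesis by (simp add: mult_ac)
  qed
  have "(LINT p|lborel. ?f p * (LINT \<xi>|lborel. ?g \<xi> * ?k p \<xi>)) = (LINT \<xi>|lborel. ?g \<xi> * (LINT p|lborel. ?f p * ?k p \<xi>))"
    by (rule Fubini_bounded_kernel[OF f g km kle, symmetric])
  then show ?thesis
    unfolding e1 e2 unfolding synthesis_def .
qed

section \<open>Cutoffs in phase space and their error terms\<close>

definition kernel_average :: "('a \<times> 'a \<Rightarrow> complex) \<Rightarrow> 'a \<times> 'a \<Rightarrow> real" where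
  "kernel_average \<phi> z = (LINT p|lborel. norm p * \<sigma> p * norm (\<phi> (z + (0, p))))"

lemma borel_measurable_shift_snd [measurable]:
  fixes \<phi> :: "'a \<times> 'a \<Rightarrow> complex"
  assumes "\<phi> \<in> borel_measurable borel"
  shows "(\<lambda>x. \<phi> (fst x + (0, snd x :: 'a))) \<in> borel_measurable (borel \<Otimes>\<^sub>M borel)"
proof -
  have "(\<lambda>x :: ('a \<times> 'a) \<times> 'a. fst x + (0, snd x)) \<in> borel_measurable borel"
    by (intro borel_measurable_continuous_onI continuous_intros)
  from measurable_compose[OF this assms] show ?thesis unfolding borel_prod .
qed

lemma borel_measurable_kernel_average [measurable]:
  assumes [measurable]: "\<phi> \<in> borel_measurable borel"
  shows "kernel_average \<phi> \<in> borel_measurable borel"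
proof -
  have "(\<lambda>x. norm (snd x) * \<sigma> (snd x) * norm (\<phi> (fst x + (0, snd x)))) \<in> borel_measurable (borel \<Otimes>\<^sub>M lborel)"
    by measurable
  then show ?thesis
    unfolding kernel_average_def[abs_def]
    by (intro lborel.borel_measurable_lebesgue_integral) (simp add: split_beta')
qed

text \<open>Young's inequality for the finite measure with density |p| \<open>\<sigma>\<close>: by
  Cauchy-Schwarz the square of the average is at most \<open>M1\<close> times the average of the
  squares, and translations preserve volume. The bound \<open>B\<close> makes each average a genuine
  integral.\<close>

lemma kernel_average_square_integrable:
  assumes \<phi>: "square_integrable \<phi>" and B: "\<And>z. norm (\<phi> z) \<le> B"
  shows "square_integrable (\<lambda>z. complex_of_real (kernel_average \<phi> z))"
proof -
  note [measurable] = square_integrable_measurable[OF \<phi>]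
  have [measurable]: "(\<lambda>p. \<phi> (z + (0, p))) \<in> borel_measurable borel" for z
    by (rule measurable_compose[of "\<lambda>p. z + (0, p)" borel borel])
      (auto intro!: borel_measurable_continuous_onI continuous_intros)
  \<comment> \<open>The square root of the weight goes into both factors of the Cauchy-Schwarz
    inequality.\<close>
  let ?s = "\<lambda>p. ennreal (sqrt (norm p * \<sigma> p))"
  have s2: "(?s p)\<^sup>2 = ennreal (norm p * \<sigma> p)" for p
    by (simp add: ennreal_power kernel_nonneg)
  have M1: "(\<integral>\<^sup>+ p. ennreal (norm p * \<sigma> p) \<partial>lborel) = ennreal M1"
    unfolding M1_def by (rule nn_integral_eq_integral[OF first_moment]) (simp add: kernel_nonneg)
  have int: "integrable lborel (\<lambda>p. norm p * \<sigma> p * norm (\<phi> (z + (0, p))))" for z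
    by (rule integrable_kernel_bound(1)[where C = B])
      (auto simp: abs_mult kernel_nonneg mult.commute[of B] intro!: mult_left_mono B)
  have avg: "ennreal (kernel_average \<phi> z) = (\<integral>\<^sup>+ p. ?s p * (?s p * ennreal (norm (\<phi> (z + (0, p))))) \<partial>lborel)" for z
  proof -
    have "ennreal (kernel_average \<phi> z) = (\<integral>\<^sup>+ p. ennreal (norm p * \<sigma> p * norm (\<phi> (z + (0, p)))) \<partial>lborel)"
      unfolding kernel_average_def by (rule nn_integral_eq_integral[OF int, symmetric]) (simp add: kernel_nonneg)
    also have "\<dots> = (\<integral>\<^sup>+ p. (?s p)\<^sup>2 * ennreal (norm (\<phi> (z + (0, p)))) \<partial>lborel)"
      unfolding s2 by (simp add: ennreal_mult kernel_nonneg)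
    finally show ?thesis by (simp add: power2_eq_square mult.assoc)
  qed
  have avg0: "0 \<le> kernel_average \<phi> z" for z
    unfolding kernel_average_def by (rule integral_nonneg_AE) (simp add: kernel_nonneg)
  have le: "ennreal ((kernel_average \<phi> z)\<^sup>2) \<le> ennreal M1 * (\<integral>\<^sup>+ p. ennreal (norm p * \<sigma> p) * ennreal ((norm (\<phi> (z + (0, p))))\<^sup>2) \<partial>lborel)" for z
  proof -
    have "ennreal ((kernel_average \<phi> z)\<^sup>2) = (\<integral>\<^sup>+ p. ?s p * (?s p * ennreal (norm (\<phi> (z + (0, p))))) \<partial>lborel)\<^sup>2"
      using avg0[of z] by (simp add: ennreal_power avg[symmetric])
    also have "\<dots> \<le> (\<integral>\<^sup>+ p. (?s p)\<^sup>2 \<partial>lborel) * (\<integral>\<^sup>+ p. (?s p * ennreal (norm (\<phi> (z + (0, p)))))\<^sup>2 \<partial>lborel)"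
      by (rule Cauchy_Schwarz_nn_integral) measurable
    also have "\<dots> = ennreal M1 * (\<integral>\<^sup>+ p. ennreal (norm p * \<sigma> p) * ennreal ((norm (\<phi> (z + (0, p))))\<^sup>2) \<partial>lborel)"
      unfolding power_mult_distrib s2 M1 by (simp add: ennreal_power)
    finally show ?thesis .
  qed
  have "(\<integral>\<^sup>+ z. ennreal ((kernel_average \<phi> z)\<^sup>2) \<partial>lborel)
     \<le> (\<integral>\<^sup>+ z. ennreal M1 * (\<integral>\<^sup>+ p. ennreal (norm p * \<sigma> p) * ennreal ((norm (\<phi> (z + (0, p))))\<^sup>2) \<partial>lborel) \<partial>lborel)"
    by (intro nn_integral_mono le)
  also have "\<dots> = ennreal M1 * (\<integral>\<^sup>+ z. (\<integral>\<^sup>+ p. ennreal (norm p * \<sigma> p) * ennreal ((norm (\<phi> (z + (0, p))))\<^sup>2) \<partial>lborel) \<partial>lborel)"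
  proof (rule nn_integral_cmult)
    have "(\<lambda>x. ennreal (norm (snd x) * \<sigma> (snd x)) * ennreal ((norm (\<phi> (fst x + (0, snd x))))\<^sup>2)) \<in> borel_measurable (lborel \<Otimes>\<^sub>M lborel)"
      by measurable
    then show "(\<lambda>z. \<integral>\<^sup>+ p. ennreal (norm p * \<sigma> p) * ennreal ((norm (\<phi> (z + (0, p))))\<^sup>2) \<partial>lborel) \<in> borel_measurable lborel"
      by (intro lborel.borel_measurable_nn_integral) (simp add: split_beta')
  qed
  also have "(\<integral>\<^sup>+ z. (\<integral>\<^sup>+ p. ennreal (norm p * \<sigma> p) * ennreal ((norm (\<phi> (z + (0, p))))\<^sup>2) \<partial>lborel) \<partial>lborel)
     = (\<integral>\<^sup>+ p. (\<integral>\<^sup>+ z. ennreal (norm p * \<sigma> p) * ennreal ((norm (\<phi> (z + (0, p))))\<^sup>2) \<partial>lborel) \<partial>lborel)"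
  proof (rule lborel_pair.Fubini'[symmetric])
    show "(\<lambda>(z, p). ennreal (norm p * \<sigma> p) * ennreal ((norm (\<phi> (z + (0, p))))\<^sup>2)) \<in> borel_measurable (lborel \<Otimes>\<^sub>M lborel)"
      unfolding split_beta' by measurable
  qed
  also have "\<dots> = (\<integral>\<^sup>+ p. ennreal (norm p * \<sigma> p) * sq_mass \<phi> \<partial>lborel)"
  proof (intro nn_integral_cong)
    fix p :: 'a
    have "(\<integral>\<^sup>+ z. ennreal ((norm (\<phi> (z + (0, p))))\<^sup>2) \<partial>lborel) = sq_mass \<phi>"
      by (rule volume_preserving_nn_integral[OF volume_preserving_translation]) measurable
    moreover have "(\<lambda>z. \<phi> (z + (0, p))) \<in> borel_measurable borel"
      by (rule measurable_compose[OF volume_preserving_measurable[OF volume_preserving_translation]]) measurable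
    ultimately show "(\<integral>\<^sup>+ z. ennreal (norm p * \<sigma> p) * ennreal ((norm (\<phi> (z + (0, p))))\<^sup>2) \<partial>lborel) = ennreal (norm p * \<sigma> p) * sq_mass \<phi>"
      by (simp add: nn_integral_cmult)
  qed
  also have "\<dots> = ennreal M1 * sq_mass \<phi>"
    by (subst nn_integral_multc) (auto simp: M1)
  also have "ennreal M1 * (ennreal M1 * sq_mass \<phi>) < \<infinity>"
    using \<phi> by (auto simp: square_integrable_iff_sq_mass ennreal_mult_less_top)
  finally show ?thesis
    unfolding square_integrable_iff_sq_mass by simp
qed


abbreviation cut :: "'a \<times> 'a \<Rightarrow> complex" where
  "cut z \<equiv> complex_of_real (bump z)"

lemma test_function_cut: "test_function cut" and smooth_cut: "smooth cut"
  using test_function_bump[of 1 0] by (auto simp: test_function_def)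

lemma norm_cut_le: "norm (cut z) \<le> 1"
  using bump_le_1[of z] bump_nonneg[of z] by simp

lemma borel_measurable_cut [measurable]: "bump \<in> borel_measurable (borel :: ('a \<times> 'a) measure)"
  using borel_measurable_complex_iff[of cut borel] smooth_borel_measurable[OF smooth_cut] by simp

text \<open>The commutator of the collision operator with the dilated cutoff. With
  \<open>\<phi>\<close> taken at the shifted point, the product rule for differences holds without
  remainder.\<close>

definition cut_commutator :: "real \<Rightarrow> ('a \<times> 'a \<Rightarrow> complex) \<Rightarrow> 'a \<times> 'a \<Rightarrow> complex" where
  "cut_commutator s \<phi> z =
     (LINT p|lborel. complex_of_real (\<sigma> p) * ((cut (s *\<^sub>R (z + (0, p))) - cut (s *\<^sub>R z)) * \<phi> (z + (0, p))))"

text \<open>The transport operator applied to the undilated cutoff. Applied to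
  \<open>cut (s *\<^sub>R z)\<close> it gives \<open>cut_transport (s *\<^sub>R z)\<close>, since
  the inner derivative s turns k into the second component of the dilated point. So this error is
  bounded uniformly in s, although k is unbounded.\<close>

definition cut_transport :: "'a \<times> 'a \<Rightarrow> complex" where
  "cut_transport z = frechet_derivative cut (at z) (snd z, 0)"

lemma test_function_cut_transport: "test_function cut_transport"
  unfolding cut_transport_def[abs_def]
  by (rule test_function_linear_derivative[OF test_function_cut, where A' = "\<lambda>b. (0, fst b)"])
    (simp add: inner_prod_def)

lemma adjoint_generator_cut:
  assumes adm: "admissible h h'"
  shows "adjoint_generator \<sigma> (\<lambda>z. cut (s *\<^sub>R z) * synthesis h z) z =
    cut (s *\<^sub>R z) * synthesis (gen h h') z + cut_transport (s *\<^sub>R z) * synthesis h z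
      + cut_commutator s (synthesis h) z"
proof -
  obtain x k where z: "z = (x, k)" by (cases z)
  have cb: "compactly_bounded h" "compactly_bounded h'" using adm by (auto simp: admissible_def)
  have rh: "rapidly_integrable h" by (rule compactly_bounded_rapidly_integrable[OF cb(1)])
  have sm: "smooth (synthesis h)" by (rule smooth_synthesis[OF rh])
  let ?\<phi> = "synthesis h"
  let ?f = "\<lambda>z. cut (s *\<^sub>R z) * ?\<phi> z"
  have d1: "((\<lambda>z. cut (s *\<^sub>R z)) has_derivative (\<lambda>v. frechet_derivative cut (at (s *\<^sub>R z)) (s *\<^sub>R v))) (at z)"
    by (rule has_derivative_compose[OF _ smooth_has_derivative[OF smooth_cut]]) (auto intro!: derivative_eq_intros)
  have d: "(?f has_derivative (\<lambda>v. cut (s *\<^sub>R z) * frechet_derivative ?\<phi> (at z) v + frechet_derivative cut (at (s *\<^sub>R z)) (s *\<^sub>R v) * ?\<phi> z)) (at z)"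
    by (rule has_derivative_mult[OF d1 smooth_has_derivative[OF sm]])
  then have "?f differentiable (at z)" unfolding differentiable_def by blast
  then have "frechet_derivative (\<lambda>x'. ?f (x', k)) (at x) k = frechet_derivative ?f (at z) (k, 0)"
    unfolding z by (rule frechet_derivative_fst_direction)
  also have "\<dots> = cut (s *\<^sub>R z) * frechet_derivative ?\<phi> (at z) (k, 0) + frechet_derivative cut (at (s *\<^sub>R z)) (s *\<^sub>R (k, 0)) * ?\<phi> z"
    unfolding frechet_derivative_at[OF d, symmetric] ..
  also have "\<dots> = - (cut (s *\<^sub>R z) * synthesis h' z) + cut_transport (s *\<^sub>R z) * ?\<phi> z"
    using transport_synthesis[OF adm, of x k] by (simp add: z cut_transport_def)
  finally have transport: "frechet_derivative (\<lambda>x'. ?f (x', k)) (at x) k = - (cut (s *\<^sub>R z) * synthesis h' z) + cut_transport (s *\<^sub>R z) * ?\<phi> z" .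
  have \<phi>m [measurable]: "?\<phi> \<in> borel_measurable borel" by (rule smooth_borel_measurable[OF sm])
  have shift: "(\<lambda>p. g (z + (0, p))) \<in> borel_measurable borel" if "g \<in> borel_measurable borel" for g :: "'a \<times> 'a \<Rightarrow> complex"
    by (rule measurable_compose[OF _ that, of "\<lambda>p. z + (0, p)"]) (auto intro!: borel_measurable_continuous_onI continuous_intros)
  have [measurable]: "(\<lambda>p. ?\<phi> (z + (0, p))) \<in> borel_measurable borel" by (rule shift[OF \<phi>m])
  have cm: "(\<lambda>z. cut (s *\<^sub>R z)) \<in> borel_measurable borel" by measurable
  have [measurable]: "(\<lambda>p. cut (s *\<^sub>R (z + (0, p)))) \<in> borel_measurable borel" by (rule shift[OF cm])
  have "(\<lambda>k'. (x, k')) \<in> borel_measurable borel" by (intro borel_measurable_continuous_onI continuous_intros)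
  from measurable_compose[OF this, of ?f borel] have "(\<lambda>k'. ?f (x, k')) \<in> borel_measurable borel" by measurable
  from collision_translate[OF this, of k]
  have "collision \<sigma> (\<lambda>k'. ?f (x, k')) k = (LINT p|lborel. complex_of_real (\<sigma> p) * (?f (z + (0, p)) - ?f z))"
    by (simp add: z)
  also have "\<dots> = (LINT p|lborel. cut (s *\<^sub>R z) * (complex_of_real (\<sigma> p) * (?\<phi> (z + (0, p)) - ?\<phi> z))
      + complex_of_real (\<sigma> p) * ((cut (s *\<^sub>R (z + (0, p))) - cut (s *\<^sub>R z)) * ?\<phi> (z + (0, p))))"
    by (intro Bochner_Integration.integral_cong refl) (simp add: algebra_simps)
  also have "\<dots> = cut (s *\<^sub>R z) * synthesis (\<lambda>\<xi>. complex_of_real (psi (snd \<xi>)) * h \<xi>) z + cut_commutator s ?\<phi> z"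
  proof (subst Bochner_Integration.integral_add)
    let ?B1 = "LINT \<xi>|lborel. norm \<xi> * norm (h \<xi>)" and ?B0 = "LINT \<xi>|lborel. norm (h \<xi>)"
    have "norm (complex_of_real (\<sigma> p) * (?\<phi> (z + (0, p)) - ?\<phi> z)) \<le> ?B1 * (norm p * \<sigma> p)" for p
    proof -
      have "norm (?\<phi> (z + (0, p)) - ?\<phi> z) \<le> ?B1 * norm p"
        using synthesis_Lipschitz[OF rh, of "z + (0, p)" z] by (simp add: norm_Pair)
      from mult_left_mono[OF this kernel_nonneg[of p]] show ?thesis
        by (simp add: norm_mult kernel_nonneg mult_ac)
    qed
    then show "integrable lborel (\<lambda>p. cut (s *\<^sub>R z) * (complex_of_real (\<sigma> p) * (?\<phi> (z + (0, p)) - ?\<phi> z)))"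
      by (intro integrable_mult_right integrable_kernel_bound(1)[where C = ?B1]) measurable
    obtain L where L: "0 < L" "\<And>z w. norm (cut z - cut w) \<le> L * norm (z - w)"
      using test_function_derivative_bounded[OF test_function_cut] by blast
    have "norm (complex_of_real (\<sigma> p) * ((cut (s *\<^sub>R (z + (0, p))) - cut (s *\<^sub>R z)) * ?\<phi> (z + (0, p)))) \<le> (L * \<bar>s\<bar> * ?B0) * (norm p * \<sigma> p)" for p
    proof -
      have "norm (cut (s *\<^sub>R (z + (0, p))) - cut (s *\<^sub>R z)) \<le> L * (\<bar>s\<bar> * norm p)"
        using L(2)[of "s *\<^sub>R (z + (0, p))" "s *\<^sub>R z"] by (simp add: norm_Pair flip: scaleR_diff_right)
      moreover have "norm (?\<phi> (z + (0, p))) \<le> ?B0"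
        by (rule norm_synthesis_le[OF rapidly_integrable_integrable[OF rh]])
      ultimately have "norm (cut (s *\<^sub>R (z + (0, p))) - cut (s *\<^sub>R z)) * norm (?\<phi> (z + (0, p))) \<le> (L * (\<bar>s\<bar> * norm p)) * ?B0"
        using L(1) by (intro mult_mono) auto
      from mult_left_mono[OF this kernel_nonneg[of p]] show ?thesis
        by (simp add: norm_mult kernel_nonneg mult_ac)
    qed
    then show "integrable lborel (\<lambda>p. complex_of_real (\<sigma> p) * ((cut (s *\<^sub>R (z + (0, p))) - cut (s *\<^sub>R z)) * ?\<phi> (z + (0, p))))"
      by (intro integrable_kernel_bound(1)[where C = "L * \<bar>s\<bar> * ?B0"]) measurable
    show "(LINT p|lborel. cut (s *\<^sub>R z) * (complex_of_real (\<sigma> p) * (?\<phi> (z + (0, p)) - ?\<phi> z)))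
       + (LINT p|lborel. complex_of_real (\<sigma> p) * ((cut (s *\<^sub>R (z + (0, p))) - cut (s *\<^sub>R z)) * ?\<phi> (z + (0, p))))
       = cut (s *\<^sub>R z) * synthesis (\<lambda>\<xi>. complex_of_real (psi (snd \<xi>)) * h \<xi>) z + cut_commutator s ?\<phi> z"
      unfolding integral_mult_right_zero kernel_synthesis[OF rh] cut_commutator_def ..
  qed
  finally have coll: "collision \<sigma> (\<lambda>k'. ?f (x, k')) k = cut (s *\<^sub>R z) * synthesis (\<lambda>\<xi>. complex_of_real (psi (snd \<xi>)) * h \<xi>) z + cut_commutator s ?\<phi> z" .
  have g: "synthesis (gen h h') z = synthesis (\<lambda>\<xi>. complex_of_real (psi (snd \<xi>)) * h \<xi>) z - synthesis h' z"
    unfolding gen_def[abs_def]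
    by (intro synthesis_diff compactly_bounded_integrable compactly_bounded_psi_mult cb)
  have "adjoint_generator \<sigma> ?f z = frechet_derivative (\<lambda>x'. ?f (x', k)) (at x) k + collision \<sigma> (\<lambda>k'. ?f (x, k')) k"
    unfolding adjoint_generator_def z prod.case ..
  then show ?thesis
    unfolding transport coll g by (simp add: algebra_simps)
qed

text \<open>The Lipschitz bound of the dilated cutoff contributes s |p|: the factor s makes the
  commutator vanish in the limit, and |p| tames the singularity of the kernel.\<close>

lemma norm_cut_commutator_le:
  assumes L: "0 \<le> L" "\<And>z w. norm (cut z - cut w) \<le> L * norm (z - w)"
    and \<phi>: "\<And>z. norm (\<phi> z) \<le> B" "\<phi> \<in> borel_measurable borel"
  shows "norm (cut_commutator s \<phi> z) \<le> L * \<bar>s\<bar> * kernel_average \<phi> z"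
    and "kernel_average \<phi> z \<le> B * M1"
proof -
  have [measurable]: "(\<lambda>p. \<phi> (z + (0, p))) \<in> borel_measurable borel"
    by (rule measurable_compose[OF _ \<phi>(2), of "\<lambda>p. z + (0, p)"]) (auto intro!: borel_measurable_continuous_onI continuous_intros)
  have [measurable]: "(\<lambda>p. bump (s *\<^sub>R (z + (0, p)))) \<in> borel_measurable borel"
    by (rule measurable_compose[OF _ borel_measurable_cut, of "\<lambda>p. s *\<^sub>R (z + (0, p))"]) (auto intro!: borel_measurable_continuous_onI continuous_intros)
  have le: "norm (norm p * \<sigma> p * norm (\<phi> (z + (0, p)))) \<le> B * (norm p * \<sigma> p)" for p
    by (auto simp: abs_mult kernel_nonneg mult.commute[of B] intro!: mult_left_mono \<phi>)
  have i: "integrable lborel (\<lambda>p. norm p * \<sigma> p * norm (\<phi> (z + (0, p))))"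
    by (rule integrable_kernel_bound(1)[OF _ le]) measurable
  have "norm (kernel_average \<phi> z) \<le> B * M1"
    unfolding kernel_average_def by (rule integrable_kernel_bound(2)[OF _ le]) measurable
  then show "kernel_average \<phi> z \<le> B * M1" by simp
  have le': "norm (complex_of_real (\<sigma> p) * ((cut (s *\<^sub>R (z + (0, p))) - cut (s *\<^sub>R z)) * \<phi> (z + (0, p)))) \<le> L * \<bar>s\<bar> * (norm p * \<sigma> p * norm (\<phi> (z + (0, p))))" for p
  proof -
    have "norm (cut (s *\<^sub>R (z + (0, p))) - cut (s *\<^sub>R z)) \<le> L * (\<bar>s\<bar> * norm p)"
      using L(2)[of "s *\<^sub>R (z + (0, p))" "s *\<^sub>R z"] by (simp add: norm_Pair flip: scaleR_diff_right)
    from mult_right_mono[OF this, of "\<sigma> p * norm (\<phi> (z + (0, p)))"] show ?thesis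
      by (simp add: norm_mult kernel_nonneg mult_ac)
  qed
  have i': "integrable lborel (\<lambda>p. L * \<bar>s\<bar> * (norm p * \<sigma> p * norm (\<phi> (z + (0, p)))))" using i by simp
  have "norm (cut_commutator s \<phi> z) \<le> (LINT p|lborel. L * \<bar>s\<bar> * (norm p * \<sigma> p * norm (\<phi> (z + (0, p)))))"
    unfolding cut_commutator_def
  proof (rule Bochner_Integration.integral_norm_bound_integral[OF _ i' le'])
    show "integrable lborel (\<lambda>p. complex_of_real (\<sigma> p) * ((cut (s *\<^sub>R (z + (0, p))) - cut (s *\<^sub>R z)) * \<phi> (z + (0, p))))"
      by (rule integrable_dominated[OF i' _ le']) measurable
  qed
  then show "norm (cut_commutator s \<phi> z) \<le> L * \<bar>s\<bar> * kernel_average \<phi> z"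
    by (simp add: kernel_average_def)
qed

lemma borel_measurable_cut_commutator:
  assumes [measurable]: "\<phi> \<in> borel_measurable borel"
  shows "cut_commutator s \<phi> \<in> borel_measurable borel"
proof -
  have [measurable]: "(\<lambda>x. cut (s *\<^sub>R (fst x + (0, snd x)))) \<in> borel_measurable (borel \<Otimes>\<^sub>M borel)"
    by (rule borel_measurable_shift_snd[of "\<lambda>z. cut (s *\<^sub>R z)"]) measurable
  have "(\<lambda>x. complex_of_real (\<sigma> (snd x)) * ((cut (s *\<^sub>R (fst x + (0, snd x))) - cut (s *\<^sub>R fst x)) * \<phi> (fst x + (0, snd x)))) \<in> borel_measurable (borel \<Otimes>\<^sub>M lborel)"
    by measurable
  then show ?thesis
    unfolding cut_commutator_def[abs_def]
    by (intro lborel.borel_measurable_lebesgue_integral) (simp add: split_beta')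
qed

text \<open>A synthesis is smooth but not of compact support, so it is tested through dilated
  cutoffs. Their errors tend to 0 pointwise under a common square-integrable majorant, hence in the
  mean; the uniform bound on \<open>W\<close> then allows passing to the limit under the time
  integral.\<close>

theorem extended_weak_formulation:
  assumes adm: "admissible h h'" and ws: "weak_solution \<sigma> W0 W" and W0: "square_integrable W0"
    and bounded: "\<forall>t\<ge>0. L2_norm (W t) \<le> C" and T: "0 \<le> T"
  shows "set_integrable lborel {0..T} (\<lambda>s. L2_inner (W s) (synthesis (gen h h')))"
    and "L2_inner (W T) (synthesis h) - L2_inner W0 (synthesis h) = (LINT s:{0..T}|lborel. L2_inner (W s) (synthesis (gen h h')))"
proof -
  have cb: "compactly_bounded h" "compactly_bounded h'" using adm by (auto simp: admissible_def)
  have bd: "L2_norm (W t) \<le> C" if "0 \<le> t" for t using bounded that by blast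
  have cbg: "compactly_bounded (gen h h')" by (rule compactly_bounded_gen[OF cb])
  have rh: "rapidly_integrable h" by (rule compactly_bounded_rapidly_integrable[OF cb(1)])
  have sm: "smooth (synthesis h)" by (rule smooth_synthesis[OF rh])
  let ?\<phi> = "synthesis h" and ?g = "synthesis (gen h h')"
  have \<phi>2: "square_integrable ?\<phi>" and g2: "square_integrable ?g"
    by (intro synthesis_L2 compactly_bounded_integrable compactly_bounded_square_integrable cb cbg)+
  note [measurable] = square_integrable_measurable[OF \<phi>2] square_integrable_measurable[OF g2]
  have W: "square_integrable (W t)" if "0 \<le> t" for t
    using ws that by (simp add: weak_solution_def)
  obtain L where L: "0 < L" "\<And>z w. norm (cut z - cut w) \<le> L * norm (z - w)"
      "\<And>z v. norm (frechet_derivative cut (at z) v) \<le> L * norm v"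
    using test_function_derivative_bounded[OF test_function_cut] by blast
  obtain E where E: "0 < E" "\<And>z. norm (cut_transport z) \<le> E"
    using test_function_bounded[OF test_function_cut_transport] by blast
  define B where "B = (LINT \<xi>|lborel. norm (h \<xi>))"
  have B: "norm (?\<phi> z) \<le> B" for z
    unfolding B_def by (rule norm_synthesis_le[OF rapidly_integrable_integrable[OF rh]])
  note comm = norm_cut_commutator_le[of L ?\<phi> B, OF less_imp_le[OF L(1)] L(2) B square_integrable_measurable[OF \<phi>2]]
  define s :: "nat \<Rightarrow> real" where "s n = inverse (real (Suc n))" for n
  have s0: "s \<longlonglongrightarrow> 0" unfolding s_def by (rule LIMSEQ_inverse_real_of_nat)
  have spos: "0 < s n" "s n \<le> 1" for n unfolding s_def by (auto simp: inverse_le_1_iff)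
  \<comment> \<open>The cutoff is not normalised to 1 at the origin, so this positive constant
    appears in every limit and is divided out at the end.\<close>
  let ?c = "complex_of_real (bump (0 :: 'a \<times> 'a))"
  define \<theta> where "\<theta> n z = cut (s n *\<^sub>R z) * ?\<phi> z" for n z
  define A where "A n z = cut (s n *\<^sub>R z) * ?g z + cut_transport (s n *\<^sub>R z) * ?\<phi> z + cut_commutator (s n) ?\<phi> z" for n z
  have A: "adjoint_generator \<sigma> (\<theta> n) = A n" for n
    unfolding \<theta>_def[abs_def] A_def[abs_def] by (intro ext adjoint_generator_cut adm)
  have \<theta>: "test_function (\<theta> n)" for n
    unfolding \<theta>_def[abs_def] using test_function_bump[of "s n" 0] spos[of n]
    by (intro test_function_mult sm) auto
  have [measurable]: "cut_transport \<in> borel_measurable borel"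
    using test_function_cut_transport by (intro smooth_borel_measurable) (simp add: test_function_def)
  have Am [measurable]: "A n \<in> borel_measurable borel" for n
    unfolding A_def[abs_def] using borel_measurable_cut_commutator[of ?\<phi> "s n"] by measurable
  have cut_lim: "(\<lambda>n. cut (s n *\<^sub>R z)) \<longlonglongrightarrow> ?c" for z
  proof -
    have "isCont cut (0 *\<^sub>R z)"
      by (rule has_derivative_continuous[OF smooth_has_derivative[OF smooth_cut]])
    moreover have "(\<lambda>n. s n *\<^sub>R z) \<longlonglongrightarrow> 0 *\<^sub>R z" by (intro tendsto_intros s0)
    ultimately show ?thesis using isCont_tendsto_compose by fastforce
  qed
  have transp_lim: "(\<lambda>n. cut_transport (s n *\<^sub>R z)) \<longlonglongrightarrow> 0" for z
  proof (rule Lim_null_comparison[OF always_eventually])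
    show "\<forall>n. norm (cut_transport (s n *\<^sub>R z)) \<le> L * (s n * norm z)"
    proof
      fix n
      have "norm (cut_transport (s n *\<^sub>R z)) \<le> L * norm (s n *\<^sub>R snd z, 0 :: 'a)"
        unfolding cut_transport_def snd_scaleR by (rule L(3))
      also have "\<dots> = L * (s n * norm (snd z))" using spos[of n] by (simp add: norm_Pair)
      also have "\<dots> \<le> L * (s n * norm z)"
        using L(1) spos[of n] norm_snd_le[of "snd z" "fst z"] by (intro mult_left_mono) auto
      finally show "norm (cut_transport (s n *\<^sub>R z)) \<le> L * (s n * norm z)" .
    qed
    show "(\<lambda>n. L * (s n * norm z)) \<longlonglongrightarrow> 0"
      by (intro tendsto_mult_right_zero tendsto_mult_left_zero s0)
  qed
  have comm_lim: "(\<lambda>n. cut_commutator (s n) ?\<phi> z) \<longlonglongrightarrow> 0" for z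
  proof (rule Lim_null_comparison[OF always_eventually])
    show "\<forall>n. norm (cut_commutator (s n) ?\<phi> z) \<le> L * s n * kernel_average ?\<phi> z"
      using comm(1)[of "s _" z] spos by (auto simp: less_imp_le abs_of_pos)
    show "(\<lambda>n. L * s n * kernel_average ?\<phi> z) \<longlonglongrightarrow> 0"
      by (intro tendsto_mult_left_zero tendsto_mult_right_zero s0)
  qed
  have A_lim: "(\<lambda>n. A n z) \<longlonglongrightarrow> ?c * ?g z" for z
  proof -
    have "(\<lambda>n. A n z) \<longlonglongrightarrow> ?c * ?g z + 0 * ?\<phi> z + 0"
      unfolding A_def by (intro tendsto_add tendsto_mult cut_lim transp_lim comm_lim tendsto_const)
    then show ?thesis by simp
  qed
  have avg0: "0 \<le> kernel_average ?\<phi> z" for z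
    unfolding kernel_average_def by (rule integral_nonneg_AE) (simp add: kernel_nonneg)
  \<comment> \<open>A majorant for all n at once, because the dilation parameters are at most 1. It
    is complex-valued only to fit \<open>square_integrable\<close>.\<close>
  define D where "D z = complex_of_real (norm (?g z)) + (complex_of_real E * complex_of_real (norm (?\<phi> z)) + complex_of_real L * complex_of_real (kernel_average ?\<phi> z))" for z
  have D2: "square_integrable D"
    unfolding D_def[abs_def]
    by (intro square_integrable_add square_integrable_cmult square_integrable_norm g2 \<phi>2 kernel_average_square_integrable[OF \<phi>2 B])
  have normD: "norm (D z) = norm (?g z) + (E * norm (?\<phi> z) + L * kernel_average ?\<phi> z)" for z
  proof -
    have "D z = complex_of_real (norm (?g z) + (E * norm (?\<phi> z) + L * kernel_average ?\<phi> z))"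
      by (simp add: D_def)
    also have "norm \<dots> = norm (?g z) + (E * norm (?\<phi> z) + L * kernel_average ?\<phi> z)"
      unfolding norm_of_real using E(1) L(1) avg0[of z] by (intro abs_of_nonneg) auto
    finally show ?thesis .
  qed
  have rest: "norm (cut_transport (s n *\<^sub>R z) * ?\<phi> z + cut_commutator (s n) ?\<phi> z) \<le> E * norm (?\<phi> z) + L * kernel_average ?\<phi> z" for n z
  proof (rule order_trans[OF norm_triangle_ineq add_mono])
    show "norm (cut_transport (s n *\<^sub>R z) * ?\<phi> z) \<le> E * norm (?\<phi> z)"
      unfolding norm_mult by (intro mult_right_mono E) auto
    have "norm (cut_commutator (s n) ?\<phi> z) \<le> L * \<bar>s n\<bar> * kernel_average ?\<phi> z" by (rule comm(1))
    also have "\<dots> \<le> L * 1 * kernel_average ?\<phi> z"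
      using spos[of n] L(1) avg0[of z] by (intro mult_right_mono mult_left_mono) auto
    finally show "norm (cut_commutator (s n) ?\<phi> z) \<le> L * kernel_average ?\<phi> z" by simp
  qed
  have A_le: "norm (A n z) \<le> norm (D z)" for n z
  proof -
    have "norm (A n z) \<le> norm (cut (s n *\<^sub>R z) * ?g z) + norm (cut_transport (s n *\<^sub>R z) * ?\<phi> z + cut_commutator (s n) ?\<phi> z)"
      unfolding A_def add.assoc by (rule norm_triangle_ineq)
    also have "norm (cut (s n *\<^sub>R z) * ?g z) \<le> 1 * norm (?g z)"
      unfolding norm_mult by (intro mult_right_mono norm_cut_le) auto
    finally show ?thesis using rest[of n z] by (simp add: normD)
  qed
  have Ad_le: "norm (A n z - ?c * ?g z) \<le> norm (D z)" for n z
  proof -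
    have "A n z - ?c * ?g z = (cut (s n *\<^sub>R z) - ?c) * ?g z + (cut_transport (s n *\<^sub>R z) * ?\<phi> z + cut_commutator (s n) ?\<phi> z)"
      unfolding A_def by (simp add: algebra_simps)
    also have "norm \<dots> \<le> norm ((cut (s n *\<^sub>R z) - ?c) * ?g z) + norm (cut_transport (s n *\<^sub>R z) * ?\<phi> z + cut_commutator (s n) ?\<phi> z)"
      by (rule norm_triangle_ineq)
    also have "norm ((cut (s n *\<^sub>R z) - ?c) * ?g z) \<le> 1 * norm (?g z)"
    proof -
      have "norm (cut (s n *\<^sub>R z) - ?c) = \<bar>bump (s n *\<^sub>R z) - bump (0 :: 'a \<times> 'a)\<bar>"
        by (metis norm_of_real of_real_diff)
      also have "\<dots> \<le> 1"
        using bump_nonneg[of "s n *\<^sub>R z"] bump_le_1[of "s n *\<^sub>R z"] bump_nonneg[of "0 :: 'a \<times> 'a"] bump_le_1[of "0 :: 'a \<times> 'a"] by linarith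
      finally show ?thesis unfolding norm_mult by (intro mult_right_mono) auto
    qed
    finally show ?thesis using rest[of n z] by (simp add: normD)
  qed
  have A2: "square_integrable (A n)" for n
    by (rule square_integrable_dominated[OF D2 Am A_le])
  have cg2: "square_integrable (\<lambda>z. ?c * ?g z)" by (intro square_integrable_cmult g2)
  have A_L2: "L2_tendsto A (\<lambda>z. ?c * ?g z)"
    by (rule L2_tendsto_dominated[OF Am _ D2 Ad_le A_lim]) measurable
  have \<theta>2: "square_integrable (\<theta> n)" for n by (rule test_function_integrable[OF \<theta>])
  have \<theta>_L2: "L2_tendsto \<theta> (\<lambda>z. ?c * ?\<phi> z)"
  proof (rule L2_tendsto_dominated[OF _ _ \<phi>2])
    show "\<theta> n \<in> borel_measurable borel" for n by (rule square_integrable_measurable[OF \<theta>2])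
    show "(\<lambda>z. ?c * ?\<phi> z) \<in> borel_measurable borel" by measurable
    show "(\<lambda>n. \<theta> n z) \<longlonglongrightarrow> ?c * ?\<phi> z" for z
      unfolding \<theta>_def by (intro tendsto_mult cut_lim tendsto_const)
    show "norm (\<theta> n z - ?c * ?\<phi> z) \<le> norm (?\<phi> z)" for n z
    proof -
      have "norm (cut (s n *\<^sub>R z) - ?c) = \<bar>bump (s n *\<^sub>R z) - bump (0 :: 'a \<times> 'a)\<bar>"
        by (metis norm_of_real of_real_diff)
      also have "\<dots> \<le> 1"
        using bump_nonneg[of "s n *\<^sub>R z"] bump_le_1[of "s n *\<^sub>R z"] bump_nonneg[of "0 :: 'a \<times> 'a"] bump_le_1[of "0 :: 'a \<times> 'a"] by linarith
      finally have "norm ((cut (s n *\<^sub>R z) - ?c) * ?\<phi> z) \<le> 1 * norm (?\<phi> z)"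
        unfolding norm_mult by (intro mult_right_mono) auto
      then show ?thesis by (simp add: \<theta>_def left_diff_distrib)
    qed
  qed
  have weak: "set_integrable lborel {0..T} (\<lambda>r. L2_inner (W r) (A n))"
    "L2_inner (W T) (\<theta> n) - L2_inner W0 (\<theta> n) = (LINT r:{0..T}|lborel. L2_inner (W r) (A n))" for n
    using ws \<theta>[of n] T unfolding weak_solution_def A[symmetric] by (auto simp: algebra_simps)
  let ?i = "\<lambda>r. indicator {0..T} r :: real"
  have lim_r: "(\<lambda>n. ?i r *\<^sub>R L2_inner (W r) (A n)) \<longlonglongrightarrow> ?i r *\<^sub>R L2_inner (W r) (\<lambda>z. ?c * ?g z)" for r
  proof (cases "0 \<le> r")
    case True
    then show ?thesis
      by (intro tendsto_scaleR tendsto_const L2_tendsto_inner_right A2 cg2 W A_L2)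
  qed simp
  have meas_n [measurable]: "(\<lambda>r. ?i r *\<^sub>R L2_inner (W r) (A n)) \<in> borel_measurable lborel" for n
    using weak(1)[of n] unfolding set_integrable_def by (rule borel_measurable_integrable)
  \<comment> \<open>No measurability of \<open>W\<close> in time is assumed beyond the weak
    formulation; for the new pairing it comes from being a pointwise limit of pairings covered
    there.\<close>
  have meas [measurable]: "(\<lambda>r. ?i r *\<^sub>R L2_inner (W r) (\<lambda>z. ?c * ?g z)) \<in> borel_measurable lborel"
    by (rule borel_measurable_LIMSEQ_metric[OF meas_n lim_r])
  have bound: "norm (?i r *\<^sub>R L2_inner (W r) (A n)) \<le> C * L2_norm D * ?i r" for r n
  proof (cases "r \<in> {0..T}")
    case True
    then have r: "0 \<le> r" by simp
    have "norm (L2_inner (W r) (A n)) \<le> L2_norm (W r) * L2_norm (A n)"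
      by (intro Cauchy_Schwarz_L2_inner W r A2)
    also have "\<dots> \<le> C * L2_norm D"
      using bd[OF r] order_trans[OF L2_norm_nonneg bd[OF r]]
      by (intro mult_mono L2_norm_mono[OF D2 Am A_le]) auto
    finally show ?thesis using True by simp
  qed simp
  have iC: "integrable lborel (\<lambda>r. C * L2_norm D * ?i r)"
    using emeasure_lborel_cbox_finite[of 0 T] by (intro integrable_mult_right integrable_real_indicator) auto
  have dc1: "integrable lborel (\<lambda>r. ?i r *\<^sub>R L2_inner (W r) (\<lambda>z. ?c * ?g z))"
    by (rule integrable_dominated_convergence[OF meas meas_n iC always_eventually[OF allI[OF lim_r]] always_eventually[OF allI[OF bound]]])
  have dc2: "(\<lambda>n. LINT r|lborel. ?i r *\<^sub>R L2_inner (W r) (A n)) \<longlonglongrightarrow> (LINT r|lborel. ?i r *\<^sub>R L2_inner (W r) (\<lambda>z. ?c * ?g z))"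
    by (rule integral_dominated_convergence[OF meas meas_n iC always_eventually[OF allI[OF lim_r]] always_eventually[OF allI[OF bound]]])
  have "0 < bump (0 :: 'a \<times> 'a)" by (rule bump_0_pos)
  then have c0: "?c \<noteq> 0" by simp
  have pull: "?i r *\<^sub>R L2_inner (W r) (\<lambda>z. ?c * ?g z) = ?c * (?i r *\<^sub>R L2_inner (W r) ?g)" for r
    by (simp add: L2_inner_cmult_right)
  show si: "set_integrable lborel {0..T} (\<lambda>s. L2_inner (W s) ?g)"
  proof -
    have "inverse ?c * (?c * x) = x" for x
      by (simp only: mult.assoc[symmetric] left_inverse[OF c0] mult_1_left)
    with integrable_mult_right[OF dc1[unfolded pull], of "inverse ?c"] show ?thesis
      unfolding set_integrable_def by (simp only:)
  qed
  have "(\<lambda>n. L2_inner (W T) (\<theta> n) - L2_inner W0 (\<theta> n)) \<longlonglongrightarrow> L2_inner (W T) (\<lambda>z. ?c * ?\<phi> z) - L2_inner W0 (\<lambda>z. ?c * ?\<phi> z)"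
    by (intro tendsto_diff L2_tendsto_inner_right \<theta>2 square_integrable_cmult \<phi>2 W T W0 \<theta>_L2)
  moreover have "(\<lambda>n. L2_inner (W T) (\<theta> n) - L2_inner W0 (\<theta> n)) \<longlonglongrightarrow> (LINT r|lborel. ?i r *\<^sub>R L2_inner (W r) (\<lambda>z. ?c * ?g z))"
    using dc2 unfolding weak(2) set_lebesgue_integral_def .
  ultimately have "L2_inner (W T) (\<lambda>z. ?c * ?\<phi> z) - L2_inner W0 (\<lambda>z. ?c * ?\<phi> z) = (LINT r|lborel. ?c * (?i r *\<^sub>R L2_inner (W r) ?g))"
    unfolding pull by (rule LIMSEQ_unique)
  also have "\<dots> = ?c * (LINT r|lborel. ?i r *\<^sub>R L2_inner (W r) ?g)" by (rule integral_mult_right_zero)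
  finally have "?c * (L2_inner (W T) ?\<phi> - L2_inner W0 ?\<phi>) = ?c * (LINT r|lborel. ?i r *\<^sub>R L2_inner (W r) ?g)"
    by (simp add: L2_inner_cmult_right right_diff_distrib)
  then show "L2_inner (W T) ?\<phi> - L2_inner W0 ?\<phi> = (LINT s:{0..T}|lborel. L2_inner (W s) ?g)"
    using c0 unfolding set_lebesgue_integral_def by simp
qed

end

subsection \<open>The adjoint evolution and uniqueness\<close>

text \<open>With n + 1 equal steps the increments add up to at most a constant divided by n +
  1.\<close>

lemma quadratic_increments_constant:
  fixes F :: "real \<Rightarrow> complex"
  assumes "0 \<le> t" and K: "\<And>a b. 0 \<le> a \<Longrightarrow> a \<le> b \<Longrightarrow> b \<le> t \<Longrightarrow> norm (F b - F a) \<le> K * (b - a)\<^sup>2"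
  shows "F t = F 0"
proof -
  have le: "norm (F t - F 0) \<le> K * t\<^sup>2 * inverse (real (Suc n))" for n
  proof -
    let ?x = "\<lambda>i. real i * (t / real (Suc n))"
    have step: "norm (F (?x (Suc i)) - F (?x i)) \<le> K * (t / real (Suc n))\<^sup>2" if "i < Suc n" for i
    proof -
      have "norm (F (?x (Suc i)) - F (?x i)) \<le> K * (?x (Suc i) - ?x i)\<^sup>2"
      proof (rule K)
        show "0 \<le> ?x i" using assms(1) by simp
        show "?x i \<le> ?x (Suc i)" using assms(1) by (intro mult_right_mono) auto
        have "?x (Suc i) \<le> real (Suc n) * (t / real (Suc n))"
          using that assms(1) by (intro mult_right_mono) auto
        then show "?x (Suc i) \<le> t" by simp
      qed
      also have "?x (Suc i) - ?x i = (real (Suc i) - real i) * (t / real (Suc n))"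
        by (simp only: left_diff_distrib)
      also have "\<dots> = t / real (Suc n)" by simp
      finally show ?thesis .
    qed
    have "F t - F 0 = (\<Sum>i<Suc n. F (?x (Suc i)) - F (?x i))"
      using sum_lessThan_telescope[of "\<lambda>i. F (?x i)" "Suc n"] by simp
    also have "norm \<dots> \<le> (\<Sum>i<Suc n. K * (t / real (Suc n))\<^sup>2)"
      by (rule order_trans[OF norm_sum sum_mono]) (use step in auto)
    also have "\<dots> = K * t\<^sup>2 * inverse (real (Suc n))"
    proof -
      have "N * (K * (t / N)\<^sup>2) = K * t\<^sup>2 * inverse N" if "N \<noteq> 0" for N :: real
        using that by (simp add: power2_eq_square field_simps)
      from this[of "real (Suc n)"] show ?thesis by simp
    qed
    finally show ?thesis .
  qed
  have "(\<lambda>n. K * t\<^sup>2 * inverse (real (Suc n))) \<longlonglongrightarrow> 0"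
    by (intro tendsto_mult_right_zero LIMSEQ_inverse_real_of_nat)
  then have "norm (F t - F 0) \<le> 0"
    by (rule LIMSEQ_le_const) (use le in blast)
  then show ?thesis by simp
qed

lemma admissible_test_function:
  fixes h :: "'a::euclidean_space \<times> 'a \<Rightarrow> complex"
  assumes "test_function h"
  shows "admissible h (\<lambda>\<xi>. frechet_derivative h (at \<xi>) (0, fst \<xi>))"
    and "test_function (\<lambda>\<xi>. frechet_derivative h (at \<xi>) (0, fst \<xi>))"
proof -
  show t: "test_function (\<lambda>\<xi>. frechet_derivative h (at \<xi>) (0, fst \<xi>))"
    by (rule test_function_linear_derivative[OF assms, where A' = "\<lambda>b. (snd b, 0)"]) (simp add: inner_prod_def)
  have s: "smooth h" using assms by (simp add: test_function_def)
  have "((\<lambda>v. h (shear v \<xi>)) has_vector_derivative frechet_derivative h (at \<xi>) (0, fst \<xi>)) (at 0)" for \<xi>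
  proof -
    have d: "((\<lambda>v. shear v \<xi>) has_derivative (\<lambda>v. v *\<^sub>R (0, fst \<xi>))) (at 0)"
      unfolding shear_def by (auto intro!: derivative_eq_intros)
    have p: "(h has_derivative frechet_derivative h (at \<xi>)) (at (shear 0 \<xi>))"
      using smooth_has_derivative[OF s, of \<xi>] by simp
    interpret linear "frechet_derivative h (at \<xi>)"
      by (rule linear_frechet_derivative[OF smooth_differentiable[OF s]])
    from has_derivative_compose[OF d p] show ?thesis
      unfolding has_vector_derivative_def scaleR .
  qed
  then show "admissible h (\<lambda>\<xi>. frechet_derivative h (at \<xi>) (0, fst \<xi>))"
    using test_function_compactly_bounded[OF assms] test_function_compactly_bounded[OF t]
    unfolding admissible_def by blast
qed

context scattering_kernel
begin

lemma borel_measurable_dpsi [measurable]: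
  "(\<lambda>\<xi> :: 'a \<times> 'a. dpsi (snd \<xi>) (fst \<xi>)) \<in> borel_measurable borel"
proof -
  have [measurable]: "(\<lambda>x :: ('a \<times> 'a) \<times> 'a. (snd x \<bullet> fst (fst x)) * sin (snd x \<bullet> snd (fst x))) \<in> borel_measurable (borel \<Otimes>\<^sub>M borel)"
    unfolding borel_prod by (intro borel_measurable_continuous_onI continuous_intros)
  have "(\<lambda>x :: ('a \<times> 'a) \<times> 'a. - (\<sigma> (snd x) * ((snd x \<bullet> fst (fst x)) * sin (snd x \<bullet> snd (fst x))))) \<in> borel_measurable (borel \<Otimes>\<^sub>M lborel)"
    by measurable
  then show ?thesis
    unfolding dpsi_def
    by (intro lborel.borel_measurable_lebesgue_integral) (simp add: split_beta' mult.assoc)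
qed

text \<open>The generator has to be applied twice, because the increments in \<open>duality\<close>
  are expanded to second order. A test function allows it: its derivatives along the shear are test
  functions, and \<open>psi\<close> has one derivative to spend.\<close>

lemma admissible_gen_test_function:
  assumes "test_function h"
  obtains h1 g1 where "admissible h h1" "admissible (gen h h1) g1"
proof -
  let ?h1 = "\<lambda>\<xi>. frechet_derivative h (at \<xi>) (0, fst \<xi>)"
  note h1 = admissible_test_function[OF assms]
  let ?h2 = "\<lambda>\<xi>. frechet_derivative ?h1 (at \<xi>) (0, fst \<xi>)"
  note h2 = admissible_test_function[OF h1(2)]
  have cb: "compactly_bounded h" "compactly_bounded ?h1" "compactly_bounded ?h2"
    using h1 h2 assms test_function_compactly_bounded by blast+
  let ?g = "\<lambda>\<xi>. complex_of_real (psi (snd \<xi>)) * h \<xi>"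
  \<comment> \<open>The product rule for \<open>psi\<close> times \<open>h\<close>, minus the second
    shear derivative of \<open>h\<close>. The two minus signs around \<open>dpsi\<close> bring the
    sum into the form of a difference, for which closure is available.\<close>
  let ?g1 = "\<lambda>\<xi>. (complex_of_real (psi (snd \<xi>)) * ?h1 \<xi> - complex_of_real (- dpsi (snd \<xi>) (fst \<xi>)) * h \<xi>) - ?h2 \<xi>"
  have "compactly_bounded (\<lambda>\<xi>. complex_of_real (- dpsi (snd \<xi>) (fst \<xi>)) * h \<xi>)"
  proof (rule compactly_bounded_mult[OF cb(1)])
    show "(\<lambda>\<xi>. complex_of_real (- dpsi (snd \<xi>) (fst \<xi>))) \<in> borel_measurable borel" by measurable
    show "\<exists>C. \<forall>\<xi> :: 'a \<times> 'a. norm \<xi> \<le> r \<longrightarrow> norm (complex_of_real (- dpsi (snd \<xi>) (fst \<xi>))) \<le> C" for r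
    proof (intro exI[of _ "M1 * r"] allI impI)
      fix \<xi> :: "'a \<times> 'a" assume "norm \<xi> \<le> r"
      then have "norm (fst \<xi>) \<le> r" using norm_fst_le[of "fst \<xi>" "snd \<xi>"] by simp
      then show "norm (complex_of_real (- dpsi (snd \<xi>) (fst \<xi>))) \<le> M1 * r"
        using order_trans[OF abs_dpsi_le mult_left_mono[OF _ M1_nonneg]] by simp
    qed
  qed
  then have cbg1: "compactly_bounded ?g1"
    by (intro compactly_bounded_diff compactly_bounded_psi_mult cb)
  have "((\<lambda>v. gen h ?h1 (shear v \<xi>)) has_vector_derivative ?g1 \<xi>) (at 0)" for \<xi>
  proof -
    have d1: "((\<lambda>v. complex_of_real (psi (snd \<xi> + v *\<^sub>R fst \<xi>))) has_vector_derivative complex_of_real (dpsi (snd \<xi>) (fst \<xi>))) (at 0)"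
      by (rule has_vector_derivative_of_real[OF psi_line_derivative])
    have "((\<lambda>v. complex_of_real (psi (snd (shear v \<xi>))) * h (shear v \<xi>) - ?h1 (shear v \<xi>)) has_vector_derivative
       (complex_of_real (psi (snd \<xi> + 0 *\<^sub>R fst \<xi>)) * ?h1 \<xi> + complex_of_real (dpsi (snd \<xi>) (fst \<xi>)) * h (shear 0 \<xi>)) - ?h2 \<xi>) (at 0)"
      unfolding snd_shear
      by (intro has_vector_derivative_diff has_vector_derivative_mult d1 admissible_derivative[OF h1(1)] admissible_derivative[OF h2(1)])
    then show ?thesis unfolding gen_def by simp
  qed
  then have "admissible (gen h ?h1) ?g1"
    using compactly_bounded_gen[OF cb(1,2)] cbg1 unfolding admissible_def by blast
  with h1(1) show thesis by (rule that)
qed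

section \<open>The adjoint flow and its derivatives\<close>

definition damping :: "real \<Rightarrow> 'a \<times> 'a \<Rightarrow> real" where
  "damping t \<xi> = exp (accum t (fst \<xi>) (snd \<xi>))"

lemma damping_pos: "0 < damping t \<xi>" and damping_le_1: "damping t \<xi> \<le> 1"
  using accum_nonpos by (auto simp: damping_def)

lemma borel_measurable_damping [measurable]: "damping t \<in> borel_measurable borel"
  unfolding damping_def[abs_def] by measurable

text \<open>The transpose of the solution formula: the solution reads the initial transform at
  \<open>shear t \<xi>\<close> with factor \<open>damping t \<xi>\<close>, so the adjoint reads h at
  \<open>shear (- t) \<xi>\<close> with the factor taken at that same point.\<close>

definition flow :: "real \<Rightarrow> ('a \<times> 'a \<Rightarrow> complex) \<Rightarrow> 'a \<times> 'a \<Rightarrow> complex" where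
  "flow t h \<xi> = complex_of_real (damping t (shear (- t) \<xi>)) * h (shear (- t) \<xi>)"

lemma norm_flow_le:
  assumes "0 \<le> t" "t \<le> T" "\<And>\<xi>. norm (h \<xi>) \<le> M * indicator (cball 0 r) \<xi>" "0 \<le> M"
  shows "norm (flow t h \<xi>) \<le> M * indicator (cball 0 ((1 + T) * r)) \<xi>"
proof -
  let ?\<eta> = "shear (- t) \<xi>"
  have "norm (flow t h \<xi>) = damping t ?\<eta> * norm (h ?\<eta>)"
    using damping_pos[of t ?\<eta>] by (simp add: flow_def norm_mult)
  also have "\<dots> \<le> 1 * norm (h ?\<eta>)"
    by (intro mult_right_mono damping_le_1) auto
  also have "\<dots> \<le> M * indicator (cball 0 r) ?\<eta>" using assms(3) by simp
  also have "\<dots> \<le> M * indicator (cball 0 ((1 + T) * r)) \<xi>"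
  proof (rule mult_left_mono[OF _ assms(4)])
    have "norm \<xi> \<le> (1 + T) * r" if "norm ?\<eta> \<le> r"
    proof -
      have "norm \<xi> \<le> (1 + \<bar>- t\<bar>) * norm ?\<eta>" by (rule norm_le_norm_shear)
      also have "\<dots> \<le> (1 + T) * r" using that assms(1,2) by (intro mult_mono) auto
      finally show ?thesis .
    qed
    then show "indicator (cball 0 r) ?\<eta> \<le> (indicator (cball 0 ((1 + T) * r)) \<xi> :: real)"
      by (auto simp: indicator_def)
  qed
  finally show ?thesis .
qed

lemma borel_measurable_flow [measurable]:
  assumes [measurable]: "h \<in> borel_measurable borel"
  shows "flow t h \<in> borel_measurable borel"
  unfolding flow_def[abs_def] by measurable

lemma compactly_bounded_flow:
  assumes "compactly_bounded h" "0 \<le> t" shows "compactly_bounded (flow t h)"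
proof -
  obtain M r where h: "0 < M" "0 < r" "\<And>\<xi>. norm (h \<xi>) \<le> M" "\<And>\<xi>. r < norm \<xi> \<Longrightarrow> h \<xi> = 0"
    using assms(1) by (rule compactly_boundedE) blast
  then have "norm (h \<xi>) \<le> M * indicator (cball 0 r) \<xi>" for \<xi>
    by (auto simp: indicator_def not_le)
  from norm_flow_le[OF assms(2) order_refl this] h(1) compactly_bounded_measurable[OF assms(1)]
  show ?thesis unfolding compactly_bounded_def by (blast intro: borel_measurable_flow less_imp_le)
qed

text \<open>Along a characteristic the damping is the exponential of a difference of two values of
  one primitive; both derivatives of the flow, along the shear and in time, are computed from this
  form.\<close>

lemma flow_line:
  assumes "0 \<le> t" "- T \<le> v - t"
  shows "flow t h (shear v \<xi>) = complex_of_real (exp (integral {-T..v} (\<lambda>w. psi (snd \<xi> + w *\<^sub>R fst \<xi>))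
     - integral {-T..v - t} (\<lambda>w. psi (snd \<xi> + w *\<^sub>R fst \<xi>)))) * h (shear (v - t) \<xi>)"
  using accum_line[OF assms, of "fst \<xi>" "snd \<xi>"] by (simp add: flow_def damping_def snd_shear)

lemma flow_gen: "flow t (gen h h') \<xi> = complex_of_real (psi (snd (shear (- t) \<xi>))) * flow t h \<xi> - flow t h' \<xi>"
  by (simp add: flow_def gen_def algebra_simps)

text \<open>The flow commutes with the generator.\<close>

lemma flow_admissible:
  assumes adm: "admissible h h'" and t: "0 \<le> t"
  obtains k where "admissible (flow t h) k" "gen (flow t h) k = flow t (gen h h')"
proof -
  have cb: "compactly_bounded h" "compactly_bounded h'" using adm by (auto simp: admissible_def)
  \<comment> \<open>Obtained by solving the desired commutation for the shear derivative; that this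
    really is the derivative is then checked along the characteristic.\<close>
  let ?k = "\<lambda>\<xi>. complex_of_real (psi (snd \<xi>)) * flow t h \<xi> - flow t (gen h h') \<xi>"
  have "compactly_bounded ?k"
    by (intro compactly_bounded_diff compactly_bounded_psi_mult compactly_bounded_flow compactly_bounded_gen cb t)
  moreover have "((\<lambda>v. flow t h (shear v \<xi>)) has_vector_derivative ?k \<xi>) (at 0)" for \<xi>
  proof -
    \<comment> \<open>The lower limit leaves room of length 1 below \<open>- t\<close>, so
      \<open>flow_line\<close> applies on a full neighbourhood of 0.\<close>
    let ?P = "\<lambda>v. integral {-(t + 1)..v} (\<lambda>w. psi (snd \<xi> + w *\<^sub>R fst \<xi>))"
    have d1: "(?P has_real_derivative psi (snd \<xi> + 0 *\<^sub>R fst \<xi>)) (at 0)"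
      using t by (intro DERIV_line_integral) auto
    have d2: "((\<lambda>v. ?P (v - t)) has_real_derivative psi (snd \<xi> + (0 - t) *\<^sub>R fst \<xi>) * 1) (at 0)"
      by (rule DERIV_chain2[OF DERIV_line_integral]) (auto intro!: derivative_eq_intros)
    have d3: "((\<lambda>v. exp (?P v - ?P (v - t))) has_real_derivative
        exp (?P 0 - ?P (0 - t)) * (psi (snd \<xi>) - psi (snd \<xi> - t *\<^sub>R fst \<xi>))) (at 0)"
      using DERIV_chain2[OF DERIV_exp DERIV_diff[OF d1 d2]] by simp
    have s: "((\<lambda>v. v - t) has_vector_derivative 1) (at 0)" by (auto intro!: derivative_eq_intros)
    have d4: "((\<lambda>v. h (shear (v - t) \<xi>)) has_vector_derivative h' (shear (- t) \<xi>)) (at 0)"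
      using vector_diff_chain_at[OF s admissible_line_derivative[OF adm, of \<xi> "0 - t"]] by (simp add: o_def)
    have "((\<lambda>v. complex_of_real (exp (?P v - ?P (v - t))) * h (shear (v - t) \<xi>)) has_vector_derivative
       complex_of_real (exp (?P 0 - ?P (0 - t))) * h' (shear (- t) \<xi>)
       + complex_of_real (exp (?P 0 - ?P (0 - t)) * (psi (snd \<xi>) - psi (snd \<xi> - t *\<^sub>R fst \<xi>))) * h (shear (0 - t) \<xi>)) (at 0)"
      by (intro has_vector_derivative_mult has_vector_derivative_of_real d3 d4)
    then have "((\<lambda>v. flow t h (shear v \<xi>)) has_vector_derivative
       complex_of_real (exp (?P 0 - ?P (0 - t))) * h' (shear (- t) \<xi>)
       + complex_of_real (exp (?P 0 - ?P (0 - t)) * (psi (snd \<xi>) - psi (snd \<xi> - t *\<^sub>R fst \<xi>))) * h (shear (0 - t) \<xi>)) (at 0)"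
      by (rule has_vector_derivative_transform_within_open[where S = "{-1<..<1}"])
        (use flow_line[OF t, of "t + 1" _ h \<xi>] in auto)
    moreover have fl: "complex_of_real (exp (?P 0 - ?P (0 - t))) * f (shear (- t) \<xi>) = flow t f \<xi>" for f
      using flow_line[OF t, of "t + 1" 0 f \<xi>] by simp
    have "complex_of_real (exp (?P 0 - ?P (0 - t))) * h' (shear (- t) \<xi>)
       + complex_of_real (exp (?P 0 - ?P (0 - t)) * (psi (snd \<xi>) - psi (snd \<xi> - t *\<^sub>R fst \<xi>))) * h (shear (0 - t) \<xi>) = ?k \<xi>"
      unfolding flow_gen fl[symmetric] snd_shear by (simp add: algebra_simps)
    ultimately show ?thesis by (simp only:)
  qed
  ultimately have "admissible (flow t h) ?k"
    using compactly_bounded_flow[OF cb(1) t] unfolding admissible_def by blast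
  moreover have "gen (flow t h) ?k = flow t (gen h h')"
    by (simp add: gen_def fun_eq_iff)
  ultimately show thesis by (rule that)
qed

text \<open>The derivative is one-sided at time 0: \<open>accum\<close> integrates over an empty
  interval for negative times, so there the flow no longer follows the equation. The derivative is
  again a flow, because of the commutation with the generator.\<close>

lemma flow_time_derivative:
  assumes adm: "admissible h h'" and t: "0 \<le> t"
  shows "((\<lambda>t. flow t h \<xi>) has_vector_derivative flow t (gen h h') \<xi>) (at t within {0..})"
proof -
  let ?P = "\<lambda>v. integral {-(t + 1)..v} (\<lambda>w. psi (snd \<xi> + w *\<^sub>R fst \<xi>))"
  have d2: "((\<lambda>s. ?P (- s)) has_real_derivative psi (snd \<xi> + (- t) *\<^sub>R fst \<xi>) * (- 1)) (at t)"
    by (rule DERIV_chain2[OF DERIV_line_integral]) (auto intro!: derivative_eq_intros)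
  have d3: "((\<lambda>s. exp (?P 0 - ?P (- s))) has_real_derivative exp (?P 0 - ?P (- t)) * psi (snd \<xi> - t *\<^sub>R fst \<xi>)) (at t)"
    using DERIV_chain2[OF DERIV_exp DERIV_diff[OF DERIV_const d2]] by simp
  have s: "((\<lambda>s. - s) has_vector_derivative - 1) (at t)" by (auto intro!: derivative_eq_intros)
  have d4: "((\<lambda>s. h (shear (- s) \<xi>)) has_vector_derivative - h' (shear (- t) \<xi>)) (at t)"
    using vector_diff_chain_at[OF s admissible_line_derivative[OF adm, of \<xi> "- t"]] by (simp add: o_def)
  have "((\<lambda>s. complex_of_real (exp (?P 0 - ?P (- s))) * h (shear (- s) \<xi>)) has_vector_derivative
     complex_of_real (exp (?P 0 - ?P (- t))) * (- h' (shear (- t) \<xi>))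
     + complex_of_real (exp (?P 0 - ?P (- t)) * psi (snd \<xi> - t *\<^sub>R fst \<xi>)) * h (shear (- t) \<xi>)) (at t)"
    by (intro has_vector_derivative_mult has_vector_derivative_of_real d3 d4)
  then have "((\<lambda>s. complex_of_real (exp (?P 0 - ?P (- s))) * h (shear (- s) \<xi>)) has_vector_derivative
     complex_of_real (exp (?P 0 - ?P (- t))) * (- h' (shear (- t) \<xi>))
     + complex_of_real (exp (?P 0 - ?P (- t)) * psi (snd \<xi> - t *\<^sub>R fst \<xi>)) * h (shear (- t) \<xi>)) (at t within {0..})"
    by (rule has_vector_derivative_at_within)
  then have "((\<lambda>s. flow s h \<xi>) has_vector_derivative
     complex_of_real (exp (?P 0 - ?P (- t))) * (- h' (shear (- t) \<xi>))
     + complex_of_real (exp (?P 0 - ?P (- t)) * psi (snd \<xi> - t *\<^sub>R fst \<xi>)) * h (shear (- t) \<xi>)) (at t within {0..})"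
  proof (rule has_vector_derivative_transform_within[where d = 1])
    fix s assume "s \<in> {0..}" "dist s t < 1"
    then show "complex_of_real (exp (?P 0 - ?P (- s))) * h (shear (- s) \<xi>) = flow s h \<xi>"
      using flow_line[of s "t + 1" 0 h \<xi>] by (simp add: dist_real_def)
  qed (use t in auto)
  moreover have fl: "complex_of_real (exp (?P 0 - ?P (- t))) * f (shear (- t) \<xi>) = flow t f \<xi>" for f
    using flow_line[OF t, of "t + 1" 0 f \<xi>] by simp
  have "complex_of_real (exp (?P 0 - ?P (- t))) * (- h' (shear (- t) \<xi>))
     + complex_of_real (exp (?P 0 - ?P (- t)) * psi (snd \<xi> - t *\<^sub>R fst \<xi>)) * h (shear (- t) \<xi>) = flow t (gen h h') \<xi>"
    unfolding flow_gen fl[symmetric] snd_shear by (simp add: algebra_simps)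
  ultimately show ?thesis by (simp only:)
qed

text \<open>The second time derivative is the flow of the twofold generator, bounded by
  \<open>M\<close> because the damping is at most 1. The mean value inequality is used for the first
  derivative and again for the remainder.\<close>

lemma flow_taylor:
  assumes adm: "admissible h h1" "admissible (gen h h1) g1"
    and M: "0 \<le> M" "\<And>\<xi>. norm (gen (gen h h1) g1 \<xi>) \<le> M"
    and ab: "0 \<le> a" "0 \<le> b"
  shows "norm (flow a h \<xi> - flow b h \<xi> - complex_of_real (a - b) * flow b (gen h h1) \<xi>) \<le> M * (a - b)\<^sup>2"
proof -
  have fl: "norm (flow v (gen (gen h h1) g1) \<xi>) \<le> M" if "0 \<le> v" for v
  proof -
    have "norm (flow v (gen (gen h h1) g1) \<xi>) \<le> 1 * norm (gen (gen h h1) g1 (shear (- v) \<xi>))"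
      unfolding flow_def norm_mult using damping_pos[of v "shear (- v) \<xi>"] damping_le_1[of v "shear (- v) \<xi>"]
      by (intro mult_right_mono) auto
    then show ?thesis using M(2)[of "shear (- v) \<xi>"] by simp
  qed
  have lip: "norm (flow v (gen h h1) \<xi> - flow b (gen h h1) \<xi>) \<le> M * \<bar>v - b\<bar>" if "0 \<le> v" for v
    by (rule line_Lipschitz[of "{0..}" "\<lambda>t. flow t (gen h h1) \<xi>" "\<lambda>t. flow t (gen (gen h h1) g1) \<xi>"])
      (use that ab fl flow_time_derivative[OF adm(2)] in auto)
  \<comment> \<open>The segment covers both orders of a and b.\<close>
  let ?S = "closed_segment b a"
  have S: "?S \<subseteq> {0..}" using ab by (auto simp: closed_segment_eq_real_ivl split: if_splits)
  have "norm ((flow a h \<xi> - complex_of_real a * flow b (gen h h1) \<xi>) - (flow b h \<xi> - complex_of_real b * flow b (gen h h1) \<xi>)) \<le> M * \<bar>a - b\<bar> * \<bar>a - b\<bar>"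
  proof (rule line_Lipschitz[of ?S "\<lambda>v. flow v h \<xi> - complex_of_real v * flow b (gen h h1) \<xi>" "\<lambda>v. flow v (gen h h1) \<xi> - 1 * flow b (gen h h1) \<xi>"])
    fix v assume v: "v \<in> ?S"
    have "((\<lambda>v. flow v h \<xi>) has_vector_derivative flow v (gen h h1) \<xi>) (at v within ?S)"
      using v S by (intro has_vector_derivative_within_subset[OF flow_time_derivative[OF adm(1)] S]) auto
    moreover have "((\<lambda>v. complex_of_real v * flow b (gen h h1) \<xi>) has_vector_derivative 1 * flow b (gen h h1) \<xi>) (at v within ?S)"
      by (auto intro!: derivative_eq_intros has_vector_derivative_mult_left)
    ultimately show "((\<lambda>v. flow v h \<xi> - complex_of_real v * flow b (gen h h1) \<xi>) has_vector_derivative flow v (gen h h1) \<xi> - 1 * flow b (gen h h1) \<xi>) (at v within ?S)"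
      by (rule has_vector_derivative_diff)
    have "\<bar>v - b\<bar> \<le> \<bar>a - b\<bar>"
      using v by (auto simp: closed_segment_eq_real_ivl split: if_splits)
    then have "M * \<bar>v - b\<bar> \<le> M * \<bar>a - b\<bar>" using M(1) by (rule mult_left_mono)
    then show "norm (flow v (gen h h1) \<xi> - 1 * flow b (gen h h1) \<xi>) \<le> M * \<bar>a - b\<bar>"
      using lip[of v] v S by auto
  qed auto
  moreover have "M * \<bar>a - b\<bar> * \<bar>a - b\<bar> = M * (a - b)\<^sup>2" by (simp add: power2_eq_square)
  ultimately show ?thesis by (simp add: algebra_simps)
qed

end

section \<open>Translated and dilated bumps separate square-integrable functions\<close>

lemma bump_integral_pos: "0 < (LINT z|lborel. bump (z :: 'b::euclidean_space))"
proof -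
  have t: "test_function (\<lambda>z :: 'b. complex_of_real (bump z))"
    using test_function_bump[of 1 "0 :: 'b"] by simp
  have i: "integrable lborel (bump :: 'b \<Rightarrow> real)"
    using test_function_integrable(1)[OF t] by (simp only: complex_of_real_integrable_eq)
  have s: "smooth (\<lambda>z :: 'b. complex_of_real (bump z))" using t by (simp add: test_function_def)
  have "(LINT z|lborel. bump (z :: 'b)) \<noteq> 0"
  proof
    assume "(LINT z|lborel. bump (z :: 'b)) = 0"
    then have "AE z in lborel. bump (z :: 'b) = 0"
      using integral_nonneg_eq_0_iff_AE[OF i] bump_nonneg by auto
    then have "{z :: 'b. bump z \<noteq> 0} \<in> null_sets lborel"
    proof -
      have "{z :: 'b. bump z \<noteq> 0} \<in> sets lborel"
        using borel_measurable_integrable[OF i] by simp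
      from AE_iff_null_sets[OF this] \<open>AE z in lborel. bump z = 0\<close> show ?thesis by simp
    qed
    then have "negligible {z :: 'b. bump z \<noteq> 0}"
      by (simp add: negligible_iff_null_sets null_sets_completionI)
    moreover have "open {z :: 'b. bump z \<noteq> 0}"
      using open_Collect_neq[OF smooth_continuous_on[OF s, of UNIV] continuous_on_const[of UNIV 0]] by simp
    moreover have "{z :: 'b. bump z \<noteq> 0} \<noteq> {}"
      using bump_0_pos[where ?'a = 'b] by force
    ultimately show False using open_not_negligible by blast
  qed
  moreover have "0 \<le> (LINT z|lborel. bump (z :: 'b))"
    by (rule integral_nonneg_AE) (simp add: bump_nonneg)
  ultimately show ?thesis by simp
qed

text \<open>Orthogonality to all bumps makes every average of \<open>u\<close> at scale
  \<open>e n\<close> vanish. By the approximate identity the integral of the bump times the squared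
  norm of \<open>u\<close> is then 0.\<close>

lemma bump_total:
  fixes u :: "'b::euclidean_space \<Rightarrow> complex"
  assumes u: "square_integrable u"
    and orth: "\<And>s a. 0 < s \<Longrightarrow> L2_inner u (\<lambda>z. complex_of_real (bump (s *\<^sub>R (z - a)))) = 0"
  shows "AE z in lborel. u z = 0"
proof -
  note [measurable] = square_integrable_measurable[OF u]
  have t: "test_function (\<lambda>z :: 'b. complex_of_real (bump z))"
    using test_function_bump[of 1 "0 :: 'b"] by simp
  have i: "integrable lborel (bump :: 'b \<Rightarrow> real)"
    using test_function_integrable(1)[OF t] by (simp only: complex_of_real_integrable_eq)
  then have [measurable]: "bump \<in> borel_measurable (borel :: 'b measure)" by (auto dest: borel_measurable_integrable)
  define e :: "nat \<Rightarrow> real" where "e n = inverse (real (Suc n))" for n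
  have e0: "e \<longlonglongrightarrow> 0" unfolding e_def by (rule LIMSEQ_inverse_real_of_nat)
  have epos: "0 < e n" for n unfolding e_def by simp
  have zero: "(LINT w|lborel. complex_of_real (bump w) * u (x + e n *\<^sub>R w)) = 0" for n x
  proof -
    let ?f = "\<lambda>z. u z * cnj (complex_of_real (bump ((1 / e n) *\<^sub>R (z - x))))"
    have "0 = (LINT z|lborel. ?f z)"
      using orth[of "1 / e n" x] epos[of n] by (simp add: L2_inner_def)
    also have "\<dots> = \<bar>e n\<bar> ^ DIM('b) *\<^sub>R (LINT w|lborel. ?f (x + e n *\<^sub>R w))"
      using epos[of n] by (intro lborel_integral_affine) auto
    also have "(\<lambda>w. ?f (x + e n *\<^sub>R w)) = (\<lambda>w. complex_of_real (bump w) * u (x + e n *\<^sub>R w))"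
      using epos[of n] by (auto simp: mult.commute)
    finally show ?thesis using epos[of n] by simp
  qed
  have "complex_of_real ((LINT w|lborel. bump (w :: 'b)) * (L2_norm u)\<^sup>2) = 0"
    using approximate_identity[OF i u e0] unfolding zero by (simp add: LIMSEQ_const_iff)
  then have "L2_norm u = 0" using bump_integral_pos[where ?'b = 'b] by simp
  with u show ?thesis by (rule L2_norm_0_imp_AE)
qed

context scattering_kernel
begin

text \<open>The difference of the weak formulations up to b and up to a, stated with the gauge
  integral for the estimates on subintervals that follow.\<close>

lemma weak_increment:
  assumes adm: "admissible h h'" and ws: "weak_solution \<sigma> W0 W" and W0: "square_integrable W0"
    and bd: "\<forall>t\<ge>0. L2_norm (W t) \<le> C" and ab: "0 \<le> a" "a \<le> b"
  shows "((\<lambda>s. L2_inner (W s) (synthesis (gen h h'))) has_integral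
     (L2_inner (W b) (synthesis h) - L2_inner (W a) (synthesis h))) {a..b}"
proof -
  let ?f = "\<lambda>s. L2_inner (W s) (synthesis (gen h h'))"
  note ext = extended_weak_formulation[OF adm ws W0 bd]
  have i: "?f integrable_on {0..T}" "L2_inner (W T) (synthesis h) - L2_inner W0 (synthesis h) = integral {0..T} ?f" if "0 \<le> T" for T
    using set_borel_integral_eq_integral[OF ext(1)[OF that]] ext(2)[OF that] by auto
  have ib: "?f integrable_on {a..b}"
    using ab by (intro integrable_subinterval_real[OF i(1)[of b]]) auto
  have "integral {0..a} ?f + integral {a..b} ?f = integral {0..b} ?f"
    using ab by (intro Henstock_Kurzweil_Integration.integral_combine i) auto
  then have "integral {a..b} ?f = L2_inner (W b) (synthesis h) - L2_inner (W a) (synthesis h)"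
    using i(2)[of a] i(2)[of b] ab by (simp add: algebra_simps)
  then show ?thesis using ib by (simp add: has_integral_iff)
qed

lemma L2_norm_synthesis_le:
  fixes k :: "'a \<times> 'a \<Rightarrow> complex"
  assumes "compactly_bounded k" "0 \<le> M" "\<And>\<xi>. norm (k \<xi>) \<le> M * indicator (cball 0 r) \<xi>"
  shows "L2_norm (synthesis k) \<le> sqrt ((2 * pi) ^ DIM('a \<times> 'a)) * (M * sqrt (measure lborel (cball 0 r :: ('a \<times> 'a) set)))"
proof -
  have "L2_norm (synthesis k) = sqrt ((L2_norm (synthesis k))\<^sup>2)" by simp
  also have "\<dots> = sqrt ((2 * pi) ^ DIM('a \<times> 'a)) * L2_norm k"
    unfolding synthesis_L2(2)[OF compactly_bounded_integrable[OF assms(1)] compactly_bounded_square_integrable[OF assms(1)]]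
    by (simp add: real_sqrt_mult)
  also have "\<dots> \<le> sqrt ((2 * pi) ^ DIM('a \<times> 'a)) * (M * sqrt (measure lborel (cball 0 r :: ('a \<times> 'a) set)))"
    using assms by (intro mult_left_mono compactly_bounded_L2_norm_le compactly_bounded_measurable) auto
  finally show ?thesis .
qed

text \<open>The pairing of the solution with the adjoint evolution is constant in time, because its increments
  are of second order.\<close>

theorem duality:
  assumes adm: "admissible h h1" "admissible (gen h h1) g1"
    and ws: "weak_solution \<sigma> W0 W" and W0: "square_integrable W0"
    and bd: "\<forall>t\<ge>0. L2_norm (W t) \<le> C" and t: "0 \<le> t"
  shows "L2_inner (W t) (synthesis h) = L2_inner W0 (synthesis (flow t h))"
proof -
  let ?g = "gen h h1" and ?g2 = "gen (gen h h1) g1"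
  have cb: "compactly_bounded h" "compactly_bounded ?g" "compactly_bounded ?g2"
    using adm compactly_bounded_gen by (auto simp: admissible_def)
  have W: "square_integrable (W t)" if "0 \<le> t" for t
    using ws that by (simp add: weak_solution_def)
  have C: "0 \<le> C" using order_trans[OF L2_norm_nonneg bd[rule_format, OF order_refl]] .
  obtain M r where M: "0 < M" "0 < r" "\<And>\<xi>. norm (?g2 \<xi>) \<le> M" "\<And>\<xi>. r < norm \<xi> \<Longrightarrow> ?g2 \<xi> = 0"
    using cb(3) by (rule compactly_boundedE) blast
  obtain Mh rh where h: "0 < Mh" "0 < rh" "\<And>\<xi>. norm (h \<xi>) \<le> Mh" "\<And>\<xi>. rh < norm \<xi> \<Longrightarrow> h \<xi> = 0"
    using cb(1) by (rule compactly_boundedE) blast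
  obtain Mg rg where g: "0 < Mg" "0 < rg" "\<And>\<xi>. norm (?g \<xi>) \<le> Mg" "\<And>\<xi>. rg < norm \<xi> \<Longrightarrow> ?g \<xi> = 0"
    using cb(2) by (rule compactly_boundedE) blast
  \<comment> \<open>The supports of \<open>h\<close> and of its first and second generator lie
    within \<open>r + rh + rg\<close>; a shear by at most t enlarges radii by a factor of at most 1
    + t.\<close>
  define R where "R = (1 + t) * (r + rh + rg)"
  have out: "flow \<tau> f \<xi> = 0" if "0 \<le> \<tau>" "\<tau> \<le> t" "R < norm \<xi>" "\<rho> \<le> r + rh + rg" "\<And>\<xi>. \<rho> < norm \<xi> \<Longrightarrow> f \<xi> = 0" for \<tau> f \<xi> \<rho>
  proof -
    have "norm \<xi> \<le> (1 + \<bar>- \<tau>\<bar>) * norm (shear (- \<tau>) \<xi>)" by (rule norm_le_norm_shear)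
    also have "\<dots> \<le> (1 + t) * norm (shear (- \<tau>) \<xi>)" using that by (intro mult_right_mono) auto
    finally have "(1 + t) * (r + rh + rg) < (1 + t) * norm (shear (- \<tau>) \<xi>)" using that(3) unfolding R_def by linarith
    then have "r + rh + rg < norm (shear (- \<tau>) \<xi>)" using t by simp
    then show ?thesis using that(4,5) by (simp add: flow_def)
  qed
  \<comment> \<open>Bounds the pairing of the solution at any time with the synthesis of the second
    generator, transported by the flow over at most time t.\<close>
  define K where "K = C * (sqrt ((2 * pi) ^ DIM('a \<times> 'a)) * (M * sqrt (measure lborel (cball 0 R :: ('a \<times> 'a) set))))"
  have fg2: "norm (flow \<tau> ?g2 \<xi>) \<le> M * indicator (cball 0 R) \<xi>" if "0 \<le> \<tau>" "\<tau> \<le> t" for \<tau> \<xi>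
  proof (cases "R < norm \<xi>")
    case True
    then show ?thesis using out[OF that True, of r ?g2] M h g by (simp add: indicator_def)
  next
    case False
    have "norm (flow \<tau> ?g2 \<xi>) \<le> 1 * norm (?g2 (shear (- \<tau>) \<xi>))"
      unfolding flow_def norm_mult using damping_pos[of \<tau> "shear (- \<tau>) \<xi>"] damping_le_1[of \<tau> "shear (- \<tau>) \<xi>"]
      by (intro mult_right_mono) auto
    then show ?thesis using False M(3)[of "shear (- \<tau>) \<xi>"] by (simp add: indicator_def)
  qed
  \<comment> \<open>Solution and adjoint evolution run in opposite directions in time, so this joins
    the two sides of the claim at s = t and s = 0.\<close>
  define F where "F s = L2_inner (W s) (synthesis (flow (t - s) h))" for s
  have "norm (F b - F a) \<le> 2 * K * (b - a)\<^sup>2" if ab: "0 \<le> a" "a \<le> b" "b \<le> t" for a b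
  proof -
    have tb: "0 \<le> t - b" "t - b \<le> t" "0 \<le> b" and ta: "0 \<le> t - a" "t - a \<le> t" using ab by auto
    obtain k where k: "admissible (flow (t - b) h) k" "gen (flow (t - b) h) k = flow (t - b) ?g"
      using adm(1) tb(1) by (rule flow_admissible)
    obtain k2 where k2: "admissible (flow (t - b) ?g) k2" "gen (flow (t - b) ?g) k2 = flow (t - b) ?g2"
      using adm(2) tb(1) by (rule flow_admissible)
    let ?H = "flow (t - b) h" and ?Ha = "flow (t - a) h" and ?G = "flow (t - b) ?g" and ?G2 = "flow (t - b) ?g2"
    have cbf: "compactly_bounded ?H" "compactly_bounded ?Ha" "compactly_bounded ?G" "compactly_bounded ?G2"
      by (intro compactly_bounded_flow cb tb ta)+
    have sq: "square_integrable (synthesis f)" if "compactly_bounded f" for f :: "'a \<times> 'a \<Rightarrow> complex"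
      using that by (intro synthesis_L2 compactly_bounded_integrable compactly_bounded_square_integrable)
    let ?f = "\<lambda>s. L2_inner (W s) (synthesis ?G)"
    have inc: "(?f has_integral (L2_inner (W b) (synthesis ?H) - L2_inner (W a) (synthesis ?H))) {a..b}"
      using weak_increment[OF k(1) ws W0 bd ab(1,2)] unfolding k(2) .
    \<comment> \<open>The pairing with the generator is itself an integral in time of the pairing
      with the second generator, hence Lipschitz, although nothing is known about the continuity of
      \<open>W\<close>.\<close>
    have lip: "norm (?f s - ?f a) \<le> K * (s - a)" if s: "a \<le> s" for s
    proof -
      have hi: "((\<lambda>r. L2_inner (W r) (synthesis ?G2)) has_integral (?f s - ?f a)) {a..s}"
        using weak_increment[OF k2(1) ws W0 bd ab(1) s] unfolding k2(2) .
      have "norm (L2_inner (W r) (synthesis ?G2)) \<le> K" if "r \<in> {a..s}" for r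
      proof -
        have r: "0 \<le> r" using that ab by simp
        have "norm (L2_inner (W r) (synthesis ?G2)) \<le> L2_norm (W r) * L2_norm (synthesis ?G2)"
          by (intro Cauchy_Schwarz_L2_inner W r sq cbf)
        also have "\<dots> \<le> K"
          unfolding K_def using bd[rule_format, OF r] C M(1)
          by (intro mult_mono L2_norm_synthesis_le cbf fg2 tb) auto
        finally show ?thesis .
      qed
      then show ?thesis
        using has_integral_bound_real[where S = "{}" and B = K, OF _ _ hi] s C M(1) by (simp add: K_def)
    qed
    have Kpos: "0 \<le> K" unfolding K_def using C M(1) by simp
    \<comment> \<open>The solution moves against a fixed test function: the increment is b - a times
      the pairing at a, up to second order.\<close>
    have first: "norm ((L2_inner (W b) (synthesis ?H) - L2_inner (W a) (synthesis ?H)) - complex_of_real (b - a) * ?f a) \<le> K * (b - a) * (b - a)"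
    proof -
      have "((\<lambda>s. ?f a) has_integral (b - a) *\<^sub>R ?f a) {a..b}"
        using has_integral_const_real[of "?f a" a b] ab by simp
      from has_integral_diff[OF inc this]
      have hi: "((\<lambda>s. ?f s - ?f a) has_integral (L2_inner (W b) (synthesis ?H) - L2_inner (W a) (synthesis ?H)) - (b - a) *\<^sub>R ?f a) {a..b}" .
      have "norm (?f s - ?f a) \<le> K * (b - a)" if "s \<in> {a..b}" for s
        using lip[of s] that Kpos mult_left_mono[of "s - a" "b - a" K] by simp
      from has_integral_bound_real[where S = "{}" and B = "K * (b - a)", OF _ _ hi] this show ?thesis
        using ab Kpos by (simp add: scaleR_conv_of_real)
    qed
    \<comment> \<open>The second-order remainder of the test function as its remaining flow time
      grows from t - b to t - a.\<close>
    let ?rem = "\<lambda>\<xi>. ?Ha \<xi> - ?H \<xi> - complex_of_real (b - a) * ?G \<xi>"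
    have cbc: "compactly_bounded (\<lambda>\<xi>. complex_of_real (b - a) * ?G \<xi>)"
      by (rule compactly_bounded_mult[OF cbf(3)]) auto
    have cbr: "compactly_bounded ?rem" by (intro compactly_bounded_diff cbf cbc)
    have rem: "norm (?rem \<xi>) \<le> (M * (b - a)\<^sup>2) * indicator (cball 0 R) \<xi>" for \<xi>
    proof (cases "R < norm \<xi>")
      case True
      then show ?thesis
        using out[OF ta True, of rh h] out[OF tb(1,2) True, of rh h] out[OF tb(1,2) True, of rg ?g] M h g
        by (simp add: indicator_def)
    next
      case False
      have "norm (flow (t - a) h \<xi> - flow (t - b) h \<xi> - complex_of_real ((t - a) - (t - b)) * flow (t - b) ?g \<xi>) \<le> M * ((t - a) - (t - b))\<^sup>2"
        by (rule flow_taylor[OF adm]) (use M ta tb in auto)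
      then show ?thesis using False by (simp add: indicator_def)
    qed
    have "synthesis ?Ha z = synthesis ?rem z + (synthesis ?H z + complex_of_real (b - a) * synthesis ?G z)" for z
      unfolding synthesis_cmult[symmetric]
      using synthesis_diff[OF compactly_bounded_integrable[OF compactly_bounded_diff[OF cbf(2,1)]] compactly_bounded_integrable[OF cbc], of z]
        synthesis_diff[OF compactly_bounded_integrable[OF cbf(2)] compactly_bounded_integrable[OF cbf(1)], of z] by simp
    then have e: "synthesis ?Ha = (\<lambda>z. synthesis ?rem z + (synthesis ?H z + complex_of_real (b - a) * synthesis ?G z))"
      by (intro ext)
    have "L2_inner (W a) (synthesis ?Ha) = L2_inner (W a) (\<lambda>z. synthesis ?rem z + (synthesis ?H z + complex_of_real (b - a) * synthesis ?G z))"
      by (rule arg_cong[OF e])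
    also have "\<dots> = L2_inner (W a) (synthesis ?rem) + (L2_inner (W a) (synthesis ?H) + L2_inner (W a) (\<lambda>z. complex_of_real (b - a) * synthesis ?G z))"
      unfolding L2_inner_add_right[OF W[OF ab(1)] sq[OF cbr] square_integrable_add[OF sq[OF cbf(1)] square_integrable_cmult[OF sq[OF cbf(3)]]]]
        L2_inner_add_right[OF W[OF ab(1)] sq[OF cbf(1)] square_integrable_cmult[OF sq[OF cbf(3)]]] ..
    also have "L2_inner (W a) (\<lambda>z. complex_of_real (b - a) * synthesis ?G z) = complex_of_real (b - a) * ?f a"
      by (simp add: L2_inner_cmult_right)
    finally have second: "L2_inner (W a) (synthesis ?Ha) = L2_inner (W a) (synthesis ?rem) + (L2_inner (W a) (synthesis ?H) + complex_of_real (b - a) * ?f a)" .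
    have third: "norm (L2_inner (W a) (synthesis ?rem)) \<le> K * (b - a)\<^sup>2"
    proof -
      have "norm (L2_inner (W a) (synthesis ?rem)) \<le> L2_norm (W a) * L2_norm (synthesis ?rem)"
        by (intro Cauchy_Schwarz_L2_inner W ab sq cbr)
      also have "\<dots> \<le> C * (sqrt ((2 * pi) ^ DIM('a \<times> 'a)) * (M * (b - a)\<^sup>2 * sqrt (measure lborel (cball 0 R :: ('a \<times> 'a) set))))"
        using bd[rule_format, OF ab(1)] C M(1) by (intro mult_mono L2_norm_synthesis_le cbr rem) auto
      also have "\<dots> = K * (b - a)\<^sup>2" by (simp add: K_def mult_ac)
      finally show ?thesis .
    qed
    \<comment> \<open>The first-order term from the solution and that from the test function are the
      same pairing at time a with opposite signs, so only second-order terms remain.\<close>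
    have "F b - F a = ((L2_inner (W b) (synthesis ?H) - L2_inner (W a) (synthesis ?H)) - complex_of_real (b - a) * ?f a) - L2_inner (W a) (synthesis ?rem)"
      unfolding F_def second by (simp add: algebra_simps)
    also have "norm \<dots> \<le> K * (b - a) * (b - a) + K * (b - a)\<^sup>2"
      by (rule order_trans[OF norm_triangle_ineq4 add_mono[OF first third]])
    finally show ?thesis by (simp add: power2_eq_square algebra_simps)
  qed
  from quadratic_increments_constant[OF t this] have "F t = F 0" by blast
  moreover have "flow 0 h = h"
    by (simp add: flow_def damping_def accum_eq_integral fun_eq_iff)
  \<comment> \<open>That the solution starts from \<open>W0\<close> is contained in the weak
    formulation at time 0, where the time integral vanishes.\<close>
  moreover have "L2_inner (W 0) (synthesis (flow t h)) = L2_inner W0 (synthesis (flow t h))"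
  proof -
    obtain k where k: "admissible (flow t h) k"
      using flow_admissible[OF adm(1) t] by blast
    have "(LINT s:{0..0::real}|lborel. L2_inner (W s) (synthesis (gen (flow t h) k))) = 0"
      using set_borel_integral_eq_integral(2)[OF extended_weak_formulation(1)[OF k ws W0 bd order_refl]] by simp
    then show ?thesis
      using extended_weak_formulation(2)[OF k ws W0 bd order_refl] by simp
  qed
  ultimately show ?thesis by (simp add: F_def)
qed

section \<open>Identification of the Fourier transform of the solution\<close>

lemma evolved_fourier_eq:
  "evolved_fourier \<sigma> W0 t \<xi> = complex_of_real (damping t \<xi>) * L2_fourier W0 (shear t \<xi>)"
proof -
  obtain y q where \<xi>: "\<xi> = (y, q)" by (cases \<xi>)
  have "(LINT u:{0..t}|lborel. Psi \<sigma> (q + u *\<^sub>R y)) = complex_of_real (accum t y q)"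
    unfolding Psi_eq accum_def by (rule set_integral_complex_of_real)
  then show ?thesis
    by (simp add: evolved_fourier_def \<xi> damping_def shear_def exp_of_real)
qed

lemma square_integrable_evolved_fourier:
  assumes "square_integrable W0"
  shows "square_integrable (evolved_fourier \<sigma> W0 t)"
proof -
  have F: "square_integrable (L2_fourier W0)"
    using has_L2_fourier_L2_fourier[OF assms] by (simp add: has_L2_fourier_iff)
  have sh: "square_integrable (\<lambda>\<xi>. L2_fourier W0 (shear t \<xi>))"
    by (rule volume_preserving_square_integrable[OF volume_preserving_shear F])
  note [measurable] = square_integrable_measurable[OF sh]
  have "norm (complex_of_real (damping t \<xi>) * L2_fourier W0 (shear t \<xi>)) \<le> norm (L2_fourier W0 (shear t \<xi>))" for \<xi>
    using damping_pos[of t \<xi>] damping_le_1[of t \<xi>] by (simp add: norm_mult mult_left_le_one_le)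
  then show ?thesis
    unfolding evolved_fourier_eq[abs_def] by (intro square_integrable_dominated[OF sh]) measurable
qed

text \<open>Pairing with a test function h on the Fourier side is pairing with its synthesis in
  phase space. There \<open>duality\<close> moves the evolution onto h, and the change of variables
  by the shear moves it back onto the initial transform. Bumps suffice as test functions.\<close>

theorem fourier_of_solution:
  assumes ws: "weak_solution \<sigma> W0 W" and W0: "square_integrable W0"
    and bd: "\<forall>t\<ge>0. L2_norm (W t) \<le> C" and t: "0 \<le> t"
  shows "has_L2_fourier (W t) (evolved_fourier \<sigma> W0 t)"
proof -
  have W: "square_integrable (W t)" using ws t by (simp add: weak_solution_def)
  let ?E = "evolved_fourier \<sigma> W0 t"
  have E: "square_integrable ?E" by (rule square_integrable_evolved_fourier[OF W0])
  note FW = has_L2_fourier_L2_fourier[OF W] and FW0 = has_L2_fourier_L2_fourier[OF W0]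
  have F: "square_integrable (L2_fourier (W t))" "square_integrable (L2_fourier W0)"
    using FW FW0 by (auto simp: has_L2_fourier_iff)
  note [measurable] = square_integrable_measurable[OF F(2)]
  have orth: "L2_inner (\<lambda>z. L2_fourier (W t) z - ?E z) h = 0" if h: "test_function h" for h
  proof -
    obtain h1 g1 where adm: "admissible h h1" "admissible (gen h h1) g1"
      using h by (rule admissible_gen_test_function)
    have cb: "compactly_bounded h" using adm by (simp add: admissible_def)
    note [measurable] = compactly_bounded_measurable[OF cb]
    have cbf: "compactly_bounded (flow t h)" by (rule compactly_bounded_flow[OF cb t])
    have "L2_inner (L2_fourier (W t)) h = L2_inner (W t) (synthesis h)"
      by (rule L2_inner_synthesis[OF FW compactly_bounded_integrable[OF cb] compactly_bounded_square_integrable[OF cb], symmetric])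
    also have "\<dots> = L2_inner W0 (synthesis (flow t h))"
      by (rule duality[OF adm ws W0 bd t])
    also have "\<dots> = L2_inner (L2_fourier W0) (flow t h)"
      by (rule L2_inner_synthesis[OF FW0 compactly_bounded_integrable[OF cbf] compactly_bounded_square_integrable[OF cbf]])
    \<comment> \<open>At \<open>shear t \<xi>\<close> the adjoint flow reads h at
      \<open>\<xi>\<close> itself, with factor \<open>damping t \<xi>\<close>.\<close>
    also have "\<dots> = (LINT \<xi>|lborel. L2_fourier W0 (shear t \<xi>) * cnj (flow t h (shear t \<xi>)))"
      unfolding L2_inner_def
      by (rule volume_preserving_integral[OF volume_preserving_shear, symmetric]) measurable
    also have "\<dots> = L2_inner ?E h"
      unfolding L2_inner_def flow_def evolved_fourier_eq by (simp add: mult_ac)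
    finally show ?thesis
      using L2_inner_diff_left[OF F(1) E compactly_bounded_square_integrable[OF cb]] by simp
  qed
  have "AE z in lborel. L2_fourier (W t) z - ?E z = 0"
  proof (intro bump_total square_integrable_diff F E)
    fix s :: real and a :: "'a \<times> 'a" assume "0 < s"
    then have "test_function (\<lambda>z. cut (s *\<^sub>R (z - a)))" by (intro test_function_bump) simp
    from orth[OF this] show "L2_inner (\<lambda>z. L2_fourier (W t) z - ?E z) (\<lambda>z. cut (s *\<^sub>R (z - a))) = 0" .
  qed
  then show ?thesis
    by (intro has_L2_fourier_cong_AE[OF FW square_integrable_measurable[OF E]]) auto
qed

end

subsection \<open>Decay of the damping factor\<close>

text \<open>Each coordinate is bounded by the norm, so the function lies below a product of
  one-dimensional functions 1 / (1 + x^2).\<close>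

lemma inverse_weight_integrable:
  "integrable lborel (\<lambda>\<xi> :: 'b::euclidean_space. 1 / (1 + (norm \<xi>)\<^sup>2) ^ DIM('b))"
proof (rule integrable_dominated)
  have "integrable lborel (\<lambda>x::real. inverse (1 + x\<^sup>2))"
    using integrable_inverse_1_plus_square by (simp add: set_integrable_def)
  then show "integrable lborel (\<lambda>\<xi> :: 'b. \<Prod>b\<in>Basis. inverse (1 + (\<xi> \<bullet> b)\<^sup>2))"
    by (intro integrable_prod_coordinates(1)[where f = "\<lambda>_ x. inverse (1 + x\<^sup>2)"])
  fix \<xi> :: 'b
  have "(\<Prod>b\<in>Basis. 1 + (\<xi> \<bullet> b)\<^sup>2) \<le> (\<Prod>b\<in>(Basis :: 'b set). 1 + (norm \<xi>)\<^sup>2)"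
  proof (rule prod_mono)
    fix b :: 'b assume "b \<in> Basis"
    then have "(\<xi> \<bullet> b)\<^sup>2 \<le> (norm \<xi>)\<^sup>2"
      using Basis_le_norm[of b \<xi>] by (intro power2_le_iff_abs_le[THEN iffD2]) auto
    then show "0 \<le> 1 + (\<xi> \<bullet> b)\<^sup>2 \<and> 1 + (\<xi> \<bullet> b)\<^sup>2 \<le> 1 + (norm \<xi>)\<^sup>2" by simp
  qed
  then have "(\<Prod>b\<in>Basis. 1 + (\<xi> \<bullet> b)\<^sup>2) \<le> (1 + (norm \<xi>)\<^sup>2) ^ DIM('b)" by simp
  moreover have "0 < (\<Prod>b\<in>Basis. 1 + (\<xi> \<bullet> b)\<^sup>2)"
    by (intro prod_pos) (auto intro: add_pos_nonneg)
  ultimately have "1 / (1 + (norm \<xi>)\<^sup>2) ^ DIM('b) \<le> 1 / (\<Prod>b\<in>Basis. 1 + (\<xi> \<bullet> b)\<^sup>2)"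
    by (intro divide_left_mono) (auto intro: mult_pos_pos order_less_le_trans)
  also have "\<dots> = (\<Prod>b\<in>Basis. inverse (1 + (\<xi> \<bullet> b)\<^sup>2))"
    by (simp add: inverse_eq_divide prod_dividef)
  finally show "norm (1 / (1 + (norm \<xi>)\<^sup>2) ^ DIM('b)) \<le> (\<Prod>b\<in>Basis. inverse (1 + (\<xi> \<bullet> b)\<^sup>2))" by simp
qed measurable

definition weight :: "nat \<Rightarrow> 'b::euclidean_space \<Rightarrow> real" where
  "weight N \<xi> = (1 + (norm \<xi>)\<^sup>2) ^ N"

lemma weight_ge_1: "1 \<le> weight N \<xi>"
  by (simp add: weight_def one_le_power)

lemma weight_pos: "0 < weight N \<xi>"
  using weight_ge_1[of N \<xi>] by linarith

lemma weight_add: "weight (M + N) \<xi> = weight M \<xi> * weight N \<xi>"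
  by (simp add: weight_def power_add)

lemma norm_power_le_weight: "norm \<xi> ^ N \<le> weight N \<xi>"
proof -
  have "norm \<xi> \<le> 1 + (norm \<xi>)\<^sup>2"
  proof -
    have "2 * norm \<xi> \<le> 1 + (norm \<xi>)\<^sup>2"
      using zero_le_power2[of "norm \<xi> - 1"] by (simp add: power2_eq_square algebra_simps)
    then show ?thesis using norm_ge_zero[of \<xi>] by linarith
  qed
  then show ?thesis unfolding weight_def by (intro power_mono) auto
qed

lemma borel_measurable_weight [measurable]: "weight N \<in> borel_measurable borel"
  unfolding weight_def[abs_def] by measurable

text \<open>The square-integrable factor that converts weighted L2 bounds into L1 bounds by the
  Cauchy-Schwarz inequality; complex-valued to fit \<open>square_integrable\<close>.\<close>

definition inverse_weight :: "'b::euclidean_space \<Rightarrow> complex" where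
  "inverse_weight \<xi> = complex_of_real (1 / weight DIM('b) \<xi>)"

lemma square_integrable_inverse_weight: "square_integrable (inverse_weight :: 'b::euclidean_space \<Rightarrow> complex)"
  unfolding square_integrable_def
proof
  show m: "inverse_weight \<in> borel_measurable (borel :: 'b measure)"
    unfolding inverse_weight_def[abs_def] by measurable
  show "integrable lborel (\<lambda>\<xi> :: 'b. (norm (inverse_weight \<xi>))\<^sup>2)"
  proof (rule integrable_dominated[OF inverse_weight_integrable])
    show "(\<lambda>\<xi> :: 'b. (norm (inverse_weight \<xi>))\<^sup>2) \<in> borel_measurable lborel" using m by measurable
    fix \<xi> :: 'b
    let ?w = "1 / weight DIM('b) \<xi>"
    have w: "0 \<le> ?w" "?w \<le> 1" using weight_ge_1[of "DIM('b)" \<xi>] by auto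
    have "norm ((norm (inverse_weight \<xi>))\<^sup>2) = ?w * ?w"
      using w by (simp add: inverse_weight_def power2_eq_square del: of_real_divide)
    also have "\<dots> \<le> 1 * ?w" using w by (intro mult_right_mono) auto
    finally show "norm ((norm (inverse_weight \<xi>))\<^sup>2) \<le> 1 / (1 + (norm \<xi>)\<^sup>2) ^ DIM('b)" by (simp add: weight_def)
  qed
qed

text \<open>Passing from L2 to L1 costs \<open>DIM('b)\<close> further powers of the weight.\<close>

lemma moment_bound:
  fixes g :: "'b::euclidean_space \<Rightarrow> complex"
  assumes "g \<in> borel_measurable borel" and w: "square_integrable (\<lambda>\<xi>. complex_of_real (weight (N + DIM('b)) \<xi>) * g \<xi>)"
  shows "integrable lborel (\<lambda>\<xi>. norm \<xi> ^ N * norm (g \<xi>))"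
    and "(LINT \<xi>|lborel. norm \<xi> ^ N * norm (g \<xi>)) \<le>
      L2_norm (inverse_weight :: 'b \<Rightarrow> complex) * L2_norm (\<lambda>\<xi>. complex_of_real (weight (N + DIM('b)) \<xi>) * g \<xi>)"
proof -
  note [measurable] = assms(1)
  let ?h = "\<lambda>\<xi>. complex_of_real (weight (N + DIM('b)) \<xi>) * g \<xi>"
  have le: "norm (norm \<xi> ^ N * norm (g \<xi>)) \<le> norm (inverse_weight \<xi>) * norm (?h \<xi>)" for \<xi>
  proof -
    have "norm (inverse_weight \<xi>) * norm (?h \<xi>) = weight N \<xi> * norm (g \<xi>)"
      using weight_pos[of "DIM('b)" \<xi>] weight_pos[of N \<xi>]
      by (simp add: inverse_weight_def norm_mult norm_divide weight_add abs_mult)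
    then show ?thesis
      using mult_right_mono[OF norm_power_le_weight[of \<xi> N] norm_ge_zero[of "g \<xi>"]] by simp
  qed
  have i: "integrable lborel (\<lambda>\<xi>. norm (inverse_weight \<xi>) * norm (?h \<xi>))"
    using integrable_norm[OF integrable_mult_square_integrable[OF square_integrable_inverse_weight w]] by (simp only: norm_mult)
  show i2: "integrable lborel (\<lambda>\<xi>. norm \<xi> ^ N * norm (g \<xi>))"
    by (rule integrable_dominated[OF i _ le]) measurable
  have "(LINT \<xi>|lborel. norm \<xi> ^ N * norm (g \<xi>)) \<le> (LINT \<xi>|lborel. norm (inverse_weight \<xi>) * norm (?h \<xi>))"
    using le by (intro integral_mono i i2) simp
  also have "\<dots> \<le> L2_norm (inverse_weight :: 'b \<Rightarrow> complex) * L2_norm ?h"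
    by (rule Cauchy_Schwarz_norm_mult[OF square_integrable_inverse_weight w])
  finally show "(LINT \<xi>|lborel. norm \<xi> ^ N * norm (g \<xi>)) \<le> L2_norm (inverse_weight :: 'b \<Rightarrow> complex) * L2_norm ?h" .
qed

text \<open>For r > 1 a single term of the exponential series at a r^\<open>\<theta>\<close>, of
  high enough order, already dominates the polynomial.\<close>

lemma stretched_exponential_bound:
  fixes a \<theta> A :: real
  assumes "0 < a" "0 < \<theta>"
  shows "\<exists>B>0. \<forall>r\<ge>0. (1 + r\<^sup>2) ^ N * exp (A - a * r powr \<theta>) \<le> B"
proof -
  \<comment> \<open>Of order at least 2 N / \<open>\<theta>\<close>, so that the k-th power of
    r^\<open>\<theta>\<close> dominates r^(2 N) for r at least 1.\<close>
  obtain k :: nat where k: "2 * real N / \<theta> < real k" using reals_Archimedean2 by blast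
  then have kN: "2 * real N \<le> \<theta> * real k" using assms by (simp add: field_simps)
  define B where "B = 2 ^ N * exp A * (1 + fact k / a ^ k)"
  have B: "0 < B" unfolding B_def using assms by (intro mult_pos_pos add_pos_nonneg) auto
  have "(1 + r\<^sup>2) ^ N * exp (A - a * r powr \<theta>) \<le> B" if r: "0 \<le> r" for r
  proof (cases "r \<le> 1")
    case True
    have "(1 + r\<^sup>2) ^ N \<le> 2 ^ N"
      using r True by (intro power_mono) (auto simp: power_le_one)
    moreover have "exp (A - a * r powr \<theta>) \<le> exp A" using assms by simp
    ultimately have "(1 + r\<^sup>2) ^ N * exp (A - a * r powr \<theta>) \<le> 2 ^ N * exp A"
      by (intro mult_mono) auto
    also have "\<dots> \<le> B" unfolding B_def using assms by (simp add: field_simps)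
    finally show ?thesis .
  next
    case False
    then have r1: "1 \<le> r" "0 < r" by auto
    let ?x = "a * r powr \<theta>"
    have "?x ^ k / fact k \<le> exp ?x" using assms by (intro power_div_fact_le_exp) simp
    then have "r powr (\<theta> * real k) \<le> fact k / a ^ k * exp ?x"
      using assms r1 by (simp add: power_mult_distrib powr_power field_simps)
    moreover have "r ^ (2 * N) \<le> r powr (\<theta> * real k)"
      using kN r1 by (subst powr_realpow[symmetric]) (auto intro: powr_mono)
    moreover have "(1 + r\<^sup>2) ^ N \<le> (2 * r\<^sup>2) ^ N"
      using r1 by (intro power_mono) (auto simp: one_le_power)
    moreover have "(2 * r\<^sup>2) ^ N = 2 ^ N * r ^ (2 * N)" by (simp add: power_mult_distrib power_mult)
    ultimately have "(1 + r\<^sup>2) ^ N \<le> 2 ^ N * (fact k / a ^ k * exp ?x)"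
      by (smt (verit) mult_left_mono zero_le_power)
    then have "(1 + r\<^sup>2) ^ N * exp (A - ?x) \<le> 2 ^ N * (fact k / a ^ k * exp ?x) * exp (A - ?x)"
      by (intro mult_right_mono) auto
    also have "\<dots> = 2 ^ N * exp A * (fact k / a ^ k)"
      by (simp add: exp_diff)
    also have "\<dots> \<le> B" unfolding B_def using assms by (intro mult_left_mono) auto
    finally show ?thesis .
  qed
  then show ?thesis using B by blast
qed

context scattering_kernel
begin

text \<open>Along the line \<open>u \<mapsto> q + u y\<close> the point stays away from 0, relative to the size of \<open>(y, q)\<close>, either in
  the first or in the last third of the time interval.\<close>

lemma accum_decay:
  assumes c: "0 < c" and \<theta>: "0 < \<theta>" and psi: "\<And>q. psi q \<le> C0 - c * norm q powr \<theta>"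
    and t0: "0 < t0" "t0 \<le> t"
  shows "accum t y q \<le> t0 / 3 * C0 - t0 / 3 * c * (min (1 / 3) (t0 / 6) / 2) powr \<theta> * norm (y, q) powr \<theta>"
proof -
  \<comment> \<open>If the line comes closer than \<open>\<epsilon> * M\<close> to 0 in both outer
    thirds, the bound \<open>t0 / 6\<close> forces |y| < M and the bound 1 / 3 forces |q| < M,
    contradicting the choice of M.\<close>
  define \<epsilon> where "\<epsilon> = min (1 / 3) (t0 / 6)"
  have \<epsilon>: "0 < \<epsilon>" "\<epsilon> \<le> 1 / 3" "\<epsilon> \<le> t0 / 6" using t0 by (auto simp: \<epsilon>_def)
  define M where "M = max (norm y) (norm q)"
  have M: "0 \<le> M" "norm y \<le> M" "norm q \<le> M" by (auto simp: M_def max_def)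
  have alt: "(\<forall>u\<in>{0..t0 / 3}. \<epsilon> * M \<le> norm (q + u *\<^sub>R y)) \<or> (\<forall>u\<in>{2 * t0 / 3..t0}. \<epsilon> * M \<le> norm (q + u *\<^sub>R y))"
  proof (rule ccontr)
    assume "\<not> ?thesis"
    then obtain u1 u2 where u1: "0 \<le> u1" "u1 \<le> t0 / 3" "norm (q + u1 *\<^sub>R y) < \<epsilon> * M"
      and u2: "2 * t0 / 3 \<le> u2" "u2 \<le> t0" "norm (q + u2 *\<^sub>R y) < \<epsilon> * M" by (auto simp: not_le)
    have "(u2 - u1) *\<^sub>R y = (q + u2 *\<^sub>R y) - (q + u1 *\<^sub>R y)" by (simp add: algebra_simps)
    then have "norm ((u2 - u1) *\<^sub>R y) \<le> norm (q + u2 *\<^sub>R y) + norm (q + u1 *\<^sub>R y)"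
      by (metis norm_triangle_ineq4)
    then have 1: "(u2 - u1) * norm y < 2 * (\<epsilon> * M)" using u1 u2 t0 by simp
    have "t0 / 3 * norm y \<le> (u2 - u1) * norm y" using u1 u2 by (intro mult_right_mono) auto
    with 1 have y: "t0 / 3 * norm y < 2 * (\<epsilon> * M)" by linarith
    also have "\<dots> \<le> 2 * (t0 / 6 * M)" using \<epsilon> M by (intro mult_left_mono mult_right_mono) auto
    finally have yM: "norm y < M" using t0 by simp
    have "q = (q + u1 *\<^sub>R y) - u1 *\<^sub>R y" by simp
    then have "norm q \<le> norm (q + u1 *\<^sub>R y) + norm (u1 *\<^sub>R y)" by (metis norm_triangle_ineq4)
    also have "norm (u1 *\<^sub>R y) \<le> t0 / 3 * norm y" 
      using mult_right_mono[OF u1(2) norm_ge_zero[of y]] u1(1) by simp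
    finally have "norm q < 3 * (\<epsilon> * M)" using u1(3) y by linarith
    also have "\<dots> \<le> 3 * (1 / 3 * M)" using \<epsilon> M by (intro mult_left_mono mult_right_mono) auto
    finally have "norm q < M" by simp
    with yM show False by (simp add: M_def)
  qed
  have step: "accum t y q \<le> t0 / 3 * (C0 - c * (\<epsilon> * M) powr \<theta>)"
  proof -
    have le: "psi (q + u *\<^sub>R y) \<le> C0 - c * (\<epsilon> * M) powr \<theta>" if "\<epsilon> * M \<le> norm (q + u *\<^sub>R y)" for u
    proof -
      have "(\<epsilon> * M) powr \<theta> \<le> norm (q + u *\<^sub>R y) powr \<theta>"
        using that \<theta> \<epsilon> M by (intro powr_mono2) auto
      then have "c * (\<epsilon> * M) powr \<theta> \<le> c * norm (q + u *\<^sub>R y) powr \<theta>" using c by simp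
      then show ?thesis using psi[of "q + u *\<^sub>R y"] by linarith
    qed
    from alt show ?thesis
    proof
      assume "\<forall>u\<in>{0..t0 / 3}. \<epsilon> * M \<le> norm (q + u *\<^sub>R y)"
      then have "accum t y q \<le> (t0 / 3 - 0) * (C0 - c * (\<epsilon> * M) powr \<theta>)"
        using t0 le by (intro accum_le_subinterval) auto
      then show ?thesis by simp
    next
      assume "\<forall>u\<in>{2 * t0 / 3..t0}. \<epsilon> * M \<le> norm (q + u *\<^sub>R y)"
      then have "accum t y q \<le> (t0 - 2 * t0 / 3) * (C0 - c * (\<epsilon> * M) powr \<theta>)"
        using t0 le by (intro accum_le_subinterval) auto
      then show ?thesis by simp
    qed
  qed
  \<comment> \<open>Passing from the maximum M back to the norm of the pair costs the factor 2 in
    the constant.\<close>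
  have "norm (y, q) \<le> norm y + norm q" by (simp add: norm_Pair sqrt_sum_squares_le_sum)
  also have "\<dots> \<le> 2 * M" using M by simp
  finally have "\<epsilon> / 2 * norm (y, q) \<le> \<epsilon> * M" using \<epsilon> by (simp add: field_simps)
  then have "(\<epsilon> / 2 * norm (y, q)) powr \<theta> \<le> (\<epsilon> * M) powr \<theta>"
    using \<theta> \<epsilon> by (intro powr_mono2) auto
  then have "(\<epsilon> / 2) powr \<theta> * norm (y, q) powr \<theta> \<le> (\<epsilon> * M) powr \<theta>"
    by (simp only: powr_mult)
  then have "t0 / 3 * c * ((\<epsilon> / 2) powr \<theta> * norm (y, q) powr \<theta>) \<le> t0 / 3 * c * (\<epsilon> * M) powr \<theta>"
    using t0 c by (intro mult_left_mono) auto
  then show ?thesis using step unfolding \<epsilon>_def[symmetric] by (simp add: algebra_simps)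
qed

text \<open>The decay rate is already reached on the time interval up to \<open>t0\<close>; later
  times only add nonpositive contributions, so one bound serves all of them.\<close>

lemma weighted_damping_bound:
  assumes c: "0 < c" and \<theta>: "0 < \<theta>" and psi: "\<And>q. psi q \<le> C0 - c * norm q powr \<theta>" and t0: "0 < t0"
  shows "\<exists>B>0. \<forall>t\<ge>t0. \<forall>\<xi>. weight N \<xi> * damping t \<xi> \<le> B"
proof -
  define a where "a = t0 / 3 * c * (min (1 / 3) (t0 / 6) / 2) powr \<theta>"
  have a: "0 < a" using c t0 by (simp add: a_def)
  obtain B where B: "B > 0" "\<And>r. 0 \<le> r \<Longrightarrow> (1 + r\<^sup>2) ^ N * exp (t0 / 3 * C0 - a * r powr \<theta>) \<le> B"
    using stretched_exponential_bound[OF a \<theta>, of N "t0 / 3 * C0"] by blast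
  have "weight N \<xi> * damping t \<xi> \<le> B" if "t \<ge> t0" for t \<xi>
  proof -
    have "damping t \<xi> \<le> exp (t0 / 3 * C0 - a * norm \<xi> powr \<theta>)"
      unfolding damping_def a_def using accum_decay[OF c \<theta> psi t0 that, of "fst \<xi>" "snd \<xi>"] by simp
    then have "weight N \<xi> * damping t \<xi> \<le> weight N \<xi> * exp (t0 / 3 * C0 - a * norm \<xi> powr \<theta>)"
      using weight_pos[of N \<xi>] by simp
    also have "\<dots> \<le> B" unfolding weight_def by (rule B) simp
    finally show ?thesis .
  qed
  then show ?thesis using B(1) by blast
qed

lemma damping_tendsto:
  assumes "0 < t" "X \<longlonglongrightarrow> t" "\<And>n. 0 < X n"
  shows "(\<lambda>n. damping (X n) \<xi>) \<longlonglongrightarrow> damping t \<xi>"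
proof -
  let ?P = "\<lambda>v. integral {-1..v} (\<lambda>w. psi (snd \<xi> + w *\<^sub>R fst \<xi>))"
  have eq: "accum s (fst \<xi>) (snd \<xi>) = ?P s - ?P 0" if "0 < s" for s
    using accum_line[of s 1 s "fst \<xi>" "snd \<xi>"] that by simp
  have "isCont ?P t"
    using DERIV_isCont[OF DERIV_line_integral[of 1 t]] assms(1) by simp
  then have "(\<lambda>n. ?P (X n)) \<longlonglongrightarrow> ?P t"
    using assms(2) by (rule isCont_tendsto_compose)
  then have "(\<lambda>n. exp (?P (X n) - ?P 0)) \<longlonglongrightarrow> exp (?P t - ?P 0)"
    by (intro tendsto_intros)
  then show ?thesis
    using eq assms(1,3) by (simp add: damping_def)
qed

end

subsection \<open>Regularity\<close>

text \<open>The Sobolev norm squared contains the weight once, the right-hand side contains it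
  squared. As every order m is treated, this loss is harmless and half powers of the weight are
  avoided; the power of \<open>2 * pi\<close> is at least 1.\<close>

lemma sobolev_of_fourier:
  fixes f :: "'b::euclidean_space \<Rightarrow> complex"
  assumes fF: "has_L2_fourier f F" and w: "square_integrable (\<lambda>\<xi>. complex_of_real (weight m \<xi>) * F \<xi>)"
  shows "f \<in> sobolev_space m" "sobolev_norm m f \<le> L2_norm (\<lambda>\<xi>. complex_of_real (weight m \<xi>) * F \<xi>)"
proof -
  have f: "square_integrable f" "square_integrable F" using fF by (auto simp: has_L2_fourier_iff)
  note Ff = has_L2_fourier_L2_fourier[OF f(1)]
  then have "square_integrable (L2_fourier f)" by (simp add: has_L2_fourier_iff)
  note [measurable] = square_integrable_measurable[OF this] square_integrable_measurable[OF f(2)]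
  have ae: "AE \<xi> in lborel. L2_fourier f \<xi> = F \<xi>" by (rule has_L2_fourier_unique[OF Ff fF])
  let ?I = "\<lambda>\<xi>. (1 + (norm \<xi>)\<^sup>2) ^ m * (norm (F \<xi>))\<^sup>2"
  have le: "norm (?I \<xi>) \<le> (norm (complex_of_real (weight m \<xi>) * F \<xi>))\<^sup>2" for \<xi>
  proof -
    have "weight m \<xi> * (norm (F \<xi>))\<^sup>2 \<le> weight m \<xi> * (weight m \<xi> * (norm (F \<xi>))\<^sup>2)"
      using weight_ge_1[of m \<xi>] by (intro mult_left_mono) (auto simp: mult_le_cancel_right1)
    also have "\<dots> = (norm (complex_of_real (weight m \<xi>) * F \<xi>))\<^sup>2"
      using weight_pos[of m \<xi>] by (simp add: norm_mult power_mult_distrib power2_eq_square)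
    finally have "weight m \<xi> * (norm (F \<xi>))\<^sup>2 \<le> (norm (complex_of_real (weight m \<xi>) * F \<xi>))\<^sup>2" .
    moreover have "norm (?I \<xi>) = weight m \<xi> * (norm (F \<xi>))\<^sup>2"
      using weight_pos[of m \<xi>] by (simp add: weight_def abs_mult)
    ultimately show ?thesis by (simp only:)
  qed
  note iw = square_integrable_integrable_sq[OF w]
  have i: "integrable lborel ?I" by (rule integrable_dominated[OF iw _ le]) measurable
  have i': "integrable lborel (\<lambda>\<xi>. (1 + (norm \<xi>)\<^sup>2) ^ m * (norm (L2_fourier f \<xi>))\<^sup>2)"
    using ae by (intro integrable_cong_AE_imp[OF i]) auto
  then show "f \<in> sobolev_space m" using f by (simp add: sobolev_space_def)
  have "(LINT \<xi>|lborel. (1 + (norm \<xi>)\<^sup>2) ^ m * (norm (L2_fourier f \<xi>))\<^sup>2) = (LINT \<xi>|lborel. ?I \<xi>)"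
    using ae by (intro integral_cong_AE) auto
  also have "\<dots> \<le> (LINT \<xi>|lborel. (norm (complex_of_real (weight m \<xi>) * F \<xi>))\<^sup>2)"
    by (intro integral_mono i iw order_trans[OF abs_ge_self le[unfolded real_norm_def]])
  finally have 1: "(LINT \<xi>|lborel. (1 + (norm \<xi>)\<^sup>2) ^ m * (norm (L2_fourier f \<xi>))\<^sup>2) \<le> (L2_norm (\<lambda>\<xi>. complex_of_real (weight m \<xi>) * F \<xi>))\<^sup>2"
    unfolding L2_norm_power2 .
  have "(1::real) \<le> (2 * pi) ^ DIM('b)" using pi_gt3 by (intro one_le_power) auto
  then have "1 / (2 * pi) ^ DIM('b) \<le> (1::real)" by simp
  moreover have "0 \<le> (LINT \<xi>|lborel. (1 + (norm \<xi>)\<^sup>2) ^ m * (norm (L2_fourier f \<xi>))\<^sup>2)"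
    by (rule integral_nonneg_AE) (auto intro!: mult_nonneg_nonneg)
  ultimately have "1 / (2 * pi) ^ DIM('b) * (LINT \<xi>|lborel. (1 + (norm \<xi>)\<^sup>2) ^ m * (norm (L2_fourier f \<xi>))\<^sup>2)
     \<le> 1 * (LINT \<xi>|lborel. (1 + (norm \<xi>)\<^sup>2) ^ m * (norm (L2_fourier f \<xi>))\<^sup>2)"
    by (intro mult_right_mono) auto
  with 1 have "sobolev_norm m f \<le> sqrt ((L2_norm (\<lambda>\<xi>. complex_of_real (weight m \<xi>) * F \<xi>))\<^sup>2)"
    unfolding sobolev_norm_def by (intro real_sqrt_le_mono) linarith
  then show "sobolev_norm m f \<le> L2_norm (\<lambda>\<xi>. complex_of_real (weight m \<xi>) * F \<xi>)" by simp
qed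

text \<open>For integrable \<open>F\<close> the truncated inverse integrals converge at every point,
  and their limit in the mean must agree with the pointwise one almost everywhere.\<close>

lemma inverse_fourier_integrable:
  fixes f :: "'b::euclidean_space \<Rightarrow> complex"
  assumes Ff: "has_L2_inverse_fourier F f" and i: "integrable lborel F"
  shows "AE z in lborel. f z = 1 / (2 * pi) ^ DIM('b) * synthesis F z"
proof (rule L2_tendsto_pointwise_unique)
  let ?S = "\<lambda>n z. 1 / (2 * pi) ^ DIM('b) * (LINT \<xi>:ball 0 (real n)|lborel. iexp (z \<bullet> \<xi>) * F \<xi>)"
  show "L2_tendsto ?S f" using Ff by (simp add: has_L2_inverse_fourier_def)
  show "f \<in> borel_measurable borel" using Ff by (simp add: has_L2_inverse_fourier_def square_integrable_def)
  note [measurable] = borel_measurable_integrable[OF i]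
  have [measurable]: "F \<in> borel_measurable borel" using borel_measurable_integrable[OF i] by simp
  have eq: "(LINT \<xi>:ball 0 (real n)|lborel. iexp (z \<bullet> \<xi>) * F \<xi>) = synthesis (truncate F n) z" for n z
    unfolding synthesis_def set_lebesgue_integral_def
    by (intro Bochner_Integration.integral_cong refl) (simp add: indicator_def)
  have [measurable]: "truncate F n \<in> borel_measurable borel" for n
    by (intro borel_measurable_times borel_measurable_indicator) auto
  show "?S n \<in> borel_measurable borel" for n
    unfolding eq by measurable
  show "AE z in lborel. (\<lambda>n. ?S n z) \<longlonglongrightarrow> 1 / (2 * pi) ^ DIM('b) * synthesis F z"
  proof (intro always_eventually allI tendsto_mult tendsto_const)
    fix z :: 'b
    have "(\<lambda>n. LINT \<xi>|lborel. iexp (z \<bullet> \<xi>) * truncate F n \<xi>) \<longlonglongrightarrow> (LINT \<xi>|lborel. iexp (z \<bullet> \<xi>) * F \<xi>)"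
    proof (rule integral_dominated_convergence[where w = "\<lambda>\<xi>. norm (F \<xi>)"])
      show "AE \<xi> in lborel. (\<lambda>n. iexp (z \<bullet> \<xi>) * truncate F n \<xi>) \<longlonglongrightarrow> iexp (z \<bullet> \<xi>) * F \<xi>"
      proof (intro always_eventually allI tendsto_mult tendsto_const)
        fix \<xi> :: 'b
        obtain N :: nat where N: "norm \<xi> < real N" using reals_Archimedean2 by blast
        have "\<forall>\<^sub>F n in sequentially. truncate F n \<xi> = F \<xi>"
          using eventually_ge_at_top[of N] by eventually_elim (use N in \<open>simp add: indicator_def\<close>)
        then show "(\<lambda>n. truncate F n \<xi>) \<longlonglongrightarrow> F \<xi>" by (rule tendsto_eventually)
      qed
      show "AE \<xi> in lborel. norm (iexp (z \<bullet> \<xi>) * truncate F n \<xi>) \<le> norm (F \<xi>)" for n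
        by (auto simp: norm_mult indicator_def)
    qed (use i in auto)
    then show "(\<lambda>n. LINT \<xi>:ball 0 (real n)|lborel. iexp (z \<bullet> \<xi>) * F \<xi>) \<longlonglongrightarrow> synthesis F z"
      unfolding eq by (simp only: synthesis_def)
  qed
qed

lemma square_integrable_L2_fourier:
  "square_integrable f \<Longrightarrow> square_integrable (L2_fourier f)"
  using has_L2_fourier_L2_fourier[of f] by (simp add: has_L2_fourier_iff)

lemma rapidly_integrable_cmult:
  assumes "rapidly_integrable h" shows "rapidly_integrable (\<lambda>\<xi>. a * h \<xi>)"
  unfolding rapidly_integrable_def
proof (intro conjI allI)
  have [measurable]: "h \<in> borel_measurable borel" using assms by (simp only: rapidly_integrable_def)
  show "(\<lambda>\<xi>. a * h \<xi>) \<in> borel_measurable borel" by measurable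
  fix N
  have "integrable lborel (\<lambda>\<xi>. norm \<xi> ^ N * norm (h \<xi>))" using assms by (simp only: rapidly_integrable_def)
  then have "integrable lborel (\<lambda>\<xi>. norm a * (norm \<xi> ^ N * norm (h \<xi>)))" by (rule integrable_mult_right)
  then show "integrable lborel (\<lambda>\<xi>. norm \<xi> ^ N * norm (a * h \<xi>))"
    by (simp only: norm_mult mult.left_commute)
qed

locale damped_kernel = scattering_kernel +
  fixes c C0 \<theta> :: real
  assumes c_pos: "0 < c" and \<theta>_pos: "0 < \<theta>"
    and psi_decay: "psi q \<le> C0 - c * norm q powr \<theta>"
begin

lemma weighted_damping:
  "0 < t0 \<Longrightarrow> \<exists>B>0. \<forall>t\<ge>t0. \<forall>\<xi>. weight N \<xi> * damping t \<xi> \<le> B"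
  by (rule weighted_damping_bound[OF c_pos \<theta>_pos psi_decay])

definition weighted_fourier :: "nat \<Rightarrow> ('a \<times> 'a \<Rightarrow> complex) \<Rightarrow> real \<Rightarrow> 'a \<times> 'a \<Rightarrow> complex" where
  "weighted_fourier N W0 t \<xi> = complex_of_real (weight N \<xi>) * evolved_fourier \<sigma> W0 t \<xi>"

text \<open>The damping absorbs the weight; what is left is the initial transform moved by a shear,
  whose norm does not depend on time.\<close>

lemma weighted_fourier_le:
  assumes "\<forall>t\<ge>t0. \<forall>\<xi>. weight N \<xi> * damping t \<xi> \<le> B" "t0 \<le> t"
  shows "norm (weighted_fourier N W0 t \<xi>) \<le> norm (complex_of_real B * L2_fourier W0 (shear t \<xi>))"
proof -
  have w: "0 \<le> weight N \<xi> * damping t \<xi>" "weight N \<xi> * damping t \<xi> \<le> B"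
    using assms(1)[rule_format, OF assms(2), of \<xi>] weight_pos[of N \<xi>] damping_pos[of t \<xi>] by auto
  have "norm (weighted_fourier N W0 t \<xi>) = (weight N \<xi> * damping t \<xi>) * norm (L2_fourier W0 (shear t \<xi>))"
    using weight_pos[of N \<xi>] damping_pos[of t \<xi>]
    by (simp add: weighted_fourier_def evolved_fourier_eq norm_mult)
  also have "\<dots> \<le> B * norm (L2_fourier W0 (shear t \<xi>))"
    using w by (intro mult_right_mono) auto
  also have "\<dots> = norm (complex_of_real B * L2_fourier W0 (shear t \<xi>))"
    using w by (simp add: norm_mult)
  finally show ?thesis .
qed

lemma borel_measurable_weighted_fourier:
  "square_integrable W0 \<Longrightarrow> weighted_fourier N W0 t \<in> borel_measurable borel"
  unfolding weighted_fourier_def[abs_def]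
  using square_integrable_measurable[OF square_integrable_evolved_fourier, of W0 t] by measurable

lemma weighted_fourier_bounded:
  assumes W0: "square_integrable W0" and t0: "0 < t0"
  shows "\<exists>C. \<forall>t\<ge>t0. square_integrable (weighted_fourier N W0 t) \<and> L2_norm (weighted_fourier N W0 t) \<le> C"
proof -
  obtain B where B: "B > 0" "\<forall>t\<ge>t0. \<forall>\<xi>. weight N \<xi> * damping t \<xi> \<le> B"
    using weighted_damping[OF t0] by blast
  note F = square_integrable_L2_fourier[OF W0]
  have "square_integrable (weighted_fourier N W0 t) \<and>
      L2_norm (weighted_fourier N W0 t) \<le> L2_norm (\<lambda>\<xi>. complex_of_real B * L2_fourier W0 \<xi>)" if t: "t \<ge> t0" for t
  proof
    let ?G = "\<lambda>\<xi>. complex_of_real B * L2_fourier W0 \<xi>"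
    have G: "square_integrable ?G" by (rule square_integrable_cmult[OF F])
    have G': "square_integrable (\<lambda>\<xi>. ?G (shear t \<xi>))"
      by (rule volume_preserving_square_integrable[OF volume_preserving_shear G])
    show "square_integrable (weighted_fourier N W0 t)"
      by (rule square_integrable_dominated[OF G' borel_measurable_weighted_fourier[OF W0] weighted_fourier_le[OF B(2) t]])
    have "L2_norm (weighted_fourier N W0 t) \<le> L2_norm (\<lambda>\<xi>. ?G (shear t \<xi>))"
      by (rule L2_norm_mono[OF G' borel_measurable_weighted_fourier[OF W0] weighted_fourier_le[OF B(2) t]])
    also have "\<dots> = L2_norm ?G"
      by (rule volume_preserving_L2_norm[OF volume_preserving_shear G])
    finally show "L2_norm (weighted_fourier N W0 t) \<le> L2_norm ?G" .
  qed
  then show ?thesis by blast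
qed

lemma square_integrable_weighted_fourier:
  "square_integrable W0 \<Longrightarrow> 0 < t \<Longrightarrow> square_integrable (weighted_fourier N W0 t)"
  using weighted_fourier_bounded[of W0 t N] by blast

text \<open>Time enters through the damping and through the shear. The damping converges pointwise
  under a common bound; the sheared transform is only square-integrable and calls for continuity in
  the mean.\<close>

lemma weighted_fourier_L2_tendsto:
  assumes W0: "square_integrable W0" and t: "0 < t" and X: "X \<longlonglongrightarrow> t" "\<And>n. t / 2 < X n"
  shows "L2_tendsto (\<lambda>n. weighted_fourier N W0 (X n)) (weighted_fourier N W0 t)"
proof -
  have t2: "0 < t / 2" using t by simp
  obtain B where B: "B > 0" "\<forall>s\<ge>t/2. \<forall>\<xi>. weight N \<xi> * damping s \<xi> \<le> B"
    using weighted_damping[OF t2] by blast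
  have Xpos: "0 < X n" for n using X(2)[of n] t by linarith
  define u where "u \<xi> = L2_fourier W0 (shear t \<xi>)" for \<xi>
  have u: "square_integrable u"
    unfolding u_def[abs_def]
    by (rule volume_preserving_square_integrable[OF volume_preserving_shear square_integrable_L2_fourier[OF W0]])
  note [measurable] = square_integrable_measurable[OF u]
  define d where "d s \<xi> = complex_of_real (weight N \<xi> * damping s \<xi>)" for s \<xi>
  have [measurable]: "d s \<in> borel_measurable borel" for s
    unfolding d_def[abs_def] by measurable
  have dle: "norm (d s \<xi>) \<le> B" if "t / 2 \<le> s" for s \<xi>
    using B(2)[rule_format, OF that, of \<xi>] weight_pos[of N \<xi>] damping_pos[of s \<xi>] by (simp add: d_def norm_mult)
  let ?T = "\<lambda>n. shear (X n - t)"
  have uT: "square_integrable (\<lambda>\<xi>. u (?T n \<xi>))" for n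
    by (rule volume_preserving_square_integrable[OF volume_preserving_shear u])
  \<comment> \<open>Separates the two effects: the multiplier varies on the fixed function
    \<open>u\<close>, and the sheared difference of \<open>u\<close> carries a bounded
    multiplier.\<close>
  have eqX: "weighted_fourier N W0 (X n) \<xi> = d (X n) \<xi> * u \<xi> - d (X n) \<xi> * (u \<xi> - u (?T n \<xi>))" for n \<xi>
    by (simp add: weighted_fourier_def evolved_fourier_eq d_def u_def algebra_simps)
  have eqt: "weighted_fourier N W0 t \<xi> = d t \<xi> * u \<xi> - 0" for \<xi>
    by (simp add: weighted_fourier_def evolved_fourier_eq d_def u_def)
  have mult2: "square_integrable (\<lambda>\<xi>. d s \<xi> * f \<xi>)" if "square_integrable f" "t / 2 \<le> s" for f s
  proof (rule square_integrable_dominated[OF square_integrable_cmult[OF that(1), of "complex_of_real B"]])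
    note [measurable] = square_integrable_measurable[OF that(1)]
    show "(\<lambda>\<xi>. d s \<xi> * f \<xi>) \<in> borel_measurable borel" by measurable
    show "norm (d s \<xi> * f \<xi>) \<le> norm (complex_of_real B * f \<xi>)" for \<xi>
      using dle[OF that(2), of \<xi>] B(1) by (simp add: norm_mult mult_right_mono)
  qed
  have X': "t / 2 \<le> X n" for n using X(2)[of n] by simp
  have 1: "L2_tendsto (\<lambda>n \<xi>. d (X n) \<xi> * u \<xi>) (\<lambda>\<xi>. d t \<xi> * u \<xi>)"
  proof (rule L2_tendsto_dominated[OF _ _ square_integrable_cmult[OF u, of "complex_of_real (2 * B)"]])
    show "norm (d (X n) \<xi> * u \<xi> - d t \<xi> * u \<xi>) \<le> norm (complex_of_real (2 * B) * u \<xi>)" for n \<xi>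
    proof -
      have "norm (d (X n) \<xi> - d t \<xi>) \<le> 2 * B"
        using norm_triangle_ineq4[of "d (X n) \<xi>" "d t \<xi>"] dle[OF X', of n \<xi>] dle[of t \<xi>] t by simp
      then have "norm (d (X n) \<xi> - d t \<xi>) * norm (u \<xi>) \<le> 2 * B * norm (u \<xi>)" by (rule mult_right_mono) simp
      then show ?thesis using B(1) by (simp add: norm_mult left_diff_distrib[symmetric])
    qed
    show "(\<lambda>n. d (X n) \<xi> * u \<xi>) \<longlonglongrightarrow> d t \<xi> * u \<xi>" for \<xi>
      unfolding d_def by (intro tendsto_intros damping_tendsto t X(1) Xpos)
  qed measurable
  have 2: "L2_tendsto (\<lambda>n \<xi>. d (X n) \<xi> * (u \<xi> - u (?T n \<xi>))) (\<lambda>\<xi>. 0)"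
  proof -
    have "(\<lambda>n. ?T n \<xi>) \<longlonglongrightarrow> shear (t - t) \<xi>" for \<xi>
      unfolding shear_def by (intro tendsto_intros X(1))
    then have "L2_tendsto (\<lambda>n \<xi>. u (?T n \<xi>)) u"
      by (intro L2_continuous_volume_preserving[OF u volume_preserving_shear]) simp
    then have "(\<lambda>n. ennreal (B\<^sup>2) * sq_mass (\<lambda>\<xi>. u (?T n \<xi>) - u \<xi>)) \<longlonglongrightarrow> ennreal (B\<^sup>2) * 0"
      unfolding L2_tendsto_def by (intro ennreal_tendsto_cmult) auto
    then have lim: "(\<lambda>n. ennreal (B\<^sup>2) * sq_mass (\<lambda>\<xi>. u (?T n \<xi>) - u \<xi>)) \<longlonglongrightarrow> 0" by simp
    have "sq_mass (\<lambda>\<xi>. d (X n) \<xi> * (u \<xi> - u (?T n \<xi>)) - 0) \<le> ennreal (B\<^sup>2) * sq_mass (\<lambda>\<xi>. u (?T n \<xi>) - u \<xi>)" for n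
    proof -
      have "sq_mass (\<lambda>\<xi>. d (X n) \<xi> * (u \<xi> - u (?T n \<xi>)) - 0) \<le> (\<integral>\<^sup>+ \<xi>. ennreal (B\<^sup>2) * ennreal ((norm (u (?T n \<xi>) - u \<xi>))\<^sup>2) \<partial>lborel)"
      proof (rule nn_integral_mono)
        fix \<xi> :: "'a \<times> 'a"
        have "(norm (d (X n) \<xi> * (u \<xi> - u (?T n \<xi>)) - 0))\<^sup>2 = (norm (d (X n) \<xi>))\<^sup>2 * (norm (u (?T n \<xi>) - u \<xi>))\<^sup>2"
          by (simp add: norm_mult power_mult_distrib norm_minus_commute)
        also have "\<dots> \<le> B\<^sup>2 * (norm (u (?T n \<xi>) - u \<xi>))\<^sup>2"
          using dle[OF X', of n \<xi>] by (intro mult_right_mono power_mono) auto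
        finally show "ennreal ((norm (d (X n) \<xi> * (u \<xi> - u (?T n \<xi>)) - 0))\<^sup>2) \<le> ennreal (B\<^sup>2) * ennreal ((norm (u (?T n \<xi>) - u \<xi>))\<^sup>2)"
          by (simp add: ennreal_mult[symmetric] ennreal_leI)
      qed
      also have "\<dots> = ennreal (B\<^sup>2) * sq_mass (\<lambda>\<xi>. u (?T n \<xi>) - u \<xi>)"
        by (rule nn_integral_cmult) measurable
      finally show ?thesis .
    qed
    then show ?thesis
      unfolding L2_tendsto_def
      by (intro tendsto_sandwich[OF _ _ tendsto_const lim]) (auto intro!: always_eventually)
  qed
  have z: "square_integrable (\<lambda>\<xi> :: 'a \<times> 'a. 0 :: complex)" by (simp add: square_integrable_def)
  show ?thesis
    unfolding eqX[abs_def] eqt[abs_def]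
    by (rule L2_tendsto_diff[OF _ _ _ z 1 2])
      (use t in \<open>auto intro!: mult2 u uT X' square_integrable_diff\<close>)
qed

text \<open>Restricting to times above t / 2 keeps the damping bound uniform and leaves the filter
  at t unchanged.\<close>

lemma weighted_fourier_continuous:
  assumes W0: "square_integrable W0" and t: "0 < t"
  shows "((\<lambda>s. L2_norm (\<lambda>\<xi>. weighted_fourier N W0 s \<xi> - weighted_fourier N W0 t \<xi>)) \<longlongrightarrow> 0) (at t)"
proof -
  have "((\<lambda>s. L2_norm (\<lambda>\<xi>. weighted_fourier N W0 s \<xi> - weighted_fourier N W0 t \<xi>)) \<longlongrightarrow> 0) (at t within {t / 2<..})"
    unfolding tendsto_at_iff_sequentially
  proof (intro allI impI)
    fix X assume X: "\<forall>i. X i \<in> {t / 2<..} - {t}" "X \<longlonglongrightarrow> t"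
    then have X2: "t / 2 < X n" for n by auto
    then have Xpos: "0 < X n" for n using t order_less_trans[of 0 "t / 2" "X n"] by simp
    have "L2_tendsto (\<lambda>n. weighted_fourier N W0 (X n)) (weighted_fourier N W0 t)"
      by (rule weighted_fourier_L2_tendsto[OF W0 t X(2) X2])
    then show "((\<lambda>s. L2_norm (\<lambda>\<xi>. weighted_fourier N W0 s \<xi> - weighted_fourier N W0 t \<xi>)) \<circ> X) \<longlonglongrightarrow> 0"
      using L2_tendsto_L2_norm[OF square_integrable_weighted_fourier[OF W0 Xpos] square_integrable_weighted_fourier[OF W0 t]]
      by (simp add: o_def)
  qed
  moreover have "at t within {t / 2<..} = at t"
    using t by (intro at_within_open) auto
  ultimately show ?thesis by simp
qed

lemma rapidly_integrable_evolved_fourier: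
  assumes W0: "square_integrable W0" and t: "0 < t"
  shows "rapidly_integrable (evolved_fourier \<sigma> W0 t)"
  unfolding rapidly_integrable_def
  using square_integrable_measurable[OF square_integrable_evolved_fourier[OF W0]]
    square_integrable_weighted_fourier[OF W0 t] unfolding weighted_fourier_def[abs_def]
  by (auto intro!: moment_bound(1))

section \<open>The smooth representative given by the inversion formula\<close>

definition inversion :: "('a \<times> 'a \<Rightarrow> complex) \<Rightarrow> real \<Rightarrow> 'a \<times> 'a \<Rightarrow> complex" where
  "inversion W0 t z = complex_of_real (1 / (2 * pi) ^ DIM('a \<times> 'a)) * synthesis (evolved_fourier \<sigma> W0 t) z"

lemma inversion_eq_synthesis:
  "inversion W0 t = synthesis (\<lambda>\<xi>. complex_of_real (1 / (2 * pi) ^ DIM('a \<times> 'a)) * evolved_fourier \<sigma> W0 t \<xi>)"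
  by (intro ext) (simp only: inversion_def synthesis_cmult)

text \<open>The Sobolev embedding on the Fourier side: derivatives are bounded uniformly in space by
  a weighted L2 norm of the transform. Boundedness and continuity in time of smooth functions both
  reduce to this estimate.\<close>

lemma norm_synthesis_symbol_le:
  fixes g :: "'a \<times> 'a \<Rightarrow> complex"
  assumes bs: "set bs \<subseteq> Basis"
    and m: "g \<in> borel_measurable borel"
    and w: "square_integrable (\<lambda>\<xi>. complex_of_real (weight (length bs + DIM('a \<times> 'a)) \<xi>) * g \<xi>)"
  shows "norm (synthesis (\<lambda>\<xi>. symbol bs \<xi> * (complex_of_real (1 / (2 * pi) ^ DIM('a \<times> 'a)) * g \<xi>)) z) \<le>
     L2_norm (inverse_weight :: 'a \<times> 'a \<Rightarrow> complex) * L2_norm (\<lambda>\<xi>. complex_of_real (weight (length bs + DIM('a \<times> 'a)) \<xi>) * g \<xi>)"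
proof -
  note [measurable] = m
  have c: "norm (complex_of_real (1 / (2 * pi) ^ DIM('a \<times> 'a))) \<le> 1"
  proof -
    have "(1::real) \<le> (2 * pi) ^ DIM('a \<times> 'a)" using pi_gt3 by (intro one_le_power) auto
    then have "norm (1 / (2 * pi) ^ DIM('a \<times> 'a)) \<le> 1" by (simp add: norm_divide)
    then show ?thesis unfolding norm_of_real by simp
  qed
  have le: "norm (symbol bs \<xi> * (complex_of_real (1 / (2 * pi) ^ DIM('a \<times> 'a)) * g \<xi>)) \<le> norm \<xi> ^ length bs * norm (g \<xi>)" for \<xi>
  proof -
    have "norm (symbol bs \<xi> * (complex_of_real (1 / (2 * pi) ^ DIM('a \<times> 'a)) * g \<xi>)) = norm (symbol bs \<xi>) * (norm (complex_of_real (1 / (2 * pi) ^ DIM('a \<times> 'a))) * norm (g \<xi>))"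
      by (simp only: norm_mult)
    also have "\<dots> \<le> norm \<xi> ^ length bs * (1 * norm (g \<xi>))"
      by (intro mult_mono norm_symbol_le bs c) auto
    finally show ?thesis by simp
  qed
  have i: "integrable lborel (\<lambda>\<xi>. norm \<xi> ^ length bs * norm (g \<xi>))" by (rule moment_bound(1)[OF m w])
  have i2: "integrable lborel (\<lambda>\<xi>. symbol bs \<xi> * (complex_of_real (1 / (2 * pi) ^ DIM('a \<times> 'a)) * g \<xi>))"
    by (rule integrable_dominated[OF i _ le]) measurable
  have "norm (synthesis (\<lambda>\<xi>. symbol bs \<xi> * (complex_of_real (1 / (2 * pi) ^ DIM('a \<times> 'a)) * g \<xi>)) z) \<le> (LINT \<xi>|lborel. norm (symbol bs \<xi> * (complex_of_real (1 / (2 * pi) ^ DIM('a \<times> 'a)) * g \<xi>)))"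
    by (rule norm_synthesis_le[OF i2])
  also have "\<dots> \<le> (LINT \<xi>|lborel. norm \<xi> ^ length bs * norm (g \<xi>))"
    by (intro integral_mono integrable_norm i i2 le)
  also have "\<dots> \<le> L2_norm (inverse_weight :: 'a \<times> 'a \<Rightarrow> complex) * L2_norm (\<lambda>\<xi>. complex_of_real (weight (length bs + DIM('a \<times> 'a)) \<xi>) * g \<xi>)"
    by (rule moment_bound(2)[OF m w])
  finally show ?thesis .
qed

lemma partial_derivs_inversion:
  assumes "square_integrable W0" "0 < t"
  shows "partial_derivs bs (inversion W0 t) = synthesis (\<lambda>\<xi>. symbol bs \<xi> * (complex_of_real (1 / (2 * pi) ^ DIM('a \<times> 'a)) * evolved_fourier \<sigma> W0 t \<xi>))"
  unfolding inversion_eq_synthesis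
  by (intro partial_derivs_synthesis rapidly_integrable_cmult rapidly_integrable_evolved_fourier assms)

lemma smooth_inversion:
  assumes "square_integrable W0" "0 < t" shows "smooth (inversion W0 t)"
  unfolding inversion_eq_synthesis
  by (intro smooth_synthesis rapidly_integrable_cmult rapidly_integrable_evolved_fourier assms)

lemma bounded_in_Cinf_inversion:
  assumes W0: "square_integrable W0" and t0: "0 < t0"
  shows "bounded_in_Cinf_from t0 (inversion W0)"
  unfolding bounded_in_Cinf_from_def
proof (intro conjI allI impI)
  show "smooth (inversion W0 t)" if "t0 \<le> t" for t
    using smooth_inversion[OF W0] t0 that by simp
  fix bs :: "('a \<times> 'a) list" and K :: "('a \<times> 'a) set" assume bs: "set bs \<subseteq> Basis"
  let ?N = "length bs + DIM('a \<times> 'a)"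
  obtain C where C: "\<And>t. t0 \<le> t \<Longrightarrow> square_integrable (weighted_fourier ?N W0 t)" "\<And>t. t0 \<le> t \<Longrightarrow> L2_norm (weighted_fourier ?N W0 t) \<le> C"
    using weighted_fourier_bounded[OF W0 t0, of ?N] by blast
  have "norm (partial_derivs bs (inversion W0 t) z) \<le> L2_norm (inverse_weight :: 'a \<times> 'a \<Rightarrow> complex) * C" if t: "t0 \<le> t" for t z
  proof -
    have "0 < t" using t0 t by simp
    have "norm (partial_derivs bs (inversion W0 t) z) \<le> L2_norm (inverse_weight :: 'a \<times> 'a \<Rightarrow> complex) * L2_norm (weighted_fourier ?N W0 t)"
      unfolding partial_derivs_inversion[OF W0 \<open>0 < t\<close>] weighted_fourier_def[abs_def]
      by (intro norm_synthesis_symbol_le[OF bs] square_integrable_measurable square_integrable_evolved_fourier W0 C(1)[OF t, unfolded weighted_fourier_def[abs_def]])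
    also have "\<dots> \<le> L2_norm (inverse_weight :: 'a \<times> 'a \<Rightarrow> complex) * C"
      by (intro mult_left_mono C t) auto
    finally show ?thesis .
  qed
  then show "\<exists>C. \<forall>t\<ge>t0. \<forall>z\<in>K. norm (partial_derivs bs (inversion W0 t) z) \<le> C" by blast
qed

lemma continuous_in_Cinf_inversion:
  assumes W0: "square_integrable W0"
  shows "continuous_in_Cinf (inversion W0)"
  unfolding continuous_in_Cinf_def
proof (intro allI impI conjI)
  fix t :: real assume t: "0 < t"
  show "smooth (inversion W0 t)" by (rule smooth_inversion[OF W0 t])
  fix bs :: "('a \<times> 'a) list" and K :: "('a \<times> 'a) set" assume bs: "set bs \<subseteq> Basis"
  let ?N = "length bs + DIM('a \<times> 'a)"
  let ?E = "evolved_fourier \<sigma> W0"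
  let ?d = "\<lambda>s. L2_norm (inverse_weight :: 'a \<times> 'a \<Rightarrow> complex) * L2_norm (\<lambda>\<xi>. weighted_fourier ?N W0 s \<xi> - weighted_fourier ?N W0 t \<xi>)"
  have lim: "(?d \<longlongrightarrow> 0) (at t)"
    by (intro tendsto_mult_right_zero weighted_fourier_continuous W0 t)
  have bound: "dist (partial_derivs bs (inversion W0 s) z) (partial_derivs bs (inversion W0 t) z) \<le> ?d s" if s: "0 < s" for s z
  proof -
    let ?c = "complex_of_real (1 / (2 * pi) ^ DIM('a \<times> 'a))"
    have r: "rapidly_integrable (\<lambda>\<xi>. symbol bs \<xi> * (?c * ?E r \<xi>))" if "0 < r" for r
      by (intro rapidly_integrable_symbol rapidly_integrable_cmult rapidly_integrable_evolved_fourier W0 that)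
    have "partial_derivs bs (inversion W0 s) z - partial_derivs bs (inversion W0 t) z
        = synthesis (\<lambda>\<xi>. symbol bs \<xi> * (?c * ?E s \<xi>) - symbol bs \<xi> * (?c * ?E t \<xi>)) z"
      unfolding partial_derivs_inversion[OF W0 s] partial_derivs_inversion[OF W0 t]
      by (rule synthesis_diff[symmetric]) (intro rapidly_integrable_integrable r s t)+
    also have "(\<lambda>\<xi>. symbol bs \<xi> * (?c * ?E s \<xi>) - symbol bs \<xi> * (?c * ?E t \<xi>)) = (\<lambda>\<xi>. symbol bs \<xi> * (?c * (?E s \<xi> - ?E t \<xi>)))"
      by (simp add: right_diff_distrib)
    also have "norm (synthesis \<dots> z) \<le> L2_norm (inverse_weight :: 'a \<times> 'a \<Rightarrow> complex) * L2_norm (\<lambda>\<xi>. complex_of_real (weight ?N \<xi>) * (?E s \<xi> - ?E t \<xi>))"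
    proof (rule norm_synthesis_symbol_le[OF bs])
      show "(\<lambda>\<xi>. ?E s \<xi> - ?E t \<xi>) \<in> borel_measurable borel"
        by (intro square_integrable_measurable square_integrable_diff square_integrable_evolved_fourier W0)
      show "square_integrable (\<lambda>\<xi>. complex_of_real (weight ?N \<xi>) * (?E s \<xi> - ?E t \<xi>))"
        using square_integrable_diff[OF square_integrable_weighted_fourier[OF W0 s] square_integrable_weighted_fourier[OF W0 t], of ?N ?N]
        by (simp add: weighted_fourier_def right_diff_distrib)
    qed
    finally show ?thesis
      by (simp add: dist_norm weighted_fourier_def right_diff_distrib)
  qed
  show "uniform_limit K (\<lambda>s. partial_derivs bs (inversion W0 s)) (partial_derivs bs (inversion W0 t)) (at t)"
  proof (rule uniform_limitI)
    fix e :: real assume "0 < e"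
    have "\<forall>\<^sub>F s in at t. ?d s < e"
      using order_tendstoD(2)[OF lim \<open>0 < e\<close>] .
    moreover have "\<forall>\<^sub>F s in at t. 0 < s"
      using order_tendstoD(1)[OF tendsto_ident_at t] .
    ultimately show "\<forall>\<^sub>F s in at t. \<forall>z\<in>K. dist (partial_derivs bs (inversion W0 s) z) (partial_derivs bs (inversion W0 t) z) < e"
      by eventually_elim (use bound in \<open>blast intro: order_le_less_trans\<close>)
  qed
qed

section \<open>Sobolev regularity of the solution\<close>

lemma solution_bounded_in_Hinf:
  assumes ws: "weak_solution \<sigma> W0 W" and W0: "square_integrable W0"
    and bd: "\<forall>t\<ge>0. L2_norm (W t) \<le> C" and t0: "0 < t0"
  shows "bounded_in_Hinf_from t0 W"
  unfolding bounded_in_Hinf_from_def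
proof
  fix m
  obtain C' where C': "\<And>t. t0 \<le> t \<Longrightarrow> square_integrable (weighted_fourier m W0 t)" "\<And>t. t0 \<le> t \<Longrightarrow> L2_norm (weighted_fourier m W0 t) \<le> C'"
    using weighted_fourier_bounded[OF W0 t0, of m] by blast
  have "W t \<in> sobolev_space m \<and> sobolev_norm m (W t) \<le> C'" if t: "t0 \<le> t" for t
  proof -
    have F: "has_L2_fourier (W t) (evolved_fourier \<sigma> W0 t)"
      using t0 t by (intro fourier_of_solution[OF ws W0 bd]) simp
    show ?thesis
      using sobolev_of_fourier[OF F C'(1)[OF t, unfolded weighted_fourier_def[abs_def]]] C'(2)[OF t]
      unfolding weighted_fourier_def[abs_def] by simp
  qed
  then show "\<exists>C. \<forall>t\<ge>t0. W t \<in> sobolev_space m \<and> sobolev_norm m (W t) \<le> C" by blast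
qed

lemma solution_continuous_in_Hinf:
  assumes ws: "weak_solution \<sigma> W0 W" and W0: "square_integrable W0"
    and bd: "\<forall>t\<ge>0. L2_norm (W t) \<le> C"
  shows "continuous_in_Hinf W"
  unfolding continuous_in_Hinf_def
proof (intro allI impI conjI)
  fix t :: real and m assume t: "0 < t"
  show "W t \<in> sobolev_space m"
    using solution_bounded_in_Hinf[OF ws W0 bd t] unfolding bounded_in_Hinf_from_def by blast
  let ?d = "\<lambda>s. L2_norm (\<lambda>\<xi>. weighted_fourier m W0 s \<xi> - weighted_fourier m W0 t \<xi>)"
  show "((\<lambda>s. sobolev_norm m (\<lambda>z. W s z - W t z)) \<longlongrightarrow> 0) (at t)"
  proof (rule Lim_null_comparison[OF _ weighted_fourier_continuous[OF W0 t, of m]])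
    have "\<forall>\<^sub>F s in at t. 0 < s"
      using order_tendstoD(1)[OF tendsto_ident_at t] .
    then show "\<forall>\<^sub>F s in at t. norm (sobolev_norm m (\<lambda>z. W s z - W t z)) \<le> ?d s"
    proof eventually_elim
      case (elim s)
      have F: "has_L2_fourier (\<lambda>z. W s z - W t z) (\<lambda>\<xi>. evolved_fourier \<sigma> W0 s \<xi> - evolved_fourier \<sigma> W0 t \<xi>)"
        using elim t by (intro has_L2_fourier_diff fourier_of_solution[OF ws W0 bd]) auto
      have w: "square_integrable (\<lambda>\<xi>. complex_of_real (weight m \<xi>) * (evolved_fourier \<sigma> W0 s \<xi> - evolved_fourier \<sigma> W0 t \<xi>))"
        using square_integrable_diff[OF square_integrable_weighted_fourier[OF W0 elim] square_integrable_weighted_fourier[OF W0 t], of m m]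
        by (simp add: weighted_fourier_def right_diff_distrib)
      have "0 \<le> sobolev_norm m (\<lambda>z. W s z - W t z)"
        unfolding sobolev_norm_def
        by (intro real_sqrt_ge_zero mult_nonneg_nonneg integral_nonneg_AE) auto
      then show ?case
        using sobolev_of_fourier(2)[OF F w] by (simp add: weighted_fourier_def right_diff_distrib)
    qed
  qed
qed

end

subsection \<open>The scattering kernel of the theorem\<close>

text \<open>Near 0 the quotient exceeds half of its asymptotic value, and this half cancels the
  factor 2 in the scattering kernel.\<close>

lemma scattering_lower_bound:
  fixes R0 g :: "'a::euclidean_space \<Rightarrow> real"
  assumes "(\<lambda>p. R0 p / g p) \<sim>[at 0] (\<lambda>p. \<sigma>0 / norm p powr (real DIM('a) + \<theta>))" and "0 < \<sigma>0"
  shows "\<exists>\<delta>>0. \<forall>p. p \<noteq> 0 \<and> norm p < \<delta> \<longrightarrow>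
    (\<sigma>0 / (2 * pi) ^ DIM('a)) / norm p powr (real DIM('a) + \<theta>) \<le> scattering R0 g p"
proof -
  let ?f = "\<lambda>p. R0 p / g p" and ?h = "\<lambda>p :: 'a. \<sigma>0 / norm p powr (real DIM('a) + \<theta>)"
  have "((\<lambda>p. if ?f p = 0 \<and> ?h p = 0 then 1 else ?f p / ?h p) \<longlongrightarrow> 1) (at 0)"
    using assms(1) unfolding asymp_equiv_def .
  from order_tendstoD(1)[OF this, of "1 / 2"]
  obtain \<delta> where \<delta>: "0 < \<delta>" "\<And>p. p \<noteq> 0 \<Longrightarrow> dist p 0 < \<delta> \<Longrightarrow> 1 / 2 < (if ?f p = 0 \<and> ?h p = 0 then 1 else ?f p / ?h p)"
    by (auto simp: eventually_at)
  have "(\<sigma>0 / (2 * pi) ^ DIM('a)) / norm p powr (real DIM('a) + \<theta>) \<le> scattering R0 g p" if p: "p \<noteq> 0" "norm p < \<delta>" for p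
  proof -
    have h: "0 < ?h p" using p assms(2) by simp
    \<comment> \<open>Asymptotic equivalence reads 0 / 0 as 1; that case is excluded because the
      comparison function is positive away from 0.\<close>
    then have "\<not> (?f p = 0 \<and> ?h p = 0)" by linarith
    moreover have "dist p 0 < \<delta>" using p by simp
    ultimately have "1 / 2 < ?f p / ?h p"
      using \<delta>(2)[OF p(1)] by (simp only: if_False simp_thms)
    then have "1 / 2 * ?h p < ?f p" using h by (simp only: pos_less_divide_eq)
    then have "?h p < 2 * ?f p" by linarith
    then have "?h p / (2 * pi) ^ DIM('a) \<le> 2 * ?f p / (2 * pi) ^ DIM('a)"
      by (intro divide_right_mono) auto
    then show ?thesis by (simp add: scattering_def mult.commute)
  qed
  then show ?thesis using \<delta>(1) by blast
qed

text \<open>The first moment is the first integrability assumption up to a constant; the bounded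
  support of \<open>R0\<close> turns it into a bound for the second moment.\<close>

lemma scattering_kernel_scattering:
  fixes R0 g :: "'a::euclidean_space \<Rightarrow> real"
  assumes "standing_assumptions R0 g"
  shows "scattering_kernel (scattering R0 g)"
proof -
  have R0: "\<And>p. 0 \<le> R0 p" "integrable lborel R0" "\<And>p. R0 (- p) = R0 p"
    and g: "\<And>p. 0 \<le> g p" "g \<in> borel_measurable borel" "\<And>p. g (- p) = g p"
    and supp: "\<exists>K. compact K \<and> 0 \<in> K \<and> closure {p. R0 p \<noteq> 0} \<subseteq> K"
    and fin: "(\<integral>\<^sup>+ p. ennreal (R0 p) * ennreal (norm p) / ennreal (g p) \<partial>lborel) < \<infinity>"
    using assms by (auto simp: standing_assumptions_def)
  have [measurable]: "R0 \<in> borel_measurable borel" using borel_measurable_integrable[OF R0(2)] by simp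
  note [measurable] = g(2)
  let ?\<sigma> = "scattering R0 g"
  let ?c = "2 / (2 * pi) ^ DIM('a) :: real"
  have \<sigma>m [measurable]: "?\<sigma> \<in> borel_measurable borel" unfolding scattering_def[abs_def] by measurable
  have \<sigma>0: "0 \<le> ?\<sigma> p" for p using R0(1)[of p] g(1)[of p] by (simp add: scattering_def)
  have i: "integrable lborel (\<lambda>p. R0 p * norm p / g p)"
  proof (rule integrableI_bounded)
    have "(\<integral>\<^sup>+ p. ennreal (norm (R0 p * norm p / g p)) \<partial>lborel) \<le> (\<integral>\<^sup>+ p. ennreal (R0 p) * ennreal (norm p) / ennreal (g p) \<partial>lborel)"
    proof (rule nn_integral_mono)
      fix p
      show "ennreal (norm (R0 p * norm p / g p)) \<le> ennreal (R0 p) * ennreal (norm p) / ennreal (g p)"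
      \<comment> \<open>Where \<open>g\<close> vanishes the real quotient is 0 by convention, so it
        lies below the extended one whatever the latter is.\<close>
      proof (cases "g p = 0")
        case False
        then show ?thesis
          using R0(1)[of p] g(1)[of p] by (simp add: ennreal_mult[symmetric] divide_ennreal)
      qed simp
    qed
    then show "(\<integral>\<^sup>+ p. ennreal (norm (R0 p * norm p / g p)) \<partial>lborel) < \<infinity>" using fin by (rule order_le_less_trans)
  qed measurable
  have first: "integrable lborel (\<lambda>p. norm p * ?\<sigma> p)"
  proof -
    have "integrable lborel (\<lambda>p. ?c * (R0 p * norm p / g p))" using i by (rule integrable_mult_right)
    moreover have "(\<lambda>p. ?c * (R0 p * norm p / g p)) = (\<lambda>p. norm p * ?\<sigma> p)"
      by (auto simp: scattering_def)
    ultimately show ?thesis by simp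
  qed
  obtain K where "compact K" "closure {p. R0 p \<noteq> 0} \<subseteq> K" using supp by blast
  then have "bounded {p. R0 p \<noteq> 0}"
    using compact_imp_bounded bounded_subset closure_subset by (metis (no_types, lifting))
  then obtain r where r: "0 < r" "\<And>p. R0 p \<noteq> 0 \<Longrightarrow> norm p \<le> r" by (auto simp: bounded_pos)
  have second: "integrable lborel (\<lambda>p. (norm p)\<^sup>2 * ?\<sigma> p)"
  proof (rule integrable_dominated)
    show "integrable lborel (\<lambda>p. r * (norm p * ?\<sigma> p))" using first by simp
    show "norm ((norm p)\<^sup>2 * ?\<sigma> p) \<le> r * (norm p * ?\<sigma> p)" for p
    proof (cases "R0 p = 0")
      case False
      then have "norm p * (norm p * ?\<sigma> p) \<le> r * (norm p * ?\<sigma> p)"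
        using r(2) \<sigma>0[of p] by (intro mult_right_mono) auto
      then show ?thesis using \<sigma>0[of p] by (simp add: power2_eq_square mult.assoc)
    qed (simp add: scattering_def)
  qed measurable
  show ?thesis
    by unfold_locales (use \<sigma>m \<sigma>0 first second in \<open>auto simp: scattering_def R0(3) g(3)\<close>)
qed

text \<open>\<open>W t\<close> is determined only up to null sets, so smoothness and the pointwise
  formula are claimed for a representative \<open>V\<close>. The integrability clause ensures that
  the integral in the formula is not a default value. At time 0 there is no damping, and the formula
  is meant in the L2 sense, as in the last clause.\<close>

theorem theorem3p1:
  fixes R0 g :: "'a::euclidean_space \<Rightarrow> real"
    and \<theta> \<sigma>0 :: real
    and W0 :: "'a \<times> 'a \<Rightarrow> complex"
    and W :: "real \<Rightarrow> 'a \<times> 'a \<Rightarrow> complex"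
  assumes "standing_assumptions R0 g"
    and "0 < \<theta>" and "\<theta> < 1" and "0 < \<sigma>0"
    and "(\<lambda>p. R0 p / g p) \<sim>[at 0] (\<lambda>p. \<sigma>0 / norm p powr (real DIM('a) + \<theta>))"
    and "square_integrable W0"
    and "weak_solution (scattering R0 g) W0 W"
    and "uniformly_L2_bounded W"
  shows "continuous_in_Hinf W \<and> (\<forall>t0>0. bounded_in_Hinf_from t0 W) \<and>
    (\<exists>V. (\<forall>t>0. AE z in lborel. W t z = V t z) \<and>
       continuous_in_Cinf V \<and> (\<forall>t0>0. bounded_in_Cinf_from t0 V) \<and>
       (\<forall>t>0. \<forall>x k.
          integrable lborel (\<lambda>(y, q). exp (\<i> * complex_of_real (x \<bullet> y + k \<bullet> q)) *
            evolved_fourier (scattering R0 g) W0 t (y, q)) \<and>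
          V t (x, k) = 1 / (2 * pi) ^ (2 * DIM('a)) *
            (LINT (y, q)|lborel. exp (\<i> * complex_of_real (x \<bullet> y + k \<bullet> q)) *
               evolved_fourier (scattering R0 g) W0 t (y, q)))) \<and>
    (\<forall>t\<ge>0. has_L2_inverse_fourier (evolved_fourier (scattering R0 g) W0 t) (W t))"
proof -
  interpret S: scattering_kernel "scattering R0 g"
    by (rule scattering_kernel_scattering[OF assms(1)])
  obtain \<delta> where \<delta>: "0 < \<delta>" "\<And>p. p \<noteq> 0 \<Longrightarrow> norm p < \<delta> \<Longrightarrow>
      (\<sigma>0 / (2 * pi) ^ DIM('a)) / norm p powr (real DIM('a) + \<theta>) \<le> scattering R0 g p"
    using scattering_lower_bound[OF assms(5,4)] by blast
  have "0 < \<sigma>0 / (2 * pi) ^ DIM('a)" using assms(4) by simp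
  from S.psi_upper_bound[OF this \<delta>(1) assms(2) \<delta>(2)] obtain c C0 where
    c: "0 < c" "\<And>q. S.psi q \<le> C0 - c * norm q powr \<theta>" by metis
  interpret D: damped_kernel "scattering R0 g" c C0 \<theta>
    by unfold_locales (use c assms(2) in auto)
  obtain C where C: "\<forall>t\<ge>0. L2_norm (W t) \<le> C"
    using assms(8) unfolding uniformly_L2_bounded_def by blast
  let ?E = "evolved_fourier (scattering R0 g) W0"
  let ?V = "D.inversion W0"
  have inv: "has_L2_inverse_fourier (?E t) (W t)" if "0 \<le> t" for t
    by (rule fourier_inversion[OF S.fourier_of_solution[OF assms(7,6) C that]])
  have iE: "integrable lborel (?E t)" if "0 < t" for t
    by (rule rapidly_integrable_integrable[OF D.rapidly_integrable_evolved_fourier[OF assms(6) that]])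
  have ae: "AE z in lborel. W t z = ?V t z" if t: "0 < t" for t
    using inverse_fourier_integrable[OF inv iE[OF t]] t unfolding D.inversion_def by simp
  have eq: "(\<lambda>(y, q). iexp (x \<bullet> y + k \<bullet> q) * ?E t (y, q))
      = (\<lambda>\<xi>. iexp ((x, k) \<bullet> \<xi>) * ?E t \<xi>)" for x k t
    by (auto simp: fun_eq_iff)
  have dim: "DIM('a \<times> 'a) = 2 * DIM('a)" by simp
  show ?thesis
  proof (intro conjI exI[of _ ?V] allI impI)
    show "continuous_in_Hinf W" by (rule D.solution_continuous_in_Hinf[OF assms(7,6) C])
    show "bounded_in_Hinf_from t0 W" if "0 < t0" for t0
      by (rule D.solution_bounded_in_Hinf[OF assms(7,6) C that])
    show "AE z in lborel. W t z = ?V t z" if "0 < t" for t by (rule ae[OF that])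
    show "continuous_in_Cinf ?V" by (rule D.continuous_in_Cinf_inversion[OF assms(6)])
    show "bounded_in_Cinf_from t0 ?V" if "0 < t0" for t0
      by (rule D.bounded_in_Cinf_inversion[OF assms(6) that])
    show "integrable lborel (\<lambda>(y, q). iexp (x \<bullet> y + k \<bullet> q) * ?E t (y, q))" if "0 < t" for t x k
      unfolding eq by (rule integrable_exp_mult(3)[OF iE[OF that]])
    show "?V t (x, k) = 1 / (2 * pi) ^ (2 * DIM('a)) *
        (LINT (y, q)|lborel. iexp (x \<bullet> y + k \<bullet> q) * ?E t (y, q))" if "0 < t" for t x k
      unfolding eq D.inversion_def synthesis_def dim ..
    show "has_L2_inverse_fourier (?E t) (W t)" if "0 \<le> t" for t by (rule inv[OF that])
  qed
qed

end
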